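(* Let $r$ be a positive integer and $p,q$ positive divisors of $r$ with $pq$ dividing $2r$. The projective reflection group $G(r,p,q,2)$ has a generalized involution model if and only if $(r,p,q)=(4,1,2)$ or $G(r,p,q,2)\cong G(r,q,p,2)$.
   Context: For a positive integer $r$ let $\zeta_r=\exp(2\pi\sqrt{-1}/r)$ and $\mathbb{Z}_r=\mathbb{Z}/r\mathbb{Z}$. $G(r,n)$ is the group of $n\times n$ complex matrices with exactly one nonzero entry in each row and column, each nonzero entry an $r$th root of unity; its elements are written $(\pi,x)$ with $\pi\in S_n$, $x\in(\mathbb{Z}_r)^n$, meaning the matrix whose $i$th column has $\zeta_r^{x_i}$ in row $\pi(i)$. Put $\Delta(\pi,x)=\sum_i x_i$. For $p\mid r$, $G(r,p,n)=\{g\in G(r,n):\Delta(g)\in p\mathbb{Z}_r\}$. With $c=\zeta_rI_n$, when $p,q\mid r$ and $pq\mid rn$ the group $C_q=\langle c^{r/q}\rangle$ is central of order $q$ in $G(r,p,n)$ and $G(r,p,q,n):=G(r,p,n)/C_q$. A model of a finite group $G$ is a set $\{\lambda_i:H_i\to\mathbb{C}^\times\}$ of linear characters of subgroups with $\sum_i\mathrm{Ind}_{H_i}^G\lambda_i=\sum_{\psi\in\mathrm{Irr}(G)}\psi$. For an automorphism $\nu$ with $\nu^2=1$ let $\mathcal{I}_{G,\nu}=\{\omega\in G:\omega^{-1}=\nu(\omega)\}$, on which $G$ acts by $g:\omega\mapsto g\omega\nu(g)^{-1}$ with stabilizers $C_{G,\nu}(\omega)$. A generalized involution model (GIM) with respect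 to $\nu$ is a model whose subgroups are the $C_{G,\nu}(\omega_i)$ for $\omega_i$ a set of orbit representatives, exactly one per orbit; $G$ has a GIM if it has one with respect to some such $\nu$. *)

theory Defs
  imports
    Complex_Main
    "HOL-Combinatorics.Permutations"
    "HOL-Algebra.Generated_Groups"
    "HOL-Algebra.Group_Action"
    "Jordan_Normal_Form.VS_Connect"
begin

section \<open>Projective reflection groups\<close>

definition zeta :: "nat \<Rightarrow> complex" where
  "zeta r = exp (2 * of_real pi * \<i> / of_nat r)"

definition colored_perm_mat :: "nat \<Rightarrow> nat \<Rightarrow> (nat \<Rightarrow> nat) \<Rightarrow> (nat \<Rightarrow> nat) \<Rightarrow> complex mat" where
  "colored_perm_mat r n \<pi> x = mat n n (\<lambda>(i, j). if i = \<pi> j then zeta r ^ x j else 0)"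

definition generalized_symmetric_set :: "nat \<Rightarrow> nat \<Rightarrow> complex mat set" where
  "generalized_symmetric_set r n = {A \<in> carrier_mat n n.
     (\<forall>i<n. \<exists>!j. j < n \<and> A $$ (i, j) \<noteq> 0) \<and>
     (\<forall>j<n. \<exists>!i. i < n \<and> A $$ (i, j) \<noteq> 0) \<and>
     (\<forall>i<n. \<forall>j<n. A $$ (i, j) \<noteq> 0 \<longrightarrow> A $$ (i, j) ^ r = 1)}"

text \<open>The statistic \<open>\<Delta>(\<pi>, x) = x\<^sub>1 + \<dots> + x\<^sub>n\<close>, valued in the integers modulo \<open>r\<close>.
  These are represented by \<open>{0..<r}\<close>, and exponent vectors by vectors of natural numbers,
  of which only the classes modulo \<open>r\<close> matter; see \<open>color_sum_colored_perm_mat\<close>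
  and \<open>generalized_symmetric_setE\<close> below.\<close>

definition color_sum :: "nat \<Rightarrow> nat \<Rightarrow> complex mat \<Rightarrow> nat" where
  "color_sum r n A = (THE d. \<exists>\<pi> x. \<pi> permutes {..<n} \<and>
     A = colored_perm_mat r n \<pi> x \<and> d = (\<Sum>i<n. x i) mod r)"

text \<open>For \<open>p dvd r\<close>, a residue modulo \<open>r\<close> lies in the subgroup generated by \<open>p\<close>
  iff its representative is divisible by \<open>p\<close>.\<close>

definition complex_reflection_group :: "nat \<Rightarrow> nat \<Rightarrow> nat \<Rightarrow> complex mat monoid" where
  "complex_reflection_group r p n =
     \<lparr>carrier = {A \<in> generalized_symmetric_set r n. p dvd color_sum r n A},
      monoid.mult = (*), one = 1\<^sub>m n\<rparr>"

definition scalar_subgroup :: "nat \<Rightarrow> nat \<Rightarrow> nat \<Rightarrow> nat \<Rightarrow> complex mat set" where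
  "scalar_subgroup r p q n =
     generate (complex_reflection_group r p n) {(zeta r \<cdot>\<^sub>m 1\<^sub>m n) ^\<^sub>m (r div q)}"

definition projective_reflection_group ::
  "nat \<Rightarrow> nat \<Rightarrow> nat \<Rightarrow> nat \<Rightarrow> complex mat set monoid" where
  "projective_reflection_group r p q n =
     complex_reflection_group r p n Mod scalar_subgroup r p q n"


section \<open>Complex characters of finite groups\<close>

definition mat_trace :: "complex mat \<Rightarrow> complex" where
  "mat_trace A = (\<Sum>i<dim_row A. A $$ (i, i))"

definition representation :: "('a, 'b) monoid_scheme \<Rightarrow> nat \<Rightarrow> ('a \<Rightarrow> complex mat) \<Rightarrow> bool" where
  "representation G d \<rho> \<longleftrightarrow> \<rho> \<in> hom G (units_of (ring_mat TYPE(complex) d ()))"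

definition irreducible_representation ::
  "('a, 'b) monoid_scheme \<Rightarrow> nat \<Rightarrow> ('a \<Rightarrow> complex mat) \<Rightarrow> bool" where
  "irreducible_representation G d \<rho> \<longleftrightarrow> representation G d \<rho> \<and> d > 0 \<and>
     (\<forall>W. subspace class_ring W (module_vec TYPE(complex) d) \<and>
          (\<forall>g\<in>carrier G. \<forall>v\<in>W. \<rho> g *\<^sub>v v \<in> W)
          \<longrightarrow> W = {0\<^sub>v d} \<or> W = carrier_vec d)"

text \<open>Characters are restricted to the carrier, so that distinct elements of \<open>Irr G\<close>
  differ on the group itself.\<close>

definition Irr :: "('a, 'b) monoid_scheme \<Rightarrow> ('a \<Rightarrow> complex) set" where
  "Irr G = {\<lambda>g\<in>carrier G. mat_trace (\<rho> g) | d \<rho>. irreducible_representation G d \<rho>}"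

definition linear_characters :: "('a, 'b) monoid_scheme \<Rightarrow> 'a set \<Rightarrow> ('a \<Rightarrow> complex) set" where
  "linear_characters G H = hom (G\<lparr>carrier := H\<rparr>) (units_of class_ring)"

definition induced_character ::
  "('a, 'b) monoid_scheme \<Rightarrow> 'a set \<Rightarrow> ('a \<Rightarrow> complex) \<Rightarrow> 'a \<Rightarrow> complex" where
  "induced_character G H \<chi> g = (\<Sum>x\<in>carrier G.
     let y = inv\<^bsub>G\<^esub> x \<otimes>\<^bsub>G\<^esub> g \<otimes>\<^bsub>G\<^esub> x in if y \<in> H then \<chi> y else 0) / of_nat (card H)"

definition character_model ::
  "('a, 'b) monoid_scheme \<Rightarrow> 'i set \<Rightarrow> ('i \<Rightarrow> 'a set) \<Rightarrow> ('i \<Rightarrow> 'a \<Rightarrow> complex) \<Rightarrow> bool" where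
  "character_model G I H lam \<longleftrightarrow> finite I \<and>
     (\<forall>i\<in>I. subgroup (H i) G \<and> lam i \<in> linear_characters G (H i)) \<and>
     (\<forall>g\<in>carrier G. (\<Sum>i\<in>I. induced_character G (H i) (lam i) g) = (\<Sum>\<psi>\<in>Irr G. \<psi> g))"


section \<open>Generalized involution models\<close>

definition gen_involutions :: "('a, 'b) monoid_scheme \<Rightarrow> ('a \<Rightarrow> 'a) \<Rightarrow> 'a set" where
  "gen_involutions G \<nu> = {\<omega> \<in> carrier G. inv\<^bsub>G\<^esub> \<omega> = \<nu> \<omega>}"

definition twisted_conj :: "('a, 'b) monoid_scheme \<Rightarrow> ('a \<Rightarrow> 'a) \<Rightarrow> 'a \<Rightarrow> 'a \<Rightarrow> 'a" where
  "twisted_conj G \<nu> g = (\<lambda>\<omega>\<in>gen_involutions G \<nu>. g \<otimes>\<^bsub>G\<^esub> \<omega> \<otimes>\<^bsub>G\<^esub> inv\<^bsub>G\<^esub> (\<nu> g))"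

definition orbit_representatives ::
  "('a, 'b) monoid_scheme \<Rightarrow> 'c set \<Rightarrow> ('a \<Rightarrow> 'c \<Rightarrow> 'c) \<Rightarrow> 'c set \<Rightarrow> bool" where
  "orbit_representatives G E \<phi> R \<longleftrightarrow> R \<subseteq> E \<and> (\<forall>X\<in>orbits G E \<phi>. \<exists>!\<omega>. \<omega> \<in> R \<and> \<omega> \<in> X)"

definition has_GIM_wrt :: "('a, 'b) monoid_scheme \<Rightarrow> ('a \<Rightarrow> 'a) \<Rightarrow> bool" where
  "has_GIM_wrt G \<nu> \<longleftrightarrow> (\<exists>R lam.
     orbit_representatives G (gen_involutions G \<nu>) (twisted_conj G \<nu>) R \<and>
     character_model G R (stabilizer G (twisted_conj G \<nu>)) lam)"

definition has_GIM :: "('a, 'b) monoid_scheme \<Rightarrow> bool" where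
  "has_GIM G \<longleftrightarrow> (\<exists>\<nu>\<in>iso G G. (\<forall>g\<in>carrier G. \<nu> (\<nu> g) = g) \<and> has_GIM_wrt G \<nu>)"


section \<open>Well-definedness of the color sum\<close>

lemma zeta_nz [simp]: "zeta r \<noteq> 0"
  by (simp add: zeta_def)

lemma zeta_pow_eq_iff:
  assumes "r > 0"
  shows "zeta r ^ a = zeta r ^ b \<longleftrightarrow> a mod r = b mod r"
proof -
  have pw: "zeta r ^ k = exp (2 * of_real pi * \<i> * of_nat k / of_nat r)" for k
    by (simp add: zeta_def exp_of_nat_mult[symmetric] mult_ac)
  have r: "zeta r ^ r = 1"
    using assms unfolding pw by simp
  have red: "zeta r ^ k = zeta r ^ (k mod r)" for k
  proof -
    have "zeta r ^ k = zeta r ^ (r * (k div r) + k mod r)" by simp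
    also have "\<dots> = zeta r ^ (k mod r)" by (simp only: power_add power_mult r) simp
    finally show ?thesis .
  qed
  have one: "k = 0" if "zeta r ^ k = 1" "k < r" for k
  proof -
    have eq: "cis (2 * pi * real k / real r) = 1"
      using that(1) unfolding pw cis_conv_exp by (simp add: mult_ac)
    then have "cos (2 * pi * (real k / real r)) = 1"
      by (metis cis.sel(1) one_complex.sel(1) times_divide_eq_right)
    then obtain m :: int where "2 * pi * (real k / real r) = of_int m * 2 * pi"
      unfolding cos_one_2pi_int by auto
    then have m: "real k = of_int m * real r" using assms by (simp add: field_simps)
    then have "int k = m * int r"
      by (metis of_int_eq_iff of_int_mult of_int_of_nat_eq)
    then have "int r dvd int k" by simp
    then show ?thesis using that(2) by (auto dest: dvd_imp_le)
  qed
  have inj: "a = b" if "a \<le> b" "b < r" "zeta r ^ a = zeta r ^ b" for a b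
  proof -
    have "zeta r ^ b = zeta r ^ a * zeta r ^ (b - a)" using that(1) by (metis le_add_diff_inverse power_add)
    with that(3) have "zeta r ^ (b - a) = 1" by simp
    moreover have "b - a < r" using that(2) by simp
    ultimately have "b - a = 0" by (rule one)
    with that(1) show ?thesis by simp
  qed
  have "a mod r = b mod r" if "zeta r ^ (a mod r) = zeta r ^ (b mod r)"
    using inj[of "a mod r" "b mod r"] inj[of "b mod r" "a mod r"] that assms
    by (metis mod_less_divisor nle_le)
  then show ?thesis using red by metis
qed

lemma color_sum_colored_perm_mat:
  assumes "r > 0" "\<pi> permutes {..<n}"
  shows "color_sum r n (colored_perm_mat r n \<pi> x) = (\<Sum>i<n. x i) mod r"
  unfolding color_sum_def
proof (rule the_equality)
  show "\<exists>\<pi>' x'. \<pi>' permutes {..<n} \<and> colored_perm_mat r n \<pi> x = colored_perm_mat r n \<pi>' x' \<and>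
      (\<Sum>i<n. x i) mod r = (\<Sum>i<n. x' i) mod r"
    using assms by blast
next
  fix d
  assume "\<exists>\<pi>' x'. \<pi>' permutes {..<n} \<and> colored_perm_mat r n \<pi> x = colored_perm_mat r n \<pi>' x' \<and>
      d = (\<Sum>i<n. x' i) mod r"
  then obtain \<pi>' x' where \<pi>': "\<pi>' permutes {..<n}"
    and eq: "colored_perm_mat r n \<pi> x = colored_perm_mat r n \<pi>' x'"
    and d: "d = (\<Sum>i<n. x' i) mod r" by blast
  have "x j mod r = x' j mod r" if j: "j < n" for j
  proof -
    have p: "\<pi> j < n" using permutes_in_image[OF assms(2), of j] j by simp
    have "colored_perm_mat r n \<pi> x $$ (\<pi> j, j) = zeta r ^ x j"
      using p j by (simp add: colored_perm_mat_def)
    moreover have "colored_perm_mat r n \<pi>' x' $$ (\<pi> j, j) =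
        (if \<pi> j = \<pi>' j then zeta r ^ x' j else 0)"
      using p j by (simp add: colored_perm_mat_def)
    ultimately have "zeta r ^ x j = (if \<pi> j = \<pi>' j then zeta r ^ x' j else 0)"
      using eq by simp
    then have "zeta r ^ x j = zeta r ^ x' j" by (auto split: if_splits)
    then show ?thesis using zeta_pow_eq_iff[OF assms(1)] by blast
  qed
  then have "(\<Sum>i<n. x i mod r) = (\<Sum>i<n. x' i mod r)" by simp
  then show "d = (\<Sum>i<n. x i) mod r"
    using d mod_sum_eq[of x r "{..<n}"] mod_sum_eq[of x' r "{..<n}"] by simp
qed

lemma root_of_unity_zeta:
  assumes "r > 0" "w ^ r = (1::complex)"
  obtains k where "w = zeta r ^ k"
proof -
  have "(\<lambda>k. zeta r ^ k) ` {..<r} \<subseteq> {z. z ^ r = 1}"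
  proof safe
    fix k
    have "zeta r ^ r = 1" using zeta_pow_eq_iff[OF assms(1), of r 0] by simp
    then show "(zeta r ^ k) ^ r = 1" by (metis power_commutes power_mult mult.commute power_one)
  qed
  moreover have "inj_on (\<lambda>k. zeta r ^ k) {..<r}"
    using zeta_pow_eq_iff[OF assms(1)] by (auto simp: inj_on_def)
  then have "card ((\<lambda>k. zeta r ^ k) ` {..<r}) = r" by (simp add: card_image)
  moreover have "card {z::complex. z ^ r = 1} = r" "finite {z::complex. z ^ r = 1}"
    using assms(1) card_roots_unity_eq[of r] finite_roots_unity[of r] by auto
  ultimately have "(\<lambda>k. zeta r ^ k) ` {..<r} = {z. z ^ r = 1}"
    by (metis card_subset_eq)
  with assms(2) show ?thesis using that by blast
qed

lemma generalized_symmetric_setE: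
  assumes "r > 0" "A \<in> generalized_symmetric_set r n"
  obtains \<pi> x where "\<pi> permutes {..<n}" "A = colored_perm_mat r n \<pi> x"
proof -
  have A: "A \<in> carrier_mat n n"
    and row: "\<And>i. i < n \<Longrightarrow> \<exists>!j. j < n \<and> A $$ (i, j) \<noteq> 0"
    and col: "\<And>j. j < n \<Longrightarrow> \<exists>!i. i < n \<and> A $$ (i, j) \<noteq> 0"
    and root: "\<And>i j. i < n \<Longrightarrow> j < n \<Longrightarrow> A $$ (i, j) \<noteq> 0 \<Longrightarrow> A $$ (i, j) ^ r = 1"
    using assms(2) unfolding generalized_symmetric_set_def by auto
  define \<pi> where "\<pi> j = (if j < n then THE i. i < n \<and> A $$ (i, j) \<noteq> 0 else j)" for j
  have \<pi>: "\<pi> j < n \<and> A $$ (\<pi> j, j) \<noteq> 0" if "j < n" for j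
    using theI'[OF col[OF that]] that unfolding \<pi>_def by simp
  have inj: "inj_on \<pi> {..<n}"
    using \<pi> row by (intro inj_onI) (metis lessThan_iff)
  have "\<pi> ` {..<n} = {..<n}"
    using \<pi> by (intro endo_inj_surj inj) auto
  with inj have perm: "\<pi> permutes {..<n}"
    by (intro bij_imp_permutes) (auto simp: bij_betw_def \<pi>_def)
  have "\<exists>k. A $$ (\<pi> j, j) = zeta r ^ k" if "j < n" for j
    using root_of_unity_zeta[OF assms(1) root] \<pi>[OF that] that by metis
  then obtain x where x: "\<And>j. j < n \<Longrightarrow> A $$ (\<pi> j, j) = zeta r ^ x j" by metis
  have "A = colored_perm_mat r n \<pi> x"
  proof (rule eq_matI)
    fix i j assume "i < dim_row (colored_perm_mat r n \<pi> x)" "j < dim_col (colored_perm_mat r n \<pi> x)"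
    then have ij: "i < n" "j < n" by (simp_all add: colored_perm_mat_def)
    show "A $$ (i, j) = colored_perm_mat r n \<pi> x $$ (i, j)"
    proof (cases "i = \<pi> j")
      case True
      then show ?thesis using ij x[of j] by (simp add: colored_perm_mat_def)
    next
      case False
      then have "A $$ (i, j) = 0" using ij \<pi>[of j] col[of j] by metis
      then show ?thesis using ij False by (simp add: colored_perm_mat_def)
    qed
  qed (use A in \<open>simp_all add: colored_perm_mat_def\<close>)
  with perm show ?thesis using that by blast
qed

end

theory Submission
  imports "HOL-Algebra.Multiplicative_Group" Defs
begin

text \<open>\<open>G = G(r, p, q, 2)\<close> is a split extension \<open>A \<rtimes> \<langle>s\<rangle>\<close> of the abelian group \<open>A\<close> of classes of
  diagonal matrices, on which \<open>s\<close> acts by swapping the entries; write \<open>\<sigma>\<close> for this action. The dual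
  of \<open>A\<close> with its action is the corresponding group for \<open>(r, q, p)\<close>. The irreducible
  characters have degree one or two and their sum is
  \<open>|A| [g = 1] + |A\<^sup>\<sigma>| [g \<in> D]\<close>, where \<open>D = {a / \<sigma>(a)}\<close>.

  If \<open>A\<close> carries a symmetric \<open>\<sigma>\<close>-invariant perfect pairing, then \<open>a \<mapsto> a\<^sup>-\<^sup>1, s \<mapsto> s\<close> admits a
  generalized involution model whose characters are written down with the pairing.
  Conversely, a model for \<open>\<nu>\<close> forces \<open>\<nu>\<close> to have \<open>|A| + |A\<^sup>\<sigma>|\<close> generalized involutions, so \<open>\<nu>\<close> is
  \<open>a \<mapsto> a\<^sup>-\<^sup>1\<close> or \<open>a \<mapsto> \<sigma>(a)\<^sup>-\<^sup>1\<close> on \<open>A\<close> (if \<open>\<nu>\<close> preserves \<open>A\<close>). When exactly one of \<open>p, q\<close> is even and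
  \<open>r\<close> divided by it is even, this is contradictory: for even \<open>p\<close> some central \<open>z \<noteq> 1\<close> acts trivially in
  every character of the model; for even \<open>q\<close> a twisted centralizer equals the group \<open>T\<close> of elements
  of \<open>A\<close> of exponent two, and its character occurs too often in the restriction to \<open>T\<close> unless
  \<open>(r, p, q) = (4, 1, 2)\<close>. In these remaining cases \<open>G(r, p, q, 2)\<close> and \<open>G(r, q, p, 2)\<close> are
  distinguished by their centres.\<close>

section \<open>Characters of a split extension\<close>

text \<open>The forced number of generalized involutions is the value of a model at the identity:
  the induced characters contribute the orbit sizes, the irreducible ones
  \<open>|A| + |A\<^sup>\<sigma>|\<close>. The stabilizer of \<omega> is the fixed subgroup of
  \<open>g \<mapsto> \<omega> \<nu>(g) \<omega>\<^sup>-\<^sup>1\<close>, again an involutive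
  automorphism with equally many generalized involutions. So whatever counting yields about the
  fixed points of such automorphisms holds for every stabilizer of a putative model, and it is
  enough to evaluate the model at central elements. The obstacle is that \<nu> need not preserve
  \<open>A\<close> when \<open>2 |A\<^sup>\<sigma>| = |A|\<close>. Among the negative cases this
  happens only for \<open>(4, 2, 1)\<close>, a group of order 16 with a count of its own. The
  pairings come from equivariant maps between the exponent lattices of \<open>(r, p, q)\<close> and
  \<open>(r, q, p)\<close>. The natural coordinates are \<open>a - b\<close>, on which \<sigma> is a
  sign, and \<open>(a + b) / p\<close>, which it fixes; going back to \<open>a\<close> and
  \<open>b\<close> requires halving, and this is how parity enters.\<close>

lemma sum_eq_zero_if_scaled:
  fixes f :: "'b \<Rightarrow> complex"
  assumes "bij_betw h S S" and "\<And>x. x \<in> S \<Longrightarrow> f (h x) = c * f x" and "c \<noteq> 1"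
  shows "sum f S = 0"
proof -
  have "sum f S = (\<Sum>x\<in>S. f (h x))"
    using sum.reindex_bij_betw[OF assms(1), of f] by simp
  also have "\<dots> = c * sum f S"
    using assms(2) by (simp add: sum_distrib_left)
  finally show ?thesis
    using assms(3) by (metis mult_cancel_right1)
qed

lemma card_eq_card_image_times:
  assumes "finite S" and "\<And>x. x \<in> S \<Longrightarrow> card {y \<in> S. h y = h x} = k"
  shows "card S = card (h ` S) * k"
proof -
  have "card S = (\<Sum>x\<in>S. 1)" by simp
  also have "\<dots> = (\<Sum>z\<in>h ` S. \<Sum>y\<in>{y \<in> S. h y = z}. 1)"
    by (rule sum.image_gen[OF assms(1)])
  also have "\<dots> = (\<Sum>z\<in>h ` S. k)"
    using assms(2) by (intro sum.cong) auto
  finally show ?thesis by simp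
qed

context group
begin

lemma bij_betw_translation:
  assumes "subgroup H G" "h \<in> H"
  shows "bij_betw (\<lambda>x. h \<otimes> x) H H"
proof (rule bij_betw_byWitness[where f' = "\<lambda>x. inv h \<otimes> x"])
  have c: "\<And>x. x \<in> H \<Longrightarrow> x \<in> carrier G" using assms(1) by (rule subgroup.mem_carrier)
  show "\<forall>x\<in>H. inv h \<otimes> (h \<otimes> x) = x" "\<forall>x\<in>H. h \<otimes> (inv h \<otimes> x) = x"
    using c assms(2) by (simp_all add: m_assoc[symmetric])
qed (use assms in \<open>auto intro: subgroup.m_closed subgroup.m_inv_closed\<close>)

lemma sum_character_eq_zero:
  fixes \<chi> :: "'a \<Rightarrow> complex"
  assumes "subgroup H G" and "\<And>a b. a \<in> H \<Longrightarrow> b \<in> H \<Longrightarrow> \<chi> (a \<otimes> b) = \<chi> a * \<chi> b"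
    and "h \<in> H" "\<chi> h \<noteq> 1"
  shows "sum \<chi> H = 0"
  using sum_eq_zero_if_scaled[OF bij_betw_translation[OF assms(1,3)], of \<chi> "\<chi> h"] assms(2-4)
  by blast

end

text \<open>The last assumption holds for every finite abelian \<open>A\<close>; it is all that is needed of the duality
  theory of \<open>A\<close> below.\<close>

locale split_extension = group G for G (structure) +
  fixes A :: "'a set" and s :: 'a
  assumes fin: "finite (carrier G)"
    and subA: "subgroup A G"
    and commA: "a \<in> A \<Longrightarrow> b \<in> A \<Longrightarrow> a \<otimes> b = b \<otimes> a"
    and s_carrier: "s \<in> carrier G" and s_notin: "s \<notin> A" and s_s: "s \<otimes> s = \<one>"
    and cover: "g \<in> carrier G \<Longrightarrow> g \<in> A \<or> (\<exists>a\<in>A. g = a \<otimes> s)"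
    and s_conj: "a \<in> A \<Longrightarrow> s \<otimes> a \<otimes> s \<in> A"
    and separation: "a \<in> A \<Longrightarrow> a \<noteq> \<one> \<Longrightarrow> \<exists>\<chi> :: 'a \<Rightarrow> complex.
      (\<forall>a\<in>A. \<forall>b\<in>A. \<chi> (a \<otimes> b) = \<chi> a * \<chi> b) \<and> \<chi> \<one> = 1 \<and> \<chi> a \<noteq> 1"
begin

definition \<sigma> :: "'a \<Rightarrow> 'a" where "\<sigma> a = s \<otimes> a \<otimes> s"

definition Fix :: "'a set" where "Fix = {a \<in> A. \<sigma> a = a}"

text \<open>The commutators \<open>[a, s]\<close>: the derived subgroup of the extension, hence the
  common kernel of the \<sigma>-invariant characters of \<open>A\<close>
  (\<open>annihilator_dfix\<close>).\<close>

definition D :: "'a set" where "D = (\<lambda>a. a \<otimes> inv (\<sigma> a)) ` A"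

text \<open>Extensionality makes characters that agree on \<open>A\<close> equal as functions, so
  that they can be counted; nonvanishing follows from the value at \<one>.\<close>

definition dual :: "('a \<Rightarrow> complex) set" where
  "dual = {\<chi> \<in> extensional A. (\<forall>a\<in>A. \<forall>b\<in>A. \<chi> (a \<otimes> b) = \<chi> a * \<chi> b) \<and> \<chi> \<one> = 1}"

definition dmult :: "('a \<Rightarrow> complex) \<Rightarrow> ('a \<Rightarrow> complex) \<Rightarrow> 'a \<Rightarrow> complex" where
  "dmult \<chi> \<psi> = (\<lambda>a\<in>A. \<chi> a * \<psi> a)"

definition dconj :: "('a \<Rightarrow> complex) \<Rightarrow> 'a \<Rightarrow> complex" where
  "dconj \<chi> = (\<lambda>a\<in>A. \<chi> (\<sigma> a))"

definition dinv :: "('a \<Rightarrow> complex) \<Rightarrow> 'a \<Rightarrow> complex" where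
  "dinv \<chi> = (\<lambda>a\<in>A. inverse (\<chi> a))"

definition dfix :: "('a \<Rightarrow> complex) set" where "dfix = {\<chi> \<in> dual. dconj \<chi> = \<chi>}"

lemma A_carrier [simp]: "a \<in> A \<Longrightarrow> a \<in> carrier G"
  using subgroup.mem_carrier[OF subA] .

lemma finA [simp]: "finite A"
  using fin subA subgroup.subset finite_subset by metis

lemma one_A [simp]: "\<one> \<in> A" using subgroup.one_closed[OF subA] .
lemma mult_A [simp]: "a \<in> A \<Longrightarrow> b \<in> A \<Longrightarrow> a \<otimes> b \<in> A" using subgroup.m_closed[OF subA] .
lemma inv_A [simp]: "a \<in> A \<Longrightarrow> inv a \<in> A" using subgroup.m_inv_closed[OF subA] .

lemmas s_carr [simp] = s_carrier

lemma s_cancel [simp]: "x \<in> carrier G \<Longrightarrow> s \<otimes> (s \<otimes> x) = x"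
  by (simp add: m_assoc[symmetric] s_s)

lemma inv_s [simp]: "inv s = s"
  using s_s inv_equality s_carrier by simp

lemma \<sigma>_A [simp]: "a \<in> A \<Longrightarrow> \<sigma> a \<in> A"
  unfolding \<sigma>_def by (rule s_conj)

lemma \<sigma>_\<sigma> [simp]: "a \<in> A \<Longrightarrow> \<sigma> (\<sigma> a) = a"
  by (simp add: \<sigma>_def m_assoc s_s)

lemma \<sigma>_mult: "a \<in> A \<Longrightarrow> b \<in> A \<Longrightarrow> \<sigma> (a \<otimes> b) = \<sigma> a \<otimes> \<sigma> b"
  by (simp add: \<sigma>_def m_assoc)

lemma \<sigma>_one [simp]: "\<sigma> \<one> = \<one>" by (simp add: \<sigma>_def s_s)

lemma \<sigma>_inv: "a \<in> A \<Longrightarrow> \<sigma> (inv a) = inv (\<sigma> a)"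
  by (simp add: \<sigma>_def inv_mult_group m_assoc)

lemma s_mult: "a \<in> A \<Longrightarrow> s \<otimes> a = \<sigma> a \<otimes> s"
  by (simp add: \<sigma>_def m_assoc s_s)

lemma as_notin: "a \<in> A \<Longrightarrow> a \<otimes> s \<notin> A"
proof
  assume "a \<in> A" "a \<otimes> s \<in> A"
  then have "inv a \<otimes> (a \<otimes> s) \<in> A" by simp
  with \<open>a \<in> A\<close> show False using s_notin by (simp add: m_assoc[symmetric])
qed

lemma commA_left: "a \<in> A \<Longrightarrow> b \<in> A \<Longrightarrow> c \<in> A \<Longrightarrow> a \<otimes> (b \<otimes> c) = b \<otimes> (a \<otimes> c)"
  by (metis A_carrier commA m_assoc)

lemmas A_ac = m_assoc commA commA_left

lemma inv_multA: "a \<in> A \<Longrightarrow> b \<in> A \<Longrightarrow> inv (a \<otimes> b) = inv a \<otimes> inv b"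
  by (simp add: inv_mult_group commA)

section \<open>The character group of the abelian subgroup\<close>

lemma dual_mult: "\<chi> \<in> dual \<Longrightarrow> a \<in> A \<Longrightarrow> b \<in> A \<Longrightarrow> \<chi> (a \<otimes> b) = \<chi> a * \<chi> b"
  by (simp add: dual_def)

lemma dual_one [simp]: "\<chi> \<in> dual \<Longrightarrow> \<chi> \<one> = 1"
  by (simp add: dual_def)

lemma dual_inv_mult: "\<chi> \<in> dual \<Longrightarrow> a \<in> A \<Longrightarrow> \<chi> (inv a) * \<chi> a = 1"
  using dual_mult[of \<chi> "inv a" a] by simp

lemma dual_nz [simp]: "\<chi> \<in> dual \<Longrightarrow> a \<in> A \<Longrightarrow> \<chi> a \<noteq> 0"
  using dual_inv_mult by fastforce

lemma dual_inv: "\<chi> \<in> dual \<Longrightarrow> a \<in> A \<Longrightarrow> \<chi> (inv a) = inverse (\<chi> a)"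
  using dual_inv_mult[of \<chi> a] by (simp add: field_simps)

lemma dual_eqI: "\<chi> \<in> dual \<Longrightarrow> \<psi> \<in> dual \<Longrightarrow> (\<And>a. a \<in> A \<Longrightarrow> \<chi> a = \<psi> a) \<Longrightarrow> \<chi> = \<psi>"
  unfolding dual_def by (rule extensionalityI[of _ A]) blast+

lemma dualI:
  "(\<And>a. a \<notin> A \<Longrightarrow> \<chi> a = undefined) \<Longrightarrow> (\<And>a b. a \<in> A \<Longrightarrow> b \<in> A \<Longrightarrow> \<chi> (a \<otimes> b) = \<chi> a * \<chi> b) \<Longrightarrow>
    \<chi> \<one> = 1 \<Longrightarrow> \<chi> \<in> dual"
  unfolding dual_def extensional_def by blast

lemma dmult_dual [simp]: "\<chi> \<in> dual \<Longrightarrow> \<psi> \<in> dual \<Longrightarrow> dmult \<chi> \<psi> \<in> dual"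
  by (rule dualI) (simp_all add: dmult_def dual_mult mult_ac)

lemma dinv_dual [simp]: "\<chi> \<in> dual \<Longrightarrow> dinv \<chi> \<in> dual"
  by (rule dualI) (simp_all add: dinv_def dual_mult)

lemma dconj_dual [simp]: "\<chi> \<in> dual \<Longrightarrow> dconj \<chi> \<in> dual"
  by (rule dualI) (simp_all add: dconj_def dual_mult \<sigma>_mult)

lemma dconj_app [simp]: "a \<in> A \<Longrightarrow> dconj \<chi> a = \<chi> (\<sigma> a)" by (simp add: dconj_def)
lemma dmult_app [simp]: "a \<in> A \<Longrightarrow> dmult \<chi> \<psi> a = \<chi> a * \<psi> a" by (simp add: dmult_def)
lemma dinv_app [simp]: "a \<in> A \<Longrightarrow> dinv \<chi> a = inverse (\<chi> a)" by (simp add: dinv_def)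

lemma dconj_dconj [simp]: "\<chi> \<in> dual \<Longrightarrow> dconj (dconj \<chi>) = \<chi>"
  by (intro dual_eqI) simp_all

lemma pow_A [simp]: "a \<in> A \<Longrightarrow> a [^] (n::nat) \<in> A"
  by (induction n) simp_all

lemma dual_pow: "\<chi> \<in> dual \<Longrightarrow> a \<in> A \<Longrightarrow> \<chi> (a [^] (n::nat)) = \<chi> a ^ n"
  by (induction n) (simp_all add: dual_mult)

lemma order_pos: "Coset.order G > 0"
  using fin by (auto simp: Coset.order_def card_gt_0_iff)

lemma dual_root_of_unity: "\<chi> \<in> dual \<Longrightarrow> a \<in> A \<Longrightarrow> \<chi> a ^ Coset.order G = 1"
  by (metis A_carrier dual_one dual_pow pow_order_eq_1)

text \<open>All values are roots of unity of order dividing \<open>|G|\<close>, so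
  \<open>dual\<close> lies in a finite space of functions.\<close>

lemma fin_dual [simp]: "finite dual"
proof -
  have "finite {z::complex. z ^ Coset.order G = 1}"
    using finite_roots_unity[of "Coset.order G"] order_pos by simp
  then have "finite (PiE A (\<lambda>_. {z::complex. z ^ Coset.order G = 1}))"
    by (intro finite_PiE) auto
  moreover have "dual \<subseteq> PiE A (\<lambda>_. {z::complex. z ^ Coset.order G = 1})"
  proof
    fix \<chi> assume \<chi>: "\<chi> \<in> dual"
    then have "\<chi> \<in> extensional A" unfolding dual_def by blast
    with \<chi> show "\<chi> \<in> PiE A (\<lambda>_. {z. z ^ Coset.order G = 1})"
      by (simp add: PiE_def dual_root_of_unity)
  qed
  ultimately show ?thesis by (rule finite_subset[rotated])
qed

definition dtriv :: "'a \<Rightarrow> complex" where "dtriv = (\<lambda>a\<in>A. 1)"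

lemma dtriv_dual [simp]: "dtriv \<in> dual" by (rule dualI) (simp_all add: dtriv_def)
lemma dtriv_app [simp]: "a \<in> A \<Longrightarrow> dtriv a = 1" by (simp add: dtriv_def)

lemma dual_separates: "a \<in> A \<Longrightarrow> a \<noteq> \<one> \<Longrightarrow> \<exists>\<chi>\<in>dual. \<chi> a \<noteq> 1"
proof -
  assume "a \<in> A" "a \<noteq> \<one>"
  then obtain \<chi> :: "'a \<Rightarrow> complex" where
    "\<forall>a\<in>A. \<forall>b\<in>A. \<chi> (a \<otimes> b) = \<chi> a * \<chi> b" "\<chi> \<one> = 1" "\<chi> a \<noteq> 1"
    using separation by blast
  with \<open>a \<in> A\<close> show ?thesis
    by (intro bexI[of _ "restrict \<chi> A"] dualI) simp_all
qed

lemma sum_dual_A: "\<chi> \<in> dual \<Longrightarrow> (\<Sum>a\<in>A. \<chi> a) = (if \<chi> = dtriv then of_nat (card A) else 0)"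
proof (cases "\<chi> = dtriv")
  case False
  assume "\<chi> \<in> dual"
  with False obtain a where "a \<in> A" "\<chi> a \<noteq> 1" using dual_eqI[of \<chi> dtriv] by fastforce
  then show ?thesis
    using sum_character_eq_zero[OF subA, of \<chi> a] False \<open>\<chi> \<in> dual\<close> by (simp add: dual_mult)
qed simp

lemma orthogonality:
  assumes "\<chi> \<in> dual" "\<psi> \<in> dual"
  shows "(\<Sum>a\<in>A. inverse (\<psi> a) * \<chi> a) = (if \<chi> = \<psi> then of_nat (card A) else 0)"
proof -
  have "(\<Sum>a\<in>A. inverse (\<psi> a) * \<chi> a) = (\<Sum>a\<in>A. dmult (dinv \<psi>) \<chi> a)"
    by (intro sum.cong) auto
  moreover have "dmult (dinv \<psi>) \<chi> = dtriv \<longleftrightarrow> \<chi> = \<psi>"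
  proof
    assume eq: "dmult (dinv \<psi>) \<chi> = dtriv"
    show "\<chi> = \<psi>"
    proof (rule dual_eqI[OF assms])
      fix a assume a: "a \<in> A"
      have "dmult (dinv \<psi>) \<chi> a = 1" using eq a by simp
      then show "\<chi> a = \<psi> a" using a assms by (simp add: field_simps)
    qed
  next
    assume "\<chi> = \<psi>"
    then show "dmult (dinv \<psi>) \<chi> = dtriv" using assms by (intro dual_eqI) simp_all
  qed
  ultimately show ?thesis using sum_dual_A[of "dmult (dinv \<psi>) \<chi>"] assms by simp
qed

section \<open>Annihilators and duality by double counting\<close>

definition annihilator :: "('a \<Rightarrow> complex) set \<Rightarrow> 'a set" where
  "annihilator Y = {a \<in> A. \<forall>\<chi>\<in>Y. \<chi> a = 1}"

text \<open>In a finite set of characters closure under products already gives a group: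
  multiplication by a member is injective, hence a permutation.\<close>

definition dsubgroup :: "('a \<Rightarrow> complex) set \<Rightarrow> bool" where
  "dsubgroup Y \<longleftrightarrow> Y \<subseteq> dual \<and> dtriv \<in> Y \<and> (\<forall>\<chi>\<in>Y. \<forall>\<psi>\<in>Y. dmult \<chi> \<psi> \<in> Y)"

lemma sum_dsubgroup:
  assumes "dsubgroup Y" "a \<in> A"
  shows "(\<Sum>\<chi>\<in>Y. \<chi> a) = (if a \<in> annihilator Y then of_nat (card Y) else 0)"
proof (cases "a \<in> annihilator Y")
  case False
  then obtain \<psi> where \<psi>: "\<psi> \<in> Y" "\<psi> a \<noteq> 1" using assms(2) by (auto simp: annihilator_def)
  have finY: "finite Y" and Y: "Y \<subseteq> dual"
    using assms(1) fin_dual by (auto simp: dsubgroup_def intro: finite_subset)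
  have "inj_on (dmult \<psi>) Y"
  proof (rule inj_onI)
    fix \<chi> \<chi>' assume *: "\<chi> \<in> Y" "\<chi>' \<in> Y" "dmult \<psi> \<chi> = dmult \<psi> \<chi>'"
    show "\<chi> = \<chi>'"
    proof (rule dual_eqI)
      fix b assume b: "b \<in> A"
      have "dmult \<psi> \<chi> b = dmult \<psi> \<chi>' b" using * by simp
      then show "\<chi> b = \<chi>' b" using b \<psi> Y by auto
    qed (use * Y in auto)
  qed
  moreover have "dmult \<psi> ` Y \<subseteq> Y" using assms(1) \<psi> by (auto simp: dsubgroup_def)
  ultimately have "bij_betw (dmult \<psi>) Y Y"
    using endo_inj_surj[OF finY] by (simp add: bij_betw_def)
  then have "(\<Sum>\<chi>\<in>Y. \<chi> a) = 0"
    by (rule sum_eq_zero_if_scaled[where c = "\<psi> a"]) (use assms(2) \<psi> in auto)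
  with False show ?thesis by simp
next
  case True
  then have "(\<Sum>\<chi>\<in>Y. \<chi> a) = (\<Sum>\<chi>\<in>Y. 1)"
    by (intro sum.cong) (auto simp: annihilator_def)
  with True show ?thesis by simp
qed

text \<open>Double count of the sum of \<open>\<chi> a\<close> over \<open>A\<close> and
  \<open>Y\<close>. Summing over \<open>Y\<close> inside gives \<open>|Y|\<close> for each
  \<open>a\<close> in the annihilator; summing over \<open>A\<close> inside leaves only the trivial
  character, with value \<open>|A|\<close>.\<close>

lemma card_dsubgroup:
  assumes "dsubgroup Y"
  shows "card Y * card (annihilator Y) = card A"
proof -
  have Y: "Y \<subseteq> dual" and finY: "finite Y" "dtriv \<in> Y"
    using assms fin_dual by (auto simp: dsubgroup_def intro: finite_subset)
  have "(\<Sum>a\<in>A. \<Sum>\<chi>\<in>Y. \<chi> a) = (\<Sum>a\<in>A. if a \<in> annihilator Y then of_nat (card Y) else (0::complex))"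
    using sum_dsubgroup[OF assms] by (intro sum.cong) auto
  also have "\<dots> = of_nat (card Y * card (annihilator Y))"
    by (subst sum.inter_filter[symmetric]) (auto simp: annihilator_def conj_ac mult.commute)
  also have "(\<Sum>a\<in>A. \<Sum>\<chi>\<in>Y. \<chi> a) = (\<Sum>\<chi>\<in>Y. \<Sum>a\<in>A. \<chi> a)"
    by (rule sum.swap)
  also have "\<dots> = (\<Sum>\<chi>\<in>Y. if \<chi> = dtriv then of_nat (card A) else 0)"
    using Y by (intro sum.cong) (auto simp: sum_dual_A)
  also have "\<dots> = of_nat (card A)" using finY by simp
  finally show ?thesis by (simp only: of_nat_eq_iff)
qed

lemma annihilator_dual: "annihilator dual = {\<one>}"
  using dual_separates by (auto simp: annihilator_def)

lemma dsubgroup_dual: "dsubgroup dual" by (simp add: dsubgroup_def)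

text \<open>Separation of points says that the annihilator of the whole dual is trivial, and the
  double count turns this into the cardinality.\<close>

lemma card_dual: "card dual = card A"
  using card_dsubgroup[OF dsubgroup_dual] by (simp add: annihilator_dual)

lemma sum_dual: "a \<in> A \<Longrightarrow> (\<Sum>\<chi>\<in>dual. \<chi> a) = (if a = \<one> then of_nat (card A) else 0)"
  using sum_dsubgroup[OF dsubgroup_dual] by (simp add: annihilator_dual card_dual)

text \<open>The homomorphism \<open>a \<mapsto> a / \<sigma>(a)\<close> has kernel
  \<open>Fix\<close> and image \<open>D\<close>, so its fibres are translates of
  \<open>Fix\<close>.\<close>

lemma card_D: "card A = card D * card Fix"
  unfolding D_def
proof (rule card_eq_card_image_times)
  fix x assume x: "x \<in> A"
  have "bij_betw (\<lambda>y. x \<otimes> y) Fix {y \<in> A. y \<otimes> inv (\<sigma> y) = x \<otimes> inv (\<sigma> x)}"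
  proof (rule bij_betw_byWitness[where f' = "\<lambda>y. inv x \<otimes> y"])
    show "(\<lambda>y. inv x \<otimes> y) ` {y \<in> A. y \<otimes> inv (\<sigma> y) = x \<otimes> inv (\<sigma> x)} \<subseteq> Fix"
    proof safe
      fix y assume y: "y \<in> A" and eq: "y \<otimes> inv (\<sigma> y) = x \<otimes> inv (\<sigma> x)"
      have "inv x \<otimes> y = inv x \<otimes> (y \<otimes> inv (\<sigma> y)) \<otimes> \<sigma> y"
        using x y by (simp add: m_assoc)
      also have "\<dots> = inv (\<sigma> x) \<otimes> \<sigma> y"
        unfolding eq using x y by (simp add: m_assoc[symmetric])
      finally show "inv x \<otimes> y \<in> Fix" using x y by (simp add: Fix_def \<sigma>_mult \<sigma>_inv)
    qed
    show "(\<lambda>y. x \<otimes> y) ` Fix \<subseteq> {y \<in> A. y \<otimes> inv (\<sigma> y) = x \<otimes> inv (\<sigma> x)}"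
    proof safe
      fix y assume "y \<in> Fix"
      then have y: "y \<in> A" "\<sigma> y = y" by (auto simp: Fix_def)
      then show "x \<otimes> y \<in> A" using x by simp
      have "x \<otimes> y \<otimes> inv (\<sigma> (x \<otimes> y)) = x \<otimes> (y \<otimes> (inv y \<otimes> inv (\<sigma> x)))"
        using x y by (simp add: \<sigma>_mult inv_mult_group m_assoc)
      then show "x \<otimes> y \<otimes> inv (\<sigma> (x \<otimes> y)) = x \<otimes> inv (\<sigma> x)"
        using x y by (simp add: m_assoc[symmetric, of y])
    qed
  qed (use x in \<open>auto simp: m_assoc[symmetric] Fix_def\<close>)
  then show "card {y \<in> A. y \<otimes> inv (\<sigma> y) = x \<otimes> inv (\<sigma> x)} = card Fix"
    by (simp add: bij_betw_same_card)
qed simp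

lemma Fix_pos: "card Fix > 0"
proof -
  have "\<one> \<in> Fix" "finite Fix" by (simp_all add: Fix_def)
  then show ?thesis by (auto simp: card_gt_0_iff)
qed

lemma dfix_dual: "\<chi> \<in> dfix \<Longrightarrow> \<chi> \<in> dual"
  unfolding dfix_def by blast

lemma dfix_\<sigma>: assumes "\<chi> \<in> dfix" "a \<in> A" shows "\<chi> (\<sigma> a) = \<chi> a"
proof -
  have "dconj \<chi> = \<chi>" using assms(1) unfolding dfix_def by blast
  then have "dconj \<chi> a = \<chi> a" by simp
  then show ?thesis using assms(2) by simp
qed

lemma dfixI: "\<chi> \<in> dual \<Longrightarrow> (\<And>a. a \<in> A \<Longrightarrow> \<chi> (\<sigma> a) = \<chi> a) \<Longrightarrow> \<chi> \<in> dfix"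
  unfolding dfix_def by (auto intro!: dual_eqI)

lemma dsubgroup_dfix: "dsubgroup dfix"
  unfolding dsubgroup_def
proof (intro conjI ballI)
  show "dtriv \<in> dfix" by (rule dfixI) simp_all
  fix \<chi> \<psi> assume *: "\<chi> \<in> dfix" "\<psi> \<in> dfix"
  then show "dmult \<chi> \<psi> \<in> dfix"
    by (intro dfixI) (simp_all add: dfix_dual dfix_\<sigma>)
qed (auto simp: dfix_def)

text \<open>The analogue on characters of the map defining \<open>D\<close>; its kernel is
  \<open>dfix\<close>.\<close>

definition dtwist :: "('a \<Rightarrow> complex) \<Rightarrow> 'a \<Rightarrow> complex" where
  "dtwist \<chi> = dmult \<chi> (dinv (dconj \<chi>))"

lemma dtwist_dual [simp]: "\<chi> \<in> dual \<Longrightarrow> dtwist \<chi> \<in> dual" by (simp add: dtwist_def)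
lemma dtwist_app [simp]: "a \<in> A \<Longrightarrow> dtwist \<chi> a = \<chi> a / \<chi> (\<sigma> a)"
  by (simp add: dtwist_def divide_inverse)

lemma card_dfix_aux: "card dual = card (dtwist ` dual) * card dfix"
proof (rule card_eq_card_image_times)
  fix \<psi> assume \<psi>: "\<psi> \<in> dual"
  have "bij_betw (dmult \<psi>) dfix {\<chi> \<in> dual. dtwist \<chi> = dtwist \<psi>}"
  proof (rule bij_betw_byWitness[where f' = "dmult (dinv \<psi>)"])
    show "dmult \<psi> ` dfix \<subseteq> {\<chi> \<in> dual. dtwist \<chi> = dtwist \<psi>}"
    proof safe
      fix \<chi> assume \<chi>: "\<chi> \<in> dfix"
      then have d: "\<chi> \<in> dual" by (simp add: dfix_def)
      have inv: "\<chi> (\<sigma> a) = \<chi> a" if "a \<in> A" for a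
        using \<chi> that by (rule dfix_\<sigma>)
      show "dmult \<psi> \<chi> \<in> dual" using \<psi> d by simp
      show "dtwist (dmult \<psi> \<chi>) = dtwist \<psi>"
        by (rule dual_eqI) (use \<psi> d inv in simp_all)
    qed
    show "dmult (dinv \<psi>) ` {\<chi> \<in> dual. dtwist \<chi> = dtwist \<psi>} \<subseteq> dfix"
    proof safe
      fix \<chi> assume \<chi>: "\<chi> \<in> dual" and eq: "dtwist \<chi> = dtwist \<psi>"
      show "dmult (dinv \<psi>) \<chi> \<in> dfix"
      proof (rule dfixI)
        fix a assume a: "a \<in> A"
        have "dtwist \<chi> a = dtwist \<psi> a" using eq by simp
        then show "dmult (dinv \<psi>) \<chi> (\<sigma> a) = dmult (dinv \<psi>) \<chi> a"
          using a \<chi> \<psi> by (simp add: field_simps)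
      qed (use \<chi> \<psi> in simp)
    qed
    show "\<forall>\<chi>\<in>dfix. dmult (dinv \<psi>) (dmult \<psi> \<chi>) = \<chi>"
    proof
      fix \<chi> assume "\<chi> \<in> dfix"
      then have "\<chi> \<in> dual" by (rule dfix_dual)
      with \<psi> show "dmult (dinv \<psi>) (dmult \<psi> \<chi>) = \<chi>" by (intro dual_eqI) simp_all
    qed
    show "\<forall>\<chi>\<in>{\<chi> \<in> dual. dtwist \<chi> = dtwist \<psi>}. dmult \<psi> (dmult (dinv \<psi>) \<chi>) = \<chi>"
    proof
      fix \<chi> assume "\<chi> \<in> {\<chi> \<in> dual. dtwist \<chi> = dtwist \<psi>}"
      with \<psi> show "dmult \<psi> (dmult (dinv \<psi>) \<chi>) = \<chi>" by (intro dual_eqI) simp_all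
    qed
  qed
  then show "card {\<chi> \<in> dual. dtwist \<chi> = dtwist \<psi>} = card dfix"
    by (simp add: bij_betw_same_card)
qed simp

text \<open>The image of \<open>dtwist\<close> has annihilator \<open>Fix\<close>, because
  characters separate \<open>a\<close> from \<open>\<sigma>(a)\<close>. Comparing
  \<open>card_dsubgroup\<close> for this image with the fibre count \<open>card_dfix_aux\<close>
  cancels the size of the image.\<close>

lemma card_dfix: "card dfix = card Fix"
proof -
  have "dsubgroup (dtwist ` dual)"
    unfolding dsubgroup_def
  proof (intro conjI ballI)
    have "dtriv = dtwist dtriv" by (rule dual_eqI) simp_all
    then show "dtriv \<in> dtwist ` dual" by (rule image_eqI[OF _ dtriv_dual])
    fix \<chi> \<psi> assume "\<chi> \<in> dtwist ` dual" "\<psi> \<in> dtwist ` dual"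
    then obtain \<chi>' \<psi>' where *: "\<chi>' \<in> dual" "\<psi>' \<in> dual" "\<chi> = dtwist \<chi>'" "\<psi> = dtwist \<psi>'" by auto
    then have "dmult \<chi> \<psi> = dtwist (dmult \<chi>' \<psi>')" by (intro dual_eqI) simp_all
    with * show "dmult \<chi> \<psi> \<in> dtwist ` dual" by simp
  qed auto
  moreover have "annihilator (dtwist ` dual) = Fix"
  proof safe
    fix a assume "a \<in> annihilator (dtwist ` dual)"
    then have a: "a \<in> A" "\<And>\<chi>. \<chi> \<in> dual \<Longrightarrow> dtwist \<chi> a = 1" by (auto simp: annihilator_def)
    have "a \<otimes> inv (\<sigma> a) = \<one>"
    proof (rule ccontr)
      assume "a \<otimes> inv (\<sigma> a) \<noteq> \<one>"
      then obtain \<chi> where "\<chi> \<in> dual" "\<chi> (a \<otimes> inv (\<sigma> a)) \<noteq> 1"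
        using dual_separates a(1) by (meson \<sigma>_A inv_A mult_A)
      then show False using a by (simp add: dual_mult dual_inv divide_inverse)
    qed
    then have "\<sigma> a = a" using a(1) by (metis A_carrier \<sigma>_A inv_A inv_comm inv_inv inv_solve_left' inv_unique' r_one)
    then show "a \<in> Fix" using a by (simp add: Fix_def)
  qed (auto simp: annihilator_def Fix_def)
  ultimately have "card (dtwist ` dual) * card Fix = card A" using card_dsubgroup by metis
  moreover have "card (dtwist ` dual) * card dfix = card A"
    using card_dfix_aux by (simp add: card_dual)
  moreover have "card (dtwist ` dual) \<noteq> 0" using \<open>dsubgroup (dtwist ` dual)\<close>
    by (auto simp: dsubgroup_def)
  ultimately show ?thesis by (metis mult_cancel1)
qed

lemma D_subset: "D \<subseteq> A" by (auto simp: D_def)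

text \<open>Invariant characters kill \<open>a / \<sigma>(a)\<close>, which is one inclusion; both
  sides have \<open>|A| / |Fix|\<close> elements.\<close>

lemma annihilator_dfix: "annihilator dfix = D"
proof -
  have "D \<subseteq> annihilator dfix"
  proof
    fix d assume "d \<in> D"
    then obtain a where a: "a \<in> A" "d = a \<otimes> inv (\<sigma> a)" by (auto simp: D_def)
    have "\<chi> d = 1" if "\<chi> \<in> dfix" for \<chi>
    proof -
      have "\<chi> \<in> dual" "\<chi> (\<sigma> a) = \<chi> a"
        using that a by (simp_all add: dfix_dual dfix_\<sigma>)
      then show ?thesis using a by (simp add: dual_mult dual_inv)
    qed
    then show "d \<in> annihilator dfix" using a by (simp add: annihilator_def)
  qed
  moreover have "card dfix * card (annihilator dfix) = card A"
    using card_dsubgroup[OF dsubgroup_dfix] .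
  then have "card (annihilator dfix) = card D"
    using card_D Fix_pos by (simp add: card_dfix)
  moreover have "finite (annihilator dfix)" by (simp add: annihilator_def)
  ultimately show ?thesis by (metis card_subset_eq)
qed

lemma sum_dfix: "a \<in> A \<Longrightarrow> (\<Sum>\<chi>\<in>dfix. \<chi> a) = (if a \<in> D then of_nat (card Fix) else 0)"
  using sum_dsubgroup[OF dsubgroup_dfix] by (simp add: annihilator_dfix card_dfix)

end

section \<open>Irreducible representations\<close>

text \<open>Irreducibility is stated with the abstract notion of subspace; below it is only handled
  through these closure conditions.\<close>

lemma subspace_vec_iff:
  "subspace class_ring W (module_vec TYPE(complex) d) \<longleftrightarrow>
    W \<subseteq> carrier_vec d \<and> 0\<^sub>v d \<in> W \<and> (\<forall>v\<in>W. \<forall>w\<in>W. v + w \<in> W) \<and> (\<forall>c. \<forall>v\<in>W. c \<cdot>\<^sub>v v \<in> W)"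
  unfolding subspace_def submodule_def
  using vec_vs[where ?'a = complex, of d] vec_module[where ?'a = complex, of d]
  by (auto simp: module_vec_simps)

definition mat2 :: "complex \<Rightarrow> complex \<Rightarrow> complex \<Rightarrow> complex \<Rightarrow> complex mat" where
  "mat2 a b c d = mat 2 2 (\<lambda>(i, j). if i = 0 then if j = 0 then a else b else if j = 0 then c else d)"

definition vec2 :: "complex \<Rightarrow> complex \<Rightarrow> complex vec" where
  "vec2 x y = vec 2 (\<lambda>i. if i = 0 then x else y)"

lemma mat2_carrier [simp]: "mat2 a b c d \<in> carrier_mat 2 2"
  and mat2_dim [simp]: "dim_row (mat2 a b c d) = 2" "dim_col (mat2 a b c d) = 2"
  and mat2_index [simp]: "mat2 a b c d $$ (0, 0) = a" "mat2 a b c d $$ (0, Suc 0) = b"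
    "mat2 a b c d $$ (Suc 0, 0) = c" "mat2 a b c d $$ (Suc 0, Suc 0) = d"
  by (simp_all add: mat2_def)

lemma vec2_carrier [simp]: "vec2 x y \<in> carrier_vec 2"
  and vec2_dim [simp]: "dim_vec (vec2 x y) = 2"
  and vec2_index [simp]: "vec2 x y $ 0 = x" "vec2 x y $ Suc 0 = y"
  by (simp_all add: vec2_def)

lemma mat2_eqI:
  assumes "M \<in> carrier_mat 2 2" "N \<in> carrier_mat 2 2" "M $$ (0,0) = N $$ (0,0)"
    "M $$ (0,Suc 0) = N $$ (0,Suc 0)" "M $$ (Suc 0,0) = N $$ (Suc 0,0)" "M $$ (Suc 0,Suc 0) = N $$ (Suc 0,Suc 0)"
  shows "M = N"
  using assms by (intro eq_matI) (auto simp: less_2_cases_iff)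

lemma vec2_eqI:
  assumes "dim_vec v = 2" "dim_vec w = 2" "v $ 0 = w $ 0" "v $ Suc 0 = w $ Suc 0"
  shows "v = w"
  using assms by (intro eq_vecI) (auto simp: less_2_cases_iff)

lemma mat2_mult: "mat2 a b c d * mat2 a' b' c' d' =
    mat2 (a * a' + b * c') (a * b' + b * d') (c * a' + d * c') (c * b' + d * d')"
  by (rule mat2_eqI, (rule mult_carrier_mat[of _ 2 2]; simp), simp)
    (simp_all add: scalar_prod_def numeral_2_eq_2)

lemma mat2_mult_vec: "dim_vec v = 2 \<Longrightarrow>
    mat2 a b c d *\<^sub>v v = vec2 (a * v $ 0 + b * v $ 1) (c * v $ 0 + d * v $ 1)"
  by (rule vec2_eqI) (simp_all add: scalar_prod_def numeral_2_eq_2)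

lemma mat2_eq_iff [simp]:
  "mat2 a b c d = mat2 a' b' c' d' \<longleftrightarrow> a = a' \<and> b = b' \<and> c = c' \<and> d = d'"
  by (metis mat2_index)

lemma mat2_one: "1\<^sub>m 2 = mat2 1 0 0 1"
  by (rule mat2_eqI) simp_all

lemma mat2_trace: "mat_trace (mat2 a b c d) = a + d"
  by (simp add: mat_trace_def numeral_2_eq_2)

text \<open>Invertibility of \<open>\<rho> g\<close> is automatic, the inverse being
  \<open>\<rho> (inv g)\<close>; this replaces the group of units by plain matrix
  identities.\<close>

lemma (in group) representation_iff:
  "representation G d \<rho> \<longleftrightarrow> (\<forall>g\<in>carrier G. \<rho> g \<in> carrier_mat d d) \<and>
    (\<forall>g\<in>carrier G. \<forall>h\<in>carrier G. \<rho> (g \<otimes> h) = \<rho> g * \<rho> h) \<and> \<rho> \<one> = 1\<^sub>m d"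
    (is "_ \<longleftrightarrow> ?R")
proof
  let ?M = "ring_mat TYPE(complex) d ()"
  interpret M: ring ?M by (rule ring_mat)
  interpret U: group "units_of ?M" by (rule M.units_group)
  assume "representation G d \<rho>"
  then have h: "\<rho> \<in> hom G (units_of ?M)" by (simp add: representation_def)
  have "\<rho> \<one> = \<one>\<^bsub>units_of ?M\<^esub>"
    using hom_one[OF h is_group U.is_group] .
  then show ?R using h
    by (auto simp: hom_def units_of_def Units_def ring_mat_simps)
next
  assume R: ?R
  have "\<rho> g \<in> Units (ring_mat TYPE(complex) d ())" if g: "g \<in> carrier G" for g
  proof -
    have "\<rho> g * \<rho> (inv g) = 1\<^sub>m d" "\<rho> (inv g) * \<rho> g = 1\<^sub>m d"
      using R g by (metis inv_closed r_inv, metis inv_closed l_inv)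
    then show ?thesis using R g by (auto simp: Units_def ring_mat_simps)
  qed
  with R show "representation G d \<rho>"
    by (auto simp: representation_def hom_def units_of_def ring_mat_simps)
qed

context split_extension
begin

text \<open>The extension of a \<sigma>-invariant \<chi> to the whole group with value \<epsilon> at
  \<open>s\<close>.\<close>

definition lin :: "('a \<Rightarrow> complex) \<Rightarrow> complex \<Rightarrow> 'a \<Rightarrow> complex" where
  "lin \<chi> \<epsilon> = (\<lambda>g\<in>carrier G. if g \<in> A then \<chi> g else \<epsilon> * \<chi> (g \<otimes> s))"

definition two :: "('a \<Rightarrow> complex) \<Rightarrow> 'a \<Rightarrow> complex" where
  "two \<chi> = (\<lambda>g\<in>carrier G. if g \<in> A then \<chi> g + \<chi> (\<sigma> g) else 0)"

text \<open>The representation induced from \<chi>, in the basis formed by an eigenvector of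
  \<open>A\<close> and its image under \<open>s\<close>; \<open>two\<close> is its
  character.\<close>

definition rep2 :: "('a \<Rightarrow> complex) \<Rightarrow> 'a \<Rightarrow> complex mat" where
  "rep2 \<chi> g = (if g \<in> A then mat2 (\<chi> g) 0 0 (\<chi> (\<sigma> g))
     else mat2 0 (\<chi> (g \<otimes> s)) (\<chi> (\<sigma> (g \<otimes> s))) 0)"

lemma cover_cases [consumes 1, case_names base outer]:
  assumes "g \<in> carrier G"
  obtains "g \<in> A" | a where "a \<in> A" "g = a \<otimes> s"
  using cover[OF assms] by blast

lemma as_s [simp]: "a \<in> A \<Longrightarrow> a \<otimes> s \<otimes> s = a"
  by (simp add: m_assoc s_s)

lemma as_b: "a \<in> A \<Longrightarrow> b \<in> A \<Longrightarrow> a \<otimes> s \<otimes> b = a \<otimes> \<sigma> b \<otimes> s"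
  by (simp add: m_assoc s_mult)

lemma a_bs: "a \<in> A \<Longrightarrow> b \<in> A \<Longrightarrow> a \<otimes> (b \<otimes> s) = a \<otimes> b \<otimes> s"
  by (simp add: m_assoc)

lemma as_bs: "a \<in> A \<Longrightarrow> b \<in> A \<Longrightarrow> a \<otimes> s \<otimes> (b \<otimes> s) = a \<otimes> \<sigma> b"
  using as_b[of a b] by (simp add: m_assoc[symmetric])

lemma lin_base: "a \<in> A \<Longrightarrow> lin \<chi> \<epsilon> a = \<chi> a"
  by (simp add: lin_def)

lemma lin_outer: "a \<in> A \<Longrightarrow> lin \<chi> \<epsilon> (a \<otimes> s) = \<epsilon> * \<chi> a"
  using as_notin by (simp add: lin_def)

lemma two_base: "a \<in> A \<Longrightarrow> two \<chi> a = \<chi> a + \<chi> (\<sigma> a)"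
  by (simp add: two_def)

lemma two_outer: "a \<in> A \<Longrightarrow> two \<chi> (a \<otimes> s) = 0"
  using as_notin by (simp add: two_def)

lemma lin_mult:
  assumes \<chi>: "\<chi> \<in> dfix" and "\<epsilon> * \<epsilon> = 1" and g: "g \<in> carrier G" and h: "h \<in> carrier G"
  shows "lin \<chi> \<epsilon> (g \<otimes> h) = lin \<chi> \<epsilon> g * lin \<chi> \<epsilon> h"
  using g
proof (cases rule: cover_cases)
  case base
  note g = this
  from h show ?thesis
    by (cases rule: cover_cases)
      (simp_all add: g lin_base lin_outer a_bs dual_mult[OF dfix_dual[OF \<chi>]])
next
  case (outer a)
  note g = this
  from h show ?thesis
    using assms(2)
    by (cases rule: cover_cases)
      (simp_all add: g lin_base lin_outer as_b as_bs dual_mult[OF dfix_dual[OF \<chi>]] dfix_\<sigma>[OF \<chi>])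
qed

lemma rep2_carrier: "rep2 \<chi> g \<in> carrier_mat 2 2"
  by (simp add: rep2_def)

lemma rep2_base: "a \<in> A \<Longrightarrow> rep2 \<chi> a = mat2 (\<chi> a) 0 0 (\<chi> (\<sigma> a))"
  by (simp add: rep2_def)

lemma rep2_outer: "a \<in> A \<Longrightarrow> rep2 \<chi> (a \<otimes> s) = mat2 0 (\<chi> a) (\<chi> (\<sigma> a)) 0"
  using as_notin by (simp add: rep2_def)

lemma rep2_mult:
  assumes \<chi>: "\<chi> \<in> dual" and g: "g \<in> carrier G" and h: "h \<in> carrier G"
  shows "rep2 \<chi> (g \<otimes> h) = rep2 \<chi> g * rep2 \<chi> h"
  using g
proof (cases rule: cover_cases)
  case base
  note g = this
  from h show ?thesis
    by (cases rule: cover_cases)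
      (simp_all add: g rep2_base rep2_outer a_bs dual_mult[OF \<chi>] \<sigma>_mult mat2_mult)
next
  case (outer a)
  note g = this
  from h show ?thesis
    by (cases rule: cover_cases)
      (simp_all add: g rep2_base rep2_outer as_b as_bs dual_mult[OF \<chi>] \<sigma>_mult mat2_mult)
qed

lemma rep2_representation: "\<chi> \<in> dual \<Longrightarrow> representation G 2 (rep2 \<chi>)"
  unfolding representation_iff
  using rep2_carrier rep2_mult by (simp add: rep2_base mat2_one)

lemma lin_representation:
  assumes "\<chi> \<in> dfix" "\<epsilon> * \<epsilon> = 1"
  shows "representation G 1 (\<lambda>g. mat 1 1 (\<lambda>_. lin \<chi> \<epsilon> g))"
  unfolding representation_iff
  using lin_mult[OF assms] dfix_dual[OF assms(1)]
  by (auto intro!: eq_matI simp: scalar_prod_def lin_base)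

lemma lin_irreducible:
  assumes "\<chi> \<in> dfix" "\<epsilon> * \<epsilon> = 1"
  shows "irreducible_representation G 1 (\<lambda>g. mat 1 1 (\<lambda>_. lin \<chi> \<epsilon> g))"
  unfolding irreducible_representation_def subspace_vec_iff
proof (intro conjI allI impI lin_representation[OF assms])
  fix W :: "complex vec set"
  assume "(W \<subseteq> carrier_vec 1 \<and> 0\<^sub>v 1 \<in> W \<and> (\<forall>v\<in>W. \<forall>w\<in>W. v + w \<in> W) \<and> (\<forall>c. \<forall>v\<in>W. c \<cdot>\<^sub>v v \<in> W)) \<and>
    (\<forall>g\<in>carrier G. \<forall>v\<in>W. mat 1 1 (\<lambda>_. lin \<chi> \<epsilon> g) *\<^sub>v v \<in> W)"
  then have W: "W \<subseteq> carrier_vec 1" "0\<^sub>v 1 \<in> W" "\<And>c v. v \<in> W \<Longrightarrow> c \<cdot>\<^sub>v v \<in> W" by auto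
  show "W = {0\<^sub>v 1} \<or> W = carrier_vec 1"
  proof (cases "W = {0\<^sub>v 1}")
    case False
    then obtain w where w: "w \<in> W" "w \<noteq> 0\<^sub>v 1" using W by auto
    then have w1: "w \<in> carrier_vec 1" using W by auto
    then have w0: "w $ 0 \<noteq> 0" using w(2) by (metis carrier_vecD eq_vecI index_zero_vec less_one)
    have "v \<in> W" if v: "v \<in> carrier_vec 1" for v
    proof -
      have "v = (v $ 0 / w $ 0) \<cdot>\<^sub>v w" using v w0 w1 by (intro eq_vecI) auto
      then show ?thesis using W(3)[OF w(1)] by metis
    qed
    then show ?thesis using W by auto
  qed simp
qed simp

text \<open>If \<chi> differs from its conjugate at \<open>a\<close>, the operator
  \<open>\<rho>(a) - \<chi>(\<sigma> a)\<close> kills the second basis vector and not the first.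
  Applied to a vector with nonzero first coordinate it yields \<open>vec2 1 0\<close>, and
  \<open>s\<close> exchanges the two basis vectors.\<close>

lemma rep2_irreducible:
  assumes \<chi>: "\<chi> \<in> dual" and nf: "\<chi> \<notin> dfix"
  shows "irreducible_representation G 2 (rep2 \<chi>)"
  unfolding irreducible_representation_def subspace_vec_iff
proof (intro conjI allI impI rep2_representation[OF \<chi>])
  fix W :: "complex vec set"
  assume "(W \<subseteq> carrier_vec 2 \<and> 0\<^sub>v 2 \<in> W \<and> (\<forall>v\<in>W. \<forall>w\<in>W. v + w \<in> W) \<and> (\<forall>c. \<forall>v\<in>W. c \<cdot>\<^sub>v v \<in> W)) \<and>
    (\<forall>g\<in>carrier G. \<forall>v\<in>W. rep2 \<chi> g *\<^sub>v v \<in> W)"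
  then have W: "W \<subseteq> carrier_vec 2" "0\<^sub>v 2 \<in> W" "\<And>c v. v \<in> W \<Longrightarrow> c \<cdot>\<^sub>v v \<in> W"
    "\<And>v w. v \<in> W \<Longrightarrow> w \<in> W \<Longrightarrow> v + w \<in> W" "\<And>g v. g \<in> carrier G \<Longrightarrow> v \<in> W \<Longrightarrow> rep2 \<chi> g *\<^sub>v v \<in> W"
    by auto
  obtain a where a: "a \<in> A" "\<chi> (\<sigma> a) \<noteq> \<chi> a" using nf \<chi> dfixI by blast
  have s_rep: "rep2 \<chi> s = mat2 0 1 1 0"
    using rep2_outer[of \<one> \<chi>] \<chi> by simp
  have e1: "vec2 0 1 \<in> W" if "vec2 1 0 \<in> W"
  proof -
    have "rep2 \<chi> s *\<^sub>v vec2 1 0 = vec2 0 1"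
      by (simp add: s_rep mat2_mult_vec)
    then show ?thesis using W(5)[OF s_carrier that] by simp
  qed
  have e0: "vec2 1 0 \<in> W" if w: "w \<in> W" "w $ 0 \<noteq> 0" for w
  proof -
    have d: "dim_vec w = 2" using W w by auto
    have "rep2 \<chi> a *\<^sub>v w + (- \<chi> (\<sigma> a)) \<cdot>\<^sub>v w \<in> W" (is "?u \<in> W") using W w a by simp
    then have *: "(1 / ((\<chi> a - \<chi> (\<sigma> a)) * w $ 0)) \<cdot>\<^sub>v ?u \<in> W" by (rule W(3))
    have "(1 / ((\<chi> a - \<chi> (\<sigma> a)) * w $ 0)) \<cdot>\<^sub>v ?u = vec2 1 0"
      using a w(2) d
      by (intro vec2_eqI) (simp_all add: rep2_base mat2_mult_vec field_simps)
    with * show ?thesis by simp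
  qed
  show "W = {0\<^sub>v 2} \<or> W = carrier_vec 2"
  proof (cases "W = {0\<^sub>v 2}")
    case False
    then obtain w where w: "w \<in> W" "w \<noteq> 0\<^sub>v 2" using W by auto
    then have d: "dim_vec w = 2" using W by auto
    have "w $ 0 \<noteq> 0 \<or> w $ 1 \<noteq> 0"
    proof (rule ccontr)
      assume "\<not> ?thesis"
      then have "w = 0\<^sub>v 2" using d by (intro eq_vecI) (auto simp: less_2_cases_iff)
      with w show False by simp
    qed
    moreover have "(rep2 \<chi> s *\<^sub>v w) $ 0 = w $ 1"
      using d by (simp add: s_rep mat2_mult_vec)
    ultimately have e: "vec2 1 0 \<in> W"
      using e0[OF w(1)] e0[OF W(5)[OF s_carrier w(1)]] by auto
    have "v \<in> W" if v: "v \<in> carrier_vec 2" for v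
    proof -
      have "v = v $ 0 \<cdot>\<^sub>v vec2 1 0 + v $ 1 \<cdot>\<^sub>v vec2 0 1"
        using v by (intro vec2_eqI) simp_all
      then show ?thesis using W(3,4) e e1[OF e] by metis
    qed
    then show ?thesis using W by auto
  qed simp
qed simp

lemma lin_in_Irr:
  assumes "\<chi> \<in> dfix" "\<epsilon> * \<epsilon> = 1" shows "lin \<chi> \<epsilon> \<in> Irr G"
proof -
  have "lin \<chi> \<epsilon> = (\<lambda>g\<in>carrier G. mat_trace (mat 1 1 (\<lambda>_. lin \<chi> \<epsilon> g)))"
    by (rule extensionalityI[of _ "carrier G"]) (auto simp: lin_def mat_trace_def)
  then show ?thesis using lin_irreducible[OF assms] by (auto simp: Irr_def)
qed

lemma two_in_Irr:
  assumes "\<chi> \<in> dual" "\<chi> \<notin> dfix" shows "two \<chi> \<in> Irr G"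
proof -
  have "two \<chi> = (\<lambda>g\<in>carrier G. mat_trace (rep2 \<chi> g))"
    by (rule extensionalityI[of _ "carrier G"])
      (auto simp: two_def rep2_def mat2_trace)
  then show ?thesis using rep2_irreducible[OF assms] by (auto simp: Irr_def)
qed

text \<open>The vectors \<open>\<Sum>a. \<chi>(a)\<^sup>-\<^sup>1 \<rho>(a) w\<close> are eigenvectors for \<open>A\<close>, and their sum over all \<open>\<chi>\<close> is
  a nonzero multiple of \<open>w\<close>, so not all of them vanish.\<close>

lemma common_eigenvector:
  assumes rep: "representation G d \<rho>" and d: "d > 0"
  obtains \<chi> v where "\<chi> \<in> dual" "v \<in> carrier_vec d" "v \<noteq> 0\<^sub>v d"
    "\<And>a. a \<in> A \<Longrightarrow> \<rho> a *\<^sub>v v = \<chi> a \<cdot>\<^sub>v v"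
proof -
  have carr: "\<And>g. g \<in> carrier G \<Longrightarrow> \<rho> g \<in> carrier_mat d d"
    and mult: "\<And>g h. g \<in> carrier G \<Longrightarrow> h \<in> carrier G \<Longrightarrow> \<rho> (g \<otimes> h) = \<rho> g * \<rho> h"
    and one: "\<rho> \<one> = 1\<^sub>m d"
    using rep unfolding representation_iff by auto
  define w :: "complex vec" where "w = unit_vec d 0"
  have w: "w \<in> carrier_vec d" by (simp add: w_def)
  define V where "V \<chi> = vec d (\<lambda>i. \<Sum>a\<in>A. inverse (\<chi> a) * (\<rho> a *\<^sub>v w) $ i)" for \<chi>
  have eig: "\<rho> b *\<^sub>v V \<chi> = \<chi> b \<cdot>\<^sub>v V \<chi>" if \<chi>: "\<chi> \<in> dual" and b: "b \<in> A" for \<chi> b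
  proof (rule eq_vecI)
    fix i assume "i < dim_vec (\<chi> b \<cdot>\<^sub>v V \<chi>)"
    then have i: "i < d" by (simp add: V_def)
    have rb: "\<rho> b \<in> carrier_mat d d" using carr b by simp
    have "(\<rho> b *\<^sub>v V \<chi>) $ i = (\<Sum>j<d. \<rho> b $$ (i, j) * (\<Sum>a\<in>A. inverse (\<chi> a) * (\<rho> a *\<^sub>v w) $ j))"
      using i rb by (simp add: V_def scalar_prod_def atLeast0LessThan)
    also have "\<dots> = (\<Sum>a\<in>A. inverse (\<chi> a) * (\<Sum>j<d. \<rho> b $$ (i, j) * (\<rho> a *\<^sub>v w) $ j))"
      by (simp only: sum_distrib_left, subst sum.swap, simp only: mult.left_commute)
    also have "\<dots> = (\<Sum>a\<in>A. inverse (\<chi> a) * (\<rho> (b \<otimes> a) *\<^sub>v w) $ i)"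
    proof (intro sum.cong refl)
      fix a assume a: "a \<in> A"
      then have ra: "\<rho> a \<in> carrier_mat d d" using carr by simp
      have "\<rho> (b \<otimes> a) *\<^sub>v w = \<rho> b *\<^sub>v (\<rho> a *\<^sub>v w)"
        using a b mult assoc_mult_mat_vec[OF rb ra w] by simp
      moreover have "(\<rho> b *\<^sub>v (\<rho> a *\<^sub>v w)) $ i = (\<Sum>j<d. \<rho> b $$ (i, j) * (\<rho> a *\<^sub>v w) $ j)"
        using i ra rb by (subst index_mult_mat_vec) (auto simp: scalar_prod_def atLeast0LessThan)
      ultimately show "inverse (\<chi> a) * (\<Sum>j<d. \<rho> b $$ (i, j) * (\<rho> a *\<^sub>v w) $ j) =
          inverse (\<chi> a) * (\<rho> (b \<otimes> a) *\<^sub>v w) $ i" by simp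
    qed
    also have "\<dots> = (\<Sum>a\<in>A. \<chi> b * (inverse (\<chi> (b \<otimes> a)) * (\<rho> (b \<otimes> a) *\<^sub>v w) $ i))"
      using b \<chi> by (intro sum.cong) (simp_all add: dual_mult)
    also have "\<dots> = (\<Sum>a\<in>A. \<chi> b * (inverse (\<chi> a) * (\<rho> a *\<^sub>v w) $ i))"
      by (rule sum.reindex_bij_betw[OF bij_betw_translation[OF subA b]])
    also have "\<dots> = (\<chi> b \<cdot>\<^sub>v V \<chi>) $ i"
      using i by (simp add: V_def sum_distrib_left)
    finally show "(\<rho> b *\<^sub>v V \<chi>) $ i = (\<chi> b \<cdot>\<^sub>v V \<chi>) $ i" .
  qed (use carr[of b] b in \<open>simp add: V_def\<close>)
  have "\<exists>\<chi>\<in>dual. V \<chi> \<noteq> 0\<^sub>v d"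
  proof (rule ccontr)
    assume "\<not> ?thesis"
    then have z: "V \<chi> $ 0 = 0" if "\<chi> \<in> dual" for \<chi> using that d by simp
    have "0 = (\<Sum>\<chi>\<in>dual. V \<chi> $ 0)" using z by simp
    also have "\<dots> = (\<Sum>\<chi>\<in>dual. \<Sum>a\<in>A. inverse (\<chi> a) * (\<rho> a *\<^sub>v w) $ 0)"
      using d by (simp add: V_def)
    also have "\<dots> = (\<Sum>a\<in>A. (\<Sum>\<chi>\<in>dual. \<chi> (inv a)) * (\<rho> a *\<^sub>v w) $ 0)"
      by (subst sum.swap) (simp add: sum_distrib_right dual_inv)
    also have "\<dots> = (\<Sum>a\<in>A. if a = \<one> then of_nat (card A) * (\<rho> a *\<^sub>v w) $ 0 else 0)"
      by (intro sum.cong) (auto simp: sum_dual)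
    also have "\<dots> = of_nat (card A) * (w $ 0)"
      using one w by simp
    finally have "card A = 0" using d by (simp add: w_def)
    then show False by (metis card_0_eq empty_iff finA one_A)
  qed
  then obtain \<chi> where "\<chi> \<in> dual" "V \<chi> \<noteq> 0\<^sub>v d" by blast
  with eig show thesis by (intro that[of \<chi> "V \<chi>"]) (auto simp: V_def)
qed

text \<open>The trace in the basis \<open>v\<close>, \<open>v'\<close> without a change of basis:
  \<open>tr(M) det(v, v') = det(M v, v') + det(v, M v')\<close>.\<close>

lemma trace_two_dim:
  fixes M :: "complex mat"
  assumes M: "M \<in> carrier_mat 2 2" and v: "dim_vec v = 2" and v': "dim_vec v' = 2"
    and indep: "v $ 0 * v' $ 1 \<noteq> v $ 1 * v' $ 0"
    and Mv: "M *\<^sub>v v = \<alpha> \<cdot>\<^sub>v v + \<beta> \<cdot>\<^sub>v v'" "M *\<^sub>v v' = \<gamma> \<cdot>\<^sub>v v + \<delta> \<cdot>\<^sub>v v'"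
  shows "mat_trace M = \<alpha> + \<delta>"
proof -
  have comp: "(M *\<^sub>v u) $ 0 = M $$ (0,0) * u $ 0 + M $$ (0,1) * u $ 1"
    "(M *\<^sub>v u) $ 1 = M $$ (1,0) * u $ 0 + M $$ (1,1) * u $ 1" if "dim_vec u = 2" for u
    using M that by (simp_all add: scalar_prod_def numeral_2_eq_2)
  have e: "M $$ (0,0) * v $ 0 + M $$ (0,1) * v $ 1 = \<alpha> * v $ 0 + \<beta> * v' $ 0"
    "M $$ (1,0) * v $ 0 + M $$ (1,1) * v $ 1 = \<alpha> * v $ 1 + \<beta> * v' $ 1"
    "M $$ (0,0) * v' $ 0 + M $$ (0,1) * v' $ 1 = \<gamma> * v $ 0 + \<delta> * v' $ 0"
    "M $$ (1,0) * v' $ 0 + M $$ (1,1) * v' $ 1 = \<gamma> * v $ 1 + \<delta> * v' $ 1"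
    using comp[OF v] comp[OF v'] Mv v v' by simp_all
  have "(M $$ (0,0) + M $$ (1,1)) * (v $ 0 * v' $ 1 - v $ 1 * v' $ 0) =
      (M $$ (0,0) * v $ 0 + M $$ (0,1) * v $ 1) * v' $ 1 - (M $$ (1,0) * v $ 0 + M $$ (1,1) * v $ 1) * v' $ 0 +
      v $ 0 * (M $$ (1,0) * v' $ 0 + M $$ (1,1) * v' $ 1) - v $ 1 * (M $$ (0,0) * v' $ 0 + M $$ (0,1) * v' $ 1)"
    by (simp add: algebra_simps)
  also have "\<dots> = (\<alpha> + \<delta>) * (v $ 0 * v' $ 1 - v $ 1 * v' $ 0)"
    unfolding e by (simp add: algebra_simps)
  finally have "M $$ (0,0) + M $$ (1,1) = \<alpha> + \<delta>" using indep by simp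
  then show ?thesis using M by (simp add: mat_trace_def numeral_2_eq_2)
qed

text \<open>A common eigenvector \<open>v\<close> of \<open>A\<close> and its image
  \<open>v'\<close> under \<open>s\<close>, which belongs to the conjugate character, span an
  invariant subspace, so irreducibility makes them span everything. If the character is invariant, a
  single vector in this span is already an eigenvector for the whole group.\<close>

lemma Irr_cases:
  assumes "\<psi> \<in> Irr G"
  obtains \<chi> \<epsilon> where "\<chi> \<in> dfix" "\<epsilon> \<in> {1, -1}" "\<psi> = lin \<chi> \<epsilon>"
  | \<chi> where "\<chi> \<in> dual" "\<chi> \<notin> dfix" "\<psi> = two \<chi>"
proof -
  obtain d \<rho> where \<psi>: "\<psi> = (\<lambda>g\<in>carrier G. mat_trace (\<rho> g))"
    and irr: "irreducible_representation G d \<rho>"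
    using assms by (auto simp: Irr_def)
  have rep: "representation G d \<rho>" and d: "d > 0"
    using irr unfolding irreducible_representation_def by auto
  have inv: "\<forall>W. (W \<subseteq> carrier_vec d \<and> 0\<^sub>v d \<in> W \<and> (\<forall>v\<in>W. \<forall>w\<in>W. v + w \<in> W) \<and> (\<forall>c. \<forall>v\<in>W. c \<cdot>\<^sub>v v \<in> W)) \<and>
      (\<forall>g\<in>carrier G. \<forall>v\<in>W. \<rho> g *\<^sub>v v \<in> W) \<longrightarrow> W = {0\<^sub>v d} \<or> W = carrier_vec d"
    using irr unfolding irreducible_representation_def subspace_vec_iff by (elim conjE)
  have whole: "W = {0\<^sub>v d} \<or> W = carrier_vec d"
    if "W \<subseteq> carrier_vec d" "0\<^sub>v d \<in> W" "\<And>v w. v \<in> W \<Longrightarrow> w \<in> W \<Longrightarrow> v + w \<in> W"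
      "\<And>c v. v \<in> W \<Longrightarrow> c \<cdot>\<^sub>v v \<in> W" "\<And>g v. g \<in> carrier G \<Longrightarrow> v \<in> W \<Longrightarrow> \<rho> g *\<^sub>v v \<in> W" for W
    by (rule inv[rule_format]) (use that in simp)
  have carr: "\<And>g. g \<in> carrier G \<Longrightarrow> \<rho> g \<in> carrier_mat d d"
    and mult: "\<And>g h. g \<in> carrier G \<Longrightarrow> h \<in> carrier G \<Longrightarrow> \<rho> (g \<otimes> h) = \<rho> g * \<rho> h"
    and one: "\<rho> \<one> = 1\<^sub>m d"
    using rep unfolding representation_iff by auto
  have app: "\<rho> (g \<otimes> h) *\<^sub>v v = \<rho> g *\<^sub>v (\<rho> h *\<^sub>v v)"
    if "g \<in> carrier G" "h \<in> carrier G" "v \<in> carrier_vec d" for g h v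
    using mult[OF that(1,2)] assoc_mult_mat_vec[OF carr[OF that(1)] carr[OF that(2)] that(3)] by simp
  obtain \<chi> v where \<chi>: "\<chi> \<in> dual" and v: "v \<in> carrier_vec d" "v \<noteq> 0\<^sub>v d"
    and eig: "\<And>a. a \<in> A \<Longrightarrow> \<rho> a *\<^sub>v v = \<chi> a \<cdot>\<^sub>v v"
    using common_eigenvector[OF rep d] by metis
  define v' where "v' = \<rho> s *\<^sub>v v"
  have v': "v' \<in> carrier_vec d"
    unfolding v'_def by (rule mult_mat_vec_carrier[OF carr[OF s_carrier] v(1)])
  have sv': "\<rho> s *\<^sub>v v' = v"
    using app[of s s v] v one by (simp add: v'_def s_s)
  have eig': "\<rho> a *\<^sub>v v' = \<chi> (\<sigma> a) \<cdot>\<^sub>v v'" if a: "a \<in> A" for a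
  proof -
    have "\<rho> a *\<^sub>v v' = \<rho> (a \<otimes> s) *\<^sub>v v" using app[of a s v] a v by (simp add: v'_def)
    also have "a \<otimes> s = s \<otimes> \<sigma> a" using a s_mult[of "\<sigma> a"] by simp
    also have "\<rho> (s \<otimes> \<sigma> a) *\<^sub>v v = \<rho> s *\<^sub>v (\<chi> (\<sigma> a) \<cdot>\<^sub>v v)" using app[of s "\<sigma> a" v] a v eig by simp
    also have "\<dots> = \<chi> (\<sigma> a) \<cdot>\<^sub>v v'"
      using mult_mat_vec[OF carr[OF s_carrier] v(1)] by (simp add: v'_def)
    finally show ?thesis .
  qed
  have s_app: "\<rho> (a \<otimes> s) *\<^sub>v u = \<rho> a *\<^sub>v (\<rho> s *\<^sub>v u)" if "a \<in> A" "u \<in> carrier_vec d" for a u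
    using app that by simp
  show thesis
  proof (cases "\<chi> \<in> dfix")
    case True
    \<comment> \<open>The sum \<open>v + v'\<close> is fixed by \<open>s\<close>; if it vanishes,
      then \<open>v\<close> itself is an eigenvector of \<open>s\<close> for the eigenvalue
      -1.\<close>
    have "\<exists>w \<epsilon>. w \<in> carrier_vec d \<and> w \<noteq> 0\<^sub>v d \<and> \<epsilon> \<in> {1, -1} \<and> \<rho> s *\<^sub>v w = \<epsilon> \<cdot>\<^sub>v w \<and>
      (\<forall>a\<in>A. \<rho> a *\<^sub>v w = \<chi> a \<cdot>\<^sub>v w)"
    proof (cases "v + v' = 0\<^sub>v d")
      case z: True
      have "v' = (-1) \<cdot>\<^sub>v v"
      proof (rule eq_vecI)
        fix i assume i: "i < dim_vec ((-1) \<cdot>\<^sub>v v)"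
        then have "(v + v') $ i = 0" using v z by simp
        then show "v' $ i = ((-1) \<cdot>\<^sub>v v) $ i" using i v v' by (simp add: add_eq_0_iff)
      qed (use v v' in simp)
      then show ?thesis using v eig by (intro exI[of _ v] exI[of _ "-1"]) (simp add: v'_def)
    next
      case False
      have "\<rho> s *\<^sub>v (v + v') = 1 \<cdot>\<^sub>v (v + v')"
        using mult_add_distrib_mat_vec[OF carr[OF s_carrier] v(1) v'] sv' v v'
        by (simp add: v'_def[symmetric] comm_add_vec)
      moreover have "\<rho> a *\<^sub>v (v + v') = \<chi> a \<cdot>\<^sub>v (v + v')" if a: "a \<in> A" for a
        using mult_add_distrib_mat_vec[OF carr v(1) v', of a] eig[OF a] eig'[OF a] a v v'
        by (simp add: dfix_\<sigma>[OF True] smult_add_distrib_vec)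
      ultimately show ?thesis using v v' False by (intro exI[of _ "v + v'"] exI[of _ "1"]) simp
    qed
    then obtain w \<epsilon> where w: "w \<in> carrier_vec d" "w \<noteq> 0\<^sub>v d" and \<epsilon>: "\<epsilon> \<in> {1, -1}"
      and sw: "\<rho> s *\<^sub>v w = \<epsilon> \<cdot>\<^sub>v w" and aw: "\<And>a. a \<in> A \<Longrightarrow> \<rho> a *\<^sub>v w = \<chi> a \<cdot>\<^sub>v w"
      by blast
    have gw: "\<rho> g *\<^sub>v w = lin \<chi> \<epsilon> g \<cdot>\<^sub>v w" if "g \<in> carrier G" for g
      using that
    proof (cases rule: cover_cases)
      case base
      then show ?thesis by (simp add: lin_base aw)
    next
      case (outer a)
      then have "\<rho> g *\<^sub>v w = \<rho> a *\<^sub>v (\<epsilon> \<cdot>\<^sub>v w)" using s_app w sw by simp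
      also have "\<dots> = \<epsilon> \<cdot>\<^sub>v (\<chi> a \<cdot>\<^sub>v w)"
        using mult_mat_vec[OF carr w(1), of a] outer aw by simp
      finally show ?thesis using outer by (simp add: lin_outer smult_smult_assoc)
    qed
    define W where "W = range (\<lambda>c. c \<cdot>\<^sub>v w)"
    have "W = {0\<^sub>v d} \<or> W = carrier_vec d"
    proof (rule whole)
      show "W \<subseteq> carrier_vec d" using w by (auto simp: W_def)
      show "0\<^sub>v d \<in> W" unfolding W_def by (rule range_eqI[of _ _ 0]) (use w in auto)
      fix u assume "u \<in> W"
      then obtain c where u: "u = c \<cdot>\<^sub>v w" by (auto simp: W_def)
      show "c' \<cdot>\<^sub>v u \<in> W" for c' unfolding u W_def by (rule range_eqI[of _ _ "c' * c"]) (simp add: smult_smult_assoc)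
      show "u + u' \<in> W" if u': "u' \<in> W" for u'
      proof -
        obtain c' where "u' = c' \<cdot>\<^sub>v w" using u' by (auto simp: W_def)
        then have "u + u' = (c + c') \<cdot>\<^sub>v w" using u by (simp add: add_smult_distrib_vec)
        then show ?thesis by (auto simp: W_def)
      qed
      show "\<rho> g *\<^sub>v u \<in> W" if "g \<in> carrier G" for g
      proof -
        have "\<rho> g *\<^sub>v u = (c * lin \<chi> \<epsilon> g) \<cdot>\<^sub>v w"
          using mult_mat_vec[OF carr[OF that] w(1)] gw[OF that] u by (simp add: smult_smult_assoc)
        then show ?thesis by (auto simp: W_def)
      qed
    qed
    moreover have "w \<in> W" unfolding W_def by (rule range_eqI[of _ _ 1]) simp
    ultimately have Wd: "W = carrier_vec d" using w by auto
    have span: "\<exists>c. u = c \<cdot>\<^sub>v w" if "u \<in> carrier_vec d" for u using that Wd by (auto simp: W_def)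
    have "d = 1"
    proof (rule ccontr)
      assume "d \<noteq> 1"
      then have d2: "1 < d" using d by simp
      obtain c0 c1 where c: "unit_vec d 0 = c0 \<cdot>\<^sub>v w" "unit_vec d 1 = c1 \<cdot>\<^sub>v w"
        using span unit_vec_carrier by metis
      have "(c0 \<cdot>\<^sub>v w) $ 0 = 1" "(c1 \<cdot>\<^sub>v w) $ 1 = 1" "(c0 \<cdot>\<^sub>v w) $ 1 = 0"
        unfolding c[symmetric] using d2 by simp_all
      then show False using d2 w by auto
    qed
    then have w0: "w $ 0 \<noteq> 0" using w by (metis carrier_vecD eq_vecI index_zero_vec less_one)
    have "mat_trace (\<rho> g) = lin \<chi> \<epsilon> g" if g: "g \<in> carrier G" for g
    proof -
      have "(\<rho> g *\<^sub>v w) $ 0 = \<rho> g $$ (0, 0) * w $ 0"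
        using carr[OF g] w \<open>d = 1\<close> by (simp add: scalar_prod_def)
      moreover have "(\<rho> g *\<^sub>v w) $ 0 = lin \<chi> \<epsilon> g * w $ 0" using gw[OF g] w \<open>d = 1\<close> by simp
      ultimately show ?thesis using w0 carr[OF g] \<open>d = 1\<close> by (simp add: mat_trace_def)
    qed
    then have "\<psi> = lin \<chi> \<epsilon>" unfolding \<psi>
      by (intro extensionalityI[of _ "carrier G"]) (auto simp: lin_def)
    with True \<epsilon> show thesis by (rule that(1))
  next
    case False
    then obtain b where b: "b \<in> A" "\<chi> (\<sigma> b) \<noteq> \<chi> b" using \<chi> dfixI by blast
    define W where "W = {c \<cdot>\<^sub>v v + c' \<cdot>\<^sub>v v' | c c'. True}"
    have WI: "c \<cdot>\<^sub>v v + c' \<cdot>\<^sub>v v' \<in> W" for c c' by (auto simp: W_def)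
    have lincomb: "M *\<^sub>v (c \<cdot>\<^sub>v v + c' \<cdot>\<^sub>v v') = c \<cdot>\<^sub>v (M *\<^sub>v v) + c' \<cdot>\<^sub>v (M *\<^sub>v v')"
      if "M \<in> carrier_mat d d" for M c c'
      using mult_add_distrib_mat_vec[OF that, of "c \<cdot>\<^sub>v v" "c' \<cdot>\<^sub>v v'"]
        mult_mat_vec[OF that v(1)] mult_mat_vec[OF that v'] v v' by simp
    have aW: "\<rho> a *\<^sub>v (c \<cdot>\<^sub>v v + c' \<cdot>\<^sub>v v') = (c * \<chi> a) \<cdot>\<^sub>v v + (c' * \<chi> (\<sigma> a)) \<cdot>\<^sub>v v'"
      if a: "a \<in> A" for a c c'
      using lincomb[OF carr, of a c c'] eig[OF a] eig'[OF a] a by (simp add: smult_smult_assoc)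
    have sW: "\<rho> s *\<^sub>v (c \<cdot>\<^sub>v v + c' \<cdot>\<^sub>v v') = c' \<cdot>\<^sub>v v + c \<cdot>\<^sub>v v'" for c c'
      using lincomb[OF carr[OF s_carrier], of c c'] sv' v v'
      by (simp add: v'_def[symmetric] comm_add_vec[of _ d])
    have Wc: "W \<subseteq> carrier_vec d" using v v' by (auto simp: W_def)
    have "W = {0\<^sub>v d} \<or> W = carrier_vec d"
    proof (rule whole)
      have "0 \<cdot>\<^sub>v v + 0 \<cdot>\<^sub>v v' = 0\<^sub>v d" using v v' by (intro eq_vecI) auto
      then show "0\<^sub>v d \<in> W" using WI[of 0 0] by simp
      fix u assume "u \<in> W"
      then obtain c c' where u: "u = c \<cdot>\<^sub>v v + c' \<cdot>\<^sub>v v'" by (auto simp: W_def)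
      show "k \<cdot>\<^sub>v u \<in> W" for k
      proof -
        have "k \<cdot>\<^sub>v u = (k * c) \<cdot>\<^sub>v v + (k * c') \<cdot>\<^sub>v v'"
          using v v' by (intro eq_vecI) (auto simp: u algebra_simps)
        then show ?thesis using WI by simp
      qed
      show "u + u' \<in> W" if u': "u' \<in> W" for u'
      proof -
        obtain k k' where "u' = k \<cdot>\<^sub>v v + k' \<cdot>\<^sub>v v'" using u' by (auto simp: W_def)
        then have "u + u' = (c + k) \<cdot>\<^sub>v v + (c' + k') \<cdot>\<^sub>v v'"
          using v v' u by (intro eq_vecI) (auto simp: algebra_simps)
        then show ?thesis using WI by simp
      qed
      show "\<rho> g *\<^sub>v u \<in> W" if "g \<in> carrier G" for g
        using that
      proof (cases rule: cover_cases)
        case base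
        then show ?thesis using aW WI u by simp
      next
        case (outer a)
        then show ?thesis using s_app[of a u] u v v' sW aW WI by simp
      qed
    qed (rule Wc)
    moreover have "1 \<cdot>\<^sub>v v + 0 \<cdot>\<^sub>v v' = v" using v v' by (intro eq_vecI) auto
    then have "v \<in> W" using WI[of 1 0] by simp
    ultimately have Wd: "W = carrier_vec d" using v by auto
    have span: "\<exists>c c'. u = c \<cdot>\<^sub>v v + c' \<cdot>\<^sub>v v'" if "u \<in> carrier_vec d" for u
      using that unfolding Wd[symmetric] W_def by blast
    have dv: "dim_vec v = d" "dim_vec v' = d" using v v' by auto
    have comp: "\<exists>c c'. \<forall>j<d. (if j = i then 1 else 0) = c * v $ j + c' * v' $ j" if i: "i < d" for i
    proof -
      obtain c c' where c: "unit_vec d i = c \<cdot>\<^sub>v v + c' \<cdot>\<^sub>v v'" using span unit_vec_carrier by metis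
      have "unit_vec d i $ j = c * v $ j + c' * v' $ j" if "j < d" for j
        unfolding c using that dv by simp
      then show ?thesis using i by (intro exI[of _ c] exI[of _ c']) auto
    qed
    \<comment> \<open>In dimension one \<open>\<rho> b\<close> is a scalar, but \<open>v\<close> and
      \<open>v'\<close> are nonzero eigenvectors of it with different eigenvalues.\<close>
    have "d \<noteq> 1"
    proof
      assume d1: "d = 1"
      have v0: "v $ 0 \<noteq> 0" using v d1 by (metis carrier_vecD eq_vecI index_zero_vec less_one)
      have "v' \<noteq> 0\<^sub>v d"
      proof
        assume z: "v' = 0\<^sub>v d"
        have "v = \<rho> s *\<^sub>v 0\<^sub>v d" using sv' z by simp
        also have "\<dots> = 0\<^sub>v d" using carr[OF s_carrier] by (intro eq_vecI) (auto simp: scalar_prod_def)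
        finally show False using v by simp
      qed
      then have v0': "v' $ 0 \<noteq> 0" using v' d1 by (metis carrier_vecD eq_vecI index_zero_vec less_one)
      have M: "(\<rho> b *\<^sub>v u) $ 0 = \<rho> b $$ (0, 0) * u $ 0" if "dim_vec u = 1" for u
        using carr[of b] b that d1 by (simp add: scalar_prod_def)
      have "\<rho> b $$ (0, 0) * v $ 0 = \<chi> b * v $ 0" "\<rho> b $$ (0, 0) * v' $ 0 = \<chi> (\<sigma> b) * v' $ 0"
        using M[of v] M[of v'] eig[OF b(1)] eig'[OF b(1)] dv d1 by auto
      then show False using v0 v0' b by simp
    qed
    have indep: "v $ 0 * v' $ 1 \<noteq> v $ 1 * v' $ 0" and "d = 2"
    proof -
      have d2: "0 < d" "1 < d" using d \<open>d \<noteq> 1\<close> by auto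
      obtain c c' where c: "\<forall>j<d. (if j = 0 then 1 else 0) = c * v $ j + c' * v' $ j"
        using comp[of 0] d2 by auto
      obtain k k' where k: "\<forall>j<d. (if j = 1 then 1 else 0) = k * v $ j + k' * v' $ j"
        using comp[of 1] d2 by auto
      have e: "1 = c * v $ 0 + c' * v' $ 0" "0 = c * v $ 1 + c' * v' $ 1"
        "0 = k * v $ 0 + k' * v' $ 0" "1 = k * v $ 1 + k' * v' $ 1"
        using c[rule_format, of 0] c[rule_format, of 1] k[rule_format, of 0] k[rule_format, of 1] d2 by auto
      \<comment> \<open>The coefficients of the first two unit vectors and the coordinates of
        \<open>v\<close>, \<open>v'\<close> form mutually inverse matrices, so the product of their
        determinants is 1.\<close>
      have "(c * k' - c' * k) * (v $ 0 * v' $ 1 - v $ 1 * v' $ 0) =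
          (c * v $ 0 + c' * v' $ 0) * (k * v $ 1 + k' * v' $ 1) -
          (c * v $ 1 + c' * v' $ 1) * (k * v $ 0 + k' * v' $ 0)"
        by (simp add: algebra_simps)
      also have "\<dots> = 1" unfolding e[symmetric] by simp
      finally show i: "v $ 0 * v' $ 1 \<noteq> v $ 1 * v' $ 0" by auto
      show "d = 2"
      proof (rule ccontr)
        assume "d \<noteq> 2"
        then have d3: "2 < d" using d2 by simp
        have z: "0 = c * v $ 2 + c' * v' $ 2" "0 = k * v $ 2 + k' * v' $ 2"
          using c[rule_format, of 2] k[rule_format, of 2] d3 by auto
        obtain l l' where l: "\<forall>j<d. (if j = 2 then 1 else 0) = l * v $ j + l' * v' $ j"
          using comp[of 2] d3 by auto
        have l: "0 = l * v $ 0 + l' * v' $ 0" "0 = l * v $ 1 + l' * v' $ 1" "1 = l * v $ 2 + l' * v' $ 2"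
          using l[rule_format, of 0] l[rule_format, of 1] l[rule_format, of 2] d2 d3 by auto
        \<comment> \<open>Cramer's rule: a third unit vector vanishes in the first two coordinates,
          so its coefficients are zero.\<close>
        have "l * (v $ 0 * v' $ 1 - v $ 1 * v' $ 0) =
            (l * v $ 0 + l' * v' $ 0) * v' $ 1 - (l * v $ 1 + l' * v' $ 1) * v' $ 0"
          "l' * (v $ 0 * v' $ 1 - v $ 1 * v' $ 0) =
            v $ 0 * (l * v $ 1 + l' * v' $ 1) - v $ 1 * (l * v $ 0 + l' * v' $ 0)"
          by (simp_all add: algebra_simps)
        then have "l = 0" "l' = 0" using i unfolding l(1,2)[symmetric] by auto
        then show False using l(3) by simp
      qed
    qed
    have "mat_trace (\<rho> g) = two \<chi> g" if g: "g \<in> carrier G" for g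
      using g
    proof (cases rule: cover_cases)
      case base
      have "mat_trace (\<rho> g) = \<chi> g + \<chi> (\<sigma> g)"
        by (rule trace_two_dim[where v = v and v' = v' and \<beta> = 0 and \<gamma> = 0])
          (use carr[OF g] indep \<open>d = 2\<close> dv eig[OF base] eig'[OF base] v v' in auto)
      then show ?thesis using base by (simp add: two_base)
    next
      case (outer a)
      have z: "0 \<cdot>\<^sub>v v + c \<cdot>\<^sub>v v' = c \<cdot>\<^sub>v v'" "c \<cdot>\<^sub>v v + 0 \<cdot>\<^sub>v v' = c \<cdot>\<^sub>v v" for c
        using v v' by (auto intro!: eq_vecI)
      have "mat_trace (\<rho> g) = 0 + 0"
      proof (rule trace_two_dim[where v = v and v' = v' and \<beta> = "\<chi> (\<sigma> a)" and \<gamma> = "\<chi> a"])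
        show "\<rho> g *\<^sub>v v = 0 \<cdot>\<^sub>v v + \<chi> (\<sigma> a) \<cdot>\<^sub>v v'"
          using outer s_app[of a v] v v' eig' by (simp add: z v'_def[symmetric])
        show "\<rho> g *\<^sub>v v' = \<chi> a \<cdot>\<^sub>v v + 0 \<cdot>\<^sub>v v'"
          using outer s_app[of a v'] v v' eig sv' by (simp add: z)
      qed (use carr[OF g] indep \<open>d = 2\<close> dv in auto)
      then show ?thesis using outer by (simp add: two_outer)
    qed
    then have "\<psi> = two \<chi>" unfolding \<psi>
      by (intro extensionalityI[of _ "carrier G"]) (auto simp: two_def)
    with \<chi> False show thesis by (rule that(2))
  qed
qed

section \<open>Enumeration of the irreducible characters and their sum\<close>

lemma two_eq_iff:
  assumes "\<chi> \<in> dual" "\<chi>' \<in> dual"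
  shows "two \<chi> = two \<chi>' \<longleftrightarrow> \<chi>' = \<chi> \<or> \<chi>' = dconj \<chi>"
proof
  assume eq: "two \<chi> = two \<chi>'"
  \<comment> \<open>The multiplicity of \<chi>' in the restriction to \<open>A\<close>, times
    \<open>|A|\<close>; it determines the pair of a character and its conjugate.\<close>
  have sum: "(\<Sum>a\<in>A. inverse (\<chi>' a) * two \<psi> a) =
      (if \<psi> = \<chi>' then of_nat (card A) else 0) + (if dconj \<psi> = \<chi>' then of_nat (card A) else 0)"
    if "\<psi> \<in> dual" for \<psi>
  proof -
    have "(\<Sum>a\<in>A. inverse (\<chi>' a) * two \<psi> a) =
      (\<Sum>a\<in>A. inverse (\<chi>' a) * \<psi> a) + (\<Sum>a\<in>A. inverse (\<chi>' a) * dconj \<psi> a)"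
      by (simp add: two_base distrib_left sum.distrib)
    then show ?thesis
      unfolding orthogonality[OF that assms(2)] orthogonality[OF dconj_dual[OF that] assms(2)] .
  qed
  have "card A \<noteq> 0" by (metis card_0_eq empty_iff finA one_A)
  then show "\<chi>' = \<chi> \<or> \<chi>' = dconj \<chi>"
    using sum[of \<chi>] sum[of \<chi>'] assms unfolding eq by (auto split: if_splits)
next
  assume "\<chi>' = \<chi> \<or> \<chi>' = dconj \<chi>"
  then show "two \<chi> = two \<chi>'"
    using assms by (auto simp: two_def intro!: restrict_ext)
qed

lemma dconj_nonfix: "\<chi> \<in> dual - dfix \<Longrightarrow> dconj \<chi> \<in> dual - dfix"
  by (auto simp: dfix_def)

lemma Irr_eq: "Irr G = (\<lambda>(\<chi>, \<epsilon>). lin \<chi> \<epsilon>) ` (dfix \<times> {1, -1}) \<union> two ` (dual - dfix)"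
proof
  show "Irr G \<subseteq> (\<lambda>(\<chi>, \<epsilon>). lin \<chi> \<epsilon>) ` (dfix \<times> {1, -1}) \<union> two ` (dual - dfix)"
  proof
    fix \<psi> assume "\<psi> \<in> Irr G"
    then show "\<psi> \<in> (\<lambda>(\<chi>, \<epsilon>). lin \<chi> \<epsilon>) ` (dfix \<times> {1, -1}) \<union> two ` (dual - dfix)"
    proof (cases rule: Irr_cases)
      case (1 \<chi> \<epsilon>)
      then have "\<psi> = (\<lambda>(\<chi>, \<epsilon>). lin \<chi> \<epsilon>) (\<chi>, \<epsilon>)" "(\<chi>, \<epsilon>) \<in> dfix \<times> {1, -1}" by auto
      then show ?thesis by blast
    qed blast
  qed
  show "(\<lambda>(\<chi>, \<epsilon>). lin \<chi> \<epsilon>) ` (dfix \<times> {1, -1}) \<union> two ` (dual - dfix) \<subseteq> Irr G"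
    using lin_in_Irr two_in_Irr by auto
qed

lemma fin_dfix [simp]: "finite dfix" by (simp add: dfix_def)

lemma sum_Irr_split:
  "(\<Sum>\<psi>\<in>Irr G. \<psi> g) =
    (\<Sum>\<chi>\<in>dfix. lin \<chi> 1 g + lin \<chi> (-1) g) + (\<Sum>\<psi>\<in>two ` (dual - dfix). \<psi> g)"
proof -
  have inj: "inj_on (\<lambda>(\<chi>, \<epsilon>). lin \<chi> \<epsilon>) (dfix \<times> {1, -1})"
  proof (rule inj_onI, clarify)
    fix \<chi> \<epsilon> \<chi>' \<epsilon>'
    assume *: "\<chi> \<in> dfix" "\<chi>' \<in> dfix" "lin \<chi> \<epsilon> = lin \<chi>' \<epsilon>'"
    have "\<chi> = \<chi>'"
      using *(3) by (intro dual_eqI dfix_dual *) (metis lin_base)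
    moreover have "lin \<chi> \<epsilon> (\<one> \<otimes> s) = lin \<chi>' \<epsilon>' (\<one> \<otimes> s)" using * by simp
    then have "\<epsilon> = \<epsilon>'" using *(1,2)[THEN dfix_dual] by (simp only: lin_outer[OF one_A] dual_one mult_1_right)
    ultimately show "\<chi> = \<chi>' \<and> \<epsilon> = \<epsilon>'" by simp
  qed
  \<comment> \<open>The degrees differ: at the identity the equation would read 1 = 2.\<close>
  have ne: "lin \<chi> \<epsilon> \<noteq> two \<chi>'" if "\<chi> \<in> dfix" "\<chi>' \<in> dual" for \<chi> \<epsilon> \<chi>'
  proof
    assume "lin \<chi> \<epsilon> = two \<chi>'"
    then have "\<chi> \<one> = \<chi>' \<one> + \<chi>' (\<sigma> \<one>)" by (metis lin_base two_base one_A)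
    then show False using that(2) dfix_dual[OF that(1)] by simp
  qed
  have disj: "(\<lambda>(\<chi>, \<epsilon>). lin \<chi> \<epsilon>) ` (dfix \<times> {1, -1}) \<inter> two ` (dual - dfix) = {}"
    using ne by fastforce
  have "(\<Sum>\<psi>\<in>Irr G. \<psi> g) =
      (\<Sum>\<psi>\<in>(\<lambda>(\<chi>, \<epsilon>). lin \<chi> \<epsilon>) ` (dfix \<times> {1, -1}). \<psi> g) + (\<Sum>\<psi>\<in>two ` (dual - dfix). \<psi> g)"
    unfolding Irr_eq by (rule sum.union_disjoint) (use disj in auto)
  also have "(\<Sum>\<psi>\<in>(\<lambda>(\<chi>, \<epsilon>). lin \<chi> \<epsilon>) ` (dfix \<times> {1, -1}). \<psi> g) =
      (\<Sum>(\<chi>, \<epsilon>)\<in>dfix \<times> {1, -1}. lin \<chi> \<epsilon> g)"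
    by (subst sum.reindex[OF inj]) (simp add: case_prod_unfold)
  also have "\<dots> = (\<Sum>\<chi>\<in>dfix. \<Sum>\<epsilon>\<in>{1, -1}. lin \<chi> \<epsilon> g)"
    by (rule sum.cartesian_product[symmetric])
  finally show ?thesis by simp
qed

text \<open>Each character of degree two comes from exactly two members of
  \<open>dual - dfix\<close>, a character and its conjugate, and restricts to \<open>A\<close> as
  their sum.\<close>

lemma sum_two:
  assumes a: "a \<in> A"
  shows "(\<Sum>\<psi>\<in>two ` (dual - dfix). \<psi> a) = (\<Sum>\<chi>\<in>dual - dfix. \<chi> a)"
proof -
  let ?S = "dual - dfix"
  have fib: "card {\<chi> \<in> ?S. two \<chi> = \<psi>} = 2" if "\<psi> \<in> two ` ?S" for \<psi>
  proof -
    from that obtain \<chi> where \<chi>: "\<chi> \<in> ?S" "\<psi> = two \<chi>" by blast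
    have "{\<chi> \<in> ?S. two \<chi> = \<psi>} = {\<chi>, dconj \<chi>}"
    proof (intro Set.set_eqI iffI)
      fix \<chi>' assume "\<chi>' \<in> {\<chi> \<in> ?S. two \<chi> = \<psi>}"
      then show "\<chi>' \<in> {\<chi>, dconj \<chi>}" using \<chi> two_eq_iff[of \<chi> \<chi>'] by simp
    next
      fix \<chi>' assume \<chi>': "\<chi>' \<in> {\<chi>, dconj \<chi>}"
      then have "\<chi>' \<in> ?S" using \<chi>(1) dconj_nonfix[OF \<chi>(1)] by blast
      with \<chi>' show "\<chi>' \<in> {\<chi> \<in> ?S. two \<chi> = \<psi>}" using \<chi> two_eq_iff[of \<chi> \<chi>'] by simp
    qed
    moreover have "dconj \<chi> \<noteq> \<chi>" using \<chi> by (auto simp: dfix_def)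
    ultimately show ?thesis by simp
  qed
  have "(\<Sum>\<chi>\<in>?S. two \<chi> a) = (\<Sum>\<psi>\<in>two ` ?S. \<Sum>\<chi>\<in>{\<chi> \<in> ?S. two \<chi> = \<psi>}. two \<chi> a)"
    by (rule sum.image_gen) simp
  also have "\<dots> = (\<Sum>\<psi>\<in>two ` ?S. \<Sum>\<chi>\<in>{\<chi> \<in> ?S. two \<chi> = \<psi>}. \<psi> a)"
    by (intro sum.cong) auto
  also have "\<dots> = (\<Sum>\<psi>\<in>two ` ?S. 2 * \<psi> a)"
    using fib by (intro sum.cong) auto
  also have "\<dots> = 2 * (\<Sum>\<psi>\<in>two ` ?S. \<psi> a)" by (simp add: sum_distrib_left)
  finally have 1: "(\<Sum>\<chi>\<in>?S. two \<chi> a) = 2 * (\<Sum>\<psi>\<in>two ` ?S. \<psi> a)" .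
  have "bij_betw dconj ?S ?S"
    by (rule bij_betw_byWitness[where f' = dconj]) (use dconj_nonfix in auto)
  from sum.reindex_bij_betw[OF this, of "\<lambda>\<chi>. \<chi> a"]
  have "(\<Sum>\<chi>\<in>?S. \<chi> (\<sigma> a)) = (\<Sum>\<chi>\<in>?S. \<chi> a)" using a by simp
  then have "(\<Sum>\<chi>\<in>?S. two \<chi> a) = 2 * (\<Sum>\<chi>\<in>?S. \<chi> a)"
    using a by (simp add: two_base sum.distrib)
  with 1 show ?thesis by simp
qed

text \<open>An invariant character has two extensions. One copy of the invariant characters
  completes the noninvariant ones to all of \<open>dual\<close>, which detects the identity; the
  other copy is the sum over \<open>dfix\<close>, which detects \<open>D\<close>.\<close>

lemma sum_Irr_base:
  assumes a: "a \<in> A"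
  shows "(\<Sum>\<psi>\<in>Irr G. \<psi> a) =
    (if a = \<one> then of_nat (card A) else 0) + (if a \<in> D then of_nat (card Fix) else 0)"
proof -
  have "(\<Sum>\<psi>\<in>Irr G. \<psi> a) = (\<Sum>\<chi>\<in>dfix. \<chi> a) + ((\<Sum>\<chi>\<in>dfix. \<chi> a) + (\<Sum>\<chi>\<in>dual - dfix. \<chi> a))"
    using a by (simp add: sum_Irr_split sum_two lin_base sum.distrib sum_distrib_left)
  also have "(\<Sum>\<chi>\<in>dfix. \<chi> a) + (\<Sum>\<chi>\<in>dual - dfix. \<chi> a) = (\<Sum>\<chi>\<in>dual. \<chi> a)"
    by (subst add.commute, rule sum.subset_diff[symmetric]) (auto simp: dfix_def)
  finally show ?thesis using a by (simp only: sum_dual sum_dfix add.commute)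
qed

text \<open>The two extensions of an invariant character have opposite signs off \<open>A\<close>,
  and the characters of degree two vanish there.\<close>

lemma sum_Irr_outer: "a \<in> A \<Longrightarrow> (\<Sum>\<psi>\<in>Irr G. \<psi> (a \<otimes> s)) = 0"
  by (simp add: sum_Irr_split lin_outer two_outer sum.neutral)

end

section \<open>Twisted conjugation and models from equivariant characters\<close>

locale twisted_involutions = group G for G (structure) +
  fixes \<nu> :: "'a \<Rightarrow> 'a"
  assumes finite_carrier: "finite (carrier G)"
    and \<nu>_iso: "\<nu> \<in> iso G G"
    and \<nu>_\<nu>: "g \<in> carrier G \<Longrightarrow> \<nu> (\<nu> g) = g"
begin

abbreviation I where "I \<equiv> gen_involutions G \<nu>"
abbreviation \<phi> where "\<phi> \<equiv> twisted_conj G \<nu>"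
abbreviation St where "St \<equiv> stabilizer G \<phi>"

lemma \<nu>_carrier [simp]: "g \<in> carrier G \<Longrightarrow> \<nu> g \<in> carrier G"
  using \<nu>_iso by (auto simp: iso_def hom_def)

lemma \<nu>_mult: "g \<in> carrier G \<Longrightarrow> h \<in> carrier G \<Longrightarrow> \<nu> (g \<otimes> h) = \<nu> g \<otimes> \<nu> h"
  using \<nu>_iso by (auto simp: iso_def hom_def)

lemma \<nu>_one [simp]: "\<nu> \<one> = \<one>"
  using hom_one[of \<nu> G] \<nu>_iso by (auto simp: iso_def)

lemma \<nu>_inv: "g \<in> carrier G \<Longrightarrow> \<nu> (inv g) = inv (\<nu> g)"
proof -
  assume g: "g \<in> carrier G"
  have "\<nu> (inv g) \<otimes> \<nu> g = \<one>" using g by (simp add: \<nu>_mult[symmetric])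
  then show ?thesis using g by (intro inv_equality[symmetric]) auto
qed

lemma I_iff: "\<omega> \<in> carrier G \<Longrightarrow> \<omega> \<in> I \<longleftrightarrow> \<nu> \<omega> = inv \<omega>"
  unfolding gen_involutions_def by auto
lemma \<nu>_I: "\<omega> \<in> I \<Longrightarrow> \<nu> \<omega> = inv \<omega>"
  unfolding gen_involutions_def by auto

lemma I_carrier [simp]: "\<omega> \<in> I \<Longrightarrow> \<omega> \<in> carrier G"
  unfolding gen_involutions_def by auto

lemma finite_I [simp]: "finite I"
  using finite_carrier by (auto intro: rev_finite_subset)

lemma \<phi>_app: "\<omega> \<in> I \<Longrightarrow> \<phi> g \<omega> = g \<otimes> \<omega> \<otimes> inv (\<nu> g)" by (simp add: twisted_conj_def)

lemma \<phi>_I: "\<omega> \<in> I \<Longrightarrow> g \<in> carrier G \<Longrightarrow> \<phi> g \<omega> \<in> I"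
proof -
  assume \<omega>: "\<omega> \<in> I" and g: "g \<in> carrier G"
  have "\<nu> (g \<otimes> \<omega> \<otimes> inv (\<nu> g)) = inv (g \<otimes> \<omega> \<otimes> inv (\<nu> g))"
    using g I_carrier[OF \<omega>] by (simp add: \<nu>_mult \<nu>_inv \<nu>_\<nu> \<nu>_I[OF \<omega>] inv_mult_group m_assoc)
  then show ?thesis
    using I_iff[of "g \<otimes> \<omega> \<otimes> inv (\<nu> g)"] g I_carrier[OF \<omega>] by (simp add: \<phi>_app[OF \<omega>])
qed

lemma \<phi>_mult: "\<omega> \<in> I \<Longrightarrow> g \<in> carrier G \<Longrightarrow> h \<in> carrier G \<Longrightarrow> \<phi> (g \<otimes> h) \<omega> = \<phi> g (\<phi> h \<omega>)"
  using \<phi>_I[of \<omega> h] by (simp add: \<phi>_app) (simp add: \<nu>_mult inv_mult_group m_assoc)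

lemma \<phi>_one: "\<omega> \<in> I \<Longrightarrow> \<phi> \<one> \<omega> = \<omega>"
  by (simp add: \<phi>_app)

lemma \<phi>_inv: "\<omega> \<in> I \<Longrightarrow> g \<in> carrier G \<Longrightarrow> \<phi> (inv g) (\<phi> g \<omega>) = \<omega>"
  "\<omega> \<in> I \<Longrightarrow> g \<in> carrier G \<Longrightarrow> \<phi> g (\<phi> (inv g) \<omega>) = \<omega>"
  by (simp_all add: \<phi>_mult[symmetric] \<phi>_one)

sublocale act: group_action G I \<phi>
proof (rule group_action.intro, rule group_hom.intro[OF is_group group_BijGroup], rule group_hom_axioms.intro)
  have ext: "\<phi> g \<in> extensional I" for g unfolding twisted_conj_def by (rule restrict_extensional)
  have bij: "\<phi> g \<in> Bij I" if g: "g \<in> carrier G" for g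
  proof -
    have "bij_betw (\<phi> g) I I"
    proof (rule bij_betw_byWitness[where f' = "\<phi> (inv g)"])
      show "\<forall>\<omega>\<in>I. \<phi> (inv g) (\<phi> g \<omega>) = \<omega>" "\<forall>\<omega>\<in>I. \<phi> g (\<phi> (inv g) \<omega>) = \<omega>"
        using g \<phi>_inv by blast+
      show "\<phi> g ` I \<subseteq> I" "\<phi> (inv g) ` I \<subseteq> I"
        using g \<phi>_I inv_closed by blast+
    qed
    then show ?thesis unfolding Bij_def using ext by blast
  qed
  show "\<phi> \<in> hom G (BijGroup I)"
  proof (rule homI)
    fix g h assume gh: "g \<in> carrier G" "h \<in> carrier G"
    have "\<phi> (g \<otimes> h) = compose I (\<phi> g) (\<phi> h)"
    proof (rule extensionalityI[OF ext])
      fix \<omega> assume "\<omega> \<in> I"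
      then show "\<phi> (g \<otimes> h) \<omega> = compose I (\<phi> g) (\<phi> h) \<omega>" using gh by (simp only: \<phi>_mult compose_eq)
    qed (rule compose_extensional)
    then show "\<phi> (g \<otimes> h) = \<phi> g \<otimes>\<^bsub>BijGroup I\<^esub> \<phi> h"
      using bij gh by (simp add: BijGroup_def)
  qed (use bij in \<open>simp add: BijGroup_def\<close>)
qed

lemma St_iff: "\<omega> \<in> I \<Longrightarrow> g \<in> St \<omega> \<longleftrightarrow> g \<in> carrier G \<and> g \<otimes> \<omega> \<otimes> inv (\<nu> g) = \<omega>"
  by (simp add: stabilizer_def \<phi>_app)

lemma finite_St [simp]: "finite (St \<omega>)"
  using finite_carrier by (simp add: stabilizer_def)

lemma St_pos: "\<omega> \<in> I \<Longrightarrow> card (St \<omega>) > 0"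
  using act.stabilizer_one_closed by (auto simp: card_gt_0_iff)

lemma card_St_nz: "\<omega> \<in> I \<Longrightarrow> of_nat (card (St \<omega>)) \<noteq> (0::complex)"
  using St_pos by fastforce

text \<open>A weighted orbit-stabilizer count: the group elements carrying \<omega> to a given point
  of its orbit form a translate of the stabilizer.\<close>

lemma sum_over_group:
  fixes F :: "'a \<Rightarrow> complex"
  assumes \<omega>: "\<omega> \<in> I"
  shows "(\<Sum>x\<in>carrier G. F (\<phi> x \<omega>)) = of_nat (card (St \<omega>)) * (\<Sum>\<omega>'\<in>orbit G \<phi> \<omega>. F \<omega>')"
proof -
  have fib: "card {x \<in> carrier G. \<phi> x \<omega> = \<phi> y \<omega>} = card (St \<omega>)" if y: "y \<in> carrier G" for y
  proof -
    have "bij_betw (\<lambda>z. y \<otimes> z) (St \<omega>) {x \<in> carrier G. \<phi> x \<omega> = \<phi> y \<omega>}"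
    proof (rule bij_betw_byWitness[where f' = "\<lambda>x. inv y \<otimes> x"])
      show "(\<lambda>z. y \<otimes> z) ` St \<omega> \<subseteq> {x \<in> carrier G. \<phi> x \<omega> = \<phi> y \<omega>}"
        using y \<omega> by (auto simp: stabilizer_def \<phi>_mult)
      show "(\<lambda>x. inv y \<otimes> x) ` {x \<in> carrier G. \<phi> x \<omega> = \<phi> y \<omega>} \<subseteq> St \<omega>"
        using y \<omega> by (auto simp: stabilizer_def \<phi>_mult \<phi>_inv)
    qed (use y in \<open>auto simp: m_assoc[symmetric] stabilizer_def\<close>)
    then show ?thesis by (simp add: bij_betw_same_card)
  qed
  have orb: "orbit G \<phi> \<omega> = (\<lambda>x. \<phi> x \<omega>) ` carrier G" by (auto simp: orbit_def)
  have "(\<Sum>x\<in>carrier G. F (\<phi> x \<omega>)) =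
      (\<Sum>\<omega>'\<in>(\<lambda>x. \<phi> x \<omega>) ` carrier G. \<Sum>x\<in>{x \<in> carrier G. \<phi> x \<omega> = \<omega>'}. F (\<phi> x \<omega>))"
    by (rule sum.image_gen[OF finite_carrier])
  also have "\<dots> = (\<Sum>\<omega>'\<in>orbit G \<phi> \<omega>. of_nat (card (St \<omega>)) * F \<omega>')"
    unfolding orb using fib by (intro sum.cong) auto
  finally show ?thesis by (simp add: sum_distrib_left)
qed

lemma sum_representatives:
  fixes f :: "'a set \<Rightarrow> complex"
  assumes R: "orbit_representatives G I \<phi> R"
  shows "(\<Sum>\<omega>\<in>R. f (orbit G \<phi> \<omega>)) = (\<Sum>X\<in>orbits G I \<phi>. f X)"
proof (rule sum.reindex_bij_betw)
  have RI: "R \<subseteq> I" and ex1: "\<And>X. X \<in> orbits G I \<phi> \<Longrightarrow> \<exists>!\<omega>. \<omega> \<in> R \<and> \<omega> \<in> X"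
    using R by (auto simp: orbit_representatives_def)
  show "bij_betw (orbit G \<phi>) R (orbits G I \<phi>)"
    unfolding bij_betw_def
  proof
    show "inj_on (orbit G \<phi>) R"
    proof (rule inj_onI)
      fix x y assume xy: "x \<in> R" "y \<in> R" "orbit G \<phi> x = orbit G \<phi> y"
      then have "x \<in> orbit G \<phi> x" "y \<in> orbit G \<phi> x" using RI act.orbit_refl by auto
      moreover have "orbit G \<phi> x \<in> orbits G I \<phi>" using xy RI by (auto simp: orbits_def)
      ultimately show "x = y" using ex1 xy by blast
    qed
    show "orbit G \<phi> ` R = orbits G I \<phi>"
    proof
      show "orbits G I \<phi> \<subseteq> orbit G \<phi> ` R"
      proof
        fix X assume X: "X \<in> orbits G I \<phi>"
        then obtain \<omega> where \<omega>: "\<omega> \<in> R" "\<omega> \<in> X" using ex1 by blast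
        then have "orbit G \<phi> \<omega> \<in> orbits G I \<phi>" "\<omega> \<in> orbit G \<phi> \<omega>"
          using RI act.orbit_refl by (auto simp: orbits_def)
        then have "X = orbit G \<phi> \<omega>" using act.disjoint_union[OF X] \<omega> by blast
        then show "X \<in> orbit G \<phi> ` R" using \<omega> by blast
      qed
    qed (use RI in \<open>auto simp: orbits_def\<close>)
  qed
qed

lemma sum_over_orbits:
  fixes F :: "'a \<Rightarrow> complex"
  assumes R: "orbit_representatives G I \<phi> R"
  shows "(\<Sum>\<omega>\<in>R. \<Sum>\<omega>'\<in>orbit G \<phi> \<omega>. F \<omega>') = (\<Sum>\<omega>\<in>I. F \<omega>)"
  using sum_representatives[OF R, of "\<lambda>X. sum F X"] act.disjoint_sum[OF finite_I, of F] by simp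

lemma ex_representatives: "\<exists>R. orbit_representatives G I \<phi> R"
proof -
  have ne: "X \<noteq> {}" "X \<subseteq> I" if "X \<in> orbits G I \<phi>" for X
    using that act.orbit_refl \<phi>_I by (auto simp: orbits_def orbit_def)
  have pick: "(SOME \<omega>. \<omega> \<in> X) \<in> X" if "X \<in> orbits G I \<phi>" for X
    using ne[OF that] some_in_eq by blast
  have "orbit_representatives G I \<phi> ((\<lambda>X. SOME \<omega>. \<omega> \<in> X) ` orbits G I \<phi>)"
    unfolding orbit_representatives_def
  proof (intro conjI ballI)
    show "(\<lambda>X. SOME \<omega>. \<omega> \<in> X) ` orbits G I \<phi> \<subseteq> I" using ne pick by blast
    fix X assume X: "X \<in> orbits G I \<phi>"
    show "\<exists>!\<omega>. \<omega> \<in> (\<lambda>X. SOME \<omega>. \<omega> \<in> X) ` orbits G I \<phi> \<and> \<omega> \<in> X"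
    proof (rule ex1I[of _ "SOME \<omega>. \<omega> \<in> X"])
      fix \<omega> assume "\<omega> \<in> (\<lambda>X. SOME \<omega>. \<omega> \<in> X) ` orbits G I \<phi> \<and> \<omega> \<in> X"
      then obtain Y where Y: "Y \<in> orbits G I \<phi>" "\<omega> = (SOME \<omega>. \<omega> \<in> Y)" "\<omega> \<in> X" by blast
      then have "Y = X" using act.disjoint_union[OF X Y(1)] pick by blast
      then show "\<omega> = (SOME \<omega>. \<omega> \<in> X)" using Y by simp
    qed (use X pick in auto)
  qed
  then show ?thesis ..
qed

lemma linear_character_iff:
  "f \<in> linear_characters G H \<longleftrightarrow> (\<forall>h\<in>H. f h \<noteq> 0) \<and> (\<forall>g\<in>H. \<forall>h\<in>H. f (g \<otimes> h) = f g * f h)"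
proof -
  have "x \<in> Units class_ring \<longleftrightarrow> x \<noteq> (0::complex)" for x
    by (auto simp: Units_def intro: exI[of _ "inverse x"])
  then show ?thesis by (auto simp: linear_characters_def hom_def units_of_def)
qed

lemma St_conj:
  assumes "\<omega> \<in> I" "x \<in> carrier G" "g \<in> carrier G"
  shows "inv x \<otimes> g \<otimes> x \<in> St \<omega> \<longleftrightarrow> g \<in> St (\<phi> x \<omega>)"
proof -
  have "\<phi> (inv x \<otimes> g \<otimes> x) \<omega> = \<phi> (inv x) (\<phi> g (\<phi> x \<omega>))"
    using assms by (simp add: \<phi>_mult \<phi>_I)
  moreover have "\<phi> (inv x) (\<phi> g (\<phi> x \<omega>)) = \<omega> \<longleftrightarrow> \<phi> g (\<phi> x \<omega>) = \<phi> x \<omega>"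
    using assms by (metis \<phi>_I \<phi>_inv(1) \<phi>_inv(2))
  ultimately show ?thesis using assms by (simp add: stabilizer_def)
qed

text \<open>An equivariant family of characters is the same as a monomial representation on the span of
  the generalized involutions, whose character is the left-hand side of the last assumption.\<close>

lemma has_GIM_if_equivariant:
  fixes lam :: "'a \<Rightarrow> 'a \<Rightarrow> complex"
  assumes lin: "\<And>\<omega>. \<omega> \<in> I \<Longrightarrow> lam \<omega> \<in> linear_characters G (St \<omega>)"
    and equiv: "\<And>\<omega> x h. \<omega> \<in> I \<Longrightarrow> x \<in> carrier G \<Longrightarrow> h \<in> St \<omega> \<Longrightarrow>
      lam (\<phi> x \<omega>) (x \<otimes> h \<otimes> inv x) = lam \<omega> h"
    and total: "\<And>g. g \<in> carrier G \<Longrightarrow>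
      (\<Sum>\<omega>\<in>I. if g \<in> St \<omega> then lam \<omega> g else 0) = (\<Sum>\<psi>\<in>Irr G. \<psi> g)"
  shows "has_GIM G"
proof -
  obtain R where R: "orbit_representatives G I \<phi> R" using ex_representatives by blast
  then have RI: "R \<subseteq> I" by (simp add: orbit_representatives_def)
  have ind: "induced_character G (St \<omega>) (lam \<omega>) g =
      (\<Sum>\<omega>'\<in>orbit G \<phi> \<omega>. if g \<in> St \<omega>' then lam \<omega>' g else 0)" if g: "g \<in> carrier G" and \<omega>: "\<omega> \<in> I" for g \<omega>
  proof -
    have "(\<Sum>x\<in>carrier G. let y = inv x \<otimes> g \<otimes> x in if y \<in> St \<omega> then lam \<omega> y else 0) =
        (\<Sum>x\<in>carrier G. if g \<in> St (\<phi> x \<omega>) then lam (\<phi> x \<omega>) g else 0)"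
    proof (intro sum.cong refl)
      fix x assume x: "x \<in> carrier G"
      have "x \<otimes> (inv x \<otimes> g \<otimes> x) \<otimes> inv x = g"
        using x g by (simp add: m_assoc[symmetric]) (simp add: m_assoc)
      then show "(let y = inv x \<otimes> g \<otimes> x in if y \<in> St \<omega> then lam \<omega> y else 0) =
          (if g \<in> St (\<phi> x \<omega>) then lam (\<phi> x \<omega>) g else 0)"
        using equiv[OF \<omega> x, of "inv x \<otimes> g \<otimes> x"] St_conj[OF \<omega> x g] by (simp add: Let_def)
    qed
    also have "\<dots> = of_nat (card (St \<omega>)) *
        (\<Sum>\<omega>'\<in>orbit G \<phi> \<omega>. if g \<in> St \<omega>' then lam \<omega>' g else 0)"
      by (rule sum_over_group[OF \<omega>])
    finally have *: "(\<Sum>x\<in>carrier G. let y = inv x \<otimes> g \<otimes> x in if y \<in> St \<omega> then lam \<omega> y else 0) =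
        of_nat (card (St \<omega>)) * (\<Sum>\<omega>'\<in>orbit G \<phi> \<omega>. if g \<in> St \<omega>' then lam \<omega>' g else 0)" .
    then show ?thesis
      unfolding induced_character_def * by (intro nonzero_mult_div_cancel_left card_St_nz \<omega>)
  qed
  have "character_model G R St lam"
    unfolding character_model_def
  proof (intro conjI ballI)
    show "finite R" using RI finite_I finite_subset by blast
    show "subgroup (St \<omega>) G" "lam \<omega> \<in> linear_characters G (St \<omega>)" if "\<omega> \<in> R" for \<omega>
      using that RI act.stabilizer_subgroup lin by auto
    fix g assume g: "g \<in> carrier G"
    have "(\<Sum>\<omega>\<in>R. induced_character G (St \<omega>) (lam \<omega>) g) =
        (\<Sum>\<omega>\<in>R. \<Sum>\<omega>'\<in>orbit G \<phi> \<omega>. if g \<in> St \<omega>' then lam \<omega>' g else 0)"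
      using ind[OF g] RI by (intro sum.cong) auto
    also have "\<dots> = (\<Sum>\<psi>\<in>Irr G. \<psi> g)"
      by (simp only: sum_over_orbits[OF R] total[OF g])
    finally show "(\<Sum>\<omega>\<in>R. induced_character G (St \<omega>) (lam \<omega>) g) = (\<Sum>\<psi>\<in>Irr G. \<psi> g)" .
  qed
  then show ?thesis
    using R \<nu>_iso \<nu>_\<nu> by (auto simp: has_GIM_def has_GIM_wrt_def)
qed

text \<open>Conjugation does not move \<open>t\<close>, so every summand is \<open>f t\<close>, and
  the index of the stabilizer is the size of the orbit.\<close>

lemma induced_central:
  assumes "\<omega> \<in> I" "t \<in> carrier G" "\<And>g. g \<in> carrier G \<Longrightarrow> g \<otimes> t = t \<otimes> g" "t \<in> St \<omega>"
  shows "induced_character G (St \<omega>) f t = of_nat (card (orbit G \<phi> \<omega>)) * f t"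
proof -
  have "inv x \<otimes> t \<otimes> x = t" if "x \<in> carrier G" for x
    using assms(2) assms(3)[of "inv x"] that by (simp add: m_assoc)
  then have "induced_character G (St \<omega>) f t = (\<Sum>x\<in>carrier G. f t) / of_nat (card (St \<omega>))"
    using assms(4) unfolding induced_character_def by (intro arg_cong2[where f = "(/)"] sum.cong) simp_all
  moreover have "of_nat (card (carrier G)) = of_nat (card (St \<omega>)) * (of_nat (card (orbit G \<phi> \<omega>)) :: complex)"
    using sum_over_group[OF assms(1), of "\<lambda>_. 1"] by simp
  ultimately show ?thesis using card_St_nz[OF assms(1)] by (simp del: of_nat_eq_0_iff)
qed

lemma card_I_eq: "orbit_representatives G I \<phi> R \<Longrightarrow> (\<Sum>\<omega>\<in>R. of_nat (card (orbit G \<phi> \<omega>))) = (of_nat (card I) :: complex)"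
  using sum_over_orbits[of R "\<lambda>_. 1"] by simp

end

section \<open>The inverting automorphism\<close>

context split_extension
begin

text \<open>Inverts \<open>A\<close> and fixes \<open>s\<close>. An element \<open>g\<close> outside
  \<open>A\<close> is written as \<open>(g s) s\<close>, where \<open>g s\<close> lies in
  \<open>A\<close>.\<close>

definition \<tau> :: "'a \<Rightarrow> 'a" where
  "\<tau> g = (if g \<in> A then inv g else inv (g \<otimes> s) \<otimes> s)"

lemma \<tau>_base: "a \<in> A \<Longrightarrow> \<tau> a = inv a" by (simp add: \<tau>_def)
lemma \<tau>_outer: "a \<in> A \<Longrightarrow> \<tau> (a \<otimes> s) = inv a \<otimes> s" using as_notin by (simp add: \<tau>_def)

lemma \<tau>_carrier: "g \<in> carrier G \<Longrightarrow> \<tau> g \<in> carrier G"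
  by (erule cover_cases) (simp_all add: \<tau>_base \<tau>_outer)

lemma \<tau>_\<tau>: "g \<in> carrier G \<Longrightarrow> \<tau> (\<tau> g) = g"
  by (erule cover_cases) (simp_all add: \<tau>_base \<tau>_outer)

lemma \<tau>_mult: assumes g: "g \<in> carrier G" and h: "h \<in> carrier G" shows "\<tau> (g \<otimes> h) = \<tau> g \<otimes> \<tau> h"
  using g
proof (cases rule: cover_cases)
  case base
  note g = this
  from h show ?thesis
    by (cases rule: cover_cases) (simp_all add: g \<tau>_base \<tau>_outer a_bs inv_multA)
next
  case (outer a)
  note g = this
  from h show ?thesis
    by (cases rule: cover_cases)
      (simp_all add: g \<tau>_base \<tau>_outer as_b as_bs inv_multA \<sigma>_inv)
qed

sublocale tw: twisted_involutions G \<tau>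
proof
  have "bij_betw \<tau> (carrier G) (carrier G)"
    by (rule bij_betw_byWitness[where f' = \<tau>]) (auto simp: \<tau>_carrier \<tau>_\<tau>)
  then show "\<tau> \<in> iso G G" by (auto simp: iso_def hom_def \<tau>_carrier \<tau>_mult)
qed (auto simp: fin \<tau>_\<tau>)

lemma base_I: "a \<in> A \<Longrightarrow> a \<in> tw.I"
  by (subst tw.I_iff) (simp_all add: \<tau>_base)

lemma inv_outer: "a \<in> A \<Longrightarrow> inv (a \<otimes> s) = \<sigma> (inv a) \<otimes> s"
  by (simp add: inv_mult_group s_mult)

lemma outer_eq_iff: "a \<in> A \<Longrightarrow> b \<in> A \<Longrightarrow> a \<otimes> s = b \<otimes> s \<longleftrightarrow> a = b"
  by simp

lemma outer_I_iff: "c \<in> A \<Longrightarrow> c \<otimes> s \<in> tw.I \<longleftrightarrow> c \<in> Fix"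
proof -
  assume c: "c \<in> A"
  then have "inv c = \<sigma> (inv c) \<longleftrightarrow> \<sigma> c = c" by (metis A_carrier \<sigma>_A \<sigma>_inv inv_inv)
  then show ?thesis
    using c tw.I_iff[of "c \<otimes> s"] by (simp add: \<tau>_outer inv_outer Fix_def)
qed

lemma Fix_A [simp]: "c \<in> Fix \<Longrightarrow> c \<in> A" unfolding Fix_def by blast
lemma Fix_\<sigma> [simp]: "c \<in> Fix \<Longrightarrow> \<sigma> c = c" unfolding Fix_def by blast
lemma FixI: "c \<in> A \<Longrightarrow> \<sigma> c = c \<Longrightarrow> c \<in> Fix" unfolding Fix_def by blast
lemma Fix_one: "\<one> \<in> Fix" by (rule FixI) simp_all
lemma Fix_inv: "c \<in> Fix \<Longrightarrow> inv c \<in> Fix" by (rule FixI) (simp_all add: \<sigma>_inv)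
lemma Fix_mult: "c \<in> Fix \<Longrightarrow> d \<in> Fix \<Longrightarrow> c \<otimes> d \<in> Fix" by (rule FixI) (simp_all add: \<sigma>_mult)
lemma Fix_norm: "a \<in> A \<Longrightarrow> a \<otimes> \<sigma> a \<in> Fix" by (rule FixI) (simp_all add: \<sigma>_mult commA)
lemma finite_Fix [simp]: "finite Fix" by (rule finite_subset[OF _ finA]) auto

text \<open>The inverse of \<open>c s\<close> is \<open>\<sigma>(c)\<^sup>-\<^sup>1 s\<close> while
  its image is \<open>c\<^sup>-\<^sup>1 s\<close>. The resulting number \<open>|A| + |Fix|\<close>
  is the value of the sum of the irreducible characters at the identity, as a model
  requires.\<close>

lemma I_eq: "tw.I = A \<union> (\<lambda>c. c \<otimes> s) ` Fix"
proof
  show "tw.I \<subseteq> A \<union> (\<lambda>c. c \<otimes> s) ` Fix"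
  proof
    fix \<omega> assume \<omega>: "\<omega> \<in> tw.I"
    then have "\<omega> \<in> carrier G" by simp
    then show "\<omega> \<in> A \<union> (\<lambda>c. c \<otimes> s) ` Fix"
      by (cases rule: cover_cases) (use \<omega> outer_I_iff in auto)
  qed
qed (use base_I outer_I_iff in auto)

lemma sum_I:
  fixes F :: "'a \<Rightarrow> complex"
  shows "(\<Sum>\<omega>\<in>tw.I. F \<omega>) = (\<Sum>a\<in>A. F a) + (\<Sum>c\<in>Fix. F (c \<otimes> s))"
proof -
  have "(\<Sum>\<omega>\<in>tw.I. F \<omega>) = (\<Sum>a\<in>A. F a) + (\<Sum>\<omega>\<in>(\<lambda>c. c \<otimes> s) ` Fix. F \<omega>)"
    unfolding I_eq by (rule sum.union_disjoint) (use as_notin in auto)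
  also have "inj_on (\<lambda>c. c \<otimes> s) Fix" by (rule inj_onI) simp
  then have "(\<Sum>\<omega>\<in>(\<lambda>c. c \<otimes> s) ` Fix. F \<omega>) = (\<Sum>c\<in>Fix. F (c \<otimes> s))"
    by (subst sum.reindex) auto
  finally show ?thesis .
qed

lemma \<tau>_s: "\<tau> s = s"
  using \<tau>_outer[of \<one>] by simp

text \<open>Elements of \<open>A\<close> act on \<open>A\<close> through translation by squares and
  on the outer generalized involutions through translation by norms \<open>d \<sigma>(d)\<close>;
  \<open>s\<close> acts as \<sigma> and trivially, respectively. The stabilizers can be read off
  from this.\<close>

lemma act_base_base: "a \<in> A \<Longrightarrow> d \<in> A \<Longrightarrow> tw.\<phi> d a = d \<otimes> d \<otimes> a"
  by (simp add: tw.\<phi>_app[OF base_I] \<tau>_base A_ac)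

lemma act_base_outer: "c \<in> Fix \<Longrightarrow> d \<in> A \<Longrightarrow> tw.\<phi> d (c \<otimes> s) = d \<otimes> \<sigma> d \<otimes> c \<otimes> s"
proof -
  assume c: "c \<in> Fix" and d: "d \<in> A"
  have "c \<otimes> s \<in> tw.I" using c outer_I_iff[of c] by simp
  then have "tw.\<phi> d (c \<otimes> s) = d \<otimes> (c \<otimes> s \<otimes> d)"
    using c d by (simp add: tw.\<phi>_app \<tau>_base m_assoc)
  also have "\<dots> = d \<otimes> (c \<otimes> \<sigma> d) \<otimes> s" using c d by (simp add: as_b a_bs)
  also have "d \<otimes> (c \<otimes> \<sigma> d) = d \<otimes> \<sigma> d \<otimes> c" using c d by (simp add: A_ac)
  finally show ?thesis .
qed

lemma act_s_base: "a \<in> A \<Longrightarrow> tw.\<phi> s a = \<sigma> a"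
  by (simp add: tw.\<phi>_app[OF base_I] \<tau>_s \<sigma>_def)

lemma act_s_outer: "c \<in> Fix \<Longrightarrow> tw.\<phi> s (c \<otimes> s) = c \<otimes> s"
proof -
  assume c: "c \<in> Fix"
  have "c \<otimes> s \<in> tw.I" using c outer_I_iff[of c] by simp
  then have "tw.\<phi> s (c \<otimes> s) = s \<otimes> c" using c by (simp add: tw.\<phi>_app \<tau>_s m_assoc s_s)
  then show ?thesis using c by (simp add: s_mult)
qed

lemma St_base_base: "a \<in> A \<Longrightarrow> b \<in> A \<Longrightarrow> b \<in> tw.St a \<longleftrightarrow> b \<otimes> b = \<one>"
  by (simp add: stabilizer_def act_base_base)

lemma St_base_outer: "a \<in> A \<Longrightarrow> b \<in> A \<Longrightarrow> b \<otimes> s \<in> tw.St a \<longleftrightarrow> b \<otimes> b \<otimes> \<sigma> a = a"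
  using base_I tw.\<phi>_mult[of a b s] by (simp add: stabilizer_def act_base_base act_s_base)

lemma St_outer_base: "c \<in> Fix \<Longrightarrow> b \<in> A \<Longrightarrow> b \<in> tw.St (c \<otimes> s) \<longleftrightarrow> b \<otimes> \<sigma> b = \<one>"
  by (simp add: stabilizer_def act_base_outer)

lemma St_outer_outer: "c \<in> Fix \<Longrightarrow> b \<in> A \<Longrightarrow> b \<otimes> s \<in> tw.St (c \<otimes> s) \<longleftrightarrow> b \<otimes> \<sigma> b = \<one>"
  using outer_I_iff[of c] tw.\<phi>_mult[of "c \<otimes> s" b s]
  by (simp add: stabilizer_def act_base_outer act_s_outer)

text \<open>\<open>A\<close> and \<open>s\<close> generate the group: \<open>a s\<close> acts as
  \<open>s\<close> followed by \<open>a\<close>, so equivariance under both gives it for every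
  element.\<close>

lemma has_GIM_if_equivariant_gens:
  fixes lam :: "'a \<Rightarrow> 'a \<Rightarrow> complex"
  assumes lin: "\<And>\<omega>. \<omega> \<in> tw.I \<Longrightarrow> lam \<omega> \<in> linear_characters G (tw.St \<omega>)"
    and equiv_A: "\<And>\<omega> x h. \<omega> \<in> tw.I \<Longrightarrow> x \<in> A \<Longrightarrow> h \<in> tw.St \<omega> \<Longrightarrow>
      lam (tw.\<phi> x \<omega>) (x \<otimes> h \<otimes> inv x) = lam \<omega> h"
    and equiv_s: "\<And>\<omega> h. \<omega> \<in> tw.I \<Longrightarrow> h \<in> tw.St \<omega> \<Longrightarrow> lam (tw.\<phi> s \<omega>) (s \<otimes> h \<otimes> s) = lam \<omega> h"
    and total: "\<And>g. g \<in> carrier G \<Longrightarrow>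
      (\<Sum>\<omega>\<in>tw.I. if g \<in> tw.St \<omega> then lam \<omega> g else 0) = (\<Sum>\<psi>\<in>Irr G. \<psi> g)"
  shows "has_GIM G"
proof (rule tw.has_GIM_if_equivariant[of lam])
  fix \<omega> x h assume \<omega>: "\<omega> \<in> tw.I" and x: "x \<in> carrier G" and h: "h \<in> tw.St \<omega>"
  have hc: "h \<in> carrier G" using h by (simp add: stabilizer_def)
  show "lam (tw.\<phi> x \<omega>) (x \<otimes> h \<otimes> inv x) = lam \<omega> h"
    using x
  proof (cases rule: cover_cases)
    case base
    then show ?thesis by (rule equiv_A[OF \<omega> _ h])
  next
    case (outer a)
    have "s \<otimes> (s \<otimes> h \<otimes> s) \<otimes> s = h" using hc by (simp add: m_assoc s_s)
    then have "s \<otimes> h \<otimes> s \<in> tw.St (tw.\<phi> s \<omega>)"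
      using tw.St_conj[OF \<omega> s_carrier, of "s \<otimes> h \<otimes> s"] h hc by simp
    from equiv_A[OF tw.\<phi>_I[OF \<omega> s_carrier] outer(1) this]
    have "lam (tw.\<phi> x \<omega>) (a \<otimes> (s \<otimes> h \<otimes> s) \<otimes> inv a) = lam \<omega> h"
      using outer \<omega> by (simp add: tw.\<phi>_mult equiv_s[OF \<omega> h])
    also have "a \<otimes> (s \<otimes> h \<otimes> s) \<otimes> inv a = x \<otimes> h \<otimes> inv x"
      using outer hc by (simp add: inv_mult_group m_assoc)
    finally show ?thesis .
  qed
qed (use lin total in auto)

text \<open>The elements \<one>, \<open>d\<close> and \<open>inv d\<close> of \<open>D\<close> are
  distinct, hence \<open>|A| = |D| |Fix|\<close> is at least \<open>3 |Fix|\<close>.\<close>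

lemma two_card_Fix_less:
  assumes d: "d \<in> D" "d \<otimes> d \<noteq> \<one>"
  shows "2 * card Fix < card A"
proof -
  have finD: "finite D" using D_subset finA finite_subset by blast
  have dA: "d \<in> A" using d D_subset by blast
  have "{\<one>, d, inv d} \<subseteq> D"
  proof -
    obtain a where a: "a \<in> A" "d = a \<otimes> inv (\<sigma> a)" using d by (auto simp: D_def)
    have "inv d = \<sigma> a \<otimes> inv (\<sigma> (\<sigma> a))" using a by (simp add: inv_mult_group)
    then have "inv d \<in> D" unfolding D_def using a by (intro image_eqI[of _ _ "\<sigma> a"]) simp_all
    moreover have "\<one> \<in> D" unfolding D_def by (rule image_eqI[of _ _ \<one>]) auto
    ultimately show ?thesis using d by simp
  qed
  moreover have "card {\<one>, d, inv d} = 3"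
  proof -
    have "d \<noteq> \<one>" using d by auto
    moreover have "inv d \<noteq> d" using d dA by (metis A_carrier r_inv)
    moreover have "inv d \<noteq> \<one>" using \<open>d \<noteq> \<one>\<close> dA by (metis A_carrier inv_inv inv_one)
    ultimately show ?thesis by auto
  qed
  ultimately have "3 \<le> card D" using card_mono[OF finD] by metis
  then have "3 * card Fix \<le> card A" using card_D by simp
  then show ?thesis using Fix_pos by simp
qed

end

section \<open>Models from self-duality\<close>

locale self_dual_extension = split_extension +
  fixes P :: "'a \<Rightarrow> 'a \<Rightarrow> complex"
  assumes P_mult_left: "a \<in> A \<Longrightarrow> b \<in> A \<Longrightarrow> c \<in> A \<Longrightarrow> P (a \<otimes> b) c = P a c * P b c"
    and P_sym: "a \<in> A \<Longrightarrow> b \<in> A \<Longrightarrow> P a b = P b a"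
    and P_\<sigma>\<sigma>: "a \<in> A \<Longrightarrow> b \<in> A \<Longrightarrow> P (\<sigma> a) (\<sigma> b) = P a b"
    and P_nz: "a \<in> A \<Longrightarrow> b \<in> A \<Longrightarrow> P a b \<noteq> 0"
    and P_nondegenerate: "a \<in> A \<Longrightarrow> (\<And>b. b \<in> A \<Longrightarrow> P a b = 1) \<Longrightarrow> a = \<one>"
begin

lemma P_mult_right: "a \<in> A \<Longrightarrow> b \<in> A \<Longrightarrow> c \<in> A \<Longrightarrow> P a (b \<otimes> c) = P a b * P a c"
  by (simp add: P_sym[of a] P_mult_left)

lemma P_one_left: "a \<in> A \<Longrightarrow> P \<one> a = 1"
  using P_mult_left[of \<one> \<one> a] P_nz[of \<one> a] by simp

lemma P_inv_left: "a \<in> A \<Longrightarrow> b \<in> A \<Longrightarrow> P (inv a) b = inverse (P a b)"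
  using P_mult_left[of "inv a" a b] P_nz[of a b] by (simp add: P_one_left field_simps)

lemma P_inv_right: "a \<in> A \<Longrightarrow> b \<in> A \<Longrightarrow> P a (inv b) = inverse (P a b)"
  by (simp add: P_sym[of a] P_inv_left)

lemma P_\<sigma>_left: "a \<in> A \<Longrightarrow> b \<in> A \<Longrightarrow> P (\<sigma> a) b = P a (\<sigma> b)"
  using P_\<sigma>\<sigma>[of a "\<sigma> b"] by simp

text \<open>The quadratic factor \<open>P b b\<close> is forced by products of outer elements:
  \<open>(b s)(d s) = b \<sigma>(d)\<close> produces the square of \<open>P b (\<sigma> d)\<close>,
  and the stabilizer equation for \<open>d s\<close> uses it to turn \<open>P b \<omega>\<close>
  into \<open>P b (\<sigma> \<omega>)\<close>. On base elements of the stabilizer, of order at most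
  two, the cross terms of this factor are trivial. The minus sign lets the contributions of
  \<open>A\<close> and of the outer generalized involutions cancel in
  \<open>total_outer\<close>.\<close>

definition lam :: "'a \<Rightarrow> 'a \<Rightarrow> complex" where
  "lam \<omega> g =
    (if \<omega> \<in> A then if g \<in> A then P g (\<omega> \<otimes> g) else - P (g \<otimes> s) (\<sigma> \<omega> \<otimes> (g \<otimes> s))
     else P (if g \<in> A then g else g \<otimes> s) (\<omega> \<otimes> s))"

lemma lam_simps:
  "a \<in> A \<Longrightarrow> b \<in> A \<Longrightarrow> lam a b = P b a * P b b"
  "a \<in> A \<Longrightarrow> b \<in> A \<Longrightarrow> lam a (b \<otimes> s) = - P b (\<sigma> a) * P b b"
  "c \<in> A \<Longrightarrow> b \<in> A \<Longrightarrow> lam (c \<otimes> s) b = P b c"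
  "c \<in> A \<Longrightarrow> b \<in> A \<Longrightarrow> lam (c \<otimes> s) (b \<otimes> s) = P b c"
  using as_notin by (simp_all add: lam_def P_mult_right)

lemma square_trivial: "b \<in> A \<Longrightarrow> b \<otimes> b = \<one> \<Longrightarrow> a \<in> A \<Longrightarrow> P b a * P b a = 1"
  using P_mult_left[of b b a] by (simp add: P_one_left)

lemma norm_trivial: "b \<in> A \<Longrightarrow> b \<otimes> \<sigma> b = \<one> \<Longrightarrow> a \<in> A \<Longrightarrow> P b a * P b (\<sigma> a) = 1"
  using P_mult_left[of b "\<sigma> b" a] by (simp add: P_one_left P_\<sigma>_left)

lemma coboundary: "b \<in> A \<Longrightarrow> a \<in> A \<Longrightarrow> b \<otimes> b \<otimes> \<sigma> a = a \<Longrightarrow> x \<in> A \<Longrightarrow>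
    P x b * P x b * P x (\<sigma> a) = P x a"
  by (metis P_mult_right \<sigma>_A mult_A)

lemma lam_linear_base:
  assumes a: "a \<in> A"
  shows "lam a \<in> linear_characters G (tw.St a)"
  unfolding tw.linear_character_iff
proof (intro conjI ballI)
  fix g assume g: "g \<in> tw.St a"
  then have gc: "g \<in> carrier G" by (simp add: stabilizer_def)
  then show "lam a g \<noteq> 0"
    by (cases rule: cover_cases) (simp_all add: lam_simps a P_nz)
  fix h assume h: "h \<in> tw.St a"
  then have hc: "h \<in> carrier G" by (simp add: stabilizer_def)
  from gc show "lam a (g \<otimes> h) = lam a g * lam a h"
  proof (cases rule: cover_cases)
    case base
    then have gg: "g \<otimes> g = \<one>" using g a St_base_base by blast
    from hc show ?thesis
    proof (cases rule: cover_cases)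
      case base': base
      have "lam a (g \<otimes> h) = (P g h * P g h) * (lam a g * lam a h)"
        using base base' a by (simp add: lam_simps P_mult_left P_mult_right P_sym[of h g])
      then show ?thesis by (simp add: square_trivial[OF base gg base'])
    next
      case (outer b)
      then have bb: "b \<otimes> b \<otimes> \<sigma> a = a" using h a St_base_outer by blast
      \<comment> \<open>Pairing \<open>g\<close> with the equation
        \<open>b^2 \<sigma>(a) = a\<close>: the square disappears because \<open>g^2\<close> is
        trivial.\<close>
      have "P g a = P g (\<sigma> a)"
        using coboundary[OF outer(1) a bb base] square_trivial[OF base gg outer(1)] by simp
      moreover have "lam a (g \<otimes> h) = - ((P g b * P g b) * (P g (\<sigma> a) * P g g * (P b (\<sigma> a) * P b b)))"
        using base outer a by (simp add: a_bs lam_simps P_mult_left P_mult_right P_sym[of b g])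
      ultimately show ?thesis
        using base outer a by (simp add: square_trivial[OF base gg outer(1)] lam_simps)
    qed
  next
    case (outer b)
    then have bb: "b \<otimes> b \<otimes> \<sigma> a = a" using g a St_base_outer by blast
    from hc show ?thesis
    proof (cases rule: cover_cases)
      case base
      then have hh: "h \<otimes> h = \<one>" using h a St_base_base by blast
      have "\<sigma> h \<otimes> \<sigma> h = \<one>" using hh base by (metis \<sigma>_mult \<sigma>_one)
      then have 1: "P (\<sigma> h) b * P (\<sigma> h) b = 1" using square_trivial base outer by simp
      have "lam a (g \<otimes> h) = - ((P (\<sigma> h) b * P (\<sigma> h) b) * (P b (\<sigma> a) * P b b * (P (\<sigma> h) (\<sigma> a) * P (\<sigma> h) (\<sigma> h))))"
        using base outer a by (simp add: as_b lam_simps P_mult_left P_mult_right P_sym[of b "\<sigma> h"])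
      also have "\<dots> = - (P b (\<sigma> a) * P b b * (P h a * P h h))"
        unfolding 1 using base a by (simp add: P_\<sigma>\<sigma>)
      finally show ?thesis using base outer a by (simp add: lam_simps)
    next
      case outer': (outer d)
      then have dd: "d \<otimes> d \<otimes> \<sigma> a = a" using h a St_base_outer by blast
      \<comment> \<open>Applying \<sigma> to the stabilizer equation of \<open>d s\<close> gives the
        form that absorbs the square of \<open>P b (\<sigma> d)\<close>.\<close>
      have "\<sigma> (d \<otimes> d \<otimes> \<sigma> a) = \<sigma> a" using dd by simp
      then have "\<sigma> d \<otimes> \<sigma> d \<otimes> a = \<sigma> a" using outer' a by (simp add: \<sigma>_mult)
      then have 1: "P b (\<sigma> d) * P b (\<sigma> d) * P b a = P b (\<sigma> a)"
        using outer outer' a by (metis P_mult_right \<sigma>_A mult_A)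
      have "lam a (g \<otimes> h) =
          (P b (\<sigma> d) * P b (\<sigma> d) * P b a) * P b b * (P (\<sigma> d) a * P (\<sigma> d) (\<sigma> d))"
        using outer outer' a by (simp add: as_bs lam_simps P_mult_left P_mult_right P_sym[of "\<sigma> d" b])
      also have "\<dots> = P b (\<sigma> a) * P b b * (P d (\<sigma> a) * P d d)"
        unfolding 1 using outer' a by (simp add: P_\<sigma>_left)
      finally show ?thesis using outer outer' a by (simp add: lam_simps)
    qed
  qed
qed

lemma P_Fix: "c \<in> Fix \<Longrightarrow> b \<in> A \<Longrightarrow> P (\<sigma> b) c = P b c"
  by (simp add: P_\<sigma>_left)

lemma lam_linear_outer:
  assumes c: "c \<in> Fix"
  shows "lam (c \<otimes> s) \<in> linear_characters G (tw.St (c \<otimes> s))"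
  unfolding tw.linear_character_iff
proof (intro conjI ballI)
  fix g assume g: "g \<in> tw.St (c \<otimes> s)"
  then have gc: "g \<in> carrier G" by (simp add: stabilizer_def)
  then show "lam (c \<otimes> s) g \<noteq> 0"
    by (cases rule: cover_cases) (simp_all add: lam_simps c P_nz)
  fix h assume "h \<in> tw.St (c \<otimes> s)"
  then have hc: "h \<in> carrier G" by (simp add: stabilizer_def)
  from gc show "lam (c \<otimes> s) (g \<otimes> h) = lam (c \<otimes> s) g * lam (c \<otimes> s) h"
  proof (cases rule: cover_cases)
    case base
    note g = this
    from hc show ?thesis
      by (cases rule: cover_cases) (simp_all add: g a_bs lam_simps c P_mult_left)
  next
    case (outer b)
    note g = this
    from hc show ?thesis
      by (cases rule: cover_cases) (simp_all add: g as_b as_bs lam_simps c P_mult_left P_Fix)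
  qed
qed

lemma lam_equivariant_A:
  assumes \<omega>: "\<omega> \<in> tw.I" and d: "d \<in> A" and h: "h \<in> tw.St \<omega>"
  shows "lam (tw.\<phi> d \<omega>) (d \<otimes> h \<otimes> inv d) = lam \<omega> h"
proof -
  have hc: "h \<in> carrier G" using h by (simp add: stabilizer_def)
  have conj_base: "d \<otimes> b \<otimes> inv d = b" if "b \<in> A" for b
    using that d commA[of d b] by (simp add: m_assoc)
  have conj_outer: "d \<otimes> (b \<otimes> s) \<otimes> inv d = d \<otimes> b \<otimes> inv (\<sigma> d) \<otimes> s" if "b \<in> A" for b
    using that d by (simp add: a_bs as_b \<sigma>_inv)
  consider "\<omega> \<in> A" | c where "c \<in> Fix" "\<omega> = c \<otimes> s" using \<omega> I_eq by blast
  then show ?thesis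
  proof cases
    case 1
    from hc show ?thesis
    proof (cases rule: cover_cases)
      case base
      then have "h \<otimes> h = \<one>" using h 1 St_base_base by blast
      then show ?thesis
        using square_trivial[OF base _ d] base 1 d
        by (simp add: act_base_base conj_base lam_simps P_mult_right)
    next
      case (outer b)
      then have bb: "b \<otimes> b \<otimes> \<sigma> \<omega> = \<omega>" using h 1 St_base_outer by blast
      have 2: "P d b * P d b * P d (\<sigma> \<omega>) = P d \<omega>" by (rule coboundary[OF outer(1) 1 bb d])
      \<comment> \<open>\<open>?x\<close> is the base part of the conjugate of \<open>h\<close>, and
        \<open>?w\<close> is \<open>\<sigma>(d^2 \<omega>) ?x\<close> after cancellation. Expanding
        \<open>P ?x ?w\<close> bilinearly leaves the wanted value times the quotient of the two
        sides of equation \<open>2\<close>.\<close>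
      let ?e = "\<sigma> d" and ?w = "\<sigma> d \<otimes> d \<otimes> b \<otimes> \<sigma> \<omega>" and ?x = "d \<otimes> b \<otimes> inv (\<sigma> d)"
      have A': "d \<in> A" "b \<in> A" "?e \<in> A" "\<sigma> \<omega> \<in> A" "?w \<in> A" "?x \<in> A" "\<omega> \<in> A"
        using outer 1 d by simp_all
      have "lam (tw.\<phi> d \<omega>) (d \<otimes> h \<otimes> inv d) = - P ?x (?e \<otimes> ?e \<otimes> \<sigma> \<omega>) * P ?x ?x"
        using outer 1 d by (simp add: act_base_base conj_outer lam_simps \<sigma>_mult)
      also have "\<dots> = - P ?x ((?e \<otimes> ?e \<otimes> \<sigma> \<omega>) \<otimes> ?x)"
        using A' P_mult_right[of ?x "?e \<otimes> ?e \<otimes> \<sigma> \<omega>" ?x] by simp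
      also have "(?e \<otimes> ?e \<otimes> \<sigma> \<omega>) \<otimes> ?x = ?w \<otimes> (?e \<otimes> inv ?e)"
        using A'(1-4) by (simp only: A_ac mult_A inv_A A_carrier m_closed)
      also have "\<dots> = ?w" using A' by simp
      also have "P ?x ?w = P d ?w * P b ?w * inverse (P ?e ?w)"
        using A' by (simp add: P_mult_left P_inv_left)
      also have "P d ?w = P d ?e * P d d * P d b * P d (\<sigma> \<omega>)" using A' by (simp add: P_mult_right)
      also have "P b ?w = P b ?e * P d b * P b b * P b (\<sigma> \<omega>)" using A' by (simp add: P_mult_right P_sym[of b d])
      also have "P ?e ?w = P d d * P d ?e * P b ?e * P d \<omega>"
        using A'(1-4) 1 P_\<sigma>\<sigma>[of d \<omega>] P_\<sigma>\<sigma>[of d d] P_sym[of ?e d] P_sym[of ?e b] by (simp only: P_mult_right mult_A)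
      also have "- (P d ?e * P d d * P d b * P d (\<sigma> \<omega>) * (P b ?e * P d b * P b b * P b (\<sigma> \<omega>)) *
          inverse (P d d * P d ?e * P b ?e * P d \<omega>)) =
          - ((P d b * P d b * P d (\<sigma> \<omega>)) * inverse (P d \<omega>) * (P b (\<sigma> \<omega>) * P b b))"
      proof -
        have nz: "P d d \<noteq> 0" "P d ?e \<noteq> 0" "P b ?e \<noteq> 0" "P d \<omega> \<noteq> 0" using A' P_nz by blast+
        show ?thesis
          using nz by (simp add: inverse_eq_divide)
      qed
      also have "\<dots> = - (P b (\<sigma> \<omega>) * P b b)"
        unfolding 2 using 1 d P_nz by simp
      finally show ?thesis using outer 1 by (simp add: lam_simps)
    qed
  next
    case (2 c)
    have c: "c \<in> A" "\<sigma> c = c" using 2 by simp_all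
    from hc show ?thesis
    proof (cases rule: cover_cases)
      case base
      then have "h \<otimes> \<sigma> h = \<one>" using h 2 St_outer_base by blast
      then have "P h d * P h (\<sigma> d) = 1" by (rule norm_trivial[OF base _ d])
      then show ?thesis
        using base 2 d c
        by (simp add: act_base_outer conj_base lam_simps P_mult_right)
    next
      case (outer b)
      then have "b \<otimes> \<sigma> b = \<one>" using h 2 St_outer_outer by blast
      then have 3: "P b d * P b (\<sigma> d) = 1" by (rule norm_trivial[OF outer(1) _ d])
      let ?e = "\<sigma> d" and ?w = "d \<otimes> \<sigma> d \<otimes> c"
      have A': "d \<in> A" "b \<in> A" "?e \<in> A" "c \<in> A" "?w \<in> A" using outer c d by simp_all
      have "lam (tw.\<phi> d \<omega>) (d \<otimes> h \<otimes> inv d) = P (d \<otimes> b \<otimes> inv ?e) ?w"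
        using outer 2 d c by (simp add: act_base_outer conj_outer lam_simps)
      also have "\<dots> = P d ?w * P b ?w * inverse (P ?e ?w)"
        using A' by (simp add: P_mult_left P_inv_left)
      \<comment> \<open>\<open>?w\<close> is a norm times an invariant element, hence
        \<sigma>-invariant.\<close>
      also have "P ?e ?w = P d ?w"
      proof -
        have "P ?e ?w = P d (\<sigma> ?w)" using A' by (simp only: P_\<sigma>_left)
        also have "\<sigma> ?w = ?w" using A' c by (simp add: \<sigma>_mult commA[of "\<sigma> d" d])
        finally show ?thesis .
      qed
      also have "P d ?w * P b ?w * inverse (P d ?w) = P b ?w" using A' P_nz[of d ?w] by simp
      also have "P b ?w = P b c * (P b d * P b (\<sigma> d))" using A' by (simp add: P_mult_right)
      finally have "lam (tw.\<phi> d \<omega>) (d \<otimes> h \<otimes> inv d) = P b c * (P b d * P b (\<sigma> d))" .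
      then show ?thesis unfolding 3 using outer 2 c by (simp add: lam_simps)
    qed
  qed
qed

lemma lam_equivariant_s:
  assumes \<omega>: "\<omega> \<in> tw.I" and h: "h \<in> tw.St \<omega>"
  shows "lam (tw.\<phi> s \<omega>) (s \<otimes> h \<otimes> s) = lam \<omega> h"
proof -
  have hc: "h \<in> carrier G" using h by (simp add: stabilizer_def)
  have conj_base: "s \<otimes> b \<otimes> s = \<sigma> b" if "b \<in> A" for b by (simp add: \<sigma>_def)
  have conj_outer: "s \<otimes> (b \<otimes> s) \<otimes> s = \<sigma> b \<otimes> s" if "b \<in> A" for b
    using that by (simp add: \<sigma>_def m_assoc s_s)
  consider "\<omega> \<in> A" | c where "c \<in> Fix" "\<omega> = c \<otimes> s" using \<omega> I_eq by blast
  then show ?thesis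
  proof cases
    case 1
    from hc show ?thesis
      by (cases rule: cover_cases)
        (use 1 in \<open>simp_all add: act_s_base conj_base conj_outer lam_simps P_\<sigma>\<sigma> P_\<sigma>_left\<close>)
  next
    case (2 c)
    from hc show ?thesis
      by (cases rule: cover_cases)
        (use 2 in \<open>simp_all add: act_s_outer conj_base conj_outer lam_simps P_Fix\<close>)
  qed
qed

definition to_dual :: "'a \<Rightarrow> 'a \<Rightarrow> complex" where "to_dual c = (\<lambda>a\<in>A. P a c)"

lemma to_dual_dual: "c \<in> A \<Longrightarrow> to_dual c \<in> dual"
  by (rule dualI) (simp_all add: to_dual_def P_mult_left P_one_left)

text \<open>Nondegeneracy makes \<open>to_dual\<close> injective, and \<open>dual\<close> has as
  many elements as \<open>A\<close>.\<close>

lemma to_dual_surj: "\<chi> \<in> dual \<Longrightarrow> \<exists>c\<in>A. \<chi> = to_dual c"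
proof -
  have "inj_on to_dual A"
  proof (rule inj_onI)
    fix c d assume *: "c \<in> A" "d \<in> A" "to_dual c = to_dual d"
    have "P (c \<otimes> inv d) b = 1" if b: "b \<in> A" for b
    proof -
      have "to_dual c b = to_dual d b" using * by simp
      then show ?thesis using * b P_nz by (simp add: to_dual_def P_mult_left P_inv_left P_sym[of c b] P_sym[of d b])
    qed
    then have "c \<otimes> inv d = \<one>" using * by (intro P_nondegenerate) auto
    then show "c = d" using * by (metis A_carrier inv_A inv_equality inv_inv)
  qed
  then have "card (to_dual ` A) = card dual" by (simp add: card_image card_dual)
  moreover have "to_dual ` A \<subseteq> dual" using to_dual_dual by blast
  ultimately have "to_dual ` A = dual" by (simp add: card_subset_eq)
  then show "\<chi> \<in> dual \<Longrightarrow> \<exists>c\<in>A. \<chi> = to_dual c" by blast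
qed

lemma subgroup_Fix: "subgroup Fix G"
proof (rule subgroupI)
  show "Fix \<noteq> {}" using FixI[of \<one>] by auto
qed (auto intro!: FixI simp: \<sigma>_mult \<sigma>_inv)

text \<open>The identification of \<open>A\<close> with its dual is equivariant and matches
  \<open>Fix\<close> with \<open>dfix\<close>; the annihilator of \<open>dfix\<close> is
  \<open>D\<close>. Together with \<open>D_props\<close> this makes \<open>D\<close> the orthogonal
  complement of \<open>Fix\<close>.\<close>

lemma ex_Fix_nontrivial:
  assumes b: "b \<in> A" "b \<notin> D"
  shows "\<exists>c\<in>Fix. P b c \<noteq> 1"
proof -
  have "b \<notin> annihilator dfix" using b annihilator_dfix by simp
  then obtain \<chi> where \<chi>: "\<chi> \<in> dfix" "\<chi> b \<noteq> 1" using b by (auto simp: annihilator_def)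
  obtain c where c: "c \<in> A" "\<chi> = to_dual c" using to_dual_surj[OF dfix_dual[OF \<chi>(1)]] by blast
  have eq: "P (\<sigma> a) c = P a c" if a: "a \<in> A" for a
    using dfix_\<sigma>[OF \<chi>(1) a] a c by (simp add: to_dual_def)
  have "P (\<sigma> c \<otimes> inv c) a = 1" if a: "a \<in> A" for a
  proof -
    have "P a (\<sigma> c) = P a c" using eq[OF a] a c by (simp add: P_\<sigma>_left)
    then show ?thesis
      using a c P_nz by (simp add: P_mult_left P_inv_left P_sym[of c a] P_sym[of "\<sigma> c" a])
  qed
  then have "\<sigma> c \<otimes> inv c = \<one>" using c by (intro P_nondegenerate) auto
  then have "\<sigma> c = c" using c by (metis A_carrier \<sigma>_A inv_A inv_equality inv_inv)
  then show ?thesis using c \<chi> b by (intro bexI[of _ c] FixI) (auto simp: to_dual_def)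
qed

text \<open>\<open>P (d / \<sigma>(d)) c\<close> equals \<open>P d c / P d (\<sigma> c)\<close> by
  invariance of the pairing, which is 1 for invariant \<open>c\<close>.\<close>

lemma D_props:
  assumes "b \<in> D"
  shows "b \<otimes> \<sigma> b = \<one>" "c \<in> Fix \<Longrightarrow> P b c = 1"
proof -
  obtain d where d: "d \<in> A" "b = d \<otimes> inv (\<sigma> d)" using assms by (auto simp: D_def)
  have "b \<otimes> \<sigma> b = d \<otimes> inv (\<sigma> d) \<otimes> (\<sigma> d \<otimes> inv d)"
    using d by (simp add: \<sigma>_mult \<sigma>_inv)
  also have "\<dots> = d \<otimes> (inv (\<sigma> d) \<otimes> \<sigma> d) \<otimes> inv d"
    using d(1) by (simp only: m_assoc A_carrier inv_closed m_closed \<sigma>_A)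
  finally show "b \<otimes> \<sigma> b = \<one>" using d by simp
  show "c \<in> Fix \<Longrightarrow> P b c = 1"
    using d P_nz by (simp add: P_mult_left P_inv_left P_Fix)
qed

lemma sum_P_A:
  assumes b: "b \<in> A"
  shows "(\<Sum>a\<in>A. P b a) = (if b = \<one> then of_nat (card A) else 0)"
proof (cases "b = \<one>")
  case False
  then obtain a where "a \<in> A" "P b a \<noteq> 1" using P_nondegenerate b by blast
  then show ?thesis
    using sum_character_eq_zero[OF subA, of "P b" a] False b by (simp add: P_mult_right)
qed (simp add: P_one_left)

lemma sum_P_Fix:
  assumes b: "b \<in> A"
  shows "(\<Sum>c\<in>Fix. P b c) = (if b \<in> D then of_nat (card Fix) else 0)"
proof (cases "b \<in> D")
  case False
  then obtain c where "c \<in> Fix" "P b c \<noteq> 1" using ex_Fix_nontrivial b by blast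
  then show ?thesis
    using sum_character_eq_zero[OF subgroup_Fix, of "P b" c] False b by (simp add: P_mult_right)
qed (simp add: D_props)

text \<open>The condition \<open>b \<sigma>(b) = \<one>\<close> holds throughout \<open>D\<close>,
  and off \<open>D\<close> the sum over \<open>Fix\<close> vanishes in any case.\<close>

lemma sum_outer_part:
  assumes b: "b \<in> A"
  shows "(\<Sum>c\<in>Fix. if b \<otimes> \<sigma> b = \<one> then P b c else 0) = (if b \<in> D then of_nat (card Fix) else 0)"
  using sum_P_Fix[OF b] D_props(1)[of b] by (cases "b \<otimes> \<sigma> b = \<one>") auto

text \<open>The two kinds of generalized involutions account separately for the two terms of
  \<open>sum_Irr_base\<close>: those in \<open>A\<close> for the term at the identity, the outer
  ones for the indicator of \<open>D\<close>.\<close>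

lemma total_base:
  assumes b: "b \<in> A"
  shows "(\<Sum>\<omega>\<in>tw.I. if b \<in> tw.St \<omega> then lam \<omega> b else 0) = (\<Sum>\<psi>\<in>Irr G. \<psi> b)"
proof -
  have "(\<Sum>a\<in>A. if b \<in> tw.St a then lam a b else 0) =
      (\<Sum>a\<in>A. if b \<otimes> b = \<one> then P b b * P b a else 0)"
    using b by (intro sum.cong) (auto simp: St_base_base lam_simps)
  also have "\<dots> = (if b \<otimes> b = \<one> then P b b * (\<Sum>a\<in>A. P b a) else 0)"
    by (simp add: sum_distrib_left)
  also have "\<dots> = (if b = \<one> then of_nat (card A) else 0)"
    using b by (simp add: sum_P_A P_one_left)
  finally have 1: "(\<Sum>a\<in>A. if b \<in> tw.St a then lam a b else 0) = (if b = \<one> then of_nat (card A) else 0)" .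
  have "(\<Sum>c\<in>Fix. if b \<in> tw.St (c \<otimes> s) then lam (c \<otimes> s) b else 0) =
      (\<Sum>c\<in>Fix. if b \<otimes> \<sigma> b = \<one> then P b c else 0)"
    using b by (intro sum.cong) (auto simp: St_outer_base lam_simps)
  then show ?thesis
    using b by (simp only: sum_I 1 sum_outer_part sum_Irr_base)
qed

text \<open>The solutions \<open>a\<close> of \<open>b^2 \<sigma>(a) = a\<close> are empty or a
  coset of \<open>Fix\<close>, so their contribution is a multiple of the sum of \<open>P b\<close>
  over \<open>Fix\<close> and vanishes for \<open>b\<close> outside \<open>D\<close>. On
  \<open>D\<close> the multiple is -1, which cancels the outer generalized involutions.\<close>

lemma total_outer:
  assumes b: "b \<in> A"
  shows "(\<Sum>\<omega>\<in>tw.I. if b \<otimes> s \<in> tw.St \<omega> then lam \<omega> (b \<otimes> s) else 0) = (\<Sum>\<psi>\<in>Irr G. \<psi> (b \<otimes> s))"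
proof -
  let ?S = "{a \<in> A. b \<otimes> b \<otimes> \<sigma> a = a}"
  have shift: "(\<Sum>a\<in>?S. - P b (\<sigma> a) * P b b) = - P b (\<sigma> a0) * P b b * (\<Sum>c\<in>Fix. P b c)"
    if a0: "a0 \<in> A" "b \<otimes> b \<otimes> \<sigma> a0 = a0" for a0
  proof -
    have "bij_betw (\<lambda>c. a0 \<otimes> c) Fix ?S"
    proof (rule bij_betw_byWitness[where f' = "\<lambda>a. inv a0 \<otimes> a"])
      show "(\<lambda>c. a0 \<otimes> c) ` Fix \<subseteq> ?S"
      proof safe
        fix c assume c: "c \<in> Fix"
        then show "a0 \<otimes> c \<in> A" using a0 by simp
        have "b \<otimes> b \<otimes> \<sigma> (a0 \<otimes> c) = (b \<otimes> b \<otimes> \<sigma> a0) \<otimes> c"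
          using a0(1) b c by (simp add: \<sigma>_mult m_assoc)
        then show "b \<otimes> b \<otimes> \<sigma> (a0 \<otimes> c) = a0 \<otimes> c" using a0 by simp
      qed
      show "(\<lambda>a. inv a0 \<otimes> a) ` ?S \<subseteq> Fix"
      proof safe
        fix a assume a: "a \<in> A" "b \<otimes> b \<otimes> \<sigma> a = a"
        have "inv a0 \<otimes> a = inv (b \<otimes> b \<otimes> \<sigma> a0) \<otimes> (b \<otimes> b \<otimes> \<sigma> a)" using a a0 by simp
        also have "\<dots> = inv (\<sigma> a0) \<otimes> (inv (b \<otimes> b) \<otimes> (b \<otimes> b \<otimes> \<sigma> a))"
          using a(1) a0(1) b by (simp add: inv_mult_group m_assoc)
        also have "\<dots> = inv (\<sigma> a0) \<otimes> \<sigma> a"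
          using a(1) a0(1) b by (simp add: m_assoc[symmetric, of "inv (b \<otimes> b)"])
        finally show "inv a0 \<otimes> a \<in> Fix" using a(1) a0(1) by (intro FixI) (simp_all add: \<sigma>_mult \<sigma>_inv)
      qed
    qed (use a0 in \<open>auto simp: m_assoc[symmetric]\<close>)
    from sum.reindex_bij_betw[OF this, of "\<lambda>a. - P b (\<sigma> a) * P b b", symmetric]
    show ?thesis
      using a0 b by (simp add: \<sigma>_mult P_mult_right sum_distrib_left sum_negf mult_ac)
  qed
  have "(\<Sum>a\<in>A. if b \<otimes> s \<in> tw.St a then lam a (b \<otimes> s) else 0) =
      (\<Sum>a\<in>A. if b \<otimes> b \<otimes> \<sigma> a = a then - P b (\<sigma> a) * P b b else 0)"
    using b by (intro sum.cong) (auto simp: St_base_outer lam_simps)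
  also have "\<dots> = (\<Sum>a\<in>?S. - P b (\<sigma> a) * P b b)" by (rule sum.inter_filter[symmetric]) simp
  also have "\<dots> = - (if b \<in> D then of_nat (card Fix) else 0)"
  proof (cases "b \<in> D")
    case True
    then obtain d where d: "d \<in> A" "b = d \<otimes> inv (\<sigma> d)" by (auto simp: D_def)
    have be: "b \<otimes> \<sigma> d = d" using d by (simp add: m_assoc)
    \<comment> \<open>For \<open>b = d / \<sigma>(d)\<close> the square of \<open>d\<close> is an
      explicit solution. With it the leading factor becomes the pairing of \<open>b\<close> with the
      norm of \<open>d\<close>, which is trivial because \<open>D\<close> is orthogonal to
      \<open>Fix\<close>.\<close>
    have "b \<otimes> b \<otimes> \<sigma> (d \<otimes> d) = b \<otimes> \<sigma> d \<otimes> (b \<otimes> \<sigma> d)"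
      using d(1) b by (simp only: \<sigma>_mult A_ac mult_A \<sigma>_A A_carrier m_closed)
    then have a0: "b \<otimes> b \<otimes> \<sigma> (d \<otimes> d) = d \<otimes> d" using be by simp
    have "P b (\<sigma> (d \<otimes> d)) * P b b = P b (\<sigma> d \<otimes> (b \<otimes> \<sigma> d))"
      using d(1) b by (simp add: \<sigma>_mult P_mult_right)
    also have "\<dots> = P b (\<sigma> d \<otimes> d)" using be by simp
    also have "\<sigma> d \<otimes> d \<in> Fix" using d(1) by (intro FixI) (simp_all add: \<sigma>_mult commA[of d "\<sigma> d"])
    then have "P b (\<sigma> d \<otimes> d) = 1" by (rule D_props(2)[OF True])
    finally have "P b (\<sigma> (d \<otimes> d)) * P b b = 1" .
    then show ?thesis using shift[OF _ a0] d True b by (simp add: sum_P_Fix)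
  next
    case False
    then have z: "(\<Sum>c\<in>Fix. P b c) = 0" using sum_P_Fix b by simp
    show ?thesis
    proof (cases "?S = {}")
      case True
      show ?thesis using \<open>b \<notin> D\<close> by (simp only: True sum.empty if_False minus_zero)
    next
      case False
      then obtain a0 where "a0 \<in> A" "b \<otimes> b \<otimes> \<sigma> a0 = a0" by blast
      from shift[OF this] show ?thesis using z \<open>b \<notin> D\<close> by simp
    qed
  qed
  finally have 1: "(\<Sum>a\<in>A. if b \<otimes> s \<in> tw.St a then lam a (b \<otimes> s) else 0) =
      - (if b \<in> D then of_nat (card Fix) else 0)" .
  have "(\<Sum>c\<in>Fix. if b \<otimes> s \<in> tw.St (c \<otimes> s) then lam (c \<otimes> s) (b \<otimes> s) else 0) =
      (\<Sum>c\<in>Fix. if b \<otimes> \<sigma> b = \<one> then P b c else 0)"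
    using b by (intro sum.cong) (auto simp: St_outer_outer lam_simps)
  also have "\<dots> = (if b \<in> D then of_nat (card Fix) else 0)" by (rule sum_outer_part[OF b])
  finally show ?thesis
    using b by (simp add: sum_I 1 sum_Irr_outer)
qed

theorem has_GIM_self_dual: "has_GIM G"
proof (rule has_GIM_if_equivariant_gens[of lam])
  show "lam \<omega> \<in> linear_characters G (tw.St \<omega>)" if "\<omega> \<in> tw.I" for \<omega>
    using that lam_linear_base lam_linear_outer unfolding I_eq by blast
  show "(\<Sum>\<omega>\<in>tw.I. if g \<in> tw.St \<omega> then lam \<omega> g else 0) = (\<Sum>\<psi>\<in>Irr G. \<psi> g)" if "g \<in> carrier G" for g
    using that by (cases rule: cover_cases) (simp_all only: total_base total_outer)
qed (use lam_equivariant_A lam_equivariant_s in auto)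

end

section \<open>Obstructions to a model\<close>

text \<open>A translate of \<open>H\<close> by an element of \<open>K\<close> outside
  \<open>H\<close> is disjoint from \<open>H\<close> and of the same size.\<close>

lemma (in group) subgroup_coset_card:
  assumes "finite K" "subgroup K G" "subgroup H G" "H \<subset> K"
  shows "2 * card H \<le> card K"
proof -
  obtain k where k: "k \<in> K" "k \<notin> H" using assms(4) by blast
  have sub: "(\<lambda>h. k \<otimes> h) ` H \<subseteq> K" using assms k subgroup.m_closed by fastforce
  have kc: "k \<in> carrier G" using k assms(2) subgroup.mem_carrier by metis
  have hc: "\<And>h. h \<in> H \<Longrightarrow> h \<in> carrier G" using assms(3) subgroup.mem_carrier by metis
  have disj: "H \<inter> (\<lambda>h. k \<otimes> h) ` H = {}"
  proof (rule equals0I, clarify)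
    fix h assume h: "h \<in> H" "k \<otimes> h \<in> H"
    then have "k \<otimes> h \<otimes> inv h \<in> H" using assms(3) subgroup.m_closed subgroup.m_inv_closed by metis
    then show False using k h kc hc by (simp add: m_assoc)
  qed
  have fin: "finite H" using assms(1,4) finite_subset by blast
  have "inj_on (\<lambda>h. k \<otimes> h) H" by (rule inj_onI) (use kc hc in auto)
  then have "2 * card H = card (H \<union> (\<lambda>h. k \<otimes> h) ` H)"
    using card_Un_disjoint[OF fin _ disj] fin by (simp add: card_image)
  also have "\<dots> \<le> card K" using sub assms(1,4) by (intro card_mono) auto
  finally show ?thesis .
qed

section \<open>Automorphisms with the forced number of generalized involutions\<close>

locale gim_twist = split_extension G A s + twisted_involutions G \<nu>
  for G (structure) and A s \<nu> +
  assumes card_I: "card I = card A + card Fix"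
begin

text \<open>The twist that moves the base point \<omega> to the identity: the stabilizer of \<omega>
  becomes a subgroup of fixed points.\<close>

definition \<nu>at :: "'a \<Rightarrow> 'a \<Rightarrow> 'a" where
  "\<nu>at \<omega> g = \<omega> \<otimes> \<nu> g \<otimes> inv \<omega>"

lemma St_eq: "\<omega> \<in> I \<Longrightarrow> St \<omega> = {g \<in> carrier G. \<nu>at \<omega> g = g}"
proof (rule Set.set_eqI)
  fix g assume \<omega>: "\<omega> \<in> I"
  have "g \<otimes> \<omega> \<otimes> inv (\<nu> g) = \<omega> \<longleftrightarrow> \<omega> \<otimes> \<nu> g \<otimes> inv \<omega> = g" if g: "g \<in> carrier G"
  proof -
    have "g \<otimes> \<omega> \<otimes> inv (\<nu> g) = \<omega> \<longleftrightarrow> g \<otimes> \<omega> = \<omega> \<otimes> \<nu> g"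
      using g I_carrier[OF \<omega>] inv_solve_right'[of \<omega> "g \<otimes> \<omega>" "\<nu> g"] by auto
    also have "\<dots> \<longleftrightarrow> g = \<omega> \<otimes> \<nu> g \<otimes> inv \<omega>"
      using g I_carrier[OF \<omega>] inv_solve_right[of g "\<omega> \<otimes> \<nu> g" \<omega>] by auto
    finally show ?thesis by auto
  qed
  then show "g \<in> St \<omega> \<longleftrightarrow> g \<in> {g \<in> carrier G. \<nu>at \<omega> g = g}"
    using \<omega> by (auto simp: St_iff \<nu>at_def)
qed

text \<open>Right multiplication by \<omega> matches the generalized involutions of the two
  automorphisms, so the count \<open>card_I\<close> survives.\<close>

lemma gim_twist_at:
  assumes \<omega>: "\<omega> \<in> I"
  shows "gim_twist G A s (\<nu>at \<omega>)"
    and "gen_involutions G (\<nu>at \<omega>) = {x \<in> carrier G. x \<otimes> \<omega> \<in> I}"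
proof -
  have \<omega>c: "\<omega> \<in> carrier G" using \<omega> by simp
  have mult: "\<nu>at \<omega> (g \<otimes> h) = \<nu>at \<omega> g \<otimes> \<nu>at \<omega> h" if "g \<in> carrier G" "h \<in> carrier G" for g h
    using that \<omega>c by (simp add: \<nu>at_def \<nu>_mult m_assoc) (simp add: m_assoc[symmetric])
  have c: "\<nu>at \<omega> g \<in> carrier G" if "g \<in> carrier G" for g using that \<omega>c by (simp add: \<nu>at_def)
  have invol: "\<nu>at \<omega> (\<nu>at \<omega> g) = g" if "g \<in> carrier G" for g
    using that \<omega>c by (simp add: \<nu>at_def \<nu>_mult \<nu>_inv \<nu>_\<nu> \<nu>_I[OF \<omega>] m_assoc) (simp add: m_assoc[symmetric])
  have "bij_betw (\<nu>at \<omega>) (carrier G) (carrier G)"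
    by (rule bij_betw_byWitness[where f' = "\<nu>at \<omega>"]) (auto simp: invol c)
  then have iso: "\<nu>at \<omega> \<in> iso G G" by (auto simp: iso_def hom_def c mult)
  have iff: "x \<in> gen_involutions G (\<nu>at \<omega>) \<longleftrightarrow> x \<otimes> \<omega> \<in> I" if x: "x \<in> carrier G" for x
  proof -
    have "x \<otimes> \<omega> \<in> I \<longleftrightarrow> \<nu> x \<otimes> inv \<omega> = inv \<omega> \<otimes> inv x"
      using I_iff[of "x \<otimes> \<omega>"] x \<omega>c by (simp add: \<nu>_mult \<nu>_I[OF \<omega>] inv_mult_group)
    also have "\<dots> \<longleftrightarrow> \<omega> \<otimes> (\<nu> x \<otimes> inv \<omega>) = inv x"
      using inv_solve_left[of "\<nu> x \<otimes> inv \<omega>" \<omega> "inv x"] x \<omega>c by auto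
    also have "\<omega> \<otimes> (\<nu> x \<otimes> inv \<omega>) = \<nu>at \<omega> x" using x \<omega>c by (simp add: \<nu>at_def m_assoc)
    finally have "x \<otimes> \<omega> \<in> I \<longleftrightarrow> \<nu>at \<omega> x = inv x" .
    moreover have "x \<in> gen_involutions G (\<nu>at \<omega>) \<longleftrightarrow> \<nu>at \<omega> x = inv x"
      using x by (auto simp only: gen_involutions_def mem_Collect_eq)
    ultimately show ?thesis by blast
  qed
  show eq: "gen_involutions G (\<nu>at \<omega>) = {x \<in> carrier G. x \<otimes> \<omega> \<in> I}"
  proof -
    have "x \<in> carrier G" if "x \<in> gen_involutions G (\<nu>at \<omega>)" for x
      using that unfolding gen_involutions_def by blast
    then show ?thesis using iff by blast
  qed
  have "bij_betw (\<lambda>x. x \<otimes> \<omega>) (gen_involutions G (\<nu>at \<omega>)) I"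
    unfolding eq
    by (rule bij_betw_byWitness[where f' = "\<lambda>x. x \<otimes> inv \<omega>"]) (use \<omega>c in \<open>auto simp: m_assoc\<close>)
  then have "card (gen_involutions G (\<nu>at \<omega>)) = card A + card Fix"
    using card_I by (simp add: bij_betw_same_card)
  then show "gim_twist G A s (\<nu>at \<omega>)"
    using iso invol finite_carrier by unfold_locales auto
qed

lemma Fix_central: "c \<in> Fix \<Longrightarrow> g \<in> carrier G \<Longrightarrow> c \<otimes> g = g \<otimes> c"
proof -
  assume c: "c \<in> Fix" and "g \<in> carrier G"
  from this(2) show ?thesis
    by (cases rule: cover_cases) (use c in \<open>simp_all add: commA as_b a_bs\<close>)
qed

text \<open>If \<open>a s\<close> commutes with \<open>b s\<close>, then \<open>a / b\<close> is
  \<sigma>-invariant; if an element of \<open>A\<close> does, it is invariant itself. This bounds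
  the centralizer by \<open>2 |Fix|\<close>.\<close>

lemma centralizer_outer:
  assumes b: "b \<in> A" and x: "x \<in> carrier G" and comm: "x \<otimes> (b \<otimes> s) = b \<otimes> s \<otimes> x"
  shows "x \<in> Fix \<union> (\<lambda>c. c \<otimes> (b \<otimes> s)) ` Fix"
  using x
proof (cases rule: cover_cases)
  case base
  then have "x \<otimes> b \<otimes> s = b \<otimes> \<sigma> x \<otimes> s" using comm b by (simp add: a_bs as_b)
  then have "b \<otimes> x = b \<otimes> \<sigma> x" using base b by (simp add: commA)
  then have "\<sigma> x = x" using base b by simp
  then show ?thesis using base FixI by blast
next
  case (outer a)
  then have eq: "a \<otimes> \<sigma> b = b \<otimes> \<sigma> a" using comm b by (simp add: as_bs)
  have "inv b \<otimes> a = inv b \<otimes> (a \<otimes> \<sigma> b) \<otimes> inv (\<sigma> b)" using outer(1) b by (simp add: m_assoc)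
  also have "\<dots> = inv b \<otimes> b \<otimes> \<sigma> a \<otimes> inv (\<sigma> b)"
    using eq outer(1) b by (simp only: m_assoc A_carrier inv_closed m_closed \<sigma>_A)
  also have "\<dots> = \<sigma> a \<otimes> inv (\<sigma> b)" using outer(1) b by simp
  also have "\<dots> = \<sigma> (inv b \<otimes> a)" using outer(1) b by (simp add: \<sigma>_mult \<sigma>_inv commA)
  finally have "inv b \<otimes> a = \<sigma> (inv b \<otimes> a)" .
  then have "a \<otimes> inv b \<in> Fix" using outer(1) b FixI[of "inv b \<otimes> a"] by (simp add: commA)
  moreover have "x = a \<otimes> (inv b \<otimes> b) \<otimes> s" using outer b by simp
  then have "x = a \<otimes> inv b \<otimes> (b \<otimes> s)"
    using outer(1) b by (simp only: m_assoc A_carrier inv_closed m_closed s_carrier)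
  ultimately show ?thesis by blast
qed

text \<open>If \<open>\<nu> a = b s\<close>, the abelian group \<open>\<nu>(A)\<close> centralizes
  \<open>b s\<close> and so has at most \<open>2 |Fix|\<close> elements, fewer than
  \<open>|A|\<close>.\<close>

lemma preserves_A:
  assumes big: "2 * card Fix < card A" and a: "a \<in> A"
  shows "\<nu> a \<in> A"
proof (rule ccontr)
  assume n: "\<nu> a \<notin> A"
  then obtain b where b: "b \<in> A" "\<nu> a = b \<otimes> s" using cover[of "\<nu> a"] a by auto
  have "\<nu> ` A \<subseteq> Fix \<union> (\<lambda>c. c \<otimes> (b \<otimes> s)) ` Fix"
  proof
    fix y assume "y \<in> \<nu> ` A"
    then obtain x where x: "x \<in> A" "y = \<nu> x" by blast
    have "\<nu> x \<otimes> \<nu> a = \<nu> a \<otimes> \<nu> x" using x a by (metis A_carrier \<nu>_mult commA)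
    then show "y \<in> Fix \<union> (\<lambda>c. c \<otimes> (b \<otimes> s)) ` Fix"
      using x b by (intro centralizer_outer) auto
  qed
  then have "card (\<nu> ` A) \<le> card (Fix \<union> (\<lambda>c. c \<otimes> (b \<otimes> s)) ` Fix)" by (intro card_mono) auto
  also have "\<dots> \<le> card Fix + card ((\<lambda>c. c \<otimes> (b \<otimes> s)) ` Fix)" by (rule card_Un_le)
  also have "\<dots> \<le> 2 * card Fix" using card_image_le[OF finite_Fix] by simp
  also have "card (\<nu> ` A) = card A"
    by (rule card_image) (metis A_carrier \<nu>_\<nu> inj_onI)
  finally show False using big by simp
qed

lemma I_split: "I = (I \<inter> A) \<union> (\<lambda>a. a \<otimes> s) ` {a \<in> A. a \<otimes> s \<in> I}"
proof
  show "I \<subseteq> (I \<inter> A) \<union> (\<lambda>a. a \<otimes> s) ` {a \<in> A. a \<otimes> s \<in> I}"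
    using cover I_carrier by blast
qed auto

lemma card_I_split: "card I = card (I \<inter> A) + card {a \<in> A. a \<otimes> s \<in> I}"
proof -
  have "card I = card (I \<inter> A) + card ((\<lambda>a. a \<otimes> s) ` {a \<in> A. a \<otimes> s \<in> I})"
    by (subst I_split, rule card_Un_disjoint) (use as_notin in auto)
  also have "inj_on (\<lambda>a. a \<otimes> s) {a \<in> A. a \<otimes> s \<in> I}" by (rule inj_onI) simp
  then have "card ((\<lambda>a. a \<otimes> s) ` {a \<in> A. a \<otimes> s \<in> I}) = card {a \<in> A. a \<otimes> s \<in> I}"
    by (rule card_image)
  finally show ?thesis .
qed

text \<open>\<open>I \<inter> A\<close> is the subgroup \<open>?H1\<close>, and two outer
  generalized involutions differ by an element of \<open>?H2\<close>. If both subgroups were proper,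
  each would contain at most half of \<open>A\<close>, and \<open>I\<close> would have at most
  \<open>|A|\<close> elements, which is too few.\<close>

lemma dichotomy:
  assumes "\<And>a. a \<in> A \<Longrightarrow> \<nu> a \<in> A"
  shows "(\<forall>a\<in>A. \<nu> a = inv a) \<or> (\<forall>a\<in>A. \<nu> a = inv (\<sigma> a))"
proof (rule ccontr)
  assume n: "\<not> ?thesis"
  let ?H1 = "{a \<in> A. \<nu> a = inv a}" and ?H2 = "{a \<in> A. \<nu> a = inv (\<sigma> a)}"
  have H1: "subgroup ?H1 G"
  proof (rule subgroupI)
    show "?H1 \<noteq> {}" using one_A by fastforce
  qed (auto simp: \<nu>_mult \<nu>_inv inv_multA)
  have H2: "subgroup ?H2 G"
  proof (rule subgroupI)
    show "?H2 \<noteq> {}" using one_A by fastforce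
  qed (auto simp: \<nu>_mult \<nu>_inv inv_multA \<sigma>_mult \<sigma>_inv)
  have "?H1 \<subset> A" "?H2 \<subset> A" using n by auto
  then have 1: "2 * card ?H1 \<le> card A" "2 * card ?H2 \<le> card A"
    using subgroup_coset_card[OF finA subA] H1 H2 by auto
  have "I \<inter> A = ?H1" using I_iff by auto
  moreover have "card {a \<in> A. a \<otimes> s \<in> I} \<le> card ?H2"
  proof (cases "{a \<in> A. a \<otimes> s \<in> I} = {}")
    case False
    then obtain a0 where a0: "a0 \<in> A" "a0 \<otimes> s \<in> I" by blast
    have "{a \<in> A. a \<otimes> s \<in> I} \<subseteq> (\<lambda>b. b \<otimes> a0) ` ?H2"
    proof safe
      fix a assume a: "a \<in> A" "a \<otimes> s \<in> I"
      define b where "b = a \<otimes> inv a0"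
      have b: "b \<in> A" "a = b \<otimes> a0" using a a0 by (simp_all add: b_def m_assoc)
      have "\<nu> b \<otimes> \<nu> (a0 \<otimes> s) = \<nu> (a \<otimes> s)" using b a0 by (simp add: \<nu>_mult[symmetric] m_assoc)
      then have "\<nu> b \<otimes> inv (a0 \<otimes> s) = inv (b \<otimes> a0 \<otimes> s)" using \<nu>_I[OF a0(2)] \<nu>_I[OF a(2)] b by simp
      then have "\<nu> b \<otimes> (\<sigma> (inv a0) \<otimes> s) = \<sigma> (inv (b \<otimes> a0)) \<otimes> s" using b(1) a0(1) by (simp add: inv_outer)
      then have "\<nu> b \<otimes> \<sigma> (inv a0) = inv (\<sigma> b) \<otimes> \<sigma> (inv a0)"
        using b(1) a0(1) assms by (simp add: a_bs inv_multA \<sigma>_mult \<sigma>_inv)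
      then have "\<nu> b = inv (\<sigma> b)" using b(1) a0(1) by simp
      then show "a \<in> (\<lambda>b. b \<otimes> a0) ` ?H2" using b by blast
    qed
    then have "card {a \<in> A. a \<otimes> s \<in> I} \<le> card ((\<lambda>b. b \<otimes> a0) ` ?H2)" by (intro card_mono) auto
    also have "\<dots> \<le> card ?H2" by (rule card_image_le) simp
    finally show ?thesis .
  next
    case True
    show ?thesis by (simp only: True card.empty le0)
  qed
  ultimately have "card I \<le> card A" using 1 card_I_split by simp
  then show False using card_I Fix_pos by simp
qed

lemma base_type_outer_ex:
  assumes "\<forall>a\<in>A. \<nu> a = inv a"
  shows "\<exists>a\<in>A. a \<otimes> s \<in> I"
proof (rule ccontr)
  assume "\<not> ?thesis"
  then have "{a \<in> A. a \<otimes> s \<in> I} = {}" by blast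
  then have "card I = card (I \<inter> A)" using card_I_split by simp
  also have "\<dots> \<le> card A" by (intro card_mono) auto
  finally show False using card_I Fix_pos by simp
qed

text \<open>In this case \<open>I \<inter> A\<close> lies in \<open>Fix\<close>, so the count forces
  every outer element into \<open>I\<close>.\<close>

lemma outer_type_all:
  assumes "\<forall>a\<in>A. \<nu> a = inv (\<sigma> a)"
  shows "s \<in> I"
proof -
  have "I \<inter> A \<subseteq> Fix"
  proof
    fix a assume a: "a \<in> I \<inter> A"
    then have "inv (\<sigma> a) = inv a" using assms \<nu>_I by auto
    then have "\<sigma> a = a" using a by (metis A_carrier IntD2 \<sigma>_A inv_inv)
    then show "a \<in> Fix" using a by (intro FixI) simp_all
  qed
  then have "card (I \<inter> A) \<le> card Fix" by (intro card_mono) auto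
  then have "card A \<le> card {a \<in> A. a \<otimes> s \<in> I}" using card_I card_I_split by simp
  then have "{a \<in> A. a \<otimes> s \<in> I} = A" by (intro card_seteq) auto
  then have "\<one> \<otimes> s \<in> I" using one_A by blast
  then show ?thesis by simp
qed

text \<open>Inversion on \<open>A\<close> and the value at one outer generalized involution
  \<open>a0 s\<close> determine \<nu>.\<close>

lemma base_type_outer:
  assumes type: "\<forall>a\<in>A. \<nu> a = inv a" and a0: "a0 \<in> A" "a0 \<otimes> s \<in> I" and b: "b \<in> A"
  shows "\<nu> (b \<otimes> s) = inv b \<otimes> (a0 \<otimes> inv (\<sigma> a0)) \<otimes> s"
proof -
  have "\<nu> (b \<otimes> s) = \<nu> (b \<otimes> inv a0 \<otimes> (a0 \<otimes> s))" 
  proof -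
    have "b \<otimes> s = b \<otimes> (inv a0 \<otimes> a0) \<otimes> s" using a0(1) b by simp
    then show ?thesis
      using a0(1) b by (simp only: m_assoc A_carrier inv_closed m_closed s_carrier)
  qed
  also have "\<dots> = inv (b \<otimes> inv a0) \<otimes> inv (a0 \<otimes> s)"
    using a0(1) b type \<nu>_I[OF a0(2)] by (simp add: \<nu>_mult)
  also have "\<dots> = inv b \<otimes> a0 \<otimes> (inv (\<sigma> a0) \<otimes> s)"
    using a0(1) b by (simp add: inv_outer inv_multA \<sigma>_inv)
  also have "\<dots> = inv b \<otimes> (a0 \<otimes> inv (\<sigma> a0)) \<otimes> s"
    using a0(1) b by (simp only: m_assoc A_carrier inv_closed m_closed s_carrier \<sigma>_A)
  finally show ?thesis .
qed

text \<open>The two descriptions of \<open>t \<sigma>(t)\<close> serve the two alternatives. If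
  \<nu> inverts \<open>A\<close>, then \<open>t\<close> and \<open>\<sigma>(t)\<close> are fixed,
  and a fixed outer element \<open>b s\<close>, with \<open>b\<close> a square root of
  \<open>a0 / \<sigma>(a0)\<close>, conjugates one to the other, so \<chi> takes equal values of
  square 1 on them. Otherwise \<open>s\<close> and \<open>d\<close> are fixed and \<open>s\<close>
  inverts \<open>d\<close>, so \<open>\<chi> d\<close> is its own inverse and the value at
  \<open>d^2\<close> is 1.\<close>

lemma type_A_character:
  fixes \<chi> :: "'a \<Rightarrow> complex"
  assumes A: "\<And>a. a \<in> A \<Longrightarrow> \<nu> a \<in> A"
    and d: "d \<in> A" "\<sigma> d = inv d" and t: "t \<in> A" "t \<otimes> t = \<one>" and z: "t \<otimes> \<sigma> t = d \<otimes> d"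
    and squares: "\<And>x. x \<in> D \<Longrightarrow> \<exists>a\<in>A. x = a \<otimes> a"
  shows "\<nu> (t \<otimes> \<sigma> t) = t \<otimes> \<sigma> t"
    and "\<chi> \<in> linear_characters G {g \<in> carrier G. \<nu> g = g} \<Longrightarrow> \<chi> (t \<otimes> \<sigma> t) = 1"
proof -
  let ?z = "t \<otimes> \<sigma> t"
  have inv_t: "inv t = t" using t inv_equality by simp
  then have inv_\<sigma>t: "inv (\<sigma> t) = \<sigma> t" using t by (metis \<sigma>_inv)
  have "?z \<in> A" "inv ?z = ?z" "\<sigma> ?z = ?z"
    using t by (simp_all add: inv_multA inv_t inv_\<sigma>t \<sigma>_mult commA)
  then show "\<nu> ?z = ?z" using dichotomy[OF A] by metis
  assume "\<chi> \<in> linear_characters G {g \<in> carrier G. \<nu> g = g}"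
  then have nz: "\<And>g. g \<in> carrier G \<Longrightarrow> \<nu> g = g \<Longrightarrow> \<chi> g \<noteq> 0"
    and mult: "\<And>g h. g \<in> carrier G \<Longrightarrow> \<nu> g = g \<Longrightarrow> h \<in> carrier G \<Longrightarrow> \<nu> h = h \<Longrightarrow> \<chi> (g \<otimes> h) = \<chi> g * \<chi> h"
    unfolding linear_character_iff by blast+
  have one: "\<chi> \<one> = 1" using mult[of \<one> \<one>] nz[of \<one>] by simp
  from dichotomy[OF A] show "\<chi> ?z = 1"
  proof
    assume type: "\<forall>a\<in>A. \<nu> a = inv a"
    obtain a0 where a0: "a0 \<in> A" "a0 \<otimes> s \<in> I" using base_type_outer_ex[OF type] by blast
    have "a0 \<otimes> inv (\<sigma> a0) \<in> D" using a0 by (auto simp: D_def)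
    then obtain b where b: "b \<in> A" "a0 \<otimes> inv (\<sigma> a0) = b \<otimes> b" using squares by blast
    have h: "\<nu> (b \<otimes> s) = b \<otimes> s"
      using base_type_outer[OF type a0 b(1)] b by (simp add: m_assoc[symmetric])
    have ft: "\<nu> t = t" "\<nu> (\<sigma> t) = \<sigma> t" using type t inv_t inv_\<sigma>t by simp_all
    have "b \<otimes> s \<otimes> t = \<sigma> t \<otimes> (b \<otimes> s)" using b(1) t by (simp add: as_b a_bs commA)
    then have "\<chi> (b \<otimes> s) * \<chi> t = \<chi> (\<sigma> t) * \<chi> (b \<otimes> s)"
      using mult[of "b \<otimes> s" t] mult[of "\<sigma> t" "b \<otimes> s"] h ft b(1) t(1) by auto
    then have "\<chi> (\<sigma> t) = \<chi> t" using nz[of "b \<otimes> s"] h b by simp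
    then show "\<chi> ?z = 1" using mult[of t "\<sigma> t"] mult[of t t] ft t one by simp
  next
    assume type: "\<forall>a\<in>A. \<nu> a = inv (\<sigma> a)"
    have fs: "\<nu> s = s" using \<nu>_I[OF outer_type_all[OF type]] by simp
    have fd: "\<nu> d = d" "\<nu> (inv d) = inv d" using type d by (simp_all add: \<sigma>_inv)
    have "s \<otimes> d = inv d \<otimes> s" using s_mult[OF d(1)] d by simp
    then have "\<chi> s * \<chi> d = \<chi> (inv d) * \<chi> s"
      using mult[of s d] mult[of "inv d" s] fs fd d by auto
    then have "\<chi> d = \<chi> (inv d)" using nz[of s] fs by simp
    moreover have "\<chi> (inv d) * \<chi> d = 1" using mult[of "inv d" d] fd d one by simp
    ultimately show "\<chi> ?z = 1" using mult[of d d] fd d unfolding z by simp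
  qed
qed

end

section \<open>Numerical data extracted from a model\<close>

context split_extension
begin

text \<open>At a central element of all stabilizers the induced characters reduce to orbit size
  times \<open>lam\<close>. At the identity this gives the number of generalized involutions; the
  equation for general \<open>t\<close> is kept for the contradictions.\<close>

lemma has_GIM_E:
  assumes "has_GIM G"
  obtains \<nu> R lam where "gim_twist G A s \<nu>"
    "orbit_representatives G (gen_involutions G \<nu>) (twisted_conj G \<nu>) R"
    "\<And>\<omega>. \<omega> \<in> R \<Longrightarrow> lam \<omega> \<in> linear_characters G (stabilizer G (twisted_conj G \<nu>) \<omega>)"
    "\<And>t. t \<in> Fix \<Longrightarrow> (\<And>\<omega>. \<omega> \<in> R \<Longrightarrow> t \<in> stabilizer G (twisted_conj G \<nu>) \<omega>) \<Longrightarrow>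
      (\<Sum>\<omega>\<in>R. of_nat (card (orbit G (twisted_conj G \<nu>) \<omega>)) * lam \<omega> t) =
      (if t = \<one> then of_nat (card A) else 0) + (if t \<in> D then of_nat (card Fix) else 0)"
proof -
  obtain \<nu> R lam where \<nu>: "\<nu> \<in> iso G G" "\<And>g. g \<in> carrier G \<Longrightarrow> \<nu> (\<nu> g) = g"
    and R: "orbit_representatives G (gen_involutions G \<nu>) (twisted_conj G \<nu>) R"
    and M: "character_model G R (stabilizer G (twisted_conj G \<nu>)) lam"
    using assms unfolding has_GIM_def has_GIM_wrt_def by blast
  interpret t: twisted_involutions G \<nu> using fin \<nu> by unfold_locales
  have RI: "R \<subseteq> t.I" using R by (simp add: orbit_representatives_def)
  have lin: "lam \<omega> \<in> linear_characters G (t.St \<omega>)" if "\<omega> \<in> R" for \<omega>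
    using M that by (simp add: character_model_def)
  have central: "g \<otimes> c = c \<otimes> g" if "c \<in> Fix" "g \<in> carrier G" for c g
    using that(2) by (cases rule: cover_cases) (use that(1) in \<open>simp_all add: commA as_b a_bs\<close>)
  have val: "(\<Sum>\<omega>\<in>R. of_nat (card (orbit G t.\<phi> \<omega>)) * lam \<omega> t) =
      (if t = \<one> then of_nat (card A) else 0) + (if t \<in> D then of_nat (card Fix) else 0)"
    if t: "t \<in> Fix" "\<And>\<omega>. \<omega> \<in> R \<Longrightarrow> t \<in> t.St \<omega>" for t
  proof -
    have "(\<Sum>\<omega>\<in>R. of_nat (card (orbit G t.\<phi> \<omega>)) * lam \<omega> t) =
        (\<Sum>\<omega>\<in>R. induced_character G (t.St \<omega>) (lam \<omega>) t)"
      using t RI central[OF t(1)] by (intro sum.cong refl t.induced_central[symmetric]) auto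
    also have "\<dots> = (\<Sum>\<psi>\<in>Irr G. \<psi> t)"
      using M t(1) by (simp add: character_model_def)
    finally show ?thesis using sum_Irr_base[of t] t(1) by simp
  qed
  have one: "\<one> \<in> t.St \<omega>" if "\<omega> \<in> R" for \<omega> using that RI t.act.stabilizer_one_closed by blast
  have lam1: "lam \<omega> \<one> = 1" if "\<omega> \<in> R" for \<omega>
  proof -
    have "lam \<omega> (\<one> \<otimes> \<one>) = lam \<omega> \<one> * lam \<omega> \<one>" "lam \<omega> \<one> \<noteq> 0"
      using lin[OF that] one[OF that] unfolding t.linear_character_iff by blast+
    then show ?thesis by simp
  qed
  have "\<one> \<in> D" unfolding D_def by (rule image_eqI[of _ _ \<one>]) auto
  then have "(of_nat (card t.I) :: complex) = of_nat (card A) + of_nat (card Fix)"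
    using val[of \<one>] one lam1 t.card_I_eq[OF R] Fix_one by simp
  then have "card t.I = card A + card Fix" by (metis of_nat_add of_nat_eq_iff)
  then have "gim_twist G A s \<nu>" by unfold_locales
  then show thesis by (rule that[OF _ R lin val])
qed

end

context gim_twist
begin

text \<open>If two of the three involutions representing the noncentral cosets of the centre are fixed
  by \<open>\<nu>\<close>, then \<open>z\<close> is a commutator of fixed elements. Counting shows that this happens.\<close>

lemma type_A_character_small:
  fixes \<chi> :: "'a \<Rightarrow> complex"
  assumes t: "t \<in> A" "t \<otimes> t = \<one>" and z: "z = t \<otimes> \<sigma> t" "z \<noteq> \<one>"
    and w: "w \<in> Fix" "w \<otimes> w = z" and Fix: "Fix = {\<one>, w, z, w \<otimes> z}" and card: "card Fix = 4" "card A = 8"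
  shows "\<nu> z = z"
    and "\<chi> \<in> linear_characters G {g \<in> carrier G. \<nu> g = g} \<Longrightarrow> \<chi> z = 1"
proof -
  have \<sigma>tt: "\<sigma> t \<otimes> \<sigma> t = \<one>" using t by (metis \<sigma>_mult \<sigma>_one)
  have zA: "z \<in> A" "\<sigma> z = z" using z t by (simp_all add: \<sigma>_mult commA)
  have "z \<otimes> z = (t \<otimes> t) \<otimes> (\<sigma> t \<otimes> \<sigma> t)" using z t(1) by (simp add: A_ac)
  then have zz: "z \<otimes> z = \<one>" using t \<sigma>tt by simp
  have wA: "w \<in> A" using w by simp
  have w1: "w \<otimes> (w \<otimes> z) = \<one>" "w \<otimes> z \<otimes> w = \<one>"
    using w zz wA zA by (simp_all add: m_assoc[symmetric]) (simp add: commA[of w z] m_assoc zz w(2))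
  have inv_w: "inv w = w \<otimes> z" using w1 wA zA by (intro inv_equality) auto
  have inv_z: "inv z = z" using zz zA by (intro inv_equality) auto
  have nt: "t \<otimes> s \<noteq> s \<otimes> t"
  proof
    assume "t \<otimes> s = s \<otimes> t"
    then have "t = \<sigma> t" using t by (simp add: s_mult)
    then show False using z t by metis
  qed
  \<comment> \<open>\<nu> preserves the centre, and the centre is \<open>Fix\<close> since an outer
    central element would make \<open>t\<close> commute with \<open>s\<close>.\<close>
  have \<nu>Fix: "\<nu> c \<in> Fix" if c: "c \<in> Fix" for c
  proof -
    have central: "\<nu> c \<otimes> g = g \<otimes> \<nu> c" if g: "g \<in> carrier G" for g
    proof -
      have "\<nu> (c \<otimes> \<nu> g) = \<nu> (\<nu> g \<otimes> c)" using Fix_central[OF c] g by simp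
      then show ?thesis using g c by (simp add: \<nu>_mult \<nu>_\<nu>)
    qed
    have "\<nu> c \<in> carrier G" using c by simp
    then show ?thesis
    proof (cases rule: cover_cases)
      case base
      then have "\<nu> c \<otimes> s = \<sigma> (\<nu> c) \<otimes> s" using central[of s] s_mult by simp
      then show ?thesis using base by (intro FixI) simp_all
    next
      case (outer b)
      then have "b \<otimes> s \<otimes> t = t \<otimes> (b \<otimes> s)" using central[of t] t by simp
      then have "b \<otimes> \<sigma> t = t \<otimes> b" using outer(1) t by (simp add: as_b a_bs)
      then have "\<sigma> t = t" using outer(1) t by (simp add: commA[of t b])
      then show ?thesis using nt t by (simp add: s_mult)
    qed
  qed
  have sq: "c \<otimes> c = \<one> \<or> c \<otimes> c = z" if "c \<in> Fix" for c
  proof -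
    have "w \<otimes> z \<otimes> (w \<otimes> z) = (w \<otimes> w) \<otimes> (z \<otimes> z)" using wA zA by (simp add: A_ac)
    then have "w \<otimes> z \<otimes> (w \<otimes> z) = z" using w(2) zz zA by simp
    then show ?thesis using that zz w(2) unfolding Fix by auto
  qed
  have "\<nu> z = \<nu> w \<otimes> \<nu> w" using w wA by (simp add: \<nu>_mult[symmetric])
  then have "\<nu> z = \<one> \<or> \<nu> z = z" using sq[OF \<nu>Fix[OF w(1)]] by simp
  moreover have "\<nu> z \<noteq> \<one>" using z(2) zA \<nu>_\<nu>[of z] by auto
  ultimately show \<nu>z: "\<nu> z = z" by blast
  \<comment> \<open>Otherwise \<open>w\<close> is fixed. Then \<open>I\<close> and
    \<open>w I\<close> are disjoint, since membership of both \<open>x\<close> and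
    \<open>w x\<close> in \<open>I\<close> would give \<open>w^2 = \<one>\<close>; but two sets of
    12 elements do not fit into 16.\<close>
  have \<nu>w: "\<nu> w = inv w"
  proof (rule ccontr)
    assume n: "\<nu> w \<noteq> inv w"
    have "\<nu> w \<noteq> \<one>" "\<nu> w \<noteq> z" using w(2) z(2) wA zA zz \<nu>z \<nu>_\<nu>[of w] by (metis A_carrier \<nu>_one r_one)+
    then have fw: "\<nu> w = w" using \<nu>Fix[OF w(1)] n inv_w unfolding Fix by auto
    have disj: "I \<inter> (\<lambda>x. w \<otimes> x) ` I = {}"
    proof (rule equals0I, clarify)
      fix x assume x: "x \<in> I" "w \<otimes> x \<in> I"
      have xc: "x \<in> carrier G" using x by simp
      have "\<nu> (w \<otimes> x) = inv (w \<otimes> x)" using x(2) by (rule \<nu>_I)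
      then have "w \<otimes> inv x = inv x \<otimes> inv w" using xc wA by (simp add: \<nu>_mult fw \<nu>_I[OF x(1)] inv_mult_group)
      also have "\<dots> = inv w \<otimes> inv x"
        using Fix_central[OF Fix_inv[OF w(1)], of "inv x"] xc by simp
      finally have "w = inv w" using xc wA by simp
      then have "w \<otimes> w = \<one>" using wA by (metis A_carrier r_inv)
      then show False using w z by simp
    qed
    have "card (I \<union> (\<lambda>x. w \<otimes> x) ` I) = card I + card ((\<lambda>x. w \<otimes> x) ` I)"
      by (rule card_Un_disjoint) (use disj in auto)
    also have "card ((\<lambda>x. w \<otimes> x) ` I) = card I"
      by (rule card_image, rule inj_onI) (use wA in auto)
    finally have "card (I \<union> (\<lambda>x. w \<otimes> x) ` I) = 24" using card_I card by simp
    moreover have "card (I \<union> (\<lambda>x. w \<otimes> x) ` I) \<le> card (carrier G)"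
      by (rule card_mono[OF fin]) (use wA in auto)
    moreover have "card (carrier G) \<le> 16"
    proof -
      have "carrier G \<subseteq> A \<union> (\<lambda>a. a \<otimes> s) ` A" using cover by blast
      then have "card (carrier G) \<le> card (A \<union> (\<lambda>a. a \<otimes> s) ` A)" by (rule card_mono[rotated]) simp
      also have "\<dots> \<le> card A + card ((\<lambda>a. a \<otimes> s) ` A)" by (rule card_Un_le)
      also have "\<dots> \<le> 16" using card_image_le[OF finA, of "\<lambda>a. a \<otimes> s"] card by simp
      finally show ?thesis .
    qed
    ultimately show False by simp
  qed
  have \<nu>c: "\<nu> c = inv c" if "c \<in> Fix" for c
    using that \<nu>w \<nu>z inv_z wA zA unfolding Fix by (auto simp: \<nu>_mult inv_multA)
  \<comment> \<open>Since \<nu> inverts the centre, \<open>I\<close> is a union of cosets of the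
    centre; its 12 elements fill three of the four cosets.\<close>
  have closed: "c \<otimes> x \<in> I" if c: "c \<in> Fix" and x: "x \<in> I" for c x
  proof -
    have xc: "x \<in> carrier G" using x by simp
    have "\<nu> (c \<otimes> x) = inv (c \<otimes> x)"
      using c xc Fix_central[OF Fix_inv[OF c], of "inv x"]
      by (simp add: \<nu>_mult \<nu>c \<nu>_I[OF x] inv_mult_group)
    then show ?thesis using I_iff[of "c \<otimes> x"] c xc by simp
  qed
  assume "\<chi> \<in> linear_characters G {g \<in> carrier G. \<nu> g = g}"
  then have nz: "\<And>g. g \<in> carrier G \<Longrightarrow> \<nu> g = g \<Longrightarrow> \<chi> g \<noteq> 0"
    and mult: "\<And>g h. g \<in> carrier G \<Longrightarrow> \<nu> g = g \<Longrightarrow> h \<in> carrier G \<Longrightarrow> \<nu> h = h \<Longrightarrow> \<chi> (g \<otimes> h) = \<chi> g * \<chi> h"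
    unfolding linear_character_iff by blast+
  \<comment> \<open>An involution lying in \<open>I\<close> is fixed by \<nu>, so \<chi> is
    multiplicative on \<open>x\<close>, \<open>y\<close> and their commutator
    \<open>z\<close>.\<close>
  have comm: "\<chi> z = 1"
    if "x \<in> I" "y \<in> I" "x \<otimes> x = \<one>" "y \<otimes> y = \<one>" "x \<otimes> y = z \<otimes> (y \<otimes> x)" for x y
  proof -
    have c: "x \<in> carrier G" "y \<in> carrier G" using that by simp_all
    have "\<nu> x = x" "\<nu> y = y" using that c by (metis inv_equality \<nu>_I)+
    then have "\<chi> x * \<chi> y = \<chi> z * (\<chi> y * \<chi> x)" "\<chi> x \<noteq> 0" "\<chi> y \<noteq> 0"
      using mult[of x y] mult[of y x] mult[of z "y \<otimes> x"] nz c zA \<nu>z that(5) by (auto simp: \<nu>_mult)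
    then show ?thesis by simp
  qed
  \<comment> \<open>Two distinct cosets of the centre that both miss \<open>I\<close> would require
    12 + 8 elements.\<close>
  have pair: "x \<in> I \<or> y \<in> I"
    if "x \<in> carrier G" "y \<in> carrier G" "\<And>c. c \<in> Fix \<Longrightarrow> c \<otimes> y \<noteq> x" for x y
  proof (rule ccontr)
    assume n: "\<not> ?thesis"
    have inj: "card ((\<lambda>c. c \<otimes> u) ` Fix) = 4" if "u \<in> carrier G" for u
      using card that by (subst card_image) (auto intro!: inj_onI)
    have out: "c \<otimes> u \<notin> I" if "u \<in> carrier G" "u \<notin> I" "c \<in> Fix" for c u
    proof
      assume "c \<otimes> u \<in> I"
      then have "inv c \<otimes> (c \<otimes> u) \<in> I" using closed[OF Fix_inv[OF that(3)]] by simp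
      then show False using that by (simp add: m_assoc[symmetric])
    qed
    have "(\<lambda>c. c \<otimes> x) ` Fix \<inter> (\<lambda>c. c \<otimes> y) ` Fix = {}"
    proof (rule equals0I, clarify)
      fix c d assume *: "c \<in> Fix" "d \<in> Fix" "c \<otimes> x = d \<otimes> y"
      then have "(inv c \<otimes> d) \<otimes> y = inv c \<otimes> (c \<otimes> x)" using that(2) by (simp add: m_assoc)
      then have "(inv c \<otimes> d) \<otimes> y = x" using that(1) *(1) by (simp add: m_assoc[symmetric])
      moreover have "inv c \<otimes> d \<in> Fix" using * by (simp add: Fix_inv Fix_mult)
      ultimately show False using that(3) by blast
    qed
    then have "card (I \<union> ((\<lambda>c. c \<otimes> x) ` Fix \<union> (\<lambda>c. c \<otimes> y) ` Fix)) = 12 + (4 + 4)"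
      using inj that card card_I out n
      by (subst card_Un_disjoint; (subst card_Un_disjoint)?) auto
    moreover have "card (I \<union> ((\<lambda>c. c \<otimes> x) ` Fix \<union> (\<lambda>c. c \<otimes> y) ` Fix)) \<le> card (A \<union> (\<lambda>a. a \<otimes> s) ` A)"
    proof (rule card_mono)
      have "carrier G \<subseteq> A \<union> (\<lambda>a. a \<otimes> s) ` A" using cover by blast
      moreover have "I \<union> ((\<lambda>c. c \<otimes> x) ` Fix \<union> (\<lambda>c. c \<otimes> y) ` Fix) \<subseteq> carrier G" using that by auto
      ultimately show "I \<union> ((\<lambda>c. c \<otimes> x) ` Fix \<union> (\<lambda>c. c \<otimes> y) ` Fix) \<subseteq> A \<union> (\<lambda>a. a \<otimes> s) ` A" by blast
    qed simp
    moreover have "card (A \<union> (\<lambda>a. a \<otimes> s) ` A) \<le> card A + card ((\<lambda>a. a \<otimes> s) ` A)" by (rule card_Un_le)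
    moreover have "card ((\<lambda>a. a \<otimes> s) ` A) \<le> 8" using card_image_le[OF finA, of "\<lambda>a. a \<otimes> s"] card by simp
    ultimately show False using card by simp
  qed
  \<comment> \<open>The factor \<open>w\<close> corrects \<open>t s\<close>, whose square is
    \<open>z\<close>, to an involution: the square of \<open>?y\<close> is
    \<open>t \<sigma>(t) w^2 = z^2\<close>.\<close>
  let ?y = "t \<otimes> w \<otimes> s"
  have yc: "?y \<in> carrier G" "t \<otimes> w \<in> A" using t wA by simp_all
  have tw: "\<sigma> (t \<otimes> w) = \<sigma> t \<otimes> w" using t w by (simp add: \<sigma>_mult)
  have \<sigma>t: "\<sigma> t = z \<otimes> t" using z t by (simp add: commA[of t "\<sigma> t"] m_assoc)
  have p1: "t \<in> I \<or> s \<in> I"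
  proof (rule pair)
    show "c \<otimes> s \<noteq> t" if "c \<in> Fix" for c using as_notin[of c] that t by auto
  qed (use t in auto)
  have p2: "t \<in> I \<or> ?y \<in> I"
  proof (rule pair)
    show "c \<otimes> ?y \<noteq> t" if "c \<in> Fix" for c
      using as_notin[of "c \<otimes> (t \<otimes> w)"] that t wA by (auto simp: a_bs)
  qed (use t yc in auto)
  have p3: "s \<in> I \<or> ?y \<in> I"
  proof (rule pair)
    show "c \<otimes> ?y \<noteq> s" if c: "c \<in> Fix" for c
    proof
      assume "c \<otimes> ?y = s"
      then have "c \<otimes> (t \<otimes> w) \<otimes> s = \<one> \<otimes> s" using c t wA by (simp add: a_bs)
      then have 1: "c \<otimes> (t \<otimes> w) = \<one>" using c t wA by simp
      have "c \<otimes> (\<sigma> t \<otimes> w) = \<sigma> (c \<otimes> (t \<otimes> w))" using c t w(1) by (simp add: \<sigma>_mult)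
      also have "\<dots> = c \<otimes> (t \<otimes> w)" unfolding 1 by simp
      finally have "c \<otimes> (\<sigma> t \<otimes> w) = c \<otimes> (t \<otimes> w)" .
      then have "\<sigma> t = t" using c t wA by simp
      then show False using z t by simp
    qed
  qed (use yc in auto)
  have yy: "?y \<otimes> ?y = \<one>"
  proof -
    have "?y \<otimes> ?y = t \<otimes> w \<otimes> (\<sigma> t \<otimes> w)" using yc by (simp add: as_bs tw)
    also have "\<dots> = (t \<otimes> \<sigma> t) \<otimes> (w \<otimes> w)" using t(1) wA by (simp add: A_ac)
    finally show ?thesis using z w zz by simp
  qed
  consider "t \<in> I" "s \<in> I" | "t \<in> I" "?y \<in> I" | "s \<in> I" "?y \<in> I" using p1 p2 p3 by blast
  then show "\<chi> z = 1"
  proof cases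
    case 1
    have "s \<otimes> t = z \<otimes> (t \<otimes> s)" using t zA by (simp add: s_mult \<sigma>t a_bs)
    then show ?thesis using comm[of s t] 1 t s_s by simp
  next
    case 2
    have "?y \<otimes> t = t \<otimes> w \<otimes> (z \<otimes> t) \<otimes> s" using yc t by (simp add: as_b \<sigma>t)
    also have "t \<otimes> w \<otimes> (z \<otimes> t) = z \<otimes> (t \<otimes> (t \<otimes> w))" using t(1) wA zA by (simp add: A_ac)
    also have "z \<otimes> (t \<otimes> (t \<otimes> w)) \<otimes> s = z \<otimes> (t \<otimes> ?y)" using t wA zA by (simp add: m_assoc)
    finally show ?thesis using comm[of ?y t] 2 t yy by simp
  next
    case 3
    have "s \<otimes> ?y = \<sigma> (t \<otimes> w)" using t(1) wA by (simp add: \<sigma>_def m_assoc)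
    also have "\<dots> = z \<otimes> (t \<otimes> w)" using t wA zA by (simp add: tw \<sigma>t m_assoc)
    finally have 1: "s \<otimes> ?y = z \<otimes> (t \<otimes> w)" .
    have "?y \<otimes> s = t \<otimes> w" using yc by simp
    then show ?thesis using comm[OF 3 s_s yy] 1 by simp
  qed
qed

end

section \<open>First obstruction: a central element in the kernel of every character\<close>

context split_extension
begin

text \<open>Such a \<open>z\<close> lies in every stabilizer and every \<open>lam\<close> is 1 at
  it, so the model has the value \<open>|A| + |Fix|\<close> there; the sum of the irreducible
  characters at \<open>z\<close> is at most \<open>|Fix|\<close>.\<close>

lemma no_GIM_aux:
  assumes z: "z \<in> Fix" "z \<noteq> \<one>"
    and fixed: "\<And>\<nu>. gim_twist G A s \<nu> \<Longrightarrow> \<nu> z = z"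
    and char: "\<And>\<nu> \<chi>. gim_twist G A s \<nu> \<Longrightarrow> \<chi> \<in> linear_characters G {g \<in> carrier G. \<nu> g = g} \<Longrightarrow> \<chi> z = (1::complex)"
  shows "\<not> has_GIM G"
proof
  assume "has_GIM G"
  then show False
  proof (rule has_GIM_E)
    fix \<nu> R and lam :: "'a \<Rightarrow> 'a \<Rightarrow> complex"
    assume "gim_twist G A s \<nu>"
      and R: "orbit_representatives G (gen_involutions G \<nu>) (twisted_conj G \<nu>) R"
      and lin: "\<And>\<omega>. \<omega> \<in> R \<Longrightarrow> lam \<omega> \<in> linear_characters G (stabilizer G (twisted_conj G \<nu>) \<omega>)"
      and val: "\<And>t. t \<in> Fix \<Longrightarrow> (\<And>\<omega>. \<omega> \<in> R \<Longrightarrow> t \<in> stabilizer G (twisted_conj G \<nu>) \<omega>) \<Longrightarrow>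
        (\<Sum>\<omega>\<in>R. of_nat (card (orbit G (twisted_conj G \<nu>) \<omega>)) * lam \<omega> t) =
        (if t = \<one> then of_nat (card A) else 0) + (if t \<in> D then of_nat (card Fix) else 0)"
    interpret t: gim_twist G A s \<nu> by fact
    have RI: "\<omega> \<in> t.I" if "\<omega> \<in> R" for \<omega> using R that by (auto simp: orbit_representatives_def)
    have zc: "z \<in> carrier G" using z by simp
    have St: "z \<in> t.St \<omega>" if "\<omega> \<in> R" for \<omega>
      using t.St_eq[OF RI[OF that]] fixed[OF t.gim_twist_at(1)[OF RI[OF that]]] zc by simp
    have "lam \<omega> z = 1" if "\<omega> \<in> R" for \<omega>
      using char[OF t.gim_twist_at(1)[OF RI[OF that]], of "lam \<omega>"] lin[OF that] t.St_eq[OF RI[OF that]] by simp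
    then have "(of_nat (card t.I) :: complex) = (if z \<in> D then of_nat (card Fix) else 0)"
      using val[OF z(1) St] z(2) t.card_I_eq[OF R] by simp
    then have "(of_nat (card t.I) :: complex) = of_nat (if z \<in> D then card Fix else 0)" by simp
    then have "card t.I = (if z \<in> D then card Fix else 0)" by (simp only: of_nat_eq_iff)
    then have "card t.I \<le> card Fix" by simp
    then have "card A = 0" using t.card_I by simp
    then show False by (metis card_0_eq empty_iff finA one_A)
  qed
qed

theorem no_GIM_type_A:
  assumes "2 * card Fix < card A"
    and d: "d \<in> A" "\<sigma> d = inv d" and t: "t \<in> A" "t \<otimes> t = \<one>"
    and z: "t \<otimes> \<sigma> t = d \<otimes> d" "t \<otimes> \<sigma> t \<noteq> \<one>"
    and squares: "\<And>x. x \<in> D \<Longrightarrow> \<exists>a\<in>A. x = a \<otimes> a"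
  shows "\<not> has_GIM G"
proof (rule no_GIM_aux)
  show "t \<otimes> \<sigma> t \<in> Fix" using t(1) by (rule Fix_norm)
  fix \<nu> assume "gim_twist G A s \<nu>"
  then interpret g: gim_twist G A s \<nu> .
  note * = g.type_A_character[OF g.preserves_A[OF assms(1)] d t z(1) squares]
  show "\<nu> (t \<otimes> \<sigma> t) = t \<otimes> \<sigma> t" using *(1) by blast
  show "\<chi> (t \<otimes> \<sigma> t) = 1" if "\<chi> \<in> linear_characters G {g \<in> carrier G. \<nu> g = g}" for \<chi> :: "'a \<Rightarrow> complex"
    using *(2) that by blast
qed (fact z(2))

text \<open>The strict inequality that secured the invariance of \<open>A\<close> is replaced by
  explicit structure: order 16 and a cyclic centre of order four generated by
  \<open>w\<close>.\<close>

theorem no_GIM_type_A_small: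
  assumes t: "t \<in> A" "t \<otimes> t = \<one>" and z: "t \<otimes> \<sigma> t \<noteq> \<one>"
    and w: "w \<in> Fix" "w \<otimes> w = t \<otimes> \<sigma> t" and Fix: "Fix = {\<one>, w, t \<otimes> \<sigma> t, w \<otimes> (t \<otimes> \<sigma> t)}"
    and card: "card Fix = 4" "card A = 8"
  shows "\<not> has_GIM G"
proof (rule no_GIM_aux)
  show "t \<otimes> \<sigma> t \<in> Fix" using t(1) by (rule Fix_norm)
  fix \<nu> assume "gim_twist G A s \<nu>"
  then interpret g: gim_twist G A s \<nu> .
  note * = g.type_A_character_small[OF t refl z w Fix card]
  show "\<nu> (t \<otimes> \<sigma> t) = t \<otimes> \<sigma> t" by (rule *(1))
  show "\<chi> (t \<otimes> \<sigma> t) = 1" if "\<chi> \<in> linear_characters G {g \<in> carrier G. \<nu> g = g}" for \<chi> :: "'a \<Rightarrow> complex"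
    by (rule *(2)[OF that])
qed (fact z)

end

section \<open>Second obstruction: a stabilizer that is too small\<close>

context gim_twist
begin

text \<open>In the second alternative of \<open>dichotomy\<close> the element \<open>s\<close> is a
  generalized involution, and composing \<nu> with conjugation by \<open>s\<close> turns it into
  inversion on \<open>A\<close>.\<close>

lemma base_type_ex:
  assumes A: "\<And>a. a \<in> A \<Longrightarrow> \<nu> a \<in> A"
  shows "\<exists>\<omega>\<in>I. \<forall>a\<in>A. \<nu>at \<omega> a = inv a"
  using dichotomy[OF A]
proof
  assume "\<forall>a\<in>A. \<nu> a = inv a"
  moreover have "\<one> \<in> I" using I_iff[of \<one>] by simp
  ultimately show ?thesis by (intro bexI[of _ \<one>]) (auto simp: \<nu>at_def)
next
  assume type: "\<forall>a\<in>A. \<nu> a = inv (\<sigma> a)"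
  have "\<nu>at s a = inv a" if "a \<in> A" for a
  proof -
    have "\<nu>at s a = \<sigma> (inv (\<sigma> a))" using type that by (simp add: \<nu>at_def \<sigma>_def)
    then show ?thesis using that by (simp add: \<sigma>_inv)
  qed
  with outer_type_all[OF type] show ?thesis by blast
qed

text \<open>For a suitable twist that inverts \<open>A\<close>, the image of \<open>b s\<close> is
  \<open>b\<^sup>-\<^sup>1 (e / \<sigma>(e)) s\<close>. It is fixed only if
  \<open>b^2 = e / \<sigma>(e)\<close>, which \<open>e\<close> excludes; in \<open>A\<close> exactly
  the elements with trivial square are fixed.\<close>

lemma type_B_stabilizer:
  assumes A: "\<And>a. a \<in> A \<Longrightarrow> \<nu> a \<in> A"
    and e: "e \<in> A" "\<And>b. b \<in> A \<Longrightarrow> b \<otimes> b \<noteq> e \<otimes> inv (\<sigma> e)"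
  shows "\<exists>\<omega>\<in>I. St \<omega> = {t \<in> A. t \<otimes> t = \<one>}"
proof -
  obtain \<omega>0 where \<omega>0: "\<omega>0 \<in> I" and type: "\<forall>a\<in>A. \<nu>at \<omega>0 a = inv a" using base_type_ex[OF A] by blast
  interpret h: gim_twist G A s "\<nu>at \<omega>0" by (rule gim_twist_at(1)[OF \<omega>0])
  obtain a0 where a0: "a0 \<in> A" "a0 \<otimes> s \<in> h.I" using h.base_type_outer_ex[OF type] by blast
  \<comment> \<open>Conjugation by \<open>e1\<close> multiplies the constant
    \<open>a0 / \<sigma>(a0)\<close> of \<open>base_type_outer\<close> by
    \<open>e1 / \<sigma>(e1)\<close>; dividing \<open>e\<close> by \<open>a0\<close> therefore makes
    the new constant \<open>e / \<sigma>(e)\<close>.\<close>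
  define e1 where "e1 = e \<otimes> inv a0"
  have e1: "e1 \<in> A" using e a0 by (simp add: e1_def)
  have "e1 \<in> h.I" using h.I_iff[of e1] type e1 by simp
  then have \<omega>: "e1 \<otimes> \<omega>0 \<in> I" using gim_twist_at(2)[OF \<omega>0] by blast
  have at: "\<nu>at (e1 \<otimes> \<omega>0) g = e1 \<otimes> \<nu>at \<omega>0 g \<otimes> inv e1" if "g \<in> carrier G" for g
    using that e1 I_carrier[OF \<omega>0] by (simp add: \<nu>at_def inv_mult_group m_assoc)
  have base: "\<nu>at (e1 \<otimes> \<omega>0) b = b \<longleftrightarrow> b \<otimes> b = \<one>" if b: "b \<in> A" for b
  proof -
    have "\<nu>at (e1 \<otimes> \<omega>0) b = inv b"
      using at[of b] b type e1 commA[of e1 "inv b"] by (simp add: m_assoc)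
    then show ?thesis using b by (metis A_carrier inv_equality r_inv)
  qed
  have outer: "\<nu>at (e1 \<otimes> \<omega>0) (b \<otimes> s) \<noteq> b \<otimes> s" if b: "b \<in> A" for b
  proof
    assume fixed: "\<nu>at (e1 \<otimes> \<omega>0) (b \<otimes> s) = b \<otimes> s"
    let ?x = "inv b \<otimes> (a0 \<otimes> inv (\<sigma> a0))"
    have x: "?x \<in> A" using a0 b by simp
    have "\<nu>at (e1 \<otimes> \<omega>0) (b \<otimes> s) = e1 \<otimes> (?x \<otimes> s) \<otimes> inv e1"
      using at[of "b \<otimes> s"] b h.base_type_outer[OF type a0 b] by simp
    also have "\<dots> = e1 \<otimes> ?x \<otimes> \<sigma> (inv e1) \<otimes> s" using x e1 by (simp only: a_bs as_b mult_A inv_A)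
    finally have "e1 \<otimes> ?x \<otimes> \<sigma> (inv e1) = b" using fixed x e1 b by simp
    then have "b \<otimes> b = b \<otimes> (e1 \<otimes> ?x \<otimes> \<sigma> (inv e1))" by simp
    also have "\<dots> = (e1 \<otimes> a0) \<otimes> (\<sigma> (inv e1) \<otimes> inv (\<sigma> a0)) \<otimes> (b \<otimes> inv b)"
      using e1 a0(1) b by (simp only: A_ac mult_A inv_A \<sigma>_A A_carrier m_closed)
    also have "\<dots> = (e1 \<otimes> a0) \<otimes> inv (\<sigma> (e1 \<otimes> a0))"
      using e1 a0(1) b by (simp add: \<sigma>_mult \<sigma>_inv inv_multA)
    also have "e1 \<otimes> a0 = e" using e a0 by (simp add: e1_def m_assoc)
    finally show False using e(2) b by blast
  qed
  have "St (e1 \<otimes> \<omega>0) = {t \<in> A. t \<otimes> t = \<one>}"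
  proof (rule Set.set_eqI)
    fix g
    show "g \<in> St (e1 \<otimes> \<omega>0) \<longleftrightarrow> g \<in> {t \<in> A. t \<otimes> t = \<one>}"
    proof (cases "g \<in> carrier G")
      case True
      then show ?thesis
      proof (cases rule: cover_cases)
        case base': base
        then show ?thesis using True base[OF base'] unfolding St_eq[OF \<omega>] by simp
      next
        case outer': (outer b)
        then have "g \<notin> A" using as_notin by blast
        then show ?thesis using outer[OF outer'(1)] outer'(2) unfolding St_eq[OF \<omega>] by simp
      qed
    next
      case False
      then show ?thesis using A_carrier unfolding St_eq[OF \<omega>] by blast
    qed
  qed
  with \<omega> show ?thesis by blast
qed

text \<open>Both alternatives of \<open>dichotomy\<close> are the identity on \<sigma>-invariant
  elements with trivial square.\<close>

lemma involutions_fixed: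
  assumes A: "\<And>a. a \<in> A \<Longrightarrow> \<nu> a \<in> A" and t: "t \<in> A" "t \<otimes> t = \<one>" "\<sigma> t = t"
  shows "\<nu> t = t"
proof -
  have "inv t = t" using t inv_equality by simp
  then show ?thesis using dichotomy[OF A] t by metis
qed

end

context split_extension
begin

text \<open>Let \<open>?T\<close> be the group of elements of \<open>A\<close> with trivial square,
  central and contained in every stabilizer. Pair the model, restricted to \<open>?T\<close>, with
  the character \<eta> carried by a representative whose stabilizer is just \<open>?T\<close>. No
  orbit contributes negatively, and that one alone contributes \<open>|G|\<close>, at least
  \<open>2 |A|\<close>. The irreducible characters give at most
  \<open>|A| + |?T \<inter> D| |Fix|\<close>, which is below
  \<open>|A| + |D| |Fix| = 2 |A|\<close>.\<close>

theorem no_GIM_type_B: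
  assumes T_fixed: "\<And>t. t \<in> A \<Longrightarrow> t \<otimes> t = \<one> \<Longrightarrow> \<sigma> t = t"
    and e: "e \<in> A" "\<And>b. b \<in> A \<Longrightarrow> b \<otimes> b \<noteq> e \<otimes> inv (\<sigma> e)"
    and d: "d \<in> D" "d \<otimes> d \<noteq> \<one>"
  shows "\<not> has_GIM G"
proof
  assume "has_GIM G"
  then show False
  proof (rule has_GIM_E)
    fix \<nu> R and lam :: "'a \<Rightarrow> 'a \<Rightarrow> complex"
    assume "gim_twist G A s \<nu>"
      and R: "orbit_representatives G (gen_involutions G \<nu>) (twisted_conj G \<nu>) R"
      and lin: "\<And>\<omega>. \<omega> \<in> R \<Longrightarrow> lam \<omega> \<in> linear_characters G (stabilizer G (twisted_conj G \<nu>) \<omega>)"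
      and val: "\<And>t. t \<in> Fix \<Longrightarrow> (\<And>\<omega>. \<omega> \<in> R \<Longrightarrow> t \<in> stabilizer G (twisted_conj G \<nu>) \<omega>) \<Longrightarrow>
        (\<Sum>\<omega>\<in>R. of_nat (card (orbit G (twisted_conj G \<nu>) \<omega>)) * lam \<omega> t) =
        (if t = \<one> then of_nat (card A) else 0) + (if t \<in> D then of_nat (card Fix) else 0)"
    interpret g: gim_twist G A s \<nu> by fact
    let ?T = "{t \<in> A. t \<otimes> t = \<one>}"
    have finD: "finite D" using D_subset finA finite_subset by blast
    have big: "2 * card Fix < card A" by (rule two_card_Fix_less[OF d])
    have pres: "\<nu>' a \<in> A" if "gim_twist G A s \<nu>'" "a \<in> A" for \<nu>' a
      using gim_twist.preserves_A[OF that(1) big that(2)] .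
    have RI: "\<omega> \<in> g.I" if "\<omega> \<in> R" for \<omega> using R that by (auto simp: orbit_representatives_def)
    have TFix: "t \<in> Fix" if "t \<in> ?T" for t using that T_fixed by (intro FixI) auto
    have T_St: "t \<in> g.St \<omega>" if t: "t \<in> ?T" and \<omega>: "\<omega> \<in> g.I" for t \<omega>
    proof -
      have "g.\<nu>at \<omega> t = t"
        using gim_twist.involutions_fixed[OF g.gim_twist_at(1)[OF \<omega>] pres[OF g.gim_twist_at(1)[OF \<omega>]]] t T_fixed by auto
      then show ?thesis using g.St_eq[OF \<omega>] t by simp
    qed
    have subT: "subgroup ?T G"
    proof (rule subgroupI)
      show "?T \<noteq> {}" using one_A r_one by blast
      show "a \<otimes> b \<in> ?T" if "a \<in> ?T" "b \<in> ?T" for a b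
      proof -
        have "a \<otimes> b \<otimes> (a \<otimes> b) = (a \<otimes> a) \<otimes> (b \<otimes> b)" using that by (simp add: A_ac)
        then show ?thesis using that by simp
      qed
      show "inv a \<in> ?T" if "a \<in> ?T" for a using that inv_equality[of a a] by auto
    qed auto
    obtain \<omega>1 where \<omega>1: "\<omega>1 \<in> g.I" "g.St \<omega>1 = ?T"
      using g.type_B_stabilizer[OF pres[OF g.gim_twist_axioms] e] by blast
    have "orbit G g.\<phi> \<omega>1 \<in> orbits G g.I g.\<phi>" using \<omega>1 by (auto simp: orbits_def)
    then obtain \<omega>R where \<omega>R: "\<omega>R \<in> R" "\<omega>R \<in> orbit G g.\<phi> \<omega>1"
      using R by (auto simp: orbit_representatives_def)
    then obtain x where x: "x \<in> carrier G" "\<omega>R = g.\<phi> x \<omega>1" by (auto simp: orbit_def)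
    \<comment> \<open>Passing to the representative conjugates the stabilizer, which changes nothing
      because \<open>?T\<close> is central.\<close>
    have StR: "g.St \<omega>R = ?T"
    proof (rule Set.set_eqI)
      fix h
      have "h \<in> ?T" if h: "h \<in> g.St \<omega>R"
      proof -
        have hc: "h \<in> carrier G" using h by (simp add: stabilizer_def)
        then have y: "inv x \<otimes> h \<otimes> x \<in> ?T" using g.St_conj[OF \<omega>1(1) x(1) hc] h x \<omega>1(2) by simp
        then have "x \<otimes> (inv x \<otimes> h \<otimes> x) = inv x \<otimes> h \<otimes> x \<otimes> x"
          using g.Fix_central[OF TFix x(1)] by simp
        moreover have "x \<otimes> (inv x \<otimes> h \<otimes> x) = h \<otimes> x" using x(1) hc by (simp add: m_assoc[symmetric])
        ultimately have "h = inv x \<otimes> h \<otimes> x" using x(1) hc by (metis inv_closed m_closed right_cancel)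
        then show ?thesis using y by simp
      qed
      then show "h \<in> g.St \<omega>R \<longleftrightarrow> h \<in> ?T" using T_St[OF _ RI[OF \<omega>R(1)]] by blast
    qed
    define \<eta> where "\<eta> = lam \<omega>R"
    have lin': "lam \<omega> (a \<otimes> b) = lam \<omega> a * lam \<omega> b" "lam \<omega> a \<noteq> 0"
      if "\<omega> \<in> R" "a \<in> ?T" "b \<in> ?T" for \<omega> a b
      using lin[OF that(1)] T_St[OF that(2) RI[OF that(1)]] T_St[OF that(3) RI[OF that(1)]]
      unfolding g.linear_character_iff by blast+
    have T1: "\<one> \<in> ?T" by simp
    have lam1: "lam \<omega> \<one> = 1" if "\<omega> \<in> R" for \<omega> using lin'[OF that T1 T1] by simp
    have sq: "lam \<omega> t * lam \<omega> t = 1" if "\<omega> \<in> R" "t \<in> ?T" for \<omega> t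
      using lin'(1)[OF that(1,2,2)] lam1[OF that(1)] that(2) by simp
    have pm: "\<eta> t = 1 \<or> \<eta> t = -1" if "t \<in> ?T" for t
      using sq[OF \<omega>R(1) that] by (simp add: \<eta>_def square_eq_1_iff)
    define S where "S \<omega> = (\<Sum>t\<in>?T. \<eta> t * lam \<omega> t)" for \<omega>
    have S: "Re (S \<omega>) \<ge> 0" if \<omega>: "\<omega> \<in> R" for \<omega>
    proof (cases "\<exists>t\<in>?T. \<eta> t * lam \<omega> t \<noteq> 1")
      case True
      then obtain t where "t \<in> ?T" "\<eta> t * lam \<omega> t \<noteq> 1" by blast
      then have "S \<omega> = 0" unfolding S_def
        by (intro sum_character_eq_zero[OF subT]) (auto simp: \<eta>_def lin'[OF \<omega>R(1)] lin'[OF \<omega>])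
      then show ?thesis by simp
    next
      case False
      then have "S \<omega> = (\<Sum>t\<in>?T. 1)" unfolding S_def by (intro sum.cong) auto
      then show ?thesis by simp
    qed
    have SR: "S \<omega>R = of_nat (card ?T)"
    proof -
      have "S \<omega>R = (\<Sum>t\<in>?T. 1)" unfolding S_def \<eta>_def using sq[OF \<omega>R(1)] by (intro sum.cong) auto
      then show ?thesis by simp
    qed
    let ?n = "\<lambda>\<omega>. card (orbit G g.\<phi> \<omega>)"
    have "(\<Sum>\<omega>\<in>R. of_nat (?n \<omega>) * S \<omega>) = (\<Sum>t\<in>?T. \<eta> t * (\<Sum>\<omega>\<in>R. of_nat (?n \<omega>) * lam \<omega> t))"
      unfolding S_def sum_distrib_left by (subst sum.swap) (simp add: mult_ac)
    also have "\<dots> = (\<Sum>t\<in>?T. \<eta> t * ((if t = \<one> then of_nat (card A) else 0) + (if t \<in> D then of_nat (card Fix) else 0)))"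
      using val TFix T_St RI by (intro sum.cong refl arg_cong2[where f = "(*)"]) blast
    also have "\<dots> = (\<Sum>t\<in>?T. if t = \<one> then \<eta> t * of_nat (card A) else 0) +
        (\<Sum>t\<in>?T. if t \<in> D then \<eta> t * of_nat (card Fix) else 0)"
      by (subst sum.distrib[symmetric]) (intro sum.cong, auto simp: distrib_left)
    also have "(\<Sum>t\<in>?T. if t = \<one> then \<eta> t * of_nat (card A) else 0) = of_nat (card A)"
      using lam1[OF \<omega>R(1)] by (simp add: \<eta>_def)
    also have "(\<Sum>t\<in>?T. if t \<in> D then \<eta> t * of_nat (card Fix) else 0) =
        (\<Sum>t\<in>{t \<in> ?T. t \<in> D}. \<eta> t * of_nat (card Fix))"
      by (rule sum.inter_filter[symmetric]) simp
    finally have eq: "(\<Sum>\<omega>\<in>R. of_nat (?n \<omega>) * S \<omega>) =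
        of_nat (card A) + (\<Sum>t\<in>{t \<in> ?T. t \<in> D}. \<eta> t * of_nat (card Fix))" .
    have finR: "finite R" using RI g.finite_I by (metis finite_subset subsetI)
    have "real (?n \<omega>R) * real (card ?T) = Re (of_nat (?n \<omega>R) * S \<omega>R)" by (simp add: SR)
    also have "\<dots> \<le> (\<Sum>\<omega>\<in>R. Re (of_nat (?n \<omega>) * S \<omega>))"
      using S by (intro member_le_sum finR \<omega>R(1)) simp
    also have "\<dots> = Re (\<Sum>\<omega>\<in>R. of_nat (?n \<omega>) * S \<omega>)" by simp
    also have "\<dots> = real (card A) + (\<Sum>t\<in>{t \<in> ?T. t \<in> D}. Re (\<eta> t) * real (card Fix))" unfolding eq by simp
    also have "\<dots> \<le> real (card A) + (\<Sum>t\<in>{t \<in> ?T. t \<in> D}. real (card Fix))"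
      using pm by (intro add_left_mono sum_mono) fastforce
    finally have "real (?n \<omega>R * card ?T) \<le> real (card A + card {t \<in> ?T. t \<in> D} * card Fix)" by simp
    then have le: "?n \<omega>R * card ?T \<le> card A + card {t \<in> ?T. t \<in> D} * card Fix" by (simp only: of_nat_le_iff)
    have "(of_nat (card (carrier G)) :: complex) = of_nat (card ?T * ?n \<omega>R)"
      using g.sum_over_group[OF RI[OF \<omega>R(1)], of "\<lambda>_. 1"] by (simp add: StR)
    then have "card (carrier G) = ?n \<omega>R * card ?T" by (simp only: of_nat_eq_iff mult.commute)
    moreover have "2 * card A \<le> card (carrier G)"
    proof -
      have inj: "inj_on (\<lambda>a. a \<otimes> s) A" by (rule inj_onI) simp
      have "card A + card ((\<lambda>a. a \<otimes> s) ` A) = card (A \<union> (\<lambda>a. a \<otimes> s) ` A)"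
        by (rule card_Un_disjoint[symmetric]) (use as_notin in auto)
      also have "\<dots> \<le> card (carrier G)" by (rule card_mono[OF fin]) auto
      finally show ?thesis by (simp add: card_image[OF inj])
    qed
    \<comment> \<open>The element \<open>d\<close> lies in \<open>D\<close> but not in
      \<open>?T\<close>; this makes the final inequality strict.\<close>
    moreover have "{t \<in> ?T. t \<in> D} \<subset> D" using d by blast
    then have "card {t \<in> ?T. t \<in> D} < card D" by (rule psubset_card_mono[OF finD])
    then have "card {t \<in> ?T. t \<in> D} * card Fix < card A" using card_D Fix_pos by simp
    ultimately show False using le by simp
  qed
qed

end

section \<open>The exceptional group\<close>

context split_extension
begin

text \<open>Restricted to \<open>Fix\<close>, the sum of the irreducible characters contains 1,
  \<chi>, \<psi> and \<chi>\<psi> with multiplicities 4, 4, 2, 2. Accordingly the four generalized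
  involutions in \<open>Fix\<close> carry \<chi>, the four in \<open>A\<close> outside
  \<open>Fix\<close> the trivial character, and the outer ones \<psi> or \<chi>\<psi>, two each. The
  sign at \<open>s\<close>, given by \<eta>, sums to zero over each family with the same
  character.\<close>

theorem has_GIM_exceptional:
  assumes \<chi>: "\<chi> \<in> dual" "\<And>a. a \<in> A \<Longrightarrow> \<chi> (\<sigma> a) = \<chi> a"
    and \<psi>: "\<psi> \<in> dual" "\<And>a. a \<in> A \<Longrightarrow> \<psi> (\<sigma> a) = inverse (\<psi> a)"
    and \<chi>\<psi>: "\<And>a. a \<in> A \<Longrightarrow> (\<chi> a * \<psi> a) * (\<chi> a * \<psi> a) = 1"
    and Fix: "Fix = {\<one>, u, v, y}" and dist: "distinct [\<one>, u, v, y]" and D: "D = {\<one>, u}"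
    and vals: "\<chi> u = 1" "\<psi> u = -1" "\<chi> v = -1" "\<psi> v = 1" "\<chi> y = -1" "\<psi> y = -1"
    and sq: "\<And>b. b \<in> A \<Longrightarrow> b \<otimes> b = \<one> \<longleftrightarrow> b \<in> Fix"
    and norm: "\<And>b. b \<in> A \<Longrightarrow> b \<otimes> \<sigma> b = \<one> \<longleftrightarrow> b \<in> Fix"
    and sq_Fix: "\<And>b. b \<in> A \<Longrightarrow> b \<otimes> b \<in> Fix"
    and nonsq: "\<And>a b. a \<in> A \<Longrightarrow> b \<in> A \<Longrightarrow> a \<notin> Fix \<Longrightarrow> b \<otimes> b \<otimes> \<sigma> a \<noteq> a"
  shows "has_GIM G"
proof -
  define \<eta> where "\<eta> a = \<chi> a * \<psi> a" for a
  define \<theta> where "\<theta> c b = \<psi> b * (if \<psi> c = 1 then 1 else \<chi> b)" for c b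
  define lam where "lam \<omega> g =
    (if \<omega> \<in> A then if \<omega> \<in> Fix then if g \<in> A then \<chi> g else \<chi> (g \<otimes> s) * \<eta> \<omega> else 1
     else if g \<in> A then \<theta> (\<omega> \<otimes> s) g else \<theta> (\<omega> \<otimes> s) (g \<otimes> s) * \<eta> (\<omega> \<otimes> s))" for \<omega> g
  have lam_Fix: "lam a b = \<chi> b" "lam a (b \<otimes> s) = \<chi> b * \<eta> a" if "a \<in> Fix" "b \<in> A" for a b
    using that as_notin by (simp_all add: lam_def)
  have lam_A: "lam a g = 1" if "a \<in> A" "a \<notin> Fix" for a g using that by (simp add: lam_def)
  have lam_outer: "lam (c \<otimes> s) b = \<theta> c b" "lam (c \<otimes> s) (b \<otimes> s) = \<theta> c b * \<eta> c" if "c \<in> A" "b \<in> A" for c b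
    using that as_notin by (simp_all add: lam_def)
  have \<eta>_mult: "\<eta> (a \<otimes> b) = \<eta> a * \<eta> b" if "a \<in> A" "b \<in> A" for a b
    using that \<chi>(1) \<psi>(1) by (simp add: \<eta>_def dual_mult)
  have \<eta>_sq: "\<eta> a * \<eta> a = 1" if "a \<in> A" for a using \<chi>\<psi>[OF that] by (simp add: \<eta>_def)
  have \<theta>_mult: "\<theta> c (a \<otimes> b) = \<theta> c a * \<theta> c b" if "a \<in> A" "b \<in> A" for a b c
    using that \<chi>(1) \<psi>(1) by (simp add: \<theta>_def dual_mult)
  have nz: "\<chi> b \<noteq> 0" "\<psi> b \<noteq> 0" "\<eta> b \<noteq> 0" "\<theta> c b \<noteq> 0" if "b \<in> A" for b c
    using that \<chi>(1) \<psi>(1) by (simp_all add: \<eta>_def \<theta>_def)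
  \<comment> \<open>By the hypotheses on squares and norms only \<open>Fix\<close> and, for the
    other generalized involutions than those in \<open>A\<close> outside \<open>Fix\<close>, also
    \<open>Fix s\<close> can occur. So a character of \<open>Fix\<close> and a sign at
    \<open>s\<close> describe each \<open>lam\<close>.\<close>
  have St: "(g \<in> Fix \<or> (\<exists>b\<in>Fix. g = b \<otimes> s \<and> (\<omega> \<in> A \<longrightarrow> \<omega> \<in> Fix)))"
    if \<omega>: "\<omega> \<in> tw.I" and g: "g \<in> tw.St \<omega>" for \<omega> g
  proof -
    have gc: "g \<in> carrier G" using g by (simp add: stabilizer_def)
    consider "\<omega> \<in> A" | c where "c \<in> Fix" "\<omega> = c \<otimes> s" using \<omega> I_eq by blast
    then show ?thesis
    proof cases
      case 1
      from gc show ?thesis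
      proof (cases rule: cover_cases)
        case base
        then show ?thesis using St_base_base[OF 1 base] g sq by blast
      next
        case (outer b)
        then have b: "b \<otimes> b \<otimes> \<sigma> \<omega> = \<omega>" using St_base_outer[OF 1 outer(1)] g by blast
        then have \<omega>F: "\<omega> \<in> Fix" using nonsq 1 outer by blast
        then have "b \<otimes> b = \<one>" using b 1 outer(1) by simp
        then show ?thesis using sq outer \<omega>F by blast
      qed
    next
      case (2 c)
      from gc show ?thesis
      proof (cases rule: cover_cases)
        case base
        then show ?thesis using St_outer_base[OF 2(1) base] g norm 2 by blast
      next
        case (outer b)
        then show ?thesis using St_outer_outer[OF 2(1) outer(1)] g norm 2 as_notin by (metis Fix_A)
      qed
    qed
  qed
  have lin: "lam \<omega> (g \<otimes> h) = lam \<omega> g * lam \<omega> h \<and> lam \<omega> g \<noteq> 0"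
    if \<omega>: "\<omega> \<in> tw.I" and g: "g \<in> tw.St \<omega>" and h: "h \<in> tw.St \<omega>" for \<omega> g h
  proof -
    consider "\<omega> \<in> Fix" | "\<omega> \<in> A" "\<omega> \<notin> Fix" | c where "c \<in> Fix" "\<omega> = c \<otimes> s" using \<omega> I_eq by blast
    then show ?thesis
    proof cases
      case 1
      then have \<eta>: "\<eta> \<omega> * (\<eta> \<omega> * x) = x" for x using \<eta>_sq[of \<omega>] by (simp add: mult.assoc[symmetric])
      from St[OF \<omega> g] show ?thesis
      proof (elim disjE bexE conjE)
        assume gF: "g \<in> Fix"
        from St[OF \<omega> h] show ?thesis
          using 1 gF nz by (elim disjE bexE conjE) (simp_all add: lam_Fix a_bs dual_mult[OF \<chi>(1)])
      next
        fix b assume gF: "b \<in> Fix" "g = b \<otimes> s"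
        from St[OF \<omega> h] show ?thesis
          using 1 gF nz by (elim disjE bexE conjE) (simp_all add: lam_Fix as_b as_bs dual_mult[OF \<chi>(1)] mult_ac \<eta> \<eta>_sq)
      qed
    next
      case 2
      then show ?thesis by (simp add: lam_A)
    next
      case (3 c)
      have \<eta>: "\<eta> c * (\<eta> c * x) = x" for x using \<eta>_sq[of c] 3 by (simp add: mult.assoc[symmetric])
      from St[OF \<omega> g] show ?thesis
      proof (elim disjE bexE conjE)
        assume gF: "g \<in> Fix"
        from St[OF \<omega> h] show ?thesis
          using 3 gF nz by (elim disjE bexE conjE) (simp_all add: lam_outer a_bs \<theta>_mult)
      next
        fix b assume gF: "b \<in> Fix" "g = b \<otimes> s"
        from St[OF \<omega> h] show ?thesis
          using 3 gF nz by (elim disjE bexE conjE) (simp_all add: lam_outer as_b as_bs \<theta>_mult mult_ac \<eta> \<eta>_sq)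
      qed
    qed
  qed
  show ?thesis
  proof (rule has_GIM_if_equivariant_gens[of lam])
    show "lam \<omega> \<in> linear_characters G (tw.St \<omega>)" if "\<omega> \<in> tw.I" for \<omega>
      unfolding tw.linear_character_iff using lin[OF that] by blast
  next
    fix \<omega> d h assume \<omega>: "\<omega> \<in> tw.I" and d: "d \<in> A" and h: "h \<in> tw.St \<omega>"
    have conj_base: "d \<otimes> b \<otimes> inv d = b" if "b \<in> A" for b
      using that d commA[of d b] by (simp add: m_assoc)
    have conj_outer: "d \<otimes> (b \<otimes> s) \<otimes> inv d = b \<otimes> (d \<otimes> inv (\<sigma> d)) \<otimes> s" if "b \<in> A" for b
    proof -
      have "d \<otimes> (b \<otimes> s) \<otimes> inv d = d \<otimes> b \<otimes> inv (\<sigma> d) \<otimes> s" using that d by (simp add: a_bs as_b \<sigma>_inv)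
      also have "d \<otimes> b \<otimes> inv (\<sigma> d) = b \<otimes> (d \<otimes> inv (\<sigma> d))" using that d by (simp add: A_ac)
      finally show ?thesis .
    qed
    have \<chi>d: "\<chi> (d \<otimes> inv (\<sigma> d)) = 1"
      using d \<chi> nz by (simp add: dual_mult dual_inv)
    have \<psi>d: "\<psi> (d \<otimes> inv (\<sigma> d)) = \<psi> d * \<psi> d" "\<psi> (d \<otimes> \<sigma> d) = 1" "\<chi> (d \<otimes> \<sigma> d) = \<chi> d * \<chi> d"
      using d \<chi> \<psi> nz by (simp_all add: dual_mult dual_inv)
    consider "\<omega> \<in> Fix" | "\<omega> \<in> A" "\<omega> \<notin> Fix" | c where "c \<in> Fix" "\<omega> = c \<otimes> s" using \<omega> I_eq by blast
    then show "lam (tw.\<phi> d \<omega>) (d \<otimes> h \<otimes> inv d) = lam \<omega> h"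
    proof cases
      case 1
      have "d \<otimes> d \<otimes> \<omega> \<in> Fix" using sq_Fix[OF d] 1 by (rule Fix_mult)
      moreover have "\<eta> (d \<otimes> d \<otimes> \<omega>) = \<eta> \<omega>" using d 1 by (simp add: \<eta>_mult \<eta>_sq)
      ultimately show ?thesis
        using St[OF \<omega> h] 1 d
        by (elim disjE bexE conjE)
          (simp_all add: act_base_base conj_base conj_outer lam_Fix dual_mult[OF \<chi>(1)] \<chi>d)
    next
      case 2
      have "d \<otimes> d \<otimes> \<omega> \<notin> Fix"
      proof
        assume "d \<otimes> d \<otimes> \<omega> \<in> Fix"
        then have "inv (d \<otimes> d) \<otimes> (d \<otimes> d \<otimes> \<omega>) \<in> Fix" by (rule Fix_mult[OF Fix_inv[OF sq_Fix[OF d]]])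
        then show False using 2 d by (simp add: m_assoc[symmetric, of "inv (d \<otimes> d)"])
      qed
      then show ?thesis using 2 d by (simp add: act_base_base lam_A)
    next
      case (3 c)
      let ?c = "d \<otimes> \<sigma> d \<otimes> c"
      have cA: "c \<in> A" "?c \<in> A" using 3 d by simp_all
      have "\<psi> ?c = \<psi> c" using d cA \<psi>d by (simp add: dual_mult[OF \<psi>(1)])
      then have \<theta>c: "\<theta> ?c = \<theta> c" by (simp add: \<theta>_def fun_eq_iff)
      \<comment> \<open>Conjugating \<open>s\<close> by \<open>d\<close> costs
        \<open>\<theta> c (d / \<sigma>(d)) = \<psi>(d)^2\<close>, and moving \<open>c\<close> by
        the norm of \<open>d\<close> changes \<eta> by \<open>\<chi>(d)^2\<close>. The two factors
        cancel because \<open>\<chi>\<psi>\<close> has square 1.\<close>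
      have "\<theta> c (d \<otimes> inv (\<sigma> d)) * \<eta> ?c = \<psi> d * \<psi> d * (\<chi> d * \<chi> d) * \<eta> c"
      proof -
        have "\<eta> ?c = \<eta> (d \<otimes> \<sigma> d) * \<eta> c" using d cA(1) by (intro \<eta>_mult) simp_all
        also have "\<eta> (d \<otimes> \<sigma> d) = \<chi> d * \<chi> d" unfolding \<eta>_def[of "d \<otimes> \<sigma> d"] \<psi>d by simp
        finally show ?thesis unfolding \<theta>_def \<psi>d \<chi>d by simp
      qed
      also have "\<dots> = \<eta> c" using \<chi>\<psi>[OF d] by (simp add: mult_ac)
      finally have key: "\<theta> c (d \<otimes> inv (\<sigma> d)) * \<eta> ?c = \<eta> c" .
      from St[OF \<omega> h] show ?thesis
      proof (elim disjE bexE conjE)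
        assume "h \<in> Fix"
        then show ?thesis using 3 d cA by (simp add: act_base_outer conj_base lam_outer \<theta>c)
      next
        fix b assume b: "b \<in> Fix" "h = b \<otimes> s"
        have "lam (tw.\<phi> d \<omega>) (d \<otimes> h \<otimes> inv d) = \<theta> c b * (\<theta> c (d \<otimes> inv (\<sigma> d)) * \<eta> ?c)"
          using 3 d cA b by (simp add: act_base_outer conj_outer lam_outer \<theta>c \<theta>_mult)
        then show ?thesis unfolding key using 3 b by (simp add: lam_outer)
      qed
    qed
  next
    fix \<omega> h assume \<omega>: "\<omega> \<in> tw.I" and h: "h \<in> tw.St \<omega>"
    have conj_base: "s \<otimes> b \<otimes> s = b" if "b \<in> Fix" for b
      using Fix_\<sigma>[OF that] by (simp add: \<sigma>_def)
    have conj_outer: "s \<otimes> (b \<otimes> s) \<otimes> s = b \<otimes> s" if "b \<in> Fix" for b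
      using that s_mult[of b] by (simp add: m_assoc s_s)
    have hh: "s \<otimes> h \<otimes> s = h" using St[OF \<omega> h] conj_base conj_outer by blast
    consider "\<omega> \<in> Fix" | "\<omega> \<in> A" "\<omega> \<notin> Fix" | c where "c \<in> Fix" "\<omega> = c \<otimes> s" using \<omega> I_eq by blast
    then show "lam (tw.\<phi> s \<omega>) (s \<otimes> h \<otimes> s) = lam \<omega> h"
    proof cases
      case 2
      have "\<sigma> \<omega> \<notin> Fix" using 2 by (metis Fix_\<sigma> \<sigma>_\<sigma>)
      then show ?thesis using 2 by (simp add: act_s_base lam_A)
    qed (simp_all add: hh act_s_base act_s_outer)
  next
    fix g assume "g \<in> carrier G"
    then show "(\<Sum>\<omega>\<in>tw.I. if g \<in> tw.St \<omega> then lam \<omega> g else 0) = (\<Sum>\<psi>\<in>Irr G. \<psi> g)"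
    proof (cases rule: cover_cases)
      case base
      have 1: "(\<Sum>a\<in>A. if g \<in> tw.St a then lam a g else 0) =
          (if g \<in> Fix then \<Sum>a\<in>A. if a \<in> Fix then \<chi> g else 1 else 0)"
      proof -
        have "(\<Sum>a\<in>A. if g \<in> tw.St a then lam a g else 0) =
            (\<Sum>a\<in>A. if g \<in> Fix then if a \<in> Fix then \<chi> g else 1 else 0)"
          using base sq by (intro sum.cong) (simp_all add: St_base_base lam_Fix lam_A)
        then show ?thesis by simp
      qed
      have AF: "(\<Sum>a\<in>A. if a \<in> Fix then \<chi> g else 1) = 4 * \<chi> g + 4"
      proof -
        have "card Fix = 4" using dist by (simp add: Fix)
        moreover have "card D = 2" using dist by (simp add: D)
        ultimately have c: "card A = 8" "card Fix = 4" using card_D by simp_all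
        have FA: "Fix \<subseteq> A" by auto
        have "(\<Sum>a\<in>A. if a \<in> Fix then \<chi> g else 1) =
            (\<Sum>a\<in>A - Fix. if a \<in> Fix then \<chi> g else 1) + (\<Sum>a\<in>Fix. if a \<in> Fix then \<chi> g else 1)"
          by (rule sum.subset_diff[OF FA finA])
        also have "(\<Sum>a\<in>A - Fix. if a \<in> Fix then \<chi> g else 1) = (\<Sum>a\<in>A - Fix. 1)" by (intro sum.cong) auto
        also have "\<dots> = 4" using c card_Diff_subset[OF finite_Fix FA] by simp
        also have "(\<Sum>a\<in>Fix. if a \<in> Fix then \<chi> g else 1) = 4 * \<chi> g" using c by simp
        finally show ?thesis by simp
      qed
      have 2: "(\<Sum>c\<in>Fix. if g \<in> tw.St (c \<otimes> s) then lam (c \<otimes> s) g else 0) =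
          (if g \<in> Fix then \<Sum>c\<in>Fix. \<theta> c g else 0)"
      proof -
        have "(\<Sum>c\<in>Fix. if g \<in> tw.St (c \<otimes> s) then lam (c \<otimes> s) g else 0) =
            (\<Sum>c\<in>Fix. if g \<in> Fix then \<theta> c g else 0)"
          using base norm by (intro sum.cong) (simp_all add: St_outer_base lam_outer)
        then show ?thesis by simp
      qed
      have 3: "(\<Sum>c\<in>Fix. \<theta> c g) = 2 * \<psi> g + 2 * \<psi> g * \<chi> g"
        using dist vals \<psi>(1) by (simp add: Fix \<theta>_def)
      have \<psi>1: "\<psi> \<one> = 1" "\<chi> \<one> = 1" using \<psi>(1) \<chi>(1) by simp_all
      have c: "card A = 8" "card Fix = 4" using dist card_D by (simp_all add: D Fix)
      have L: "(\<Sum>\<omega>\<in>tw.I. if g \<in> tw.St \<omega> then lam \<omega> g else 0) =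
          (if g \<in> Fix then 4 * \<chi> g + 4 + (2 * \<psi> g + 2 * \<psi> g * \<chi> g) else 0)"
        unfolding sum_I 1 2 3 AF by simp
      have R: "(\<Sum>\<psi>\<in>Irr G. \<psi> g) = (if g = \<one> then 8 else 0) + (if g = \<one> \<or> g = u then 4 else 0)"
        using sum_Irr_base[OF base] c by (simp add: D)
      show ?thesis
      proof (cases "g \<in> Fix")
        case True
        then have "g = \<one> \<or> g = u \<or> g = v \<or> g = y" by (simp add: Fix)
        then have "4 * \<chi> g + 4 + (2 * \<psi> g + 2 * \<psi> g * \<chi> g) =
            (if g = \<one> then 8 else 0) + (if g = \<one> \<or> g = u then 4 else 0)"
          using dist vals \<psi>1 by (elim disjE) auto
        then show ?thesis unfolding L R using True by simp
      next
        case False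
        then have "g \<noteq> u" "g \<noteq> \<one>" by (auto simp: Fix)
        then show ?thesis unfolding L R using False by simp
      qed
    next
      case (outer b)
      have bF: "b \<otimes> b \<otimes> \<sigma> a = a \<longleftrightarrow> a \<in> Fix \<and> b \<in> Fix" if "a \<in> A" for a
      proof -
        have "b \<otimes> b \<otimes> a = a \<longleftrightarrow> b \<otimes> b = \<one>" using that outer(1) right_cancel[of a "b \<otimes> b" \<one>] by simp
        then show ?thesis using nonsq[OF that outer(1)] sq[OF outer(1)] by (cases "a \<in> Fix") auto
      qed
      have "(\<Sum>a\<in>A. if g \<in> tw.St a then lam a g else 0) =
          (\<Sum>a\<in>A. if a \<in> Fix then if b \<in> Fix then \<chi> b * \<eta> a else 0 else 0)"
        using outer bF by (intro sum.cong) (auto simp: St_base_outer lam_Fix)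
      also have "\<dots> = (\<Sum>a\<in>{a \<in> A. a \<in> Fix}. if b \<in> Fix then \<chi> b * \<eta> a else 0)"
        by (rule sum.inter_filter[symmetric]) simp
      also have "{a \<in> A. a \<in> Fix} = Fix" by auto
      \<comment> \<open>On \<one>, \<open>u\<close>, \<open>v\<close>, \<open>y\<close> the values
        of \<eta> are 1, -1, -1, 1.\<close>
      also have "(\<Sum>a\<in>Fix. if b \<in> Fix then \<chi> b * \<eta> a else 0) = 0"
        using dist vals \<psi>(1) \<chi>(1) by (simp add: Fix \<eta>_def)
      finally have 1: "(\<Sum>a\<in>A. if g \<in> tw.St a then lam a g else 0) = 0" .
      have "(\<Sum>c\<in>Fix. if g \<in> tw.St (c \<otimes> s) then lam (c \<otimes> s) g else 0) =
          (\<Sum>c\<in>Fix. if b \<in> Fix then \<theta> c b * \<eta> c else 0)"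
        using outer norm by (intro sum.cong) (simp_all add: St_outer_outer lam_outer)
      also have "\<dots> = 0"
        using dist vals \<psi>(1) \<chi>(1) by (simp add: Fix \<eta>_def \<theta>_def)
      finally show ?thesis using outer 1 by (simp add: sum_I sum_Irr_outer)
    qed
  qed
qed

end

section \<open>Lattice coordinates\<close>

text \<open>The powers of \<open>zeta r\<close> with integer exponents, so that exponent vectors
  form a lattice with negatives.\<close>

definition root :: "nat \<Rightarrow> int \<Rightarrow> complex" where
  "root r k = cis (2 * pi * of_int k / of_nat r)"

lemma root_add: "root r (k + l) = root r k * root r l"
  by (simp add: root_def cis_mult add_divide_distrib distrib_left)

lemma root_nz [simp]: "root r k \<noteq> 0" by (simp add: root_def)

lemma root_0 [simp]: "root r 0 = 1" by (simp add: root_def)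

lemma root_eq_1_iff: assumes "r > 0" shows "root r k = 1 \<longleftrightarrow> int r dvd k"
proof
  assume "root r k = 1"
  then have "cos (2 * pi * (of_int k / of_nat r)) = 1"
    unfolding root_def by (metis cis.sel(1) one_complex.sel(1) times_divide_eq_right)
  then obtain m :: int where "2 * pi * (of_int k / of_nat r) = of_int m * 2 * pi"
    unfolding cos_one_2pi_int by auto
  then have "(of_int k :: real) = of_int m * of_nat r" using assms by (simp add: field_simps)
  then have "k = m * int r" by (metis of_int_eq_iff of_int_mult of_int_of_nat_eq)
  then show "int r dvd k" by simp
next
  assume "int r dvd k"
  then obtain m where "k = int r * m" by blast
  then show "root r k = 1"
    using assms cis_multiple_2pi[of "of_int m"] by (simp add: root_def mult.assoc)
qed

lemma root_diff: "root r (k - l) * root r l = root r k"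
  by (simp add: root_add[symmetric])

lemma root_eq_iff: assumes "r > 0" shows "root r k = root r l \<longleftrightarrow> int r dvd k - l"
  using root_diff[of r k l] root_eq_1_iff[OF assms, of "k - l"]
  by (metis mult_cancel_right2 root_nz mult_cancel_right1)

text \<open>The group \<open>G(r, p, q, 2)\<close> in coordinates: \<open>diag a b\<close> is the class of the diagonal matrix with
  entries \<open>\<zeta>\<^sub>r\<^sup>a\<close> and \<open>\<zeta>\<^sub>r\<^sup>b\<close>, and \<open>s\<close> is the class of the transposition.\<close>

locale lattice_model = group G for G (structure) +
  fixes r p q :: nat and diag :: "int \<Rightarrow> int \<Rightarrow> 'a" and s :: 'a
  assumes r_pos: "r > 0" and p_r: "p dvd r" and q_r: "q dvd r" and pq_r: "p * q dvd 2 * r"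
    and finite_G: "finite (carrier G)"
    and diag_carrier: "int p dvd a + b \<Longrightarrow> diag a b \<in> carrier G"
    and diag_mult: "int p dvd a + b \<Longrightarrow> int p dvd c + d \<Longrightarrow>
      diag a b \<otimes> diag c d = diag (a + c) (b + d)"
    and diag_eq_one: "int p dvd a + b \<Longrightarrow>
      diag a b = \<one> \<longleftrightarrow> int r dvd a - b \<and> int (r div q) dvd a"
    and swap_carrier: "s \<in> carrier G" and swap_swap: "s \<otimes> s = \<one>"
    and swap_diag: "int p dvd a + b \<Longrightarrow> s \<otimes> diag a b \<otimes> s = diag b a"
    and swap_neq: "int p dvd a + b \<Longrightarrow> s \<noteq> diag a b"
    and covered: "g \<in> carrier G \<Longrightarrow>
      \<exists>a b. int p dvd a + b \<and> (g = diag a b \<or> g = diag a b \<otimes> s)"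
begin

definition A :: "'a set" where "A = {diag a b | a b. int p dvd a + b}"

lemma diag_A: "int p dvd a + b \<Longrightarrow> diag a b \<in> A"
  unfolding A_def by blast

lemma A_E: assumes "x \<in> A" obtains a b where "int p dvd a + b" "x = diag a b"
  using assms unfolding A_def by blast

lemma diag_0: "diag 0 0 = \<one>" by (subst diag_eq_one) auto

lemma diag_inv: "int p dvd a + b \<Longrightarrow> inv (diag a b) = diag (- a) (- b)"
proof -
  assume *: "int p dvd a + b"
  then have 1: "int p dvd - a + - b" by (metis add.commute dvd_minus_iff minus_add)
  then have "diag (- a) (- b) \<otimes> diag a b = \<one>" using * by (simp add: diag_mult diag_0)
  then show ?thesis using * 1 by (intro inv_equality diag_carrier)
qed

lemma dvd_diffs: "int p dvd a + b \<Longrightarrow> int p dvd c + d \<Longrightarrow> int p dvd (a - c) + (b - d)"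
  by (metis (no_types, opaque_lifting) add_diff_eq diff_add_eq diff_diff_add dvd_diff)

lemma diag_eq_iff:
  assumes "int p dvd a + b" "int p dvd c + d"
  shows "diag a b = diag c d \<longleftrightarrow> int r dvd (a - c) - (b - d) \<and> int (r div q) dvd a - c"
proof -
  have "diag (a - c) (b - d) \<otimes> diag c d = diag a b"
    using assms by (subst diag_mult) (auto intro: dvd_diffs)
  then have "diag a b = diag c d \<longleftrightarrow> diag (a - c) (b - d) = \<one>"
    using diag_carrier[OF assms(2)] diag_carrier[OF dvd_diffs[OF assms]] by (metis l_one right_cancel one_closed)
  then show ?thesis using diag_eq_one[OF dvd_diffs[OF assms]] by simp
qed

text \<open>Arbitrary exponents of an element of \<open>A\<close>. Functions on \<open>A\<close> are
  defined through this choice by \<open>lift\<close>, and \<open>lift_diag\<close> removes the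
  choice for functions that do not see the relations.\<close>

definition coords :: "'a \<Rightarrow> int \<times> int" where
  "coords x = (SOME (a, b). int p dvd a + b \<and> x = diag a b)"

lemma coords: assumes "x \<in> A"
  shows "int p dvd fst (coords x) + snd (coords x)" "diag (fst (coords x)) (snd (coords x)) = x"
proof -
  have "\<exists>ab. case ab of (a, b) \<Rightarrow> int p dvd a + b \<and> x = diag a b" using assms unfolding A_def by auto
  then have "case coords x of (a, b) \<Rightarrow> int p dvd a + b \<and> x = diag a b"
    unfolding coords_def by (rule someI_ex)
  then show "int p dvd fst (coords x) + snd (coords x)" "diag (fst (coords x)) (snd (coords x)) = x"
    by (auto simp: case_prod_unfold)
qed

definition lift :: "(int \<Rightarrow> int \<Rightarrow> 'c) \<Rightarrow> 'a \<Rightarrow> 'c" where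
  "lift F x = F (fst (coords x)) (snd (coords x))"

lemma lift_diag:
  assumes F: "\<And>a b c d. int p dvd a + b \<Longrightarrow> int p dvd c + d \<Longrightarrow>
      int r dvd a - b \<Longrightarrow> int (r div q) dvd a \<Longrightarrow> F (a + c) (b + d) = F c d"
    and ab: "int p dvd a + b"
  shows "lift F (diag a b) = F a b"
proof -
  let ?a = "fst (coords (diag a b))" and ?b = "snd (coords (diag a b))"
  have c: "int p dvd ?a + ?b" "diag ?a ?b = diag a b" using coords[OF diag_A[OF ab]] by auto
  then have "int r dvd (?a - a) - (?b - b)" "int (r div q) dvd ?a - a" using diag_eq_iff[OF c(1) ab] by auto
  then have "F ((?a - a) + a) ((?b - b) + b) = F a b"
    by (intro F dvd_diffs c ab)
  then show ?thesis by (simp add: lift_def)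
qed

lemma qm: "int r = int q * int (r div q)" using q_r by (metis dvd_mult_div_cancel of_nat_mult)

lemma q_pos: "q > 0" and p_pos: "p > 0" and m_pos: "r div q > 0"
  using r_pos p_r q_r by (auto intro: Nat.gr0I simp: div_greater_zero_iff dvd_imp_le)

text \<open>Modulo \<open>r\<close> the form is \<open>a (c + d)\<close> because \<open>a\<close>
  and \<open>b\<close> are congruent, and the factors are multiples of \<open>r / q\<close> and
  \<open>q\<close>.\<close>

lemma pairing_trivial:
  assumes "int q dvd c + d" "int r dvd a - b" "int (r div q) dvd a"
  shows "int r dvd a * c + b * d"
proof -
  have "int r dvd a * (c + d)"
    using mult_dvd_mono[OF assms(1,3)] unfolding qm by (simp add: mult.commute)
  moreover have "int r dvd (a - b) * d" using assms(2) by simp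
  ultimately have "int r dvd a * (c + d) - (a - b) * d" by (rule dvd_diff)
  then show ?thesis by (simp add: algebra_simps)
qed

text \<open>The exponents \<open>(c, d)\<close> run through the lattice of the group for
  \<open>(r, q, p)\<close>: this is the duality exchanging \<open>p\<close> and
  \<open>q\<close>.\<close>

definition char :: "int \<Rightarrow> int \<Rightarrow> 'a \<Rightarrow> complex" where
  "char c d = lift (\<lambda>a b. root r (a * c + b * d))"

lemma char_diag:
  assumes "int q dvd c + d" "int p dvd a + b"
  shows "char c d (diag a b) = root r (a * c + b * d)"
  unfolding char_def
proof (rule lift_diag[OF _ assms(2)])
  fix x y z w assume "int r dvd x - y" "int (r div q) dvd x"
  then have "int r dvd x * c + y * d" by (rule pairing_trivial[OF assms(1)])
  then have "root r (x * c + y * d) = 1" using root_eq_1_iff[OF r_pos] by blast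
  moreover have "(x + z) * c + (y + w) * d = (x * c + y * d) + (z * c + w * d)" by (simp add: algebra_simps)
  ultimately show "root r ((x + z) * c + (y + w) * d) = root r (z * c + w * d)" by (simp only: root_add mult_1)
qed

lemma char_mult:
  assumes "int q dvd c + d" "x \<in> A" "y \<in> A"
  shows "char c d (x \<otimes> y) = char c d x * char c d y"
proof -
  obtain a b where x: "int p dvd a + b" "x = diag a b" using assms(2) by (rule A_E)
  obtain a' b' where y: "int p dvd a' + b'" "y = diag a' b'" using assms(3) by (rule A_E)
  have s: "int p dvd (a + a') + (b + b')" using dvd_add[OF x(1) y(1)] by (simp add: algebra_simps)
  have e: "(a + a') * c + (b + b') * d = (a * c + b * d) + (a' * c + b' * d)" by (simp add: algebra_simps)
  show ?thesis unfolding x(2) y(2) diag_mult[OF x(1) y(1)] char_diag[OF assms(1) s]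
      char_diag[OF assms(1) x(1)] char_diag[OF assms(1) y(1)] e root_add ..
qed

lemma char_one: "int q dvd c + d \<Longrightarrow> char c d \<one> = 1"
  using char_diag[of c d 0 0] by (simp add: diag_0)

sublocale split_extension G A s
proof (rule split_extension.intro, rule is_group, rule split_extension_axioms.intro)
  show "subgroup A G"
  proof (rule subgroupI)
    show "A \<subseteq> carrier G" by (auto elim: A_E intro: diag_carrier)
    show "A \<noteq> {}" using diag_A[of 0 0] by auto
    show "inv x \<in> A" if xA: "x \<in> A" for x
    proof -
      obtain a b where x: "int p dvd a + b" "x = diag a b" using xA by (rule A_E)
      have "int p dvd - a + - b" using x(1) by (metis add.commute dvd_minus_iff minus_add)
      then show ?thesis using x by (simp add: diag_inv diag_A)
    qed
    show "x \<otimes> y \<in> A" if xy: "x \<in> A" "y \<in> A" for x y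
    proof -
      obtain a b where x: "int p dvd a + b" "x = diag a b" using xy(1) by (rule A_E)
      obtain a' b' where y: "int p dvd a' + b'" "y = diag a' b'" using xy(2) by (rule A_E)
      have "int p dvd (a + a') + (b + b')" using dvd_add[OF x(1) y(1)] by (simp add: algebra_simps)
      then show ?thesis using x y by (simp add: diag_mult diag_A)
    qed
  qed
  show "x \<otimes> y = y \<otimes> x" if xy: "x \<in> A" "y \<in> A" for x y
  proof -
    obtain a b where x: "int p dvd a + b" "x = diag a b" using xy(1) by (rule A_E)
    obtain a' b' where y: "int p dvd a' + b'" "y = diag a' b'" using xy(2) by (rule A_E)
    show ?thesis using x y by (simp add: diag_mult add.commute)
  qed
  show "s \<notin> A" using swap_neq by (auto elim!: A_E)
  show "g \<in> A \<or> (\<exists>a\<in>A. g = a \<otimes> s)" if "g \<in> carrier G" for g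
    using covered[OF that] diag_A by blast
  show "s \<otimes> x \<otimes> s \<in> A" if xA: "x \<in> A" for x
  proof -
    obtain a b where x: "int p dvd a + b" "x = diag a b" using xA by (rule A_E)
    then have "int p dvd b + a" by (simp add: add.commute)
    then show ?thesis using x by (simp add: swap_diag diag_A)
  qed
  show "\<exists>\<chi> :: 'a \<Rightarrow> complex. (\<forall>a\<in>A. \<forall>b\<in>A. \<chi> (a \<otimes> b) = \<chi> a * \<chi> b) \<and> \<chi> \<one> = 1 \<and> \<chi> x \<noteq> 1"
    if xA: "x \<in> A" and x1: "x \<noteq> \<one>" for x
  proof -
    obtain a b where x: "int p dvd a + b" "x = diag a b" using xA by (rule A_E)
    \<comment> \<open>The character for \<open>(1, -1)\<close> detects \<open>a - b\<close> modulo
      \<open>r\<close>. Once that vanishes, the one for \<open>(q, 0)\<close> detects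
      \<open>a\<close> modulo \<open>r / q\<close>.\<close>
    have "\<exists>c d. int q dvd c + d \<and> char c d x \<noteq> 1"
    proof (cases "int r dvd a - b")
      case False
      have "char 1 (-1) x = root r (a - b)" using x by (simp add: char_diag)
      then show ?thesis using False root_eq_1_iff[OF r_pos] by (intro exI[of _ 1] exI[of _ "-1"]) simp
    next
      case True
      then have "\<not> int (r div q) dvd a" using x x1 diag_eq_one by blast
      then have "\<not> int q * int (r div q) dvd int q * a" using q_pos by simp
      then have "\<not> int r dvd a * int q" unfolding qm by (simp add: mult.commute)
      moreover have "char (int q) 0 x = root r (a * int q)" using x by (simp add: char_diag)
      ultimately show ?thesis using root_eq_1_iff[OF r_pos] by (intro exI[of _ "int q"] exI[of _ 0]) simp
    qed
    then show ?thesis using char_mult char_one by blast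
  qed
qed (use swap_carrier swap_swap finite_G in auto)

lemma \<sigma>_diag: "int p dvd a + b \<Longrightarrow> \<sigma> (diag a b) = diag b a"
  by (simp add: \<sigma>_def swap_diag)

lemma diag_square: "int p dvd a + b \<Longrightarrow> diag a b \<otimes> diag a b = diag (2 * a) (2 * b)"
  by (simp add: diag_mult)

lemma swap_dvd: "int p dvd a + b \<Longrightarrow> int p dvd b + a" by (simp add: add.commute)

lemma Fix_diag_iff:
  assumes "int p dvd a + b"
  shows "diag a b \<in> Fix \<longleftrightarrow> int r dvd 2 * (a - b) \<and> int (r div q) dvd a - b"
proof -
  have "diag a b \<in> Fix \<longleftrightarrow> diag a b = diag b a"
    using diag_A[OF assms] unfolding Fix_def \<sigma>_diag[OF assms, symmetric] by auto
  also have "\<dots> \<longleftrightarrow> int r dvd (a - b) - (b - a) \<and> int (r div q) dvd a - b"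
    by (rule diag_eq_iff[OF assms swap_dvd[OF assms]])
  finally show ?thesis by (simp add: algebra_simps)
qed

lemma diag_twist:
  assumes ab: "int p dvd a + b"
  shows "diag a b \<otimes> inv (\<sigma> (diag a b)) = diag (a - b) (b - a)"
proof -
  have "int p dvd - b + - a" using ab by (metis dvd_minus_iff minus_add)
  then have "diag a b \<otimes> diag (- b) (- a) = diag (a + - b) (b + - a)" by (rule diag_mult[OF ab])
  then show ?thesis unfolding \<sigma>_diag[OF ab] diag_inv[OF swap_dvd[OF ab]] by simp
qed

lemma D_E:
  assumes "x \<in> D" obtains a b where "int p dvd a + b" "x = diag (a - b) (b - a)"
proof -
  obtain y where y: "y \<in> A" "x = y \<otimes> inv (\<sigma> y)" using assms unfolding D_def by blast
  obtain a b where ab: "int p dvd a + b" "y = diag a b" using y(1) by (rule A_E)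
  have "x = diag (a - b) (b - a)" using y(2) unfolding ab(2) diag_twist[OF ab(1)] .
  with ab(1) show thesis by (rule that)
qed

lemma D_I: assumes ab: "int p dvd a + b" shows "diag (a - b) (b - a) \<in> D"
  unfolding D_def by (rule image_eqI[where x = "diag a b"]) (simp_all only: diag_twist[OF ab] diag_A[OF ab])

end

lemma even_diff_swap: "even (x + y) \<Longrightarrow> even (y - x)" for x y :: int
  by presburger

section \<open>Invariant pairings on the exponent lattice\<close>

context lattice_model
begin

text \<open>The pairing is \<open>root r\<close> of an integral form on the exponent lattice.
  \<open>kernel\<close> lets it descend to \<open>A\<close>, and \<open>nondeg\<close> says that its
  radical modulo \<open>r\<close> is no larger than the lattice of relations.\<close>

lemma self_dualI:
  fixes K :: "int \<Rightarrow> int \<Rightarrow> int \<Rightarrow> int \<Rightarrow> int"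
  assumes add: "\<And>a b a' b' c d. int p dvd a + b \<Longrightarrow> int p dvd a' + b' \<Longrightarrow> int p dvd c + d \<Longrightarrow>
      K (a + a') (b + b') c d = K a b c d + K a' b' c d"
    and sym: "\<And>a b c d. int p dvd a + b \<Longrightarrow> int p dvd c + d \<Longrightarrow> K a b c d = K c d a b"
    and swap: "\<And>a b c d. int p dvd a + b \<Longrightarrow> int p dvd c + d \<Longrightarrow> int r dvd K b a d c - K a b c d"
    and kernel: "\<And>a b c d. int p dvd a + b \<Longrightarrow> int p dvd c + d \<Longrightarrow>
      int r dvd a - b \<Longrightarrow> int (r div q) dvd a \<Longrightarrow> int r dvd K a b c d"
    and nondeg: "\<And>a b. int p dvd a + b \<Longrightarrow>
      (\<And>c d. int p dvd c + d \<Longrightarrow> int r dvd K a b c d) \<Longrightarrow> int r dvd a - b \<and> int (r div q) dvd a"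
  shows "has_GIM G"
proof -
  define P where "P x y = root r (K (fst (coords x)) (snd (coords x)) (fst (coords y)) (snd (coords y)))" for x y
  have P: "P (diag a b) (diag c d) = root r (K a b c d)"
    if ab: "int p dvd a + b" and cd: "int p dvd c + d" for a b c d
  proof -
    have inv: "root r (K (x + z) (y + w) c d) = root r (K z w c d)"
      if "int p dvd x + y" "int p dvd z + w" "int r dvd x - y" "int (r div q) dvd x" "int p dvd c + d" for x y z w c d
    proof -
      have "root r (K x y c d) = 1" using kernel[OF that(1,5,3,4)] root_eq_1_iff[OF r_pos] by blast
      then show ?thesis unfolding add[OF that(1,2,5)] root_add by simp
    qed
    let ?c = "fst (coords (diag c d))" and ?d = "snd (coords (diag c d))"
    have c': "int p dvd ?c + ?d" by (rule coords[OF diag_A[OF cd]])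
    \<comment> \<open>The chosen representatives are replaced one argument at a time, symmetry
      reducing the second to the first.\<close>
    have "P (diag a b) (diag c d) = lift (\<lambda>a b. root r (K a b ?c ?d)) (diag a b)" by (simp add: P_def lift_def)
    also have "\<dots> = root r (K a b ?c ?d)" by (rule lift_diag[OF _ ab]) (rule inv[OF _ _ _ _ c'])
    also have "\<dots> = root r (K ?c ?d a b)" unfolding sym[OF ab c'] ..
    also have "\<dots> = lift (\<lambda>c d. root r (K c d a b)) (diag c d)" by (simp add: lift_def)
    also have "\<dots> = root r (K c d a b)" by (rule lift_diag[OF _ cd]) (rule inv[OF _ _ _ _ ab])
    finally show ?thesis unfolding sym[OF cd ab] .
  qed
  interpret self_dual_extension G A s P
  proof
    show "P (x \<otimes> y) z = P x z * P y z" if xyz: "x \<in> A" "y \<in> A" "z \<in> A" for x y z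
    proof -
      obtain a b where x: "int p dvd a + b" "x = diag a b" using xyz(1) by (rule A_E)
      obtain a' b' where y: "int p dvd a' + b'" "y = diag a' b'" using xyz(2) by (rule A_E)
      obtain c d where z: "int p dvd c + d" "z = diag c d" using xyz(3) by (rule A_E)
      have s: "int p dvd (a + a') + (b + b')" using dvd_add[OF x(1) y(1)] by (simp add: algebra_simps)
      show ?thesis unfolding x(2) y(2) z(2) diag_mult[OF x(1) y(1)] P[OF s z(1)] P[OF x(1) z(1)]
          P[OF y(1) z(1)] add[OF x(1) y(1) z(1)] root_add ..
    qed
    show "P x y = P y x" if xy: "x \<in> A" "y \<in> A" for x y
    proof -
      obtain a b where x: "int p dvd a + b" "x = diag a b" using xy(1) by (rule A_E)
      obtain c d where y: "int p dvd c + d" "y = diag c d" using xy(2) by (rule A_E)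
      show ?thesis unfolding x(2) y(2) P[OF x(1) y(1)] P[OF y(1) x(1)] sym[OF x(1) y(1)] ..
    qed
    show "P (\<sigma> x) (\<sigma> y) = P x y" if xy: "x \<in> A" "y \<in> A" for x y
    proof -
      obtain a b where x: "int p dvd a + b" "x = diag a b" using xy(1) by (rule A_E)
      obtain c d where y: "int p dvd c + d" "y = diag c d" using xy(2) by (rule A_E)
      show ?thesis
        unfolding x(2) y(2) \<sigma>_diag[OF x(1)] \<sigma>_diag[OF y(1)] P[OF x(1) y(1)]
          P[OF swap_dvd[OF x(1)] swap_dvd[OF y(1)]] root_eq_iff[OF r_pos]
        by (rule swap[OF x(1) y(1)])
    qed
    show "P x y \<noteq> 0" for x y by (simp add: P_def)
    show "x = \<one>" if xA: "x \<in> A" and triv: "\<And>y. y \<in> A \<Longrightarrow> P x y = 1" for x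
    proof -
      obtain a b where x: "int p dvd a + b" "x = diag a b" using xA by (rule A_E)
      have "int r dvd K a b c d" if cd: "int p dvd c + d" for c d
        using triv[OF diag_A[OF cd]] unfolding x(2) P[OF x(1) cd] root_eq_1_iff[OF r_pos] .
      from nondeg[OF x(1) this] show ?thesis unfolding x(2) diag_eq_one[OF x(1)] by blast
    qed
  qed
  show ?thesis by (rule has_GIM_self_dual)
qed

lemma div_add_p: "int p dvd a + b \<Longrightarrow> int p dvd a' + b' \<Longrightarrow>
    ((a + a') + (b + b')) div int p = (a + b) div int p + (a' + b') div int p"
proof -
  assume *: "int p dvd a + b" "int p dvd a' + b'"
  have "(a + a') + (b + b') = (a + b) + (a' + b')" by simp
  then show ?thesis using div_plus_div_distrib_dvd_left[OF *(1), of "a' + b'"] by (simp only:)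
qed

lemma sum_by_q:
  assumes "int p dvd a + b" "int r dvd a - b" "int (r div q) dvd a" "int q dvd e"
  shows "int r dvd (a + b) * e"
proof -
  have "int q * int (r div q) dvd e * a" by (rule mult_dvd_mono[OF assms(4,3)])
  then have "int r dvd 2 * (a * e)" unfolding qm by (simp add: mult.commute)
  moreover have "int r dvd (a - b) * e" using assms(2) by simp
  ultimately have "int r dvd 2 * (a * e) - (a - b) * e" by (rule dvd_diff)
  then show ?thesis by (simp add: algebra_simps)
qed

text \<open>Send \<open>(c, d)\<close> to \<open>(c', d')\<close> with
  \<open>c' - d' = c - d\<close> and \<open>(c' + d') / q = (c + d) / p\<close>. Equal parity makes
  \<open>c'\<close> and \<open>d'\<close> integral, so this identifies the lattice with the one for
  \<open>(r, q, p)\<close>; composed with the duality \<open>a c' + b d'\<close> it is the form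
  \<open>K\<close>, as \<open>Kf\<close> states.\<close>

theorem has_GIM_same_parity:
  assumes par: "even p \<longleftrightarrow> even q"
  shows "has_GIM G"
proof -
  define Y where "Y a b = (a + b) div int p" for a b :: int
  have Y: "a + b = int p * Y a b" if "int p dvd a + b" for a b using that by (simp add: Y_def)
  have Yadd: "Y (a + a') (b + b') = Y a b + Y a' b'" if "int p dvd a + b" "int p dvd a' + b'" for a b a' b'
    using div_add_p[OF that] by (simp add: Y_def)
  have ev: "even ((c - d) + int q * Y c d)" if "int p dvd c + d" for c d
  proof -
    have eqn: "(c - d) + int q * Y c d = (int p + int q) * Y c d - 2 * d"
      using Y[OF that] by (simp add: algebra_simps)
    have "even (int p + int q)" using par by simp
    then show ?thesis unfolding eqn by (intro dvd_diff dvd_mult2 dvd_triv_left)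
  qed
  have ev': "even ((a - b) * (c - d) + int p * int q * (Y a b * Y c d))" if "int p dvd a + b" "int p dvd c + d" for a b c d
  proof -
    have ab: "a - b = int p * Y a b - 2 * b" and cd: "c - d = int p * Y c d - 2 * d" using Y that by simp_all
    have eqn: "(a - b) * (c - d) + int p * int q * (Y a b * Y c d) =
        (int p + int q) * (int p * (Y a b * Y c d)) -
        2 * (b * int p * Y c d + d * int p * Y a b - 2 * b * d)"
      unfolding ab cd by (simp add: algebra_simps)
    have "even (int p + int q)" using par by simp
    then show ?thesis unfolding eqn by (intro dvd_diff dvd_mult2 dvd_triv_left)
  qed
  define K where "K a b c d = ((a - b) * (c - d) + int p * int q * (Y a b * Y c d)) div 2" for a b c d
  have K2: "2 * K a b c d = (a - b) * (c - d) + int p * int q * (Y a b * Y c d)"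
    if "int p dvd a + b" "int p dvd c + d" for a b c d
    using ev'[OF that] by (simp add: K_def)
  have Kf: "K a b c d = a * (((c - d) + int q * Y c d) div 2) + b * ((int q * Y c d - (c - d)) div 2)"
    if "int p dvd a + b" "int p dvd c + d" for a b c d
  proof -
    have e: "even (int q * Y c d - (c - d))" by (rule even_diff_swap[OF ev[OF that(2)]])
    have "2 * (a * (((c - d) + int q * Y c d) div 2) + b * ((int q * Y c d - (c - d)) div 2)) =
        a * (2 * (((c - d) + int q * Y c d) div 2)) + b * (2 * ((int q * Y c d - (c - d)) div 2))"
      by (simp add: algebra_simps)
    also have "\<dots> = a * ((c - d) + int q * Y c d) + b * (int q * Y c d - (c - d))"
      using ev[OF that(2)] e by simp
    also have "\<dots> = (a - b) * (c - d) + (a + b) * (int q * Y c d)" by (simp add: algebra_simps)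
    also have "\<dots> = 2 * K a b c d" unfolding K2[OF that] Y[OF that(1)] by simp
    finally show ?thesis by simp
  qed
  show ?thesis
  proof (rule self_dualI[of K])
    fix a b a' b' c d assume *: "int p dvd a + b" "int p dvd a' + b'" "int p dvd c + d"
    have s: "int p dvd (a + a') + (b + b')" using dvd_add[OF *(1,2)] by (simp add: algebra_simps)
    have "2 * K (a + a') (b + b') c d = 2 * (K a b c d + K a' b' c d)"
      unfolding distrib_left K2[OF s *(3)] K2[OF *(1,3)] K2[OF *(2,3)] Yadd[OF *(1,2)] by (simp add: algebra_simps)
    then show "K (a + a') (b + b') c d = K a b c d + K a' b' c d" by simp
  next
    fix a b c d show "K a b c d = K c d a b" by (simp add: K_def mult_ac)
  next
    fix a b c d :: int
    have "(b - a) * (d - c) = (a - b) * (c - d)" by (simp add: algebra_simps)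
    then show "int r dvd K b a d c - K a b c d" by (simp add: K_def Y_def add.commute)
  next
    fix a b c d assume *: "int p dvd a + b" "int p dvd c + d" "int r dvd a - b" "int (r div q) dvd a"
    have e: "even (int q * Y c d - (c - d))" by (rule even_diff_swap[OF ev[OF *(2)]])
    have "2 * (((c - d) + int q * Y c d) div 2 + (int q * Y c d - (c - d)) div 2) = 2 * (int q * Y c d)"
      using ev[OF *(2)] e by (simp add: distrib_left)
    then have sum: "((c - d) + int q * Y c d) div 2 + (int q * Y c d - (c - d)) div 2 = int q * Y c d"
      by (rule mult_left_cancel[THEN iffD1, rotated]) simp
    show "int r dvd K a b c d" unfolding Kf[OF *(1,2)]
      by (rule pairing_trivial[OF _ *(3,4)]) (simp only: sum dvd_triv_left)
  next
    fix a b assume ab: "int p dvd a + b" and triv: "\<And>c d. int p dvd c + d \<Longrightarrow> int r dvd K a b c d"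
    have "K a b 1 (-1) = a - b" unfolding Kf[OF ab, of 1 "-1", simplified] by (simp add: Y_def)
    then have 1: "int r dvd a - b" using triv[of 1 "-1"] by simp
    \<comment> \<open>The vector with sum \<open>p\<close> and difference \<open>q\<close> is sent
      to \<open>(q, 0)\<close>, so pairing with it reads off \<open>a q\<close>.\<close>
    let ?c = "(int p + int q) div 2" and ?d = "(int p - int q) div 2"
    have e: "2 * ?c = int p + int q" "2 * ?d = int p - int q" using par by auto
    then have cd: "?c + ?d = int p" "?c - ?d = int q" by simp_all
    have d: "int p dvd ?c + ?d" unfolding cd by simp
    have y: "Y ?c ?d = 1" unfolding Y_def cd using p_pos by simp
    have "K a b ?c ?d = a * int q" unfolding Kf[OF ab d] y cd by simp
    then have "int r dvd a * int q" using triv[OF d] by simp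
    then have "int (r div q) * int q dvd a * int q" unfolding qm by (simp add: mult.commute)
    then have "int (r div q) dvd a" using q_pos by simp
    with 1 show "int r dvd a - b \<and> int (r div q) dvd a" by blast
  qed
qed

text \<open>Here the form of the equal parity case is not integral, so its double is used. Doubling
  weakens the test for \<open>a - b\<close> to \<open>2 (a - b)\<close>. The second test vector
  supplies divisibility of \<open>a - b\<close> by \<open>q\<close>, and then the factor 2 can be
  removed because \<open>r / q\<close> is odd.\<close>

theorem has_GIM_odd_even:
  assumes "odd p" "even q" "odd (r div q)"
  shows "has_GIM G"
proof -
  define Y where "Y a b = (a + b) div int p" for a b :: int
  have Y: "a + b = int p * Y a b" if "int p dvd a + b" for a b using that by (simp add: Y_def)
  have Yadd: "Y (a + a') (b + b') = Y a b + Y a' b'" if "int p dvd a + b" "int p dvd a' + b'" for a b a' b'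
    using div_add_p[OF that] by (simp add: Y_def)
  define K where "K a b c d = (a - b) * (c - d) + int p * int q * (Y a b * Y c d)" for a b c d
  show ?thesis
  proof (rule self_dualI[of K])
    fix a b a' b' c d assume *: "int p dvd a + b" "int p dvd a' + b'"
    show "K (a + a') (b + b') c d = K a b c d + K a' b' c d"
      unfolding K_def Yadd[OF *] by (simp add: algebra_simps)
  next
    fix a b c d show "K a b c d = K c d a b" by (simp add: K_def mult_ac)
  next
    fix a b c d :: int
    have "(b - a) * (d - c) = (a - b) * (c - d)" by (simp add: algebra_simps)
    then show "int r dvd K b a d c - K a b c d" by (simp add: K_def Y_def add.commute)
  next
    fix a b c d assume *: "int p dvd a + b" "int p dvd c + d" "int r dvd a - b" "int (r div q) dvd a"
    have "K a b c d = (a - b) * (c - d) + (a + b) * (int q * Y c d)" unfolding Y[OF *(1)] K_def by simp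
    then show "int r dvd K a b c d" using sum_by_q[OF *(1,3,4), of "int q * Y c d"] *(3) by simp
  next
    fix a b assume ab: "int p dvd a + b" and triv: "\<And>c d. int p dvd c + d \<Longrightarrow> int r dvd K a b c d"
    \<comment> \<open>\<open>?c\<close> and \<open>?d\<close> have sum \<open>p\<close> and
      difference 1, which is possible for odd \<open>p\<close>.\<close>
    let ?m = "int (r div q)" and ?x = "a - b" and ?c = "(int p + 1) div 2" and ?d = "(int p - 1) div 2"
    have Y0: "Y 1 (-1) = 0" by (simp add: Y_def)
    have "K a b 1 (-1) = 2 * ?x" unfolding K_def Y0 by simp
    then have x2: "int r dvd 2 * ?x" using triv[of 1 "-1"] by simp
    have e: "2 * ?c = int p + 1" "2 * ?d = int p - 1" using assms(1) by (auto elim!: oddE)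
    then have cd: "?c + ?d = int p" "?c - ?d = 1" by simp_all
    have d: "int p dvd ?c + ?d" unfolding cd by simp
    have y: "Y ?c ?d = 1" unfolding Y_def cd using p_pos by simp
    have "K a b ?c ?d = ?x + (a + b) * int q" unfolding K_def y cd Y[OF ab] by simp
    then have 2: "int r dvd ?x + (a + b) * int q" using triv[OF d] by simp
    have "int q dvd int r" using q_r by simp
    then have "int q dvd ?x + (a + b) * int q" using 2 dvd_trans by blast
    then have "int q dvd ?x" by (metis dvd_add_left_iff dvd_triv_right)
    then obtain x1 where x1: "?x = int q * x1" by blast
    have "int q * ?m dvd int q * (2 * x1)" using x2 unfolding x1 qm by (simp add: mult_ac)
    then have "?m dvd 2 * x1" using q_pos by simp
    moreover have "coprime ?m 2" using assms(3) by simp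
    ultimately have "?m dvd x1" using coprime_dvd_mult_right_iff by blast
    then have rx: "int r dvd ?x" unfolding x1 qm by simp
    then have "int r dvd (a + b) * int q" using 2 dvd_add_right_iff by blast
    then have "int q * ?m dvd int q * (a + b)" unfolding qm by (simp add: mult.commute)
    then have "?m dvd a + b" using q_pos by simp
    moreover have "?m dvd ?x" using rx unfolding qm by (rule dvd_mult_right)
    ultimately have "?m dvd (a + b) + (a - b)" by (rule dvd_add)
    then have "?m dvd 2 * a" by simp
    then have "?m dvd a" using \<open>coprime ?m 2\<close> coprime_dvd_mult_right_iff by blast
    with rx show "int r dvd a - b \<and> int (r div q) dvd a" by blast
  qed
qed

text \<open>In the coordinates \<open>X = (a - b) / 2\<close> and \<open>Y = (a + b) / p\<close> the
  relations are generated by \<open>(h, - q m)\<close> and \<open>(0, 2 m)\<close>, where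
  \<open>h = r / 2\<close>. Pairing the first with \<open>X\<close> alone gives \<open>h X\<close>,
  an odd multiple of \<open>h\<close>. The cross term with coefficient \<open>h\<close> repairs this
  because \<open>q m\<close> is odd, and it is \<sigma>-invariant modulo \<open>r\<close> since a
  change of sign costs a multiple of \<open>2 h\<close>.\<close>

theorem has_GIM_even_odd:
  assumes "even p" "odd q" "odd (r div p)"
  shows "has_GIM G"
proof -
  have "p * q dvd 2 * (p * (r div p))" using pq_r p_r by simp
  then have "p * q dvd p * (2 * (r div p))" by (simp only: mult.left_commute)
  then have "q dvd 2 * (r div p)" using p_pos by simp
  moreover have "coprime q 2" using assms(2) by simp
  ultimately have "q dvd r div p" using coprime_dvd_mult_right_iff by blast
  then obtain m' where m': "r div p = q * m'" by blast
  define m where "m = int m'"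
  have odd_m: "odd m" using assms(3) unfolding m' m_def by simp
  obtain p2' where p2': "p = 2 * p2'" using assms(1) by blast
  define P2 where "P2 = int p2'"
  have pP: "int p = 2 * P2" unfolding P2_def p2' by simp
  have rm': "r = p * (q * m')" using m' p_r by (metis dvd_mult_div_cancel)
  define h where "h = P2 * int q * m"
  have rh: "int r = 2 * h" unfolding rm' h_def m_def p2' P2_def by simp
  have "r div q = p * m'" unfolding rm' using q_pos by simp
  then have rq: "int (r div q) = 2 * P2 * m" unfolding m_def P2_def p2' by simp
  define X where "X a b = (a - b) div 2" for a b :: int
  define Y where "Y a b = (a + b) div int p" for a b :: int
  have Y: "a + b = 2 * P2 * Y a b" if "int p dvd a + b" for a b
    using that unfolding Y_def pP[symmetric] by simp
  have Yadd: "Y (a + a') (b + b') = Y a b + Y a' b'" if "int p dvd a + b" "int p dvd a' + b'" for a b a' b'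
    using div_add_p[OF that] by (simp add: Y_def)
  have X: "a - b = 2 * X a b" if "int p dvd a + b" for a b
  proof -
    have "a - b = 2 * (P2 * Y a b - b)" using Y[OF that] by simp
    then have "even (a - b)" by (metis dvd_triv_left)
    then show ?thesis unfolding X_def by (rule dvd_mult_div_cancel[symmetric])
  qed
  have Xadd: "X (a + a') (b + b') = X a b + X a' b'" if *: "int p dvd a + b" "int p dvd a' + b'" for a b a' b'
  proof -
    have s: "int p dvd (a + a') + (b + b')" using dvd_add[OF *] by (simp add: algebra_simps)
    show ?thesis using X[OF s] X[OF *(1)] X[OF *(2)] by linarith
  qed
  \<comment> \<open>Chosen so that \<open>N m = 2 h - h^2\<close>. Then the relation
    \<open>(h, - q m)\<close> has \<open>Y\<close>-coefficient \<open>h^2 (1 + q) - 2 h q\<close>, a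
    multiple of \<open>2 h\<close> for odd \<open>q\<close>.\<close>
  define N where "N = 2 * P2 * int q - P2 * h * int q"
  have Nm: "N * m = 2 * h - h * h" unfolding N_def h_def by (simp add: algebra_simps)
  define K where "K a b c d = X a b * X c d + h * (X a b * Y c d + X c d * Y a b) + N * (Y a b * Y c d)" for a b c d
  have "even (1 - int q * m)" "even (1 + int q)" "even (1 + m)" using odd_m assms(2) by simp_all
  then obtain j l' i where j: "1 - int q * m = 2 * j" and l': "1 + int q = 2 * l'" and i: "1 + m = 2 * i"
    unfolding dvd_def by blast
  show ?thesis
  proof (rule self_dualI[of K])
    fix a b a' b' c d assume *: "int p dvd a + b" "int p dvd a' + b'"
    show "K (a + a') (b + b') c d = K a b c d + K a' b' c d"
      unfolding K_def Yadd[OF *] Xadd[OF *] by (simp add: algebra_simps)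
  next
    fix a b c d show "K a b c d = K c d a b" by (simp add: K_def algebra_simps)
  next
    fix a b c d assume *: "int p dvd a + b" "int p dvd c + d"
    have "X b a = - X a b" "X d c = - X c d"
      using X[OF *(1)] X[OF *(2)] X[OF swap_dvd[OF *(1)]] X[OF swap_dvd[OF *(2)]] by linarith+
    moreover have "Y b a = Y a b" "Y d c = Y c d" by (simp_all add: Y_def add.commute)
    ultimately have "K b a d c - K a b c d = int r * - (X a b * Y c d + X c d * Y a b)"
      unfolding K_def rh by (simp add: algebra_simps)
    then show "int r dvd K b a d c - K a b c d" by simp
  next
    fix a b c d assume *: "int p dvd a + b" "int p dvd c + d" "int r dvd a - b" "int (r div q) dvd a"
    obtain k where k: "a - b = int r * k" using *(3) by blast
    obtain l where l: "a = 2 * P2 * m * l" using *(4) unfolding rq by blast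
    have Xk: "X a b = h * k" using k X[OF *(1)] unfolding rh by simp
    have "2 * P2 * Y a b = 2 * a - (a - b)" using Y[OF *(1)] by simp
    also have "\<dots> = 2 * P2 * (2 * m * l - int q * m * k)" unfolding k rh unfolding l h_def by (simp add: algebra_simps)
    finally have Yk: "Y a b = 2 * m * l - int q * m * k" using p_pos pP by simp
    have "K a b c d = X c d * (h * k * (1 - int q * m) + 2 * h * m * l) +
        Y c d * (h * h * k + (N * m) * (2 * l - int q * k))"
      unfolding K_def Xk Yk by (simp add: algebra_simps)
    also have "h * h * k + (N * m) * (2 * l - int q * k) = h * h * k * (1 + int q) + 2 * h * (2 * l - int q * k - h * l)"
      unfolding Nm by (simp add: algebra_simps)
    also have "X c d * (h * k * (1 - int q * m) + 2 * h * m * l) +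
        Y c d * (h * h * k * (1 + int q) + 2 * h * (2 * l - int q * k - h * l)) =
        int r * (X c d * (k * j + m * l) + Y c d * (h * k * l' + (2 * l - int q * k - h * l)))"
      unfolding j l' rh by (simp add: algebra_simps)
    finally show "int r dvd K a b c d" by simp
  next
    fix a b assume ab: "int p dvd a + b" and triv: "\<And>c d. int p dvd c + d \<Longrightarrow> int r dvd K a b c d"
    \<comment> \<open>The vectors \<open>(1, -1)\<close> and \<open>(p, 0)\<close> generate the
      lattice, so pairing with these two exhausts the hypothesis \<open>triv\<close>.\<close>
    have "X 1 (-1) = 1" "Y 1 (-1) = 0" by (simp_all add: X_def Y_def)
    then have "K a b 1 (-1) = X a b + h * Y a b" by (simp add: K_def)
    then have 1: "int r dvd X a b + h * Y a b" using triv[of 1 "-1"] by simp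
    have "X (int p) 0 = P2" "Y (int p) 0 = 1" using p_pos pP by (simp_all add: X_def Y_def)
    then have "K a b (int p) 0 = P2 * (X a b + h * Y a b) + (h * X a b + N * Y a b)"
      by (simp add: K_def algebra_simps)
    then have "int r dvd P2 * (X a b + h * Y a b) + (h * X a b + N * Y a b)" using triv[of "int p" 0] by simp
    moreover have "int r dvd P2 * (X a b + h * Y a b)" using 1 by simp
    ultimately have "int r dvd h * X a b + N * Y a b" using dvd_add_right_iff by blast
    moreover have "int r dvd h * (X a b + h * Y a b)" using 1 by simp
    \<comment> \<open>Elimination of \<open>X\<close>. After division by \<open>2 P2 q\<close> the
      coefficient of \<open>Y\<close> is \<open>1 - h i\<close>, which is 1 modulo \<open>m\<close>
      because \<open>m\<close> divides \<open>h\<close>.\<close>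
    ultimately have "int r dvd (h * X a b + N * Y a b) - h * (X a b + h * Y a b)" by (rule dvd_diff)
    also have "(h * X a b + N * Y a b) - h * (X a b + h * Y a b) = (P2 * int q) * ((2 - h * (1 + m)) * Y a b)"
      unfolding N_def h_def by (simp add: algebra_simps)
    also have "\<dots> = (2 * P2 * int q) * ((1 - h * i) * Y a b)" unfolding i by (simp add: algebra_simps)
    also have "int r = (2 * P2 * int q) * m" unfolding rh h_def by simp
    finally have "m dvd (1 - h * i) * Y a b" using p_pos pP q_pos by simp
    moreover have "m dvd (h * i) * Y a b" unfolding h_def by simp
    ultimately have "m dvd (1 - h * i) * Y a b + (h * i) * Y a b" by (rule dvd_add)
    then have "m dvd Y a b" by (simp add: algebra_simps)
    then obtain y where y: "Y a b = m * y" by blast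
    obtain k where "X a b + h * Y a b = int r * k" using 1 by blast
    then have Xk: "X a b = int r * k - h * m * y" unfolding y by (simp add: algebra_simps)
    have "a - b = int r * (2 * k - m * y)" unfolding X[OF ab] Xk rh by (simp add: algebra_simps)
    then have r1: "int r dvd a - b" by simp
    have "2 * a = (a - b) + (a + b)" by simp
    also have "\<dots> = 2 * (X a b + P2 * Y a b)" using X[OF ab] Y[OF ab] by simp
    finally have "a = X a b + P2 * Y a b" by simp
    also have "\<dots> = P2 * m * (y * (1 - int q * m)) + int r * k"
      unfolding Xk y h_def by (simp add: algebra_simps)
    also have "\<dots> = 2 * P2 * m * (y * j + int q * k)" unfolding j rh h_def by (simp add: algebra_simps)
    finally have "int (r div q) dvd a" unfolding rq by (metis dvd_triv_left)
    with r1 show "int r dvd a - b \<and> int (r div q) dvd a" by blast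
  qed
qed

section \<open>The exceptional triple and the triples without a model\<close>

theorem has_GIM_4_1_2:
  assumes "r = 4" "p = 1" "q = 2"
  shows "has_GIM G"
proof (rule has_GIM_exceptional)
  have one: "diag a b = \<one> \<longleftrightarrow> 4 dvd a - b \<and> 2 dvd a" for a b
    using diag_eq_one[of a b] assms by simp
  have eq: "diag a b = diag c d \<longleftrightarrow> 4 dvd (a - c) - (b - d) \<and> 2 dvd a - c" for a b c d
    using diag_eq_iff[of a b c d] assms by simp
  have mult: "diag a b \<otimes> diag c d = diag (a + c) (b + d)" for a b c d
    using diag_mult[of a b c d] assms by simp
  have \<sigma>: "\<sigma> (diag a b) = diag b a" for a b using \<sigma>_diag[of a b] assms by simp
  have dA: "diag a b \<in> A" for a b using diag_A[of a b] assms by simp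
  have AE: "\<exists>a b. x = diag a b" if "x \<in> A" for x using that unfolding A_def by blast
  have Fix: "diag a b \<in> Fix \<longleftrightarrow> 2 dvd a - b" for a b
  proof -
    have "diag a b \<in> Fix \<longleftrightarrow> 4 dvd 2 * (a - b) \<and> 2 dvd a - b" using Fix_diag_iff[of a b] assms by simp
    also have "\<dots> \<longleftrightarrow> 2 dvd a - b" by presburger
    finally show ?thesis .
  qed
  have root2: "root 4 2 = -1"
  proof -
    have "root 4 2 * root 4 2 = 1" "root 4 2 \<noteq> 1"
      using root_eq_1_iff[of 4 4] root_eq_1_iff[of 4 2] by (simp_all flip: root_add)
    then show ?thesis by (metis square_eq_1_iff)
  qed
  \<comment> \<open>On the matrix with exponents \<open>a\<close>, \<open>b\<close> these are the
    powers of the imaginary unit with exponents \<open>a + b\<close> and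
    \<open>a - b\<close>.\<close>
  let ?\<chi> = "restrict (char 1 1) A" and ?\<psi> = "restrict (char 1 (-1)) A"
  have \<chi>: "?\<chi> (diag a b) = root 4 (a + b)" and \<psi>: "?\<psi> (diag a b) = root 4 (a - b)" for a b
    using char_diag[of 1 1 a b] char_diag[of 1 "-1" a b] dA assms by simp_all
  show "?\<chi> \<in> dual" "?\<psi> \<in> dual"
  proof -
    have q: "int q dvd 1 + 1" "int q dvd 1 + - 1" using assms by simp_all
    show "?\<chi> \<in> dual" "?\<psi> \<in> dual"
      by (rule dualI; simp add: char_mult[OF q(1)] char_mult[OF q(2)] char_one[OF q(1)] char_one[OF q(2)])+
  qed
  show "?\<chi> (\<sigma> x) = ?\<chi> x" if "x \<in> A" for x
    using AE[OF that] by (elim exE) (simp only: \<sigma> \<chi> add.commute)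
  show "?\<psi> (\<sigma> x) = inverse (?\<psi> x)" if xA: "x \<in> A" for x
  proof -
    obtain a b where x: "x = diag a b" using AE[OF xA] by blast
    have "root 4 (b - a) * root 4 (a - b) = 1" by (simp flip: root_add)
    then show ?thesis unfolding x \<sigma> \<psi> by (simp add: field_simps)
  qed
  show "?\<chi> x * ?\<psi> x * (?\<chi> x * ?\<psi> x) = 1" if xA: "x \<in> A" for x
  proof -
    obtain a b where x: "x = diag a b" using AE[OF xA] by blast
    have "root 4 (((a + b) + (a - b)) + ((a + b) + (a - b))) = 1"
      using root_eq_1_iff[of 4 "((a + b) + (a - b)) + ((a + b) + (a - b))"] by simp
    then show ?thesis unfolding x \<chi> \<psi> by (simp only: root_add)
  qed
  show "Fix = {\<one>, diag 1 (-1), diag 1 1, diag 2 0}"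
  proof (rule subset_antisym)
    show "Fix \<subseteq> {\<one>, diag 1 (-1), diag 1 1, diag 2 0}"
    proof
      fix x assume x: "x \<in> Fix"
      obtain a b where ab: "x = diag a b" using AE[OF Fix_A[OF x]] by blast
      have "2 dvd a - b" using x Fix unfolding ab by blast
      then have "(4 dvd a - b \<and> 2 dvd a) \<or> (4 dvd (a - 1) - (b - (-1)) \<and> 2 dvd a - 1) \<or>
          (4 dvd (a - 1) - (b - 1) \<and> 2 dvd a - 1) \<or> (4 dvd (a - 2) - (b - 0) \<and> 2 dvd a - 2)" by presburger
      then show "x \<in> {\<one>, diag 1 (-1), diag 1 1, diag 2 0}" unfolding ab
        using one[of a b] eq[of a b 1 "-1"] eq[of a b 1 1] eq[of a b 2 0] by blast
    qed
    show "{\<one>, diag 1 (-1), diag 1 1, diag 2 0} \<subseteq> Fix" using Fix Fix_one by auto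
  qed
  have d0: "\<one> = diag 0 0" by (rule diag_0[symmetric])
  show "distinct [\<one>, diag 1 (-1), diag 1 1, diag 2 0]"
    unfolding d0 by (simp add: eq)
  show "D = {\<one>, diag 1 (-1)}"
  proof (rule subset_antisym)
    show "D \<subseteq> {\<one>, diag 1 (-1)}"
    proof
      fix x assume "x \<in> D"
      then obtain a b where x: "x = diag (a - b) (b - a)" by (rule D_E)
      have "(4 dvd (a - b) - (b - a) \<and> 2 dvd a - b) \<or>
          (4 dvd ((a - b) - 1) - ((b - a) - (-1)) \<and> 2 dvd (a - b) - 1)" by presburger
      then show "x \<in> {\<one>, diag 1 (-1)}" unfolding x
        using one[of "a - b" "b - a"] eq[of "a - b" "b - a" 1 "-1"] by blast
    qed
    have "diag (1 - 0) (0 - 1) \<in> D" by (rule D_I) (simp add: assms)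
    moreover have "diag (0 - 0) (0 - 0) \<in> D" by (rule D_I) (simp add: assms)
    ultimately show "{\<one>, diag 1 (-1)} \<subseteq> D" by (simp add: diag_0)
  qed
  show "?\<chi> (diag 1 (-1)) = 1" "?\<psi> (diag 1 (-1)) = -1" "?\<chi> (diag 1 1) = -1" "?\<psi> (diag 1 1) = 1"
    "?\<chi> (diag 2 0) = -1" "?\<psi> (diag 2 0) = -1"
    unfolding \<chi> \<psi> by (simp_all add: root2)
  show "x \<otimes> x = \<one> \<longleftrightarrow> x \<in> Fix" if xA: "x \<in> A" for x
  proof -
    obtain a b where x: "x = diag a b" using AE[OF xA] by blast
    have "(4 dvd (a + a) - (b + b) \<and> 2 dvd a + a) \<longleftrightarrow> 2 dvd a - b" by presburger
    then show ?thesis unfolding x mult one Fix .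
  qed
  show "x \<otimes> \<sigma> x = \<one> \<longleftrightarrow> x \<in> Fix" if xA: "x \<in> A" for x
  proof -
    obtain a b where x: "x = diag a b" using AE[OF xA] by blast
    have "(4 dvd (a + b) - (b + a) \<and> 2 dvd a + b) \<longleftrightarrow> 2 dvd a - b" by presburger
    then show ?thesis unfolding x \<sigma> mult one Fix .
  qed
  show "x \<otimes> x \<in> Fix" if xA: "x \<in> A" for x
  proof -
    obtain a b where x: "x = diag a b" using AE[OF xA] by blast
    have "2 dvd (a + a) - (b + b)" by presburger
    then show ?thesis unfolding x mult Fix .
  qed
  show "y \<otimes> y \<otimes> \<sigma> x \<noteq> x" if xA: "x \<in> A" and yA: "y \<in> A" and nF: "x \<notin> Fix" for x y
  proof -
    obtain a b where x: "x = diag a b" using AE[OF xA] by blast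
    obtain c d where y: "y = diag c d" using AE[OF yA] by blast
    have "\<not> 2 dvd a - b" using nF unfolding x Fix .
    then have "\<not> (4 dvd (c + c + b - a) - (d + d + a - b) \<and> 2 dvd c + c + b - a)" by presburger
    then show ?thesis unfolding x y \<sigma> mult eq .
  qed
qed

text \<open>Since \<open>h\<close> is \<open>r / 4\<close>, \<open>?t\<close> is the class of the
  diagonal matrix with entries -1, 1, and \<open>?d\<close> that of the entries \<open>i\<close>,
  \<open>-i\<close>. The central element is the class of the scalar -1, which is nontrivial because
  \<open>q\<close> is odd.\<close>

theorem no_GIM_even_odd:
  assumes "even p" "odd q" "even (r div p)"
  shows "\<not> has_GIM G"
proof -
  obtain k where k: "r div p = 2 * k" using assms(3) by blast
  obtain p2 where p2: "p = 2 * p2" using assms(1) by blast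
  have rk: "r = p * (2 * k)" using k p_r by (metis dvd_mult_div_cancel)
  define h :: int where "h = int p2 * int k"
  have r4: "int r = 4 * h" unfolding rk p2 h_def by simp
  have pd: "int p dvd 2 * h" unfolding p2 h_def by simp
  obtain m where m: "int r = int q * m" "int (r div q) = m" using qm by blast
  have "4 dvd int q * m" using r4 m by simp
  moreover have "coprime 4 (int q)" using assms(2) by (metis coprime_left_2_iff_odd coprime_power_left_iff even_of_nat num_double numeral_times_numeral power2_eq_square)
  ultimately have m4: "4 dvd m" using coprime_dvd_mult_right_iff by blast
  let ?t = "diag (2 * h) 0" and ?d = "diag h (- h)"
  have tp: "int p dvd 2 * h + 0" using pd by simp
  have dp: "int p dvd h + - h" by simp
  have t2: "?t \<otimes> ?t = \<one>"
  proof -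
    have c: "int p dvd 2 * (2 * h) + 2 * 0" using dvd_mult[OF pd, of 2] by simp
    have "2 * (2 * h) - 2 * 0 = int r" "2 * (2 * h) = m * int q" using r4 m(1) by (simp_all add: mult.commute)
    then show ?thesis unfolding diag_square[OF tp] diag_eq_one[OF c] m(2) by (metis dvd_refl dvd_triv_left)
  qed
  have z: "?t \<otimes> \<sigma> ?t = diag (2 * h) (2 * h)"
    using diag_mult[OF tp swap_dvd[OF tp]] by (simp add: \<sigma>_diag[OF tp])
  have zp: "int p dvd 2 * h + 2 * h" by (rule dvd_add[OF pd pd])
  have zd: "?t \<otimes> \<sigma> ?t = ?d \<otimes> ?d"
    unfolding z diag_square[OF dp] using diag_eq_iff[OF zp, of "2 * h" "2 * (- h)"] r4 by simp
  have zn: "?t \<otimes> \<sigma> ?t \<noteq> \<one>"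
  proof
    assume "?t \<otimes> \<sigma> ?t = \<one>"
    then have "m dvd 2 * h" unfolding z using diag_eq_one[OF zp] m(2) by simp
    then obtain i where i: "2 * h = m * i" by blast
    have "int q * m = m * (2 * i)" using r4 m(1) i by simp
    then have "int q = 2 * i" using m r_pos by (metis mult.commute mult_cancel_left mult_zero_right of_nat_0_less_iff less_irrefl)
    then show False using assms(2) by presburger
  qed
  \<comment> \<open>For even \<open>p\<close> the sum \<open>a + b\<close>, hence also
    \<open>a - b\<close>, is even, and the exponents can be halved.\<close>
  have sq: "\<exists>a\<in>A. x = a \<otimes> a" if xD: "x \<in> D" for x
  proof -
    obtain a b where ab: "int p dvd a + b" "x = diag (a - b) (b - a)" using xD by (rule D_E)
    have "even (a + b)" using ab(1) assms(1) by (metis dvd_trans even_of_nat)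
    then obtain c where c: "a - b = 2 * c" by (metis even_add even_diff evenE)
    then have c': "b - a = 2 * (- c)" by simp
    have "x = diag c (- c) \<otimes> diag c (- c)" unfolding ab(2) c c' by (subst diag_square) simp_all
    moreover have "diag c (- c) \<in> A" by (rule diag_A) simp
    ultimately show ?thesis by blast
  qed
  have D2: "diag 2 (-2) \<in> D" using D_I[of 1 "-1"] by simp
  show ?thesis
  \<comment> \<open>The square of \<open>diag 2 (-2)\<close> is nontrivial except for
    \<open>r = 4\<close>. There \<open>p = 2\<close> and \<open>q = 1\<close>, and
    \<open>2 |Fix| = |A| = 8\<close>, so the argument for order 16 takes over.\<close>
  proof (cases "r = 4")
    case False
    have "diag 2 (-2) \<otimes> diag 2 (-2) \<noteq> \<one>"
    proof
      assume "diag 2 (-2) \<otimes> diag 2 (-2) = \<one>"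
      then have "int r dvd 8" "m dvd 4" using diag_square[of 2 "-2"] diag_eq_one[of 4 "-4"] m(2) by simp_all
      have "0 \<le> m" unfolding m(2)[symmetric] by simp
      then have "m = 4" using m4 \<open>m dvd 4\<close> zdvd_antisym_nonneg[of m 4] by simp
      then have "int q * 4 dvd 2 * 4" using \<open>int r dvd 8\<close> m(1) by simp
      then have "int q dvd 2" by (simp only: dvd_mult_cancel_right) simp
      then have "q dvd 2" by (metis int_dvd_int_iff of_nat_numeral)
      then have "q = 1 \<or> q = 2" using dvd_imp_le[of q 2] q_pos by auto
      then have "q = 1" using assms(2) by auto
      then have "r = 4" using m \<open>m = 4\<close> by simp
      with False show False by simp
    qed
    from two_card_Fix_less[OF D2 this] show ?thesis
      by (rule no_GIM_type_A[where d = ?d and t = ?t])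
        (use diag_A[OF dp] diag_A[OF tp] diag_inv[OF dp] \<sigma>_diag[OF dp] t2 zd zn sq in auto)
  next
    case True
    have h1: "h = 1" using True r4 by simp
    then have "p2 = 1" unfolding h_def by (simp add: zmult_eq_1_iff)
    then have p2': "p = 2" using p2 by simp
    have "q dvd 4" using q_r True by simp
    then have "coprime q 4 \<Longrightarrow> q = 1" by (metis coprime_common_divisor_nat dvd_refl)
    moreover have "coprime q 4" using assms(2) by (metis coprime_right_2_iff_odd coprime_power_right_iff num_double numeral_times_numeral power2_eq_square)
    ultimately have q1: "q = 1" by blast
    have one: "diag a b = \<one> \<longleftrightarrow> 4 dvd a - b \<and> 4 dvd a" if "even (a + b)" for a b
      using diag_eq_one[of a b] that True p2' q1 by simp
    have eq: "diag a b = diag c d \<longleftrightarrow> 4 dvd (a - c) - (b - d) \<and> 4 dvd a - c" if "even (a + b)" "even (c + d)" for a b c d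
      using diag_eq_iff[of a b c d] that True p2' q1 by simp
    have mult: "diag a b \<otimes> diag c d = diag (a + c) (b + d)" if "even (a + b)" "even (c + d)" for a b c d
      using diag_mult[of a b c d] that p2' by simp
    have Fx: "diag a b \<in> Fix \<longleftrightarrow> 4 dvd a - b" if "even (a + b)" for a b
    proof -
      have "diag a b \<in> Fix \<longleftrightarrow> 4 dvd 2 * (a - b) \<and> 4 dvd a - b"
        using Fix_diag_iff[of a b] that True p2' q1 by simp
      then show ?thesis using dvd_mult by blast
    qed
    have zz: "?t \<otimes> \<sigma> ?t = diag 2 2" using z h1 by simp
    let ?w = "diag 1 1"
    have ww: "?w \<otimes> ?w = diag 2 2" "?w \<otimes> diag 2 2 = diag 3 3" using mult by simp_all
    have d0: "\<one> = diag 0 0" by (rule diag_0[symmetric])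
    have F: "Fix = {\<one>, ?w, diag 2 2, diag 3 3}"
    proof (rule subset_antisym)
      show "Fix \<subseteq> {\<one>, ?w, diag 2 2, diag 3 3}"
      proof
        fix x assume x: "x \<in> Fix"
        obtain a b where ab: "int p dvd a + b" "x = diag a b" using Fix_A[OF x] by (rule A_E)
        have e: "even (a + b)" using ab(1) p2' by simp
        have "4 dvd a - b" using x Fx[OF e] unfolding ab(2) by blast
        then have "(4 dvd (a - 0) - (b - 0) \<and> 4 dvd a - 0) \<or> (4 dvd (a - 1) - (b - 1) \<and> 4 dvd a - 1) \<or>
            (4 dvd (a - 2) - (b - 2) \<and> 4 dvd a - 2) \<or> (4 dvd (a - 3) - (b - 3) \<and> 4 dvd a - 3)" by presburger
        then have "diag a b = diag 0 0 \<or> diag a b = diag 1 1 \<or> diag a b = diag 2 2 \<or> diag a b = diag 3 3"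
          using eq[OF e] by simp
        then show "x \<in> {\<one>, ?w, diag 2 2, diag 3 3}" unfolding ab(2) d0 by blast
      qed
      show "{\<one>, ?w, diag 2 2, diag 3 3} \<subseteq> Fix" using Fx Fix_one by auto
    qed
    have cF: "card Fix = 4"
    proof -
      have "distinct [diag 0 0, diag 1 1, diag 2 2, diag 3 3]" by (simp add: eq)
      then show ?thesis unfolding F d0 by simp
    qed
    have "D = {diag 0 0, diag 2 (-2)}"
    proof (rule subset_antisym)
      show "D \<subseteq> {diag 0 0, diag 2 (-2)}"
      proof
        fix x assume "x \<in> D"
        then obtain a b where x: "int p dvd a + b" "x = diag (a - b) (b - a)" by (rule D_E)
        have e: "even ((a - b) + (b - a))" "even (a + b)" using x(1) p2' by simp_all
        have "(4 dvd ((a - b) - 0) - ((b - a) - 0) \<and> 4 dvd (a - b) - 0) \<or>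
            (4 dvd ((a - b) - 2) - ((b - a) - (-2)) \<and> 4 dvd (a - b) - 2)" using e(2) by presburger
        then show "x \<in> {diag 0 0, diag 2 (-2)}" unfolding x(2) using eq[OF e(1), of 0 0] eq[OF e(1), of 2 "-2"] by simp
      qed
      have "diag 0 0 \<in> D" using D_I[of 0 0] by simp
      then show "{diag 0 0, diag 2 (-2)} \<subseteq> D" using D2 by simp
    qed
    moreover have "diag 0 0 \<noteq> diag 2 (-2)" by (simp add: eq)
    ultimately have cA: "card A = 8" using card_D cF by simp
    show ?thesis
    proof (rule no_GIM_type_A_small[of ?t ?w])
      show "?w \<in> Fix" using F by simp
      show "?w \<otimes> ?w = ?t \<otimes> \<sigma> ?t" unfolding zz ww ..
      show "Fix = {\<one>, ?w, ?t \<otimes> \<sigma> ?t, ?w \<otimes> (?t \<otimes> \<sigma> ?t)}" unfolding zz ww F ..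
    qed (use diag_A[OF tp] t2 zn cF cA in auto)
  qed
qed

text \<open>The nonsquare \<open>e / \<sigma>(e)\<close> comes from exponents \<open>(p, 0)\<close>:
  a square root would make \<open>p\<close> even, because \<open>r / q\<close> is even. The element
  \<open>diag 1 (-1)\<close> of \<open>D\<close> has trivial square only if \<open>r\<close> divides
  4; as 4 divides \<open>r\<close>, this leaves just the excluded \<open>r = 4\<close>.\<close>

theorem no_GIM_odd_even:
  assumes "odd p" "even q" "even (r div q)" "r \<noteq> 4"
  shows "\<not> has_GIM G"
proof (rule no_GIM_type_B)
  let ?m = "int (r div q)"
  have em: "even ?m" using assms(3) by simp
  obtain q2 where q2: "q = 2 * q2" using assms(2) by blast
  have rq: "int r = 2 * (int q2 * ?m)" using qm q2 by simp
  \<comment> \<open>Trivial square gives \<open>r\<close> dividing \<open>2 (a - b)\<close>. As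
    \<open>q\<close> is even, \<open>2 (r / q)\<close> divides \<open>r\<close>, which yields the
    remaining condition modulo \<open>r / q\<close>.\<close>
  show "\<sigma> x = x" if xA: "x \<in> A" and x2: "x \<otimes> x = \<one>" for x
  proof -
    obtain a b where x: "int p dvd a + b" "x = diag a b" using xA by (rule A_E)
    have "int p dvd 2 * a + 2 * b" using x(1) by (metis distrib_left dvd_mult)
    then have "int r dvd 2 * a - 2 * b" using x2 diag_eq_one unfolding x(2) diag_square[OF x(1)] by blast
    then have r2: "int r dvd 2 * (a - b)" by (simp add: right_diff_distrib)
    then have "int q2 * ?m dvd a - b" unfolding rq by (simp only: dvd_mult_cancel_left) simp
    then have "?m dvd a - b" by (rule dvd_mult_right)
    with r2 have "diag a b \<in> Fix" using Fix_diag_iff[OF x(1)] by blast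
    then show ?thesis unfolding x(2) by (rule Fix_\<sigma>)
  qed
  have pp: "int p dvd int p + 0" by simp
  show "diag (int p) 0 \<in> A" by (rule diag_A[OF pp])
  show "b \<otimes> b \<noteq> diag (int p) 0 \<otimes> inv (\<sigma> (diag (int p) 0))" if bA: "b \<in> A" for b
  proof
    obtain c d where b: "int p dvd c + d" "b = diag c d" using bA by (rule A_E)
    have p1: "int p dvd 2 * c + 2 * d" using b(1) by (metis distrib_left dvd_mult)
    have p2: "int p dvd (int p - 0) + (0 - int p)" by simp
    assume "b \<otimes> b = diag (int p) 0 \<otimes> inv (\<sigma> (diag (int p) 0))"
    then have "?m dvd 2 * c - (int p - 0)"
      unfolding b(2) diag_square[OF b(1)] diag_twist[OF pp] diag_eq_iff[OF p1 p2] by blast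
    then have "even (2 * c - (int p - 0))" using em dvd_trans by blast
    then show False using assms(1) by simp
  qed
  have "even r" using assms(2) q_r dvd_trans by blast
  let ?a = "(int p + 1) div 2" and ?b = "(int p - 1) div 2"
  have e: "2 * ?a = int p + 1" "2 * ?b = int p - 1" using assms(1) by (auto elim!: oddE)
  have ab: "?a + ?b = int p" "?a - ?b = 1" "?b - ?a = -1" using e by linarith+
  show "diag 1 (-1) \<in> D" using D_I[of ?a ?b] unfolding ab by simp
  show "diag 1 (-1) \<otimes> diag 1 (-1) \<noteq> \<one>"
  proof
    assume "diag 1 (-1) \<otimes> diag 1 (-1) = \<one>"
    then have "int r dvd 4" using diag_square[of 1 "-1"] diag_eq_one[of 2 "-2"] by simp
    then have r4: "r dvd 4" by (metis int_dvd_int_iff of_nat_numeral)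
    have "r = q * (r div q)" using q_r by simp
    moreover obtain m2 where "r div q = 2 * m2" using assms(3) by blast
    ultimately have "r = 4 * (q2 * m2)" using q2 by simp
    then have "4 dvd r" by simp
    then have "r = 4" using r4 dvd_antisym by blast
    with assms(4) show False by simp
  qed
qed

theorem has_GIM_iff:
  "has_GIM G \<longleftrightarrow> (r, p, q) = (4, 1, 2) \<or> (even p \<longleftrightarrow> even q) \<or>
    (odd p \<and> even q \<and> odd (r div q)) \<or> (even p \<and> odd q \<and> odd (r div p))"
proof (cases "even p \<longleftrightarrow> even q")
  case True
  then show ?thesis using has_GIM_same_parity by blast
next
  case False
  show ?thesis
  proof (cases "even p")
    case True
    then show ?thesis using False has_GIM_even_odd no_GIM_even_odd by auto
  next
    case odd: False
    then have "even q" using False by blast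
    \<comment> \<open>The value \<open>r = 4\<close>, excluded from the second obstruction, leaves
      precisely the exceptional triple.\<close>
    have "p = 1 \<and> q = 2" if "r = 4" "even (r div q)"
    proof -
      have "p dvd 4" "q dvd 4" using p_r q_r that by auto
      then have "p \<in> {1,2,3,4}" "q \<in> {1,2,3,4}" using dvd_imp_le[of p 4] dvd_imp_le[of q 4] p_pos q_pos by auto
      then show ?thesis using that odd \<open>even q\<close> \<open>p dvd 4\<close> by auto
    qed
    then show ?thesis
      using odd \<open>even q\<close> has_GIM_odd_even no_GIM_odd_even has_GIM_4_1_2 by auto
  qed
qed

end

section \<open>Isomorphisms\<close>

locale lattice_pair =
  L: lattice_model G r p q diag s + L': lattice_model G' r q p diag' s'
  for G (structure) and G' r p q diag s diag' s'
begin

text \<open>The linear map descends to an isomorphism of the abelian parts by \<open>kernel\<close>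
  and \<open>surj\<close>. Equivariance under the swap allows the extension by sending
  \<open>s\<close> to \<open>s'\<close>.\<close>

lemma iso_from_lattice:
  fixes f1 f2 :: "int \<Rightarrow> int \<Rightarrow> int"
  assumes add: "\<And>a b c d. int p dvd a + b \<Longrightarrow> int p dvd c + d \<Longrightarrow>
      f1 (a + c) (b + d) = f1 a b + f1 c d \<and> f2 (a + c) (b + d) = f2 a b + f2 c d"
    and swap: "\<And>a b. int p dvd a + b \<Longrightarrow> f1 b a = f2 a b"
    and range: "\<And>a b. int p dvd a + b \<Longrightarrow> int q dvd f1 a b + f2 a b"
    and kernel: "\<And>a b. int p dvd a + b \<Longrightarrow>
      int r dvd f1 a b - f2 a b \<and> int (r div p) dvd f1 a b \<longleftrightarrow> int r dvd a - b \<and> int (r div q) dvd a"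
    and surj: "\<And>c d. int q dvd c + d \<Longrightarrow> \<exists>a b. int p dvd a + b \<and>
      int r dvd (c - f1 a b) - (d - f2 a b) \<and> int (r div p) dvd c - f1 a b"
  shows "G \<cong> G'"
proof -
  define F where "F x = diag' (f1 (fst (L.coords x)) (snd (L.coords x))) (f2 (fst (L.coords x)) (snd (L.coords x)))" for x
  have F: "F (diag a b) = diag' (f1 a b) (f2 a b)" if ab: "int p dvd a + b" for a b
  proof -
    have "F (diag a b) = L.lift (\<lambda>a b. diag' (f1 a b) (f2 a b)) (diag a b)" by (simp add: F_def L.lift_def)
    also have "\<dots> = diag' (f1 a b) (f2 a b)"
    proof (rule L.lift_diag[OF _ ab])
      fix x y c d assume *: "int p dvd x + y" "int p dvd c + d" "int r dvd x - y" "int (r div q) dvd x"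
      have s: "int p dvd (x + c) + (y + d)" using dvd_add[OF *(1,2)] by (simp add: algebra_simps)
      have k: "int r dvd f1 x y - f2 x y" "int (r div p) dvd f1 x y" using kernel[OF *(1)] *(3,4) by blast+
      have "f1 (x + c) (y + d) - f1 c d = f1 x y" "f2 (x + c) (y + d) - f2 c d = f2 x y"
        using add[OF *(1,2)] by simp_all
      then show "diag' (f1 (x + c) (y + d)) (f2 (x + c) (y + d)) = diag' (f1 c d) (f2 c d)"
        unfolding L'.diag_eq_iff[OF range[OF s] range[OF *(2)]] using k by simp
    qed
    finally show ?thesis .
  qed
  have FA: "F x \<in> L'.A" if xA: "x \<in> L.A" for x
  proof -
    obtain a b where x: "int p dvd a + b" "x = diag a b" using xA by (rule L.A_E)
    show ?thesis unfolding x(2) F[OF x(1)] by (rule L'.diag_A[OF range[OF x(1)]])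
  qed
  have F_mult: "F (x \<otimes> y) = F x \<otimes>\<^bsub>G'\<^esub> F y" if xy: "x \<in> L.A" "y \<in> L.A" for x y
  proof -
    obtain a b where x: "int p dvd a + b" "x = diag a b" using xy(1) by (rule L.A_E)
    obtain c d where y: "int p dvd c + d" "y = diag c d" using xy(2) by (rule L.A_E)
    have s: "int p dvd (a + c) + (b + d)" using dvd_add[OF x(1) y(1)] by (simp add: algebra_simps)
    show ?thesis
      unfolding x(2) y(2) L.diag_mult[OF x(1) y(1)] F[OF x(1)] F[OF y(1)] F[OF s]
        L'.diag_mult[OF range[OF x(1)] range[OF y(1)]] using add[OF x(1) y(1)] by simp
  qed
  have F_\<sigma>: "F (L.\<sigma> x) = L'.\<sigma> (F x)" if xA: "x \<in> L.A" for x
  proof -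
    obtain a b where x: "int p dvd a + b" "x = diag a b" using xA by (rule L.A_E)
    show ?thesis
      unfolding x(2) L.\<sigma>_diag[OF x(1)] F[OF x(1)] F[OF L.swap_dvd[OF x(1)]] L'.\<sigma>_diag[OF range[OF x(1)]]
        swap[OF x(1)] swap[OF L.swap_dvd[OF x(1)], symmetric] ..
  qed
  have F_one: "F x = \<one>\<^bsub>G'\<^esub> \<longleftrightarrow> x = \<one>" if xA: "x \<in> L.A" for x
  proof -
    obtain a b where x: "int p dvd a + b" "x = diag a b" using xA by (rule L.A_E)
    show ?thesis
      unfolding x(2) F[OF x(1)] L'.diag_eq_one[OF range[OF x(1)]] L.diag_eq_one[OF x(1)] by (rule kernel[OF x(1)])
  qed
  have F_inj: "x = y" if xy: "x \<in> L.A" "y \<in> L.A" "F x = F y" for x y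
  proof -
    have "F (inv y) \<otimes>\<^bsub>G'\<^esub> F y = \<one>\<^bsub>G'\<^esub>"
      using xy F_mult[of "inv y" y] F_one[of \<one>] by simp
    then have "F (inv y \<otimes> x) = \<one>\<^bsub>G'\<^esub>" using xy F_mult[of "inv y" x] by simp
    then have "inv y \<otimes> x = \<one>" using F_one xy by simp
    then show ?thesis using xy by (metis L.A_carrier L.inv_A L.inv_equality L.inv_inv)
  qed
  have F_surj: "\<exists>x\<in>L.A. F x = y" if yA: "y \<in> L'.A" for y
  proof -
    obtain c d where y: "int q dvd c + d" "y = diag' c d" using yA by (rule L'.A_E)
    obtain a b where ab: "int p dvd a + b" "int r dvd (c - f1 a b) - (d - f2 a b)" "int (r div p) dvd c - f1 a b"
      using surj[OF y(1)] by blast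
    have "diag' c d = F (diag a b)"
      unfolding F[OF ab(1)] L'.diag_eq_iff[OF y(1) range[OF ab(1)]] using ab by blast
    then show ?thesis using L.diag_A[OF ab(1)] y(2) by metis
  qed
  define h where "h g = (if g \<in> L.A then F g else F (g \<otimes> s) \<otimes>\<^bsub>G'\<^esub> s')" for g
  have hA: "h a = F a" "h (a \<otimes> s) = F a \<otimes>\<^bsub>G'\<^esub> s'" if "a \<in> L.A" for a
    using that L.as_notin by (simp_all add: h_def)
  have h_carrier: "h g \<in> carrier G'" if "g \<in> carrier G" for g
    using that by (cases rule: L.cover_cases) (simp_all add: hA FA L'.swap_carrier)
  have h_mult: "h (x \<otimes> y) = h x \<otimes>\<^bsub>G'\<^esub> h y" if x: "x \<in> carrier G" and y: "y \<in> carrier G" for x y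
    using x
  proof (cases rule: L.cover_cases)
    case base
    note x = this
    from y show ?thesis
      by (cases rule: L.cover_cases) (simp_all add: x hA F_mult FA L.a_bs L'.a_bs)
  next
    case (outer a)
    note x = this
    from y show ?thesis
      by (cases rule: L.cover_cases)
        (simp_all add: x hA F_mult F_\<sigma> FA L.as_b L.as_bs L'.as_b L'.as_bs)
  qed
  have "bij_betw h (carrier G) (carrier G')"
    unfolding bij_betw_def
  proof
    show "inj_on h (carrier G)"
    proof (rule inj_onI)
      fix x y assume x: "x \<in> carrier G" and y: "y \<in> carrier G" and eq: "h x = h y"
      from x show "x = y"
      proof (cases rule: L.cover_cases)
        case base
        note x = this
        from y show ?thesis
        proof (cases rule: L.cover_cases)
          case base
          then show ?thesis using x eq F_inj by (simp add: hA)
        next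
          case (outer b)
          then have "F b \<otimes>\<^bsub>G'\<^esub> s' \<in> L'.A" using x eq FA by (metis hA)
          then show ?thesis using L'.as_notin[OF FA[OF outer(1)]] by blast
        qed
      next
        case (outer a)
        note x = this
        from y show ?thesis
        proof (cases rule: L.cover_cases)
          case base
          then have "F a \<otimes>\<^bsub>G'\<^esub> s' \<in> L'.A" using x eq FA by (metis hA)
          then show ?thesis using L'.as_notin[OF FA[OF x(1)]] by blast
        next
          case (outer b)
          then have "F a = F b" using x eq FA L'.outer_eq_iff by (simp add: hA)
          then show ?thesis using x outer F_inj by simp
        qed
      qed
    qed
    show "h ` carrier G = carrier G'"
    proof
      show "carrier G' \<subseteq> h ` carrier G"
      proof
        fix y assume "y \<in> carrier G'"
        then show "y \<in> h ` carrier G"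
        proof (cases rule: L'.cover_cases)
          case base
          then obtain x where "x \<in> L.A" "F x = y" using F_surj by blast
          then show ?thesis using hA(1) by (metis L.A_carrier image_eqI)
        next
          case (outer b)
          then obtain x where x: "x \<in> L.A" "F x = b" using F_surj by blast
          then have "h (x \<otimes> s) = y" using hA(2) outer by simp
          moreover have "x \<otimes> s \<in> carrier G" using x by simp
          ultimately show ?thesis by blast
        qed
      qed
    qed (use h_carrier in blast)
  qed
  then have "h \<in> iso G G'" using h_carrier h_mult by (auto simp: iso_def hom_def)
  then show ?thesis by (auto simp: is_iso_def)
qed

text \<open>The map is the one behind the pairing for equal parity: it preserves
  \<open>a - b\<close> and multiplies the sum by \<open>q / p\<close>.\<close>

lemma iso_same_parity:
  assumes par: "even p \<longleftrightarrow> even q"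
  shows "G \<cong> G'"
proof -
  define Y where "Y a b = (a + b) div int p" for a b :: int
  have Y: "a + b = int p * Y a b" if "int p dvd a + b" for a b using that by (simp add: Y_def)
  have Yadd: "Y (a + a') (b + b') = Y a b + Y a' b'" if "int p dvd a + b" "int p dvd a' + b'" for a b a' b'
    using L.div_add_p[OF that] by (simp add: Y_def)
  have Ysw: "Y b a = Y a b" for a b by (simp add: Y_def add.commute)
  have pq: "even (int p + int q)" "even (int q + int p)" using par by simp_all
  have ev: "even ((c - d) + int q * Y c d)" if "int p dvd c + d" for c d
  proof -
    have eqn: "(c - d) + int q * Y c d = (int p + int q) * Y c d - 2 * d"
      using Y[OF that] by (simp add: algebra_simps)
    show ?thesis unfolding eqn using pq by (intro dvd_diff dvd_mult2 dvd_triv_left)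
  qed
  define f1 where "f1 a b = ((a - b) + int q * Y a b) div 2" for a b
  have f1: "2 * f1 a b = (a - b) + int q * Y a b" if "int p dvd a + b" for a b
    unfolding f1_def by (rule dvd_mult_div_cancel[OF ev[OF that]])
  have f2: "2 * f1 b a = (b - a) + int q * Y a b" if "int p dvd a + b" for a b
    using f1[OF L.swap_dvd[OF that]] by (simp add: Ysw[of b a])
  show ?thesis
  proof (rule iso_from_lattice[of f1 "\<lambda>a b. f1 b a"])
    fix a b c d assume *: "int p dvd a + b" "int p dvd c + d"
    have s: "int p dvd (a + c) + (b + d)" using dvd_add[OF *] by (simp add: algebra_simps)
    have "2 * f1 (a + c) (b + d) = 2 * (f1 a b + f1 c d)" "2 * f1 (b + d) (a + c) = 2 * (f1 b a + f1 d c)"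
      unfolding distrib_left f1[OF s] f1[OF *(1)] f1[OF *(2)] f2[OF s] f2[OF *(1)] f2[OF *(2)] Yadd[OF *]
      by (simp_all add: algebra_simps)
    then show "f1 (a + c) (b + d) = f1 a b + f1 c d \<and> f1 (b + d) (a + c) = f1 b a + f1 d c" by simp
  next
    fix a b assume ab: "int p dvd a + b"
    have diff: "f1 a b - f1 b a = a - b" and sum: "f1 a b + f1 b a = int q * Y a b"
      using f1[OF ab] f2[OF ab] by linarith+
    then show "int q dvd f1 a b + f1 b a" by simp
    let ?m = "int (r div q)" and ?n = "int (r div p)"
    have "?n dvd f1 a b \<longleftrightarrow> ?m dvd a" if r: "int r dvd a - b"
    proof -
      obtain k where k: "a - b = int r * k" using r by blast
      \<comment> \<open>Scaling the two divisibility conditions by \<open>2 p\<close> and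
        \<open>2 q\<close> brings both to the modulus \<open>2 r\<close>. They then differ by
        \<open>r (p - q) k\<close>, a multiple of \<open>2 r\<close>.\<close>
      have 1: "?n dvd f1 a b \<longleftrightarrow> int r * 2 dvd (int p * int q) * Y a b + int p * int r * k"
      proof -
        have "?n dvd f1 a b \<longleftrightarrow> int p * 2 * ?n dvd int p * 2 * f1 a b" using L.p_pos by simp
        also have "int p * 2 * f1 a b = (int p * int q) * Y a b + int p * int r * k"
          using f1[OF ab] k by (simp add: algebra_simps)
        also have "int p * 2 * ?n = int r * 2" using L'.qm by simp
        finally show ?thesis .
      qed
      have 2: "?m dvd a \<longleftrightarrow> int r * 2 dvd (int p * int q) * Y a b + int q * int r * k"
      proof -
        have "?m dvd a \<longleftrightarrow> int q * 2 * ?m dvd int q * 2 * a" using L.q_pos by simp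
        also have "int q * 2 * a = int q * ((a + b) + (a - b))" by simp
        also have "\<dots> = (int p * int q) * Y a b + int q * int r * k"
          unfolding Y[OF ab] k by (simp add: algebra_simps)
        also have "int q * 2 * ?m = int r * 2" using L.qm by simp
        finally show ?thesis .
      qed
      have "2 dvd int p - int q" using par by simp
      then have "int r * 2 dvd int r * (int p - int q) * k" by (intro dvd_mult2 mult_dvd_mono) simp_all
      moreover have "(int p * int q) * Y a b + int p * int r * k =
          ((int p * int q) * Y a b + int q * int r * k) + int r * (int p - int q) * k"
        by (simp add: algebra_simps)
      ultimately show ?thesis unfolding 1 2 by (metis dvd_add_left_iff)
    qed
    then show "int r dvd f1 a b - f1 b a \<and> ?n dvd f1 a b \<longleftrightarrow> int r dvd a - b \<and> ?m dvd a"
      unfolding diff by blast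
  next
    fix c d assume cd: "int q dvd c + d"
    define y where "y = (c + d) div int q"
    have y: "c + d = int q * y" using cd by (simp add: y_def)
    have e: "even ((c - d) + int p * y)"
    proof -
      have eqn: "(c - d) + int p * y = (int q + int p) * y - 2 * d" using y by (simp add: algebra_simps)
      show ?thesis unfolding eqn using pq by (intro dvd_diff dvd_mult2 dvd_triv_left)
    qed
    define a where "a = ((c - d) + int p * y) div 2"
    have a2: "2 * a = (c - d) + int p * y" unfolding a_def by (rule dvd_mult_div_cancel[OF e])
    define b where "b = a - (c - d)"
    have ab: "a + b = int p * y" "a - b = c - d" using a2 by (simp_all add: b_def)
    then have d: "int p dvd a + b" by simp
    have "Y a b = y" unfolding Y_def ab using L.p_pos by simp
    then have "f1 a b = c" "f1 b a = d" using f1[OF d] f2[OF d] ab y by simp_all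
    then show "\<exists>a b. int p dvd a + b \<and> int r dvd (c - f1 a b) - (d - f1 b a) \<and> int (r div p) dvd c - f1 a b"
      using d by (intro exI[of _ a] exI[of _ b]) simp
  qed simp
qed

text \<open>The map of the equal parity case would leave the lattice, so its double is used; the
  oddness of \<open>r / q\<close> keeps it bijective modulo the relations.\<close>

lemma iso_odd_even:
  assumes "odd p" "even q" "odd (r div q)"
  shows "G \<cong> G'"
proof -
  \<comment> \<open>With \<open>p\<close> odd the condition \<open>p q\<close> dividing
    \<open>2 r\<close> loses its 2, so that \<open>r = p q m\<close> with \<open>m\<close>
    odd.\<close>
  have pdm: "p dvd r div q"
  proof -
    have "p * q dvd 2 * (q * (r div q))" using L.pq_r L.q_r by simp
    then have "q * p dvd q * (2 * (r div q))" by (simp only: mult.left_commute mult.commute[of p q])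
    then have "p dvd 2 * (r div q)" using L.q_pos by simp
    moreover have "coprime p 2" using assms(1) by simp
    ultimately show ?thesis using coprime_dvd_mult_right_iff by blast
  qed
  then obtain m' where m': "r div q = p * m'" by blast
  define m where "m = int m'"
  have odd_m: "odd m" using assms(3) unfolding m' m_def by simp
  have rm: "int r = int q * (int p * m)" using L.qm m' m_def by simp
  have rq: "int (r div q) = int p * m" using m' m_def by simp
  have rp: "int (r div p) = int q * m"
  proof -
    have "int p * int (r div p) = int p * (int q * m)" unfolding L'.qm[symmetric] rm by (rule mult.left_commute)
    then have "int p = 0 \<or> int (r div p) = int q * m" by (simp only: mult_cancel_left)
    moreover have "int p \<noteq> 0" using L.p_pos by simp
    ultimately show ?thesis by blast
  qed
  define Y where "Y a b = (a + b) div int p" for a b :: int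
  have Y: "a + b = int p * Y a b" if "int p dvd a + b" for a b using that by (simp add: Y_def)
  have Yadd: "Y (a + a') (b + b') = Y a b + Y a' b'" if "int p dvd a + b" "int p dvd a' + b'" for a b a' b'
    using L.div_add_p[OF that] by (simp add: Y_def)
  have Ysw: "Y b a = Y a b" for a b by (simp add: Y_def add.commute)
  define f where "f a b = (a - b) + int q * Y a b" for a b
  obtain q2 where q2: "int q = 2 * q2" using assms(2) by (metis even_of_nat evenE)
  obtain p2 where p2: "int p = 2 * p2 + 1" using assms(1) by (metis even_of_nat oddE)
  have cop: "coprime (int p * m) 2" using assms(1) odd_m by simp
  have q0: "int q \<noteq> 0" "int p \<noteq> 0" "m \<noteq> 0" using L.q_pos L.p_pos odd_m by auto
  show ?thesis
  proof (rule iso_from_lattice[of f "\<lambda>a b. f b a"])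
    fix a b c d assume *: "int p dvd a + b" "int p dvd c + d"
    have s: "int p dvd b + a" "int p dvd d + c" using * by (simp_all add: add.commute)
    show "f (a + c) (b + d) = f a b + f c d \<and> f (b + d) (a + c) = f b a + f d c"
      unfolding f_def Yadd[OF *] Yadd[OF s] by (simp add: algebra_simps)
  next
    fix a b assume ab: "int p dvd a + b"
    have diff: "f a b - f b a = 2 * (a - b)" and sum: "f a b + f b a = int q * (2 * Y a b)"
      unfolding f_def Ysw[of b a] by (simp_all add: algebra_simps)
    show "int q dvd f a b + f b a" unfolding sum by simp
    show "int r dvd f a b - f b a \<and> int (r div p) dvd f a b \<longleftrightarrow> int r dvd a - b \<and> int (r div q) dvd a"
      unfolding diff rp rq
    proof
      assume l: "int r dvd 2 * (a - b) \<and> int q * m dvd f a b"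
      have "int q dvd (a - b) + int q * Y a b" using l unfolding f_def by (metis dvd_mult_left)
      then have "int q dvd a - b" by (simp add: dvd_add_left_iff)
      then obtain x where x: "a - b = int q * x" by blast
      have "int q * (int p * m) dvd int q * (2 * x)" using l unfolding x rm by (simp add: mult_ac)
      then have "int p * m dvd 2 * x" using q0 by simp
      then have pmx: "int p * m dvd x" using cop coprime_dvd_mult_right_iff by blast
      then have r1: "int r dvd a - b" unfolding x rm by (rule mult_dvd_mono[OF dvd_refl])
      have "int q * m dvd int q * (x + Y a b)" using l unfolding f_def x by (simp add: algebra_simps)
      then have "m dvd x + Y a b" using q0 by simp
      moreover have "m dvd x" using pmx by (rule dvd_mult_right)
      ultimately have "m dvd Y a b" using dvd_add_right_iff by blast
      then have "int p * m dvd a + b" unfolding Y[OF ab] by (rule mult_dvd_mono[OF dvd_refl])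
      moreover have "int p * m dvd a - b" using pmx unfolding x by (rule dvd_mult)
      ultimately have "int p * m dvd (a + b) + (a - b)" by (rule dvd_add)
      then have "int p * m dvd 2 * a" by simp
      then have "int p * m dvd a" using cop coprime_dvd_mult_right_iff by blast
      with r1 show "int r dvd a - b \<and> int p * m dvd a" by blast
    next
      assume rr: "int r dvd a - b \<and> int p * m dvd a"
      have ab': "int p * m dvd a - b" using rr unfolding rm by (meson dvd_mult_right)
      have "int p * m dvd 2 * a - (a - b)" by (rule dvd_diff[OF dvd_mult[OF conjunct2[OF rr]] ab'])
      then have "int p * m dvd int p * Y a b" using Y[OF ab] by simp
      then have "m dvd Y a b" using q0 by simp
      then have 1: "int q * m dvd int q * Y a b" by (rule mult_dvd_mono[OF dvd_refl])
      have "int q * m dvd int r" unfolding rm by (intro mult_dvd_mono) simp_all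
      then have "int q * m dvd a - b" using rr dvd_trans by blast
      then have "int q * m dvd f a b" unfolding f_def using 1 by (rule dvd_add)
      then show "int r dvd 2 * (a - b) \<and> int q * m dvd f a b"
        using dvd_mult[OF conjunct1[OF rr]] by blast
    qed
  next
    fix c d assume cd: "int q dvd c + d"
    define v where "v = (c + d) div int q"
    have v: "c + d = int q * v" using cd by (simp add: v_def)
    have "even (c + d)" unfolding v q2 by simp
    then have "even (c - d)" by presburger
    then obtain u where u: "c - d = 2 * u" by blast
    text \<open>Since \<open>m\<close> and \<open>p\<close> are odd, \<open>(u, v)\<close> and \<open>(u + r/2, v + m)\<close> describe the same class;
      hence \<open>v\<close> may be assumed even.\<close>
    define \<epsilon> where "\<epsilon> = v mod 2"
    define x where "x = u + \<epsilon> * (q2 * (int p * m))"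
    obtain w where w: "v + \<epsilon> * m = 2 * w"
    proof -
      have "even (v + v mod 2 * m)" using odd_m by (simp add: even_mod_2_iff)
      then show ?thesis using that unfolding \<epsilon>_def by blast
    qed
    \<comment> \<open>Adding the odd number \<open>m\<close> where necessary makes
      \<open>x + y\<close> even without changing \<open>w\<close> modulo \<open>m\<close>. Then
      \<open>a - b = x\<close> and \<open>a + b = p y\<close> are solvable in integers.\<close>
    define y where "y = w + (if even (x + w) then 0 else m)"
    have "even (x + y)" using odd_m by (simp add: y_def)
    then have "even (x + (2 * p2 + 1) * y)" by simp
    then have "even (x + int p * y)" unfolding p2 .
    then obtain a where a: "x + int p * y = 2 * a" by blast
    define b where "b = a - x"
    have ab: "a + b = int p * y" "a - b = x" using a by (simp_all add: b_def)
    then have dv: "int p dvd a + b" by simp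
    have Yab: "Y a b = y" unfolding Y_def ab using q0 by simp
    have fa: "f a b = x + int q * y" and fb: "f b a = - x + int q * y"
      unfolding f_def Ysw[of b a] Yab using ab by simp_all
    have "(c - f a b) - (d - f b a) = (c - d) - 2 * x" unfolding fa fb by simp
    also have "\<dots> = int r * (- \<epsilon>)" unfolding u x_def rm q2 by (simp add: algebra_simps)
    finally have g1: "int r dvd (c - f a b) - (d - f b a)" by simp
    have c2: "c = u + q2 * v" using u v q2 by simp
    have vw: "v = 2 * w - \<epsilon> * m" using w by simp
    have "c - f a b = (u + q2 * v) - (u + \<epsilon> * (q2 * (int p * m))) - int q * y"
      unfolding fa c2 x_def by simp
    also have "\<dots> = int q * (w - y) - \<epsilon> * (q2 * m * (1 + int p))"
      unfolding vw q2 by (simp add: algebra_simps)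
    also have "\<dots> = int q * (w - y) - int q * m * (\<epsilon> * (p2 + 1))" unfolding p2 q2 by (simp add: algebra_simps)
    finally have e: "c - f a b = int q * (w - y) - int q * m * (\<epsilon> * (p2 + 1))" .
    have "m dvd w - y" by (simp add: y_def)
    then have "int q * m dvd int q * (w - y)" by (rule mult_dvd_mono[OF dvd_refl])
    then have "int (r div p) dvd c - f a b" unfolding rp e by (intro dvd_diff) simp_all
    with dv g1 show "\<exists>a b. int p dvd a + b \<and> int r dvd (c - f a b) - (d - f b a) \<and> int (r div p) dvd c - f a b"
      by blast
  qed simp
qed

text \<open>The two groups differ in their number of central elements \<open>z\<close> with \<open>z\<^sup>2 = 1\<close>.\<close>

lemma not_iso:
  assumes "even p" "odd q" "even (r div p)"
  shows "\<not> G \<cong> G'"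
proof
  assume "G \<cong> G'"
  then obtain h0 where h0: "h0 \<in> iso G G'" by (auto simp: is_iso_def)
  define h where "h = inv_into (carrier G) h0"
  have h: "h \<in> iso G' G" unfolding h_def using L.iso_set_sym[OF h0] .
  then have hm: "h (x \<otimes>\<^bsub>G'\<^esub> y) = h x \<otimes> h y" if "x \<in> carrier G'" "y \<in> carrier G'" for x y
    using that by (auto simp: iso_def hom_def)
  have hbij: "bij_betw h (carrier G') (carrier G)" using h by (simp add: iso_def)
  have hc: "h x \<in> carrier G" if "x \<in> carrier G'" for x using hbij that by (auto simp: bij_betw_def)
  obtain k where k: "r div p = 2 * k" using assms(3) by blast
  obtain P where P: "p = 2 * P" using assms(1) by blast
  have rk: "r = p * (2 * k)" using k L.p_r by (metis dvd_mult_div_cancel)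
  define n where "n = int (r div p)"
  have n: "n = 2 * int k" "int r = int p * n" using k L'.qm by (simp_all add: n_def)
  have "n \<noteq> 0"
  proof
    assume "n = 0"
    then have "int r = 0" using n(2) by simp
    then show False using L.r_pos by simp
  qed
  then have n0: "n \<noteq> 0" "int k \<noteq> 0" using n(1) by simp_all
  have qk: "q dvd k"
  proof -
    have "p * q dvd 2 * (p * (2 * k))" using L.pq_r rk by simp
    then have "p * q dvd p * (4 * k)" by simp
    then have "q dvd 4 * k" using L.p_pos by simp
    moreover have "coprime q 4" using assms(2)
      by (metis coprime_right_2_iff_odd coprime_power_right_iff num_double numeral_times_numeral power2_eq_square)
    ultimately show ?thesis using coprime_dvd_mult_right_iff by blast
  qed
  define H where "H = int P * n"
  have rH: "int r = 2 * H" using n P by (simp add: H_def)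
  have qH: "int q dvd H" using qk by (simp add: H_def n)
  have qk': "int q dvd int k" using qk by simp
  \<comment> \<open>\<open>H\<close> is \<open>r / 2\<close> and \<open>k\<close> is
    \<open>r / (2 p)\<close>. \<open>?z1\<close> is the class of the entries -1, 1, central because
    -1 lies in the scalar subgroup of even order \<open>p\<close>; \<open>?z2\<close> is a scalar
    whose square generates that subgroup.\<close>
  let ?z1 = "diag' H 0" and ?z2 = "diag' (int k) (int k)"
  have d1: "int q dvd H + 0" "int q dvd int k + int k" using qH qk' by simp_all
  have F: "?z1 \<in> L'.Fix" "?z2 \<in> L'.Fix"
    unfolding L'.Fix_diag_iff[OF d1(1)] L'.Fix_diag_iff[OF d1(2)] n_def[symmetric] using rH by (simp_all add: H_def)
  have sq: "?z1 \<otimes>\<^bsub>G'\<^esub> ?z1 = \<one>\<^bsub>G'\<^esub>" "?z2 \<otimes>\<^bsub>G'\<^esub> ?z2 = \<one>\<^bsub>G'\<^esub>"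
  proof -
    have e: "int q dvd 2 * H + 2 * 0" "int q dvd 2 * int k + 2 * int k" using qH qk' by simp_all
    show "?z1 \<otimes>\<^bsub>G'\<^esub> ?z1 = \<one>\<^bsub>G'\<^esub>" "?z2 \<otimes>\<^bsub>G'\<^esub> ?z2 = \<one>\<^bsub>G'\<^esub>"
      unfolding L'.diag_square[OF d1(1)] L'.diag_square[OF d1(2)] L'.diag_eq_one[OF e(1)] L'.diag_eq_one[OF e(2)]
        n_def[symmetric]
    proof -
      have "int r dvd 2 * H - 2 * 0" using rH by simp
      moreover have "n dvd 2 * H" unfolding H_def by simp
      ultimately show "int r dvd 2 * H - 2 * 0 \<and> n dvd 2 * H" ..
      have "n dvd 2 * int k" using n(1) by simp
      then show "int r dvd 2 * int k - 2 * int k \<and> n dvd 2 * int k" by simp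
    qed
  qed
  have nk: "\<not> n dvd int k"
  proof
    assume "n dvd int k"
    then have "n \<le> int k" using n0 by (intro zdvd_imp_le) simp_all
    then show False using n n0 by simp
  qed
  have "H > 0" using rH L.r_pos by simp
  have nH: "\<not> int r dvd H"
  proof
    assume "int r dvd H"
    then have "int r \<le> H" using \<open>H > 0\<close> by (intro zdvd_imp_le)
    then show False using rH \<open>H > 0\<close> by simp
  qed
  have ne: "?z1 \<noteq> \<one>\<^bsub>G'\<^esub>" "?z2 \<noteq> \<one>\<^bsub>G'\<^esub>" "?z1 \<noteq> ?z2"
    unfolding L'.diag_eq_one[OF d1(1)] L'.diag_eq_one[OF d1(2)] L'.diag_eq_iff[OF d1] n_def[symmetric]
    using nH nk by simp_all
  let ?m = "int (r div q)"
  have central: "c \<otimes>\<^bsub>G'\<^esub> g = g \<otimes>\<^bsub>G'\<^esub> c" if "c \<in> L'.Fix" "g \<in> carrier G'" for c g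
    using that(2) by (cases rule: L'.cover_cases) (use that(1) in \<open>simp_all add: L'.commA L'.as_b L'.a_bs\<close>)
  \<comment> \<open>In \<open>G\<close> there is at most one such element. For odd \<open>q\<close>
    the central elements are classes of scalars, and \<open>r / q\<close> dividing
    \<open>2 a\<close> but not \<open>a\<close> determines \<open>a\<close> modulo
    \<open>r / q\<close>.\<close>
  have two: "x = y" if x: "x \<in> carrier G" "\<And>g. g \<in> carrier G \<Longrightarrow> x \<otimes> g = g \<otimes> x" "x \<otimes> x = \<one>" "x \<noteq> \<one>"
    and y: "y \<in> carrier G" "\<And>g. g \<in> carrier G \<Longrightarrow> y \<otimes> g = g \<otimes> y" "y \<otimes> y = \<one>" "y \<noteq> \<one>" for x y
  proof -
    have m4: "4 dvd ?m"
    proof -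
      have "int q * ?m = 4 * (int P * int k)" using L.qm rk P by simp
      then have "4 dvd int q * ?m" by simp
      moreover have "coprime 4 (int q)" using assms(2) by (metis coprime_left_2_iff_odd coprime_power_left_iff even_of_nat num_double numeral_times_numeral power2_eq_square)
      ultimately show ?thesis using coprime_dvd_mult_right_iff by blast
    qed
    have cent: "\<exists>a. int p dvd 2 * a \<and> z = diag a a \<and> ?m dvd 2 * a \<and> \<not> ?m dvd a"
      if z: "z \<in> carrier G" "\<And>g. g \<in> carrier G \<Longrightarrow> z \<otimes> g = g \<otimes> z" "z \<otimes> z = \<one>" "z \<noteq> \<one>" for z
    proof -
      from z(1) have "z \<in> L.A"
      proof (cases rule: L.cover_cases)
        \<comment> \<open>Commuting with \<open>?u\<close> would force \<open>?u\<close> to be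
          \<sigma>-invariant, so that \<open>r / q\<close>, a multiple of 4, would divide 2.\<close>
        case (outer c)
        let ?u = "diag 1 (-1)"
        have u: "?u \<in> L.A" "L.\<sigma> ?u = diag (-1) 1" by (simp_all add: L.diag_A L.\<sigma>_diag)
        have "c \<otimes> s \<otimes> ?u = ?u \<otimes> (c \<otimes> s)" using z(2)[of ?u] u outer by simp
        then have "c \<otimes> L.\<sigma> ?u = ?u \<otimes> c" using outer(1) u(1) by (simp add: L.as_b L.a_bs)
        then have "L.\<sigma> ?u = ?u" using outer(1) u(1) by (simp add: L.commA[of ?u c])
        then have "diag (-1) 1 = diag 1 (-1)" using u by simp
        then have "?m dvd -1 - 1" using L.diag_eq_iff[of "-1" 1 1 "-1"] by simp
        with m4 have "(4::int) dvd -1 - 1" by (rule dvd_trans)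
        then show ?thesis by simp
      qed
      then obtain a b where ab: "int p dvd a + b" "z = diag a b" by (rule L.A_E)
      have "L.\<sigma> z = z"
        unfolding L.\<sigma>_def z(2)[OF L.s_carr, symmetric] using \<open>z \<in> L.A\<close> by (rule L.as_s)
      then have "z \<in> L.Fix" using \<open>z \<in> L.A\<close> L.FixI by blast
      then have F: "int r dvd 2 * (a - b)" "?m dvd a - b" unfolding ab(2) L.Fix_diag_iff[OF ab(1)] by blast+
      obtain j where j: "a - b = ?m * j" using F(2) by blast
      have "?m * int q dvd ?m * (2 * j)" using F(1) unfolding L.qm j by (simp add: mult_ac)
      then have "int q dvd 2 * j" using L.m_pos by simp
      moreover have "coprime (int q) 2" using assms(2) by simp
      ultimately have "int q dvd j" using coprime_dvd_mult_right_iff by blast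
      then have "?m * int q dvd ?m * j" by (rule mult_dvd_mono[OF dvd_refl])
      then have rab: "int r dvd a - b" unfolding j L.qm by (simp only: mult.commute)
      have "int p dvd int r" using L.p_r by simp
      then have "int p dvd a - b" using rab by (rule dvd_trans)
      with ab(1) have "int p dvd (a + b) + (a - b)" by (rule dvd_add)
      then have p2: "int p dvd 2 * a" "int p dvd a + a" by simp_all
      have "int r dvd (a - a) - (b - a)" using rab by simp
      then have za: "z = diag a a" unfolding ab(2) L.diag_eq_iff[OF ab(1) p2(2)] by simp
      have "int p dvd 2 * a + 2 * a" by (rule dvd_add[OF p2(1) p2(1)])
      then have "?m dvd 2 * a" using z(3) unfolding za L.diag_square[OF p2(2)] using L.diag_eq_one by blast
      moreover have "\<not> ?m dvd a" using z(4) unfolding za L.diag_eq_one[OF p2(2)] by simp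
      ultimately show ?thesis using p2 za by blast
    qed
    obtain a where a: "int p dvd 2 * a" "x = diag a a" "?m dvd 2 * a" "\<not> ?m dvd a" using cent[OF x] by blast
    obtain b where b: "int p dvd 2 * b" "y = diag b b" "?m dvd 2 * b" "\<not> ?m dvd b" using cent[OF y] by blast
    have "2 dvd (4::int)" by simp
    then have "2 dvd ?m" using m4 by (rule dvd_trans)
    then obtain m2 where m2: "?m = 2 * m2" by (rule dvdE)
    \<comment> \<open>Both exponents are odd multiples of half of \<open>r / q\<close>, so they
      agree modulo \<open>r / q\<close>.\<close>
    have "m2 dvd a" "m2 dvd b" using a(3) b(3) unfolding m2 by simp_all
    then obtain i j where ij: "a = m2 * i" "b = m2 * j" unfolding dvd_def by blast
    have "odd i" "odd j" using a(4) b(4) unfolding m2 ij by auto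
    then have "even (i - j)" by simp
    then have "?m dvd a - b" unfolding m2 ij
      by (metis dvd_refl mult.commute mult_dvd_mono right_diff_distrib)
    then show ?thesis
      unfolding a(2) b(2) using L.diag_eq_iff[of a a b b] a(1) b(1) by simp
  qed
  have hone: "h \<one>\<^bsub>G'\<^esub> = \<one>" using hm[of "\<one>\<^bsub>G'\<^esub>" "\<one>\<^bsub>G'\<^esub>"] hc[of "\<one>\<^bsub>G'\<^esub>"] L.l_cancel_one by simp
  have hinj: "h x = h y \<longleftrightarrow> x = y" if "x \<in> carrier G'" "y \<in> carrier G'" for x y
    using hbij that by (auto simp: bij_betw_def inj_on_def)
  have img: "h z \<in> carrier G" "\<And>g. g \<in> carrier G \<Longrightarrow> h z \<otimes> g = g \<otimes> h z" "h z \<otimes> h z = \<one>" "h z \<noteq> \<one>"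
    if z: "z \<in> L'.Fix" "z \<otimes>\<^bsub>G'\<^esub> z = \<one>\<^bsub>G'\<^esub>" "z \<noteq> \<one>\<^bsub>G'\<^esub>" for z
  proof -
    have zc: "z \<in> carrier G'" using z(1) by simp
    show "h z \<in> carrier G" by (rule hc[OF zc])
    show "h z \<otimes> h z = \<one>" using hm[OF zc zc] z(2) hone by simp
    show "h z \<noteq> \<one>" using hinj[OF zc, of "\<one>\<^bsub>G'\<^esub>"] hone z(3) by simp
    show "h z \<otimes> g = g \<otimes> h z" if g: "g \<in> carrier G" for g
    proof -
      obtain y where y: "y \<in> carrier G'" "g = h y" using g hbij by (auto simp: bij_betw_def)
      show ?thesis unfolding y(2) hm[OF zc y(1), symmetric] hm[OF y(1) zc, symmetric] central[OF z(1) y(1)] ..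
    qed
  qed
  have "h ?z1 = h ?z2"
    by (rule two[OF img[OF F(1) sq(1) ne(1)] img[OF F(2) sq(2) ne(2)]])
  then show False using hinj[of ?z1 ?z2] F ne(3) by simp
qed

end

section \<open>Matrices\<close>

lemma zeta_power: "r > 0 \<Longrightarrow> zeta r ^ n = root r (int n)"
  by (simp add: zeta_def root_def cis_conv_exp exp_of_nat_mult[symmetric] mult_ac)

lemma root_power_r: assumes "r > 0" shows "root r k ^ r = 1"
proof -
  have "root r k ^ n = root r (k * int n)" for n
    by (induction n) (simp_all add: algebra_simps root_add)
  then show ?thesis using root_eq_1_iff[OF assms] by simp
qed

locale reflection_data =
  fixes r p q :: nat
  assumes r0: "r > 0" and pr: "p dvd r" and qr: "q dvd r" and pqr: "p * q dvd 2 * r"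
begin

abbreviation R where "R \<equiv> complex_reflection_group r p 2"
abbreviation C where "C \<equiv> scalar_subgroup r p q 2"

definition dm :: "int \<Rightarrow> int \<Rightarrow> complex mat" where "dm a b = mat2 (root r a) 0 0 (root r b)"
definition am :: "int \<Rightarrow> int \<Rightarrow> complex mat" where "am a b = mat2 0 (root r a) (root r b) 0"

lemma dm_dm: "dm a b * dm c d = dm (a + c) (b + d)"
  and dm_am: "dm a b * am c d = am (a + c) (b + d)"
  and am_dm: "am a b * dm c d = am (a + d) (b + c)"
  and am_am: "am a b * am c d = dm (a + d) (b + c)"
  by (simp_all add: dm_def am_def mat2_mult root_add)

lemma dm_one: "dm 0 0 = 1\<^sub>m 2" by (simp add: dm_def mat2_one)

lemma dm_eq_iff: "dm a b = dm c d \<longleftrightarrow> int r dvd a - c \<and> int r dvd b - d"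
  by (simp add: dm_def root_eq_iff[OF r0])

lemma am_eq_iff: "am a b = am c d \<longleftrightarrow> int r dvd a - c \<and> int r dvd b - d"
  by (simp add: am_def root_eq_iff[OF r0])

lemma am_neq_dm: "am a b \<noteq> dm c d" by (simp add: am_def dm_def)

text \<open>Column \<open>j\<close> has its entry in row \<open>\<pi> j\<close>. For the
  transposition the first row therefore shows the exponent \<open>x 1\<close>, which reverses the
  order of the arguments of \<open>am\<close>.\<close>

lemma carrier_mat_of_permutation:
  assumes \<pi>: "\<pi> permutes {..<2}"
  shows "colored_perm_mat r 2 \<pi> x = dm (int (x 0)) (int (x 1)) \<or>
    colored_perm_mat r 2 \<pi> x = am (int (x 1)) (int (x 0))"
proof -
  have "\<pi> 0 < 2" "\<pi> 1 < 2" using permutes_in_image[OF \<pi>] by (metis lessThan_iff pos2 one_less_numeral_iff semiring_norm(76))+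
  moreover have "\<pi> 0 \<noteq> \<pi> 1" using permutes_inj[OF \<pi>] by (metis injD zero_neq_one)
  ultimately consider "\<pi> 0 = 0" "\<pi> 1 = 1" | "\<pi> 0 = 1" "\<pi> 1 = 0" by (auto simp: less_2_cases_iff)
  then show ?thesis
  proof cases
    case 1
    have "colored_perm_mat r 2 \<pi> x = dm (int (x 0)) (int (x 1))"
      by (rule mat2_eqI) (use 1 in \<open>simp_all add: colored_perm_mat_def dm_def zeta_power[OF r0]\<close>)
    then show ?thesis ..
  next
    case 2
    have "colored_perm_mat r 2 \<pi> x = am (int (x 1)) (int (x 0))"
      by (rule mat2_eqI) (use 2 in \<open>simp_all add: colored_perm_mat_def am_def zeta_power[OF r0]\<close>)
    then show ?thesis ..
  qed
qed

lemma sum_2: "(\<Sum>i<(2::nat). x i) = x 0 + (x 1 :: nat)"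
  by (simp add: numeral_2_eq_2)

lemma dm_index: "i < 2 \<Longrightarrow> j < 2 \<Longrightarrow> dm a b $$ (i, j) = (if i = j then root r (if i = 0 then a else b) else 0)"
  by (auto simp: dm_def less_2_cases_iff)

lemma am_index: "i < 2 \<Longrightarrow> j < 2 \<Longrightarrow> am a b $$ (i, j) = (if i = j then 0 else root r (if i = 0 then a else b))"
  by (auto simp: am_def less_2_cases_iff)

lemma dm_generalized: "dm a b \<in> generalized_symmetric_set r 2"
  unfolding generalized_symmetric_set_def
proof (intro CollectI conjI allI impI)
  show "\<exists>!j. j < 2 \<and> dm a b $$ (i, j) \<noteq> 0" if "i < 2" for i
    by (rule ex1I[of _ i]) (use that in \<open>auto simp: dm_index split: if_splits\<close>)
  show "\<exists>!i. i < 2 \<and> dm a b $$ (i, j) \<noteq> 0" if "j < 2" for j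
    by (rule ex1I[of _ j]) (use that in \<open>auto simp: dm_index split: if_splits\<close>)
  show "dm a b $$ (i, j) ^ r = 1" if "i < 2" "j < 2" "dm a b $$ (i, j) \<noteq> 0" for i j
    using that by (simp add: dm_index root_power_r[OF r0] split: if_splits)
qed (simp add: dm_def)

lemma am_generalized: "am a b \<in> generalized_symmetric_set r 2"
  unfolding generalized_symmetric_set_def
proof (intro CollectI conjI allI impI)
  show "\<exists>!j. j < 2 \<and> am a b $$ (i, j) \<noteq> 0" if "i < 2" for i
    by (rule ex1I[of _ "1 - i"]) (use that in \<open>auto simp: am_def less_2_cases_iff\<close>)
  show "\<exists>!i. i < 2 \<and> am a b $$ (i, j) \<noteq> 0" if "j < 2" for j
    by (rule ex1I[of _ "1 - j"]) (use that in \<open>auto simp: am_def less_2_cases_iff\<close>)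
  show "am a b $$ (i, j) ^ r = 1" if "i < 2" "j < 2" "am a b $$ (i, j) \<noteq> 0" for i j
    using that by (simp add: am_index root_power_r[OF r0] split: if_splits)
qed (simp add: am_def)

text \<open>The color sum is read off from exponents reduced to natural numbers; divisibility by
  \<open>p\<close> survives the reduction because \<open>p\<close> divides \<open>r\<close>.\<close>

lemma dm_carrier: assumes "int p dvd a + b" shows "dm a b \<in> carrier R"
proof -
  define x where "x i = (if i = 0 then nat (a mod int r) else nat (b mod int r))" for i :: nat
  have e: "dm a b = colored_perm_mat r 2 id x"
    by (rule mat2_eqI)
      (use r0 in \<open>simp_all add: dm_def colored_perm_mat_def zeta_power x_def root_eq_iff\<close>)
  have "color_sum r 2 (dm a b) = (x 0 + x 1) mod r"
    unfolding e by (subst color_sum_colored_perm_mat[OF r0 permutes_id]) (simp only: sum_2)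
  moreover have "int p dvd int (x 0 + x 1)"
  proof -
    have "int p dvd int r" using pr by simp
    then have "int p dvd a mod int r + b mod int r"
      using assms by (metis dvd_mod_iff mod_add_eq)
    then show ?thesis using r0 by (simp add: x_def)
  qed
  then have "p dvd x 0 + x 1" by (simp only: int_dvd_int_iff)
  then have "p dvd (x 0 + x 1) mod r" using pr by (simp add: dvd_mod_iff)
  moreover have "dm a b \<in> generalized_symmetric_set r 2"
    by (rule dm_generalized)
  ultimately show ?thesis by (simp add: complex_reflection_group_def)
qed

lemma am_carrier: assumes "int p dvd a + b" shows "am a b \<in> carrier R"
proof -
  define x where "x i = (if i = 0 then nat (b mod int r) else nat (a mod int r))" for i :: nat
  let ?\<pi> = "Transposition.transpose 0 (1::nat)"
  have \<pi>: "?\<pi> permutes {..<2}" by (rule permutes_swap_id) simp_all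
  have e: "am a b = colored_perm_mat r 2 ?\<pi> x"
    by (rule mat2_eqI)
      (use r0 in \<open>simp_all add: am_def colored_perm_mat_def zeta_power x_def root_eq_iff\<close>)
  have "color_sum r 2 (am a b) = (x 0 + x 1) mod r"
    unfolding e by (subst color_sum_colored_perm_mat[OF r0 \<pi>]) (simp only: sum_2)
  moreover have "int p dvd int (x 0 + x 1)"
  proof -
    have "int p dvd int r" using pr by simp
    then have "int p dvd b mod int r + a mod int r"
      using assms by (metis add.commute dvd_mod_iff mod_add_eq)
    then show ?thesis using r0 by (simp add: x_def)
  qed
  then have "p dvd x 0 + x 1" by (simp only: int_dvd_int_iff)
  then have "p dvd (x 0 + x 1) mod r" using pr by (simp add: dvd_mod_iff)
  moreover have "am a b \<in> generalized_symmetric_set r 2"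
    by (rule am_generalized)
  ultimately show ?thesis by (simp add: complex_reflection_group_def)
qed

lemma R_cases:
  assumes "g \<in> carrier R"
  obtains a b where "int p dvd a + b" "g = dm a b" | a b where "int p dvd a + b" "g = am a b"
proof -
  have g: "g \<in> generalized_symmetric_set r 2" "p dvd color_sum r 2 g"
    using assms by (simp_all add: complex_reflection_group_def)
  obtain \<pi> x where \<pi>: "\<pi> permutes {..<2}" "g = colored_perm_mat r 2 \<pi> x"
    using generalized_symmetric_setE[OF r0 g(1)] by blast
  have "color_sum r 2 g = (x 0 + x 1) mod r"
    unfolding \<pi>(2) color_sum_colored_perm_mat[OF r0 \<pi>(1)] sum_2 ..
  then have "p dvd x 0 + x 1" using g(2) pr by (simp add: dvd_mod_iff)
  then have "int p dvd int (x 0) + int (x 1)" "int p dvd int (x 1) + int (x 0)"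
    by (metis int_dvd_int_iff of_nat_add, metis add.commute int_dvd_int_iff of_nat_add)
  then show thesis using carrier_mat_of_permutation[OF \<pi>(1), of x] that \<pi>(2) by blast
qed

lemma R_mult [simp]: "x \<otimes>\<^bsub>R\<^esub> y = x * y" and R_one [simp]: "\<one>\<^bsub>R\<^esub> = 1\<^sub>m 2"
  by (simp_all add: complex_reflection_group_def)

lemma R_carrier_mat: "g \<in> carrier R \<Longrightarrow> g \<in> carrier_mat 2 2"
  by (erule R_cases) (simp_all add: dm_def am_def)

lemma dvd_sums: "int p dvd a + b \<Longrightarrow> int p dvd c + d \<Longrightarrow> int p dvd (a + c) + (b + d)"
  "int p dvd a + b \<Longrightarrow> int p dvd c + d \<Longrightarrow> int p dvd (a + d) + (b + c)"
proof -
  assume "int p dvd a + b" "int p dvd c + d"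
  then have "int p dvd (a + b) + (c + d)" by (rule dvd_add)
  then show "int p dvd (a + c) + (b + d)" "int p dvd (a + d) + (b + c)" by (simp_all add: ac_simps)
qed

lemma R_group: "group R"
proof (rule groupI)
  fix x y assume x: "x \<in> carrier R" and y: "y \<in> carrier R"
  from x show "x \<otimes>\<^bsub>R\<^esub> y \<in> carrier R"
  proof (cases rule: R_cases)
    case x: (1 a b)
    from y show ?thesis
      by (cases rule: R_cases) (use x in \<open>auto simp: dm_dm dm_am intro!: dm_carrier am_carrier dvd_sums(1)\<close>)
  next
    case x: (2 a b)
    from y show ?thesis
      by (cases rule: R_cases) (use x in \<open>auto simp: am_dm am_am intro!: dm_carrier am_carrier dvd_sums(2)\<close>)
  qed
next
  show "\<one>\<^bsub>R\<^esub> \<in> carrier R" using dm_carrier[of 0 0] by (simp add: dm_one)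
next
  fix x y z assume "x \<in> carrier R" "y \<in> carrier R" "z \<in> carrier R"
  then show "x \<otimes>\<^bsub>R\<^esub> y \<otimes>\<^bsub>R\<^esub> z = x \<otimes>\<^bsub>R\<^esub> (y \<otimes>\<^bsub>R\<^esub> z)"
    using assoc_mult_mat[of x 2 2 y 2 z 2] R_carrier_mat by simp
next
  fix x assume x: "x \<in> carrier R"
  then show "\<one>\<^bsub>R\<^esub> \<otimes>\<^bsub>R\<^esub> x = x" using left_mult_one_mat[OF R_carrier_mat] by simp
  from x show "\<exists>y\<in>carrier R. y \<otimes>\<^bsub>R\<^esub> x = \<one>\<^bsub>R\<^esub>"
  proof (cases rule: R_cases)
    case (1 a b)
    have "int p dvd - a + - b" using 1 by (metis add.commute dvd_minus_iff minus_add)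
    then show ?thesis using 1 by (intro bexI[of _ "dm (- a) (- b)"] dm_carrier) (simp_all add: dm_dm dm_one)
  next
    case (2 a b)
    have "int p dvd - b + - a" using 2 by (metis dvd_minus_iff minus_add)
    then show ?thesis using 2 by (intro bexI[of _ "am (- b) (- a)"] am_carrier) (simp_all add: am_am dm_one)
  qed
qed

sublocale R: group R by (rule R_group)

abbreviation m where "m \<equiv> int (r div q)"

lemma q0: "q > 0" using r0 qr by (auto intro: Nat.gr0I)

lemma rqm: "int r = int q * m" using qr by (metis dvd_mult_div_cancel of_nat_mult)

text \<open>The condition that \<open>p q\<close> divides \<open>2 r\<close> in the form
  \<open>p\<close> divides \<open>2 (r / q)\<close>: it places the generating scalar in the group
  for \<open>(r, p)\<close>.\<close>

lemma p_2m: "int p dvd m * k + m * k"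
proof -
  have "p * q dvd q * (2 * (r div q))" using pqr qr by (metis dvd_mult_div_cancel mult.left_commute)
  then have "p dvd 2 * (r div q)" using q0 by (simp add: mult.commute[of p])
  then have "int p dvd int (2 * (r div q))" by (simp only: int_dvd_int_iff)
  then have "int p dvd int (2 * (r div q)) * k" by (rule dvd_mult2)
  then show ?thesis by (simp add: algebra_simps)
qed

lemma scalar_generator: "(zeta r \<cdot>\<^sub>m 1\<^sub>m 2) ^\<^sub>m k = dm (int k) (int k)"
proof (induction k)
  case (Suc k)
  have z: "zeta r \<cdot>\<^sub>m 1\<^sub>m 2 = dm 1 1"
    using zeta_power[OF r0, of 1] by (intro mat2_eqI) (simp_all add: dm_def)
  show ?case unfolding pow_mat.simps Suc unfolding z dm_dm by (simp add: add.commute)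
qed (simp add: dm_one)

lemma C_eq: "C = {dm (m * k) (m * k) | k. True}"
proof -
  have g: "dm m m \<in> carrier R" using dm_carrier[of m m] p_2m[of 1] by simp
  have pow: "dm m m [^]\<^bsub>R\<^esub> n = dm (m * int n) (m * int n)" for n :: nat
    by (induction n) (simp_all add: dm_one dm_dm algebra_simps)
  have inv: "inv\<^bsub>R\<^esub> (dm (m * k) (m * k)) = dm (m * - k) (m * - k)" for k
    by (rule R.inv_equality[OF _ dm_carrier[OF p_2m] dm_carrier[OF p_2m]]) (simp add: dm_dm dm_one)
  have powi: "dm m m [^]\<^bsub>R\<^esub> k = dm (m * k) (m * k)" for k :: int
  proof (cases "k \<ge> 0")
    case True
    then have "dm m m [^]\<^bsub>R\<^esub> k = dm m m [^]\<^bsub>R\<^esub> nat k" by (metis int_pow_int int_nat_eq)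
    then show ?thesis using True by (simp add: pow)
  next
    case False
    then have k: "k = - int (nat (- k))" by simp
    have "dm m m [^]\<^bsub>R\<^esub> k = inv\<^bsub>R\<^esub> (dm m m [^]\<^bsub>R\<^esub> nat (- k))"
      by (subst k) (rule R.int_pow_neg_int[OF g])
    then show ?thesis using k unfolding pow inv by simp
  qed
  have "C = generate R {dm m m}" unfolding scalar_subgroup_def scalar_generator ..
  also have "\<dots> = {dm m m [^]\<^bsub>R\<^esub> (k::int) | k. k \<in> UNIV}" by (rule R.generate_pow[OF g])
  finally show ?thesis unfolding powi by simp
qed

lemma dm_in_C: "dm a b \<in> C \<longleftrightarrow> int r dvd a - b \<and> m dvd a"
proof
  assume "dm a b \<in> C"
  then obtain k where "dm a b = dm (m * k) (m * k)" unfolding C_eq by blast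
  then have 1: "int r dvd a - m * k" "int r dvd b - m * k" unfolding dm_eq_iff by auto
  then have "int r dvd (a - m * k) - (b - m * k)" by (rule dvd_diff)
  moreover have "m dvd (a - m * k) + m * k" using 1 unfolding rqm by (intro dvd_add) (auto dest: dvd_mult_right)
  ultimately show "int r dvd a - b \<and> m dvd a" by simp
next
  assume *: "int r dvd a - b \<and> m dvd a"
  then obtain k where "a = m * k" by blast
  moreover have "int r dvd b - a" using * by (simp add: dvd_diff_commute)
  ultimately have "dm a b = dm (m * k) (m * k)" unfolding dm_eq_iff by simp
  then show "dm a b \<in> C" unfolding C_eq by blast
qed

lemma C_normal: "C \<lhd> R"
proof -
  have g: "dm m m \<in> carrier R" using dm_carrier[of m m] p_2m[of 1] by simp
  have "subgroup C R" unfolding scalar_subgroup_def scalar_generator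
    by (rule R.generate_is_subgroup) (use g in simp)
  moreover have "x \<otimes>\<^bsub>R\<^esub> h \<otimes>\<^bsub>R\<^esub> inv\<^bsub>R\<^esub> x \<in> C" if x: "x \<in> carrier R" and h: "h \<in> C" for x h
  proof -
    obtain k where k: "h = dm (m * k) (m * k)" using h unfolding C_eq by blast
    have hc: "h \<in> carrier R" unfolding k by (rule dm_carrier[OF p_2m])
    have "x \<otimes>\<^bsub>R\<^esub> h = h \<otimes>\<^bsub>R\<^esub> x"
      using x by (cases rule: R_cases) (simp_all add: k dm_dm dm_am am_dm add.commute)
    then have "x \<otimes>\<^bsub>R\<^esub> h \<otimes>\<^bsub>R\<^esub> inv\<^bsub>R\<^esub> x = h"
      using x hc by (metis R.inv_solve_right' R.m_closed)
    then show ?thesis using h by simp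
  qed
  ultimately show ?thesis unfolding R.normal_inv_iff by blast
qed

section \<open>The quotient by the scalars in lattice coordinates\<close>

sublocale N: normal C R by (rule C_normal)

abbreviation Q where "Q \<equiv> projective_reflection_group r p q 2"

definition diag where "diag a b = C #>\<^bsub>R\<^esub> dm a b"
definition swap where "swap = C #>\<^bsub>R\<^esub> am 0 0"

lemma Q_mult: "x \<in> carrier R \<Longrightarrow> y \<in> carrier R \<Longrightarrow> (C #>\<^bsub>R\<^esub> x) \<otimes>\<^bsub>Q\<^esub> (C #>\<^bsub>R\<^esub> y) = C #>\<^bsub>R\<^esub> (x * y)"
  using N.rcos_sum[of x y] by (simp add: projective_reflection_group_def FactGroup_def)

lemma Q_one: "\<one>\<^bsub>Q\<^esub> = C" by (simp add: projective_reflection_group_def FactGroup_def)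

lemma Q_carrier: "carrier Q = (\<lambda>x. C #>\<^bsub>R\<^esub> x) ` carrier R"
  by (auto simp: projective_reflection_group_def FactGroup_def RCOSETS_def)

lemma finite_R: "finite (carrier R)"
proof -
  have "carrier R \<subseteq> (\<lambda>(a, b). dm a b) ` ({0..<int r} \<times> {0..<int r}) \<union> (\<lambda>(a, b). am a b) ` ({0..<int r} \<times> {0..<int r})"
  proof
    fix g assume "g \<in> carrier R"
    then show "g \<in> (\<lambda>(a, b). dm a b) ` ({0..<int r} \<times> {0..<int r}) \<union> (\<lambda>(a, b). am a b) ` ({0..<int r} \<times> {0..<int r})"
    proof (cases rule: R_cases)
      case (1 a b)
      have "g = dm (a mod int r) (b mod int r)" unfolding 1(2) dm_eq_iff by simp
      then show ?thesis using r0 by (intro UnI1 image_eqI[of _ _ "(a mod int r, b mod int r)"]) auto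
    next
      case (2 a b)
      have "g = am (a mod int r) (b mod int r)" unfolding 2(2) am_eq_iff by simp
      then show ?thesis using r0 by (intro UnI2 image_eqI[of _ _ "(a mod int r, b mod int r)"]) auto
    qed
  qed
  then show ?thesis by (rule finite_subset) simp
qed

lemma swap_in: "am 0 0 \<in> carrier R" by (rule am_carrier) simp

lemma lattice_model_Q: "lattice_model Q r p q diag swap"
proof (rule lattice_model.intro)
  show "group Q" unfolding projective_reflection_group_def by (rule N.factorgroup_is_group)
  show "lattice_model_axioms Q r p q diag swap"
  proof
    show "finite (carrier Q)" unfolding Q_carrier using finite_R by simp
    show "diag a b \<in> carrier Q" if "int p dvd a + b" for a b
      unfolding Q_carrier diag_def using dm_carrier[OF that] by blast
    show "diag a b \<otimes>\<^bsub>Q\<^esub> diag c d = diag (a + c) (b + d)" if "int p dvd a + b" "int p dvd c + d" for a b c d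
      unfolding diag_def Q_mult[OF dm_carrier[OF that(1)] dm_carrier[OF that(2)]] dm_dm ..
    show "diag a b = \<one>\<^bsub>Q\<^esub> \<longleftrightarrow> int r dvd a - b \<and> int (r div q) dvd a" if ab: "int p dvd a + b" for a b
    proof -
      have "C #>\<^bsub>R\<^esub> dm a b = C \<longleftrightarrow> dm a b \<in> C"
        using R.coset_join1[OF _ dm_carrier[OF ab] N.subgroup_axioms] R.coset_join2[OF dm_carrier[OF ab] N.subgroup_axioms]
          N.subset by blast
      then show ?thesis unfolding diag_def Q_one dm_in_C .
    qed
    show "swap \<in> carrier Q" unfolding Q_carrier swap_def using swap_in by blast
    show "swap \<otimes>\<^bsub>Q\<^esub> swap = \<one>\<^bsub>Q\<^esub>"
    proof -
      have "swap \<otimes>\<^bsub>Q\<^esub> swap = C #>\<^bsub>R\<^esub> \<one>\<^bsub>R\<^esub>" unfolding swap_def Q_mult[OF swap_in swap_in] am_am by (simp add: dm_one)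
      also have "\<dots> = C" by (rule R.coset_mult_one[OF N.subset])
      finally show ?thesis unfolding Q_one .
    qed
    show "swap \<otimes>\<^bsub>Q\<^esub> diag a b \<otimes>\<^bsub>Q\<^esub> swap = diag b a" if ab: "int p dvd a + b" for a b
    proof -
      have ba: "int p dvd b + a" using ab by (simp add: add.commute)
      have "swap \<otimes>\<^bsub>Q\<^esub> diag a b = C #>\<^bsub>R\<^esub> am b a"
        unfolding swap_def diag_def Q_mult[OF swap_in dm_carrier[OF ab]] am_dm by simp
      then show ?thesis unfolding swap_def diag_def using Q_mult[OF am_carrier[OF ba] swap_in] by (simp add: am_am)
    qed
    show "swap \<noteq> diag a b" if ab: "int p dvd a + b" for a b
    proof
      assume eq: "swap = diag a b"
      have "am 0 0 \<in> C #>\<^bsub>R\<^esub> am 0 0" by (rule R.rcos_self[OF swap_in N.subgroup_axioms])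
      then have "am 0 0 \<in> C #>\<^bsub>R\<^esub> dm a b" using eq unfolding swap_def diag_def by simp
      then obtain h where "h \<in> C" "am 0 0 = h * dm a b" by (auto simp: r_coset_def)
      then obtain k where "am 0 0 = dm (m * k) (m * k) * dm a b" unfolding C_eq by blast
      then show False unfolding dm_dm using am_neq_dm by blast
    qed
    show "\<exists>a b. int p dvd a + b \<and> (g = diag a b \<or> g = diag a b \<otimes>\<^bsub>Q\<^esub> swap)" if g: "g \<in> carrier Q" for g
    proof -
      obtain x where x: "x \<in> carrier R" "g = C #>\<^bsub>R\<^esub> x" using g unfolding Q_carrier by blast
      from x(1) show ?thesis
      proof (cases rule: R_cases)
        case (1 a b)
        then show ?thesis using x(2) unfolding diag_def by blast
      next
        case (2 a b)
        then have "g = diag a b \<otimes>\<^bsub>Q\<^esub> swap"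
          unfolding diag_def swap_def Q_mult[OF dm_carrier[OF 2(1)] swap_in] dm_am x(2) by simp
        then show ?thesis using 2 by blast
      qed
    qed
  qed (fact r0 pr qr pqr)+
qed

end

theorem theorem1p5:
  fixes r p q :: nat
  assumes "r > 0" and "p dvd r" and "q dvd r" and "p * q dvd 2 * r"
  shows "has_GIM (projective_reflection_group r p q 2) \<longleftrightarrow>
    (r, p, q) = (4, 1, 2) \<or>
    projective_reflection_group r p q 2 \<cong> projective_reflection_group r q p 2"
proof -
  let ?G = "projective_reflection_group r p q 2" and ?H = "projective_reflection_group r q p 2"
  interpret PQ: reflection_data r p q using assms by unfold_locales
  interpret QP: reflection_data r q p using assms by unfold_locales (simp_all add: mult.commute)
  interpret G: lattice_pair ?G ?H r p q PQ.diag PQ.swap QP.diag QP.swap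
    unfolding lattice_pair_def using PQ.lattice_model_Q QP.lattice_model_Q by blast
  interpret H: lattice_pair ?H ?G r q p QP.diag QP.swap PQ.diag PQ.swap
    unfolding lattice_pair_def using PQ.lattice_model_Q QP.lattice_model_Q by blast
  have sym: "?H \<cong> ?G \<longleftrightarrow> ?G \<cong> ?H"
    using G.L.iso_sym G.L'.iso_sym by blast
  \<comment> \<open>\<open>iso_odd_even\<close> is stated for odd \<open>p\<close> and
    \<open>not_iso\<close> for even \<open>p\<close>; the two mirror cases apply them with
    \<open>p\<close> and \<open>q\<close> interchanged and use the symmetry
    \<open>sym\<close>.\<close>
  consider "even p \<longleftrightarrow> even q" | "even p" "odd q" "odd (r div p)" | "even p" "odd q" "even (r div p)"
    | "odd p" "even q" "odd (r div q)" | "odd p" "even q" "even (r div q)" by blast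
  then show ?thesis
  proof cases
    case 1
    then show ?thesis using G.iso_same_parity G.L.has_GIM_iff by blast
  next
    case 2
    then have "?H \<cong> ?G" by (intro H.iso_odd_even)
    then show ?thesis using 2 sym G.L.has_GIM_iff by blast
  next
    case 3
    then have "\<not> ?G \<cong> ?H" by (intro G.not_iso)
    then show ?thesis using 3 unfolding G.L.has_GIM_iff by auto
  next
    case 4
    then have "?G \<cong> ?H" by (intro G.iso_odd_even)
    then show ?thesis using 4 G.L.has_GIM_iff by blast
  next
    case 5
    then have "\<not> ?H \<cong> ?G" by (intro H.not_iso)
    then show ?thesis using 5 sym unfolding G.L.has_GIM_iff by auto
  qed
qed

end
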